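(* Let $X:M\to\mathbb{R}^m$ be an isometric immersion of an $n$-dimensional Riemannian manifold $M$ in $\mathbb{R}^m$, with mean curvature vector field $H$. Let $\Omega$ be a bounded domain of $M$ and let $0<\lambda_1\le\lambda_2\le\cdots\to+\infty$ be the eigenvalues of the clamped plate problem $$\Delta^2u=\lambda u\ \text{ in }\Omega,\qquad u=\frac{\partial u}{\partial\nu}=0\ \text{ on }\partial\Omega .$$ Put $\delta=\sup_{\Omega}|H|^2$. Then for any $k\ge1$ such that $\lambda_{k+1}>\lambda_k$ and for any couple $(f,g)$ in $\Im_{\lambda_{k+1}}$, $$\sum_{i=1}^k f(\lambda_i)\le\frac{2}{n}\left[\sum_{i=1}^k g(\lambda_i)\Big(2(n+2)\lambda_i^{1/2}+n^2\delta\Big)\right]^{1/2}\left[\sum_{i=1}^k\frac{f(\lambda_i)^2}{g(\lambda_i)(\lambda_{k+1}-\lambda_i)}\Big(\lambda_i^{1/2}+\frac{n^2}{4}\delta\Big)\right]^{1/2}.$$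
   Context: $\Delta$ denotes the Laplacian ($\Delta=\operatorname{div}\nabla$) of the Riemannian manifold $M$, $\Delta^2$ the biharmonic operator, and $\nu$ the outward unit normal to $\partial\Omega$. It is taken as well known that the eigenvalues of the clamped plate problem on the bounded domain $\Omega$, repeated according to multiplicity, form a countable family $0<\lambda_1\le\lambda_2\le\cdots\to+\infty$. The mean curvature vector field of the immersion is $H=\frac1n\operatorname{trace}h$, where $h$ is the second fundamental form of $X$. For $\lambda>0$, $\Im_\lambda$ is the set of couples $(f,g)$ of functions defined on the open interval $(0,\lambda)$ such that: (1) $f$ and $g$ are positive; (2) for all $x,y\in(0,\lambda)$ with $x\ne y$, $$\left(\frac{f(x)-f(y)}{x-y}\right)^2+\left(\frac{f(x)^2}{g(x)(\lambda-x)}+\frac{f(y)^2}{g(y)(\lambda-y)}\right)\left(\frac{g(x)-g(y)}{x-y}\right)\le0 .$$ *)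

theory Defs
  imports "HOL-Analysis.Analysis"
begin

section \<open>Smooth maps between Euclidean spaces\<close>

definition partial :: "'n::finite \<Rightarrow> (real^'n \<Rightarrow> 'b::real_normed_vector) \<Rightarrow> real^'n \<Rightarrow> 'b" where
  "partial i f = (\<lambda>x. frechet_derivative f (at x) (axis i 1))"

text \<open>C-infinity on an open set: all iterated partial derivatives, of any order and in any
  sequence of directions, are (totally) differentiable functions.\<close>

definition smooth_on :: "(real^'n::finite) set \<Rightarrow> (real^'n \<Rightarrow> 'b::real_normed_vector) \<Rightarrow> bool" where
  "smooth_on S f \<longleftrightarrow> (\<forall>js. foldr partial js f differentiable_on S)"


section \<open>Smooth manifolds\<close>

text \<open>The manifold is the whole type \<open>'a\<close>, a second countable Hausdorff space, with an atlas of
  charts \<open>(U, \<phi>)\<close> modelled on \<open>real^'n\<close>; its dimension is \<open>CARD('n)\<close>. The value of \<open>\<phi>\<close> outside of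
  \<open>U\<close> is irrelevant.\<close>

type_synonym ('a, 'n) chart = "'a set \<times> ('a \<Rightarrow> real^'n)"

abbreviation dom_of :: "('a, 'n::finite) chart \<Rightarrow> 'a set" where
  "dom_of c \<equiv> fst c"

abbreviation coord :: "('a, 'n::finite) chart \<Rightarrow> 'a \<Rightarrow> real^'n" where
  "coord c \<equiv> snd c"

abbreviation param :: "('a, 'n::finite) chart \<Rightarrow> real^'n \<Rightarrow> 'a" where
  "param c \<equiv> inv_into (fst c) (snd c)"

definition smooth_manifold ::
  "('a::{t2_space, second_countable_topology}, 'n::finite) chart set \<Rightarrow> bool" where
  "smooth_manifold A \<longleftrightarrow>
     (\<Union>c\<in>A. dom_of c) = UNIV \<and>
     (\<forall>c\<in>A. open (dom_of c) \<and> open (coord c ` dom_of c) \<and>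
            homeomorphism (dom_of c) (coord c ` dom_of c) (coord c) (param c)) \<and>
     (\<forall>c\<in>A. \<forall>d\<in>A. smooth_on (coord c ` (dom_of c \<inter> dom_of d)) (coord d \<circ> param c))"

definition smooth_map ::
  "('a::{t2_space, second_countable_topology}, 'n::finite) chart set \<Rightarrow>
   ('a \<Rightarrow> 'b::real_normed_vector) \<Rightarrow> bool" where
  "smooth_map A f \<longleftrightarrow> (\<forall>c\<in>A. smooth_on (coord c ` dom_of c) (f \<circ> param c))"

text \<open>The derivative of \<open>f\<close> along the \<open>i\<close>-th coordinate vector field of the chart \<open>c\<close>, as a function
  on the manifold.\<close>

definition cpartial ::
  "('a, 'n::finite) chart \<Rightarrow> 'n \<Rightarrow> ('a \<Rightarrow> 'b::real_normed_vector) \<Rightarrow> 'a \<Rightarrow> 'b" where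
  "cpartial c i f p = partial i (f \<circ> param c) (coord c p)"

text \<open>Objects below that do not depend on the chart used to compute them (Laplacian, mean
  curvature vector) are computed in an arbitrarily selected chart around the point.\<close>

definition chart_at :: "('a, 'n::finite) chart set \<Rightarrow> 'a \<Rightarrow> ('a, 'n) chart" where
  "chart_at A p = (SOME c. c \<in> A \<and> p \<in> dom_of c)"


section \<open>Riemannian metric, volume and Laplacian\<close>

text \<open>A Riemannian metric is given by its matrices \<open>G c p\<close> of components in the charts \<open>c\<close>,
  transforming as a covariant 2-tensor.\<close>

definition riemannian_metric ::
  "('a::{t2_space, second_countable_topology}, 'n::finite) chart set \<Rightarrow>
   (('a, 'n) chart \<Rightarrow> 'a \<Rightarrow> real^'n^'n) \<Rightarrow> bool" where
  "riemannian_metric A G \<longleftrightarrow>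
     (\<forall>c\<in>A. smooth_on (coord c ` dom_of c) (G c \<circ> param c)) \<and>
     (\<forall>c\<in>A. \<forall>p\<in>dom_of c. transpose (G c p) = G c p \<and>
        (\<forall>v. v \<noteq> 0 \<longrightarrow> 0 < v \<bullet> (G c p *v v))) \<and>
     (\<forall>c\<in>A. \<forall>d\<in>A. \<forall>p\<in>dom_of c \<inter> dom_of d.
        let J = matrix (frechet_derivative (coord d \<circ> param c) (at (coord c p)))
        in G c p = transpose J ** G d p ** J)"

definition riemannian_manifold ::
  "('a::{t2_space, second_countable_topology}, 'n::finite) chart set \<Rightarrow>
   (('a, 'n) chart \<Rightarrow> 'a \<Rightarrow> real^'n^'n) \<Rightarrow> bool" where
  "riemannian_manifold A G \<longleftrightarrow> smooth_manifold A \<and> riemannian_metric A G"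

text \<open>The Riemannian measure is the only Borel measure that has density \<open>sqrt (det G)\<close> in
  every chart.\<close>

definition riemannian_volume ::
  "('a::{t2_space, second_countable_topology}, 'n::finite) chart set \<Rightarrow>
   (('a, 'n) chart \<Rightarrow> 'a \<Rightarrow> real^'n^'n) \<Rightarrow> 'a measure" where
  "riemannian_volume A G = (THE \<mu>. sets \<mu> = sets borel \<and>
     (\<forall>c\<in>A. \<forall>B\<in>sets borel. B \<subseteq> dom_of c \<longrightarrow>
        emeasure \<mu> B =
          (\<integral>\<^sup>+x\<in>coord c ` B. ennreal (sqrt (det (G c (param c x)))) \<partial>lborel)))"

definition gradient_in ::
  "(('a, 'n::finite) chart \<Rightarrow> 'a \<Rightarrow> real^'n^'n) \<Rightarrow> ('a, 'n) chart \<Rightarrow> ('a \<Rightarrow> real) \<Rightarrow> 'a \<Rightarrow> real^'n"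
  where
  "gradient_in G c u p = matrix_inv (G c p) *v (\<chi> j. cpartial c j u p)"

definition divergence_in ::
  "(('a, 'n::finite) chart \<Rightarrow> 'a \<Rightarrow> real^'n^'n) \<Rightarrow> ('a, 'n) chart \<Rightarrow> ('a \<Rightarrow> real^'n) \<Rightarrow> 'a \<Rightarrow> real"
  where
  "divergence_in G c V p =
     (\<Sum>i\<in>UNIV. cpartial c i (\<lambda>q. sqrt (det (G c q)) * V q $ i) p) / sqrt (det (G c p))"

definition laplacian ::
  "('a, 'n::finite) chart set \<Rightarrow> (('a, 'n) chart \<Rightarrow> 'a \<Rightarrow> real^'n^'n) \<Rightarrow>
   ('a \<Rightarrow> real) \<Rightarrow> 'a \<Rightarrow> real" where
  "laplacian A G u p = (let c = chart_at A p in divergence_in G c (gradient_in G c u) p)"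


section \<open>Isometric immersions into Euclidean space\<close>

definition isometric_immersion ::
  "('a::{t2_space, second_countable_topology}, 'n::finite) chart set \<Rightarrow>
   (('a, 'n) chart \<Rightarrow> 'a \<Rightarrow> real^'n^'n) \<Rightarrow> ('a \<Rightarrow> real^'m::finite) \<Rightarrow> bool" where
  "isometric_immersion A G X \<longleftrightarrow>
     smooth_map A X \<and>
     (\<forall>c\<in>A. \<forall>p\<in>dom_of c.
        inj (frechet_derivative (X \<circ> param c) (at (coord c p))) \<and>
        (\<forall>i j. G c p $ i $ j = cpartial c i X p \<bullet> cpartial c j X p))"

text \<open>The second fundamental form on the coordinate vector fields \<open>i\<close>, \<open>j\<close> is the component of the
  second derivative of \<open>X\<close> normal to the tangent space; the nearest point of a linear
  subspace is the orthogonal projection onto it.\<close>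

definition tangent_space_in ::
  "('a, 'n::finite) chart \<Rightarrow> ('a \<Rightarrow> real^'m::finite) \<Rightarrow> 'a \<Rightarrow> (real^'m) set" where
  "tangent_space_in c X p = span (range (\<lambda>k. cpartial c k X p))"

definition second_fundamental_form_in ::
  "('a, 'n::finite) chart \<Rightarrow> ('a \<Rightarrow> real^'m::finite) \<Rightarrow> 'n \<Rightarrow> 'n \<Rightarrow> 'a \<Rightarrow> real^'m" where
  "second_fundamental_form_in c X i j p =
     (let w = cpartial c i (cpartial c j X) p
      in w - closest_point (tangent_space_in c X p) w)"

definition mean_curvature ::
  "('a, 'n::finite) chart set \<Rightarrow> (('a, 'n) chart \<Rightarrow> 'a \<Rightarrow> real^'n^'n) \<Rightarrow>
   ('a \<Rightarrow> real^'m::finite) \<Rightarrow> 'a \<Rightarrow> real^'m" where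
  "mean_curvature A G X p =
     (let c = chart_at A p
      in (1 / real CARD('n)) *\<^sub>R
           (\<Sum>i\<in>UNIV. \<Sum>j\<in>UNIV.
              matrix_inv (G c p) $ i $ j *\<^sub>R second_fundamental_form_in c X i j p))"


section \<open>The clamped plate problem\<close>

text \<open>Bounded domains are relatively compact, as usual on a manifold that need not be complete.\<close>

definition bounded_domain :: "'a::topological_space set \<Rightarrow> bool" where
  "bounded_domain \<Omega> \<longleftrightarrow> \<Omega> \<noteq> {} \<and> open \<Omega> \<and> connected \<Omega> \<and> compact (closure \<Omega>)"

definition test_functions ::
  "('a::{t2_space, second_countable_topology}, 'n::finite) chart set \<Rightarrow> 'a set \<Rightarrow> ('a \<Rightarrow> real) set"
  where
  "test_functions A \<Omega> =
     {\<phi>. smooth_map A \<phi> \<and> compact (closure {p. \<phi> p \<noteq> 0}) \<and> closure {p. \<phi> p \<noteq> 0} \<subseteq> \<Omega>}"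

definition L2_on :: "'a measure \<Rightarrow> 'a set \<Rightarrow> ('a \<Rightarrow> real) \<Rightarrow> bool" where
  "L2_on M \<Omega> u \<longleftrightarrow> set_borel_measurable M \<Omega> u \<and> set_integrable M \<Omega> (\<lambda>p. (u p)\<^sup>2)"

text \<open>The Sobolev space of functions with \<open>u = 0\<close> and vanishing normal derivative on the boundary:
  the closure of the test functions for the norm \<open>(\<integral> u\<^sup>2 + (\<Delta>u)\<^sup>2) powr (1/2)\<close>. On test functions of
  a relatively compact domain this norm is equivalent to the full second order Sobolev norm (integrate
  \<open>|grad \<phi>|\<^sup>2\<close> by parts and use the Bochner formula), so that no convergence of first derivatives
  or of Hessians has to be required. No regularity of the boundary is needed; if the boundary is
  smooth, the space consists of the second order Sobolev functions for which the traces of \<open>u\<close> and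
  of its normal derivative both vanish.\<close>

definition H20 ::
  "('a::{t2_space, second_countable_topology}, 'n::finite) chart set \<Rightarrow>
   (('a, 'n) chart \<Rightarrow> 'a \<Rightarrow> real^'n^'n) \<Rightarrow> 'a set \<Rightarrow> ('a \<Rightarrow> real) set" where
  "H20 A G \<Omega> = (let M = riemannian_volume A G in
     {u. L2_on M \<Omega> u \<and>
         (\<exists>w \<phi>. L2_on M \<Omega> w \<and> (\<forall>j::nat. \<phi> j \<in> test_functions A \<Omega>) \<and>
            (\<lambda>j. LINT p:\<Omega>|M. (\<phi> j p - u p)\<^sup>2) \<longlonglongrightarrow> 0 \<and>
            (\<lambda>j. LINT p:\<Omega>|M. (laplacian A G (\<phi> j) p - w p)\<^sup>2) \<longlonglongrightarrow> 0)})"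

text \<open>Solutions of \<open>\<Delta>\<^sup>2 u = \<mu> u\<close> in \<open>\<Omega>\<close> (in the sense of distributions) that satisfy the clamped
  boundary conditions. The elements are functions, not classes of functions modulo null sets.\<close>

definition clamped_eigenspace ::
  "('a::{t2_space, second_countable_topology}, 'n::finite) chart set \<Rightarrow>
   (('a, 'n) chart \<Rightarrow> 'a \<Rightarrow> real^'n^'n) \<Rightarrow> 'a set \<Rightarrow> real \<Rightarrow> ('a \<Rightarrow> real) set" where
  "clamped_eigenspace A G \<Omega> \<mu> = (let M = riemannian_volume A G in
     {u \<in> H20 A G \<Omega>. \<forall>\<psi>\<in>test_functions A \<Omega>.
        (LINT p:\<Omega>|M. u p * laplacian A G (laplacian A G \<psi>) p) = \<mu> * (LINT p:\<Omega>|M. u p * \<psi> p)})"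

text \<open>The eigenspace of \<open>\<mu>\<close>, modulo functions vanishing almost everywhere in \<open>\<Omega>\<close>, has a basis with
  \<open>d\<close> elements. In particular multiplicity \<open>0\<close> means that \<open>\<mu>\<close> is not an eigenvalue.\<close>

definition has_multiplicity ::
  "('a::{t2_space, second_countable_topology}, 'n::finite) chart set \<Rightarrow>
   (('a, 'n) chart \<Rightarrow> 'a \<Rightarrow> real^'n^'n) \<Rightarrow> 'a set \<Rightarrow> real \<Rightarrow> nat \<Rightarrow> bool" where
  "has_multiplicity A G \<Omega> \<mu> d \<longleftrightarrow>
     (\<exists>e :: nat \<Rightarrow> 'a \<Rightarrow> real.
        (\<forall>j<d. e j \<in> clamped_eigenspace A G \<Omega> \<mu>) \<and>
        (\<forall>a. (AE p in riemannian_volume A G. p \<in> \<Omega> \<longrightarrow> (\<Sum>j<d. a j * e j p) = 0) \<longrightarrow>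
             (\<forall>j<d. a j = 0)) \<and>
        (\<forall>u\<in>clamped_eigenspace A G \<Omega> \<mu>. \<exists>a.
             AE p in riemannian_volume A G. p \<in> \<Omega> \<longrightarrow> u p = (\<Sum>j<d. a j * e j p)))"

text \<open>\<open>\<lambda>\<^sub>1 \<le> \<lambda>\<^sub>2 \<le> \<dots>\<close> is the list of all eigenvalues, each repeated according to its
  multiplicity; \<open>ev 0\<close> is not used.\<close>

definition clamped_spectrum ::
  "('a::{t2_space, second_countable_topology}, 'n::finite) chart set \<Rightarrow>
   (('a, 'n) chart \<Rightarrow> 'a \<Rightarrow> real^'n^'n) \<Rightarrow> 'a set \<Rightarrow> (nat \<Rightarrow> real) \<Rightarrow> bool" where
  "clamped_spectrum A G \<Omega> ev \<longleftrightarrow>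
     0 < ev 1 \<and> (\<forall>i\<ge>1. ev i \<le> ev (Suc i)) \<and> filterlim ev at_top sequentially \<and>
     (\<forall>\<mu>. has_multiplicity A G \<Omega> \<mu> (card {i. 1 \<le> i \<and> ev i = \<mu>}))"


section \<open>The couples of functions\<close>

definition couples :: "real \<Rightarrow> ((real \<Rightarrow> real) \<times> (real \<Rightarrow> real)) set" where
  "couples l = {(f, g).
     (\<forall>x\<in>{0<..<l}. 0 < f x \<and> 0 < g x) \<and>
     (\<forall>x\<in>{0<..<l}. \<forall>y\<in>{0<..<l}. x \<noteq> y \<longrightarrow>
        ((f x - f y) / (x - y))\<^sup>2 +
        ((f x)\<^sup>2 / (g x * (l - x)) + (f y)\<^sup>2 / (g y * (l - y))) * ((g x - g y) / (x - y)) \<le> 0)}"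

end

theory Submission
  imports Defs
begin

text \<open>
  Let \<open>u\<^sub>1, \<dots>, u\<^sub>k\<close> be orthonormal eigenfunctions and let \<open>x\<close> be a coordinate function of the immersion.
  The functions \<open>v\<^sub>i = x u\<^sub>i - (\<Sum>\<^sub>j a\<^sub>i\<^sub>j u\<^sub>j)\<close> with \<open>a\<^sub>i\<^sub>j = \<integral> x u\<^sub>i u\<^sub>j\<close> are orthogonal to all \<open>u\<^sub>j\<close>, so that
  \<open>\<lambda>\<^sub>k\<^sub>+\<^sub>1 \<parallel>v\<^sub>i\<parallel>\<^sup>2 \<le> \<parallel>\<Delta>v\<^sub>i\<parallel>\<^sup>2\<close>. The commutator \<open>P = [\<Delta>, x]\<close> is skew, hence \<open>b\<^sub>i\<^sub>j = \<integral> u\<^sub>j P u\<^sub>i / 2\<close> is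
  antisymmetric while \<open>a\<^sub>i\<^sub>j\<close> is symmetric, and the Cauchy-Schwarz inequality for \<open>v\<^sub>i\<close> and
  \<open>P u\<^sub>i / 2 - (\<Sum>\<^sub>j b\<^sub>i\<^sub>j u\<^sub>j)\<close>, weighted with \<open>f\<close> and \<open>g\<close>, is summed over \<open>i\<close>: the condition on the couple
  \<open>(f, g)\<close> is exactly what makes the double sums containing \<open>a\<^sub>i\<^sub>j\<close> and \<open>b\<^sub>i\<^sub>j\<close> have the right sign.
  Summing over the coordinates, \<open>\<Sum> |grad x|\<^sup>2 = n\<close> and \<open>\<Delta>X = n H\<close> is normal, so that
  \<open>\<Sum> \<parallel>P u\<parallel>\<^sup>2 \<le> 4 \<integral> |grad u|\<^sup>2 + n\<^sup>2 \<delta> \<le> 4 \<lambda> powr (1/2) + n\<^sup>2 \<delta>\<close> for an eigenfunction, and a free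
  parameter is optimized at the end.

  The spectrum is only given by the dimensions of the eigenspaces. The inequality
  \<open>\<lambda>\<^sub>k\<^sub>+\<^sub>1 \<parallel>v\<parallel>\<^sup>2 \<le> \<parallel>\<Delta>v\<parallel>\<^sup>2\<close> follows from them by minimizing \<open>\<parallel>\<Delta>v\<parallel>\<^sup>2 / \<parallel>v\<parallel>\<^sup>2\<close> among functions orthogonal to
  the \<open>u\<^sub>j\<close>: a minimizer would be a further eigenfunction. It exists by Rellich's compactness theorem,
  which is reduced to a Poincare inequality on small cubes in charts.\<close>

section \<open>Functions of class C^k on open subsets of Euclidean space\<close>

text \<open>Eigenfunctions are never shown to be differentiable. Identities are proved for test
  functions and passed to \<open>L^2\<close> limits: \<open>pairs\<close> is the closed graph of the
  Laplacian, and \<open>eigen_ip\<close>, the equation tested against an arbitrary pair, is how the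
  eigenvalue equation is used. Multiplying by \<open>x\<close> brings in first derivatives, on which
  the norm of \<open>H20\<close> is silent; the bound on the commutators makes them converge too.
  The Laplacian and the mean curvature are computed in a selected chart, so their regularity has to
  wait for independence of the chart; for \<open>|H|^2\<close> it comes from
  \<open>\<Delta>X = n H\<close>. Constants: the weight of \<open>g\<close> is the sum over the
  coordinates of \<open>\<parallel>P u\<parallel>^2 - 2 \<integral> |grad x|^2 u \<Delta>u\<close>.
  Since \<open>- \<integral> u \<Delta>u \<le> \<lambda> powr (1/2)\<close>, the second term adds
  \<open>2 n\<close> to the \<open>4\<close> from the commutators, whence \<open>2 (n + 2)\<close>.
  The other weight is a quarter of the commutator bound, as half of \<open>P u\<close> enters
  Cauchy-Schwarz. The integrals of \<open>|grad x|^2 u^2\<close> add up to \<open>n\<close>, and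
  optimizing \<open>s A + B / s\<close> gives the factor \<open>2\<close>.\<close>

primrec Ck :: "nat \<Rightarrow> (real^'n::finite) set \<Rightarrow> (real^'n \<Rightarrow> 'b::real_normed_vector) \<Rightarrow> bool" where
  "Ck 0 S f \<longleftrightarrow> continuous_on S f"
| "Ck (Suc k) S f \<longleftrightarrow> f differentiable_on S \<and> (\<forall>i. Ck k S (partial i f))"

lemma partial_cong:
  assumes "open S" "\<And>x. x \<in> S \<Longrightarrow> f x = g x" "x \<in> S"
  shows "partial i f x = partial i g x"
proof -
  have "(f has_derivative D) (at x) \<longleftrightarrow> (g has_derivative D) (at x)" for D
    using assms by (intro iffI; elim has_derivative_transform_within_open) auto
  then show ?thesis by (simp add: partial_def frechet_derivative_def)
qed

lemma differentiable_on_cong_open: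
  assumes "open S" "\<And>x. x \<in> S \<Longrightarrow> f x = g x" "f differentiable_on S"
  shows "g differentiable_on S"
  unfolding differentiable_on_def
proof
  fix x assume x: "x \<in> S"
  then have "f differentiable (at x within S)" using assms(3) by (auto simp: differentiable_on_def)
  then show "g differentiable (at x within S)"
    by (rule differentiable_transform_within[OF _ zero_less_one x]) (use assms in auto)
qed

lemma Ck_cong:
  assumes "open S" "\<And>x. x \<in> S \<Longrightarrow> f x = g x" "Ck k S f"
  shows "Ck k S g"
  using assms(2,3)
proof (induction k arbitrary: f g)
  case 0
  then show ?case using continuous_on_cong[of S S f g] by simp
next
  case (Suc k)
  have "Ck k S (partial i g)" for i
    by (rule Suc.IH[of "partial i f"]) (use Suc.prems partial_cong[OF assms(1), of f g] in auto)
  then show ?case using Suc.prems differentiable_on_cong_open[OF assms(1), of f g] by auto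
qed

lemma Ck_subset: assumes "Ck k S f" "U \<subseteq> S" shows "Ck k U f"
  using assms
  by (induction k arbitrary: f) (auto intro: continuous_on_subset differentiable_on_subset)

lemma Ck_Union:
  assumes "\<And>S. S \<in> F \<Longrightarrow> open S" "\<And>S. S \<in> F \<Longrightarrow> Ck k S f"
  shows "Ck k (\<Union>F) f"
  using assms(2)
proof (induction k arbitrary: f)
  case 0
  then show ?case using assms(1) by (simp add: continuous_on_open_Union)
next
  case (Suc k)
  have "f differentiable_on \<Union>F"
    unfolding differentiable_on_def
  proof
    fix x assume "x \<in> \<Union>F"
    then obtain S where "S \<in> F" "x \<in> S" by blast
    then have "f differentiable at x"
      using Suc.prems[of S] assms(1)[of S] by (simp add: differentiable_on_eq_differentiable_at)
    then show "f differentiable at x within \<Union>F" by (rule differentiable_at_withinI)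
  qed
  then show ?case using Suc by simp
qed

lemma Ck_Un: "open S \<Longrightarrow> open U \<Longrightarrow> Ck k S f \<Longrightarrow> Ck k U f \<Longrightarrow> Ck k (S \<union> U) f"
  using Ck_Union[of "{S, U}" k f] by auto

lemma Ck_imp_continuous_on: "Ck k S f \<Longrightarrow> continuous_on S f"
  by (cases k) (auto intro: differentiable_imp_continuous_on)

lemma Ck_SucD: "Ck (Suc k) S f \<Longrightarrow> Ck k S f"
proof (induction k arbitrary: f)
  case 0
  then show ?case by (auto intro: differentiable_imp_continuous_on)
next
  case (Suc k)
  then show ?case by auto
qed

lemma Ck_mono: "Ck k S f \<Longrightarrow> j \<le> k \<Longrightarrow> Ck j S f"
  by (induction k rule: nat_induct) (auto simp: le_Suc_eq intro: Ck_SucD simp del: Ck.simps(2))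

lemma Ck_differentiable: "open S \<Longrightarrow> Ck (Suc k) S f \<Longrightarrow> x \<in> S \<Longrightarrow> f differentiable at x"
  by (simp add: differentiable_on_eq_differentiable_at)

text \<open>Finite orders allow closure properties to be proved by induction with the loss of one
  derivative, and they cover the cut-offs of class \<open>C^1\<close> and the Laplacians of
  \<open>C^3\<close> functions below. Each order includes continuity of the highest derivatives,
  which for smooth functions follows from differentiability of the next ones.\<close>

lemma smooth_on_iff: "smooth_on S f \<longleftrightarrow> (\<forall>k. Ck k S f)"
proof
  assume s: "smooth_on S f"
  have "Ck k S (foldr partial js f)" for k js
  proof (induction k arbitrary: js)
    case 0
    then show ?case using s by (simp add: smooth_on_def differentiable_imp_continuous_on)
  next
    case (Suc k)
    have "Ck k S (partial i (foldr partial js f))" for i using Suc.IH[of "i # js"] by simp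
    then show ?case using s by (simp add: smooth_on_def)
  qed
  from this[of _ "[]"] show "\<forall>k. Ck k S f" by simp
next
  assume s: "\<forall>k. Ck k S f"
  have "\<forall>k. Ck k S (foldr partial js f)" for js
  proof (induction js)
    case (Cons i js)
    then have "Ck (Suc k) S (foldr partial js f)" for k by blast
    then show ?case by simp
  qed (use s in simp)
  then have "Ck (Suc 0) S (foldr partial js f)" for js by blast
  then show "smooth_on S f" by (simp add: smooth_on_def)
qed

lemma differentiable_imp_has_frechet: "f differentiable at x \<Longrightarrow> (f has_derivative frechet_derivative f (at x)) (at x)"
  by (simp add: frechet_derivative_works)

lemma partial_has_derivative: "(f has_derivative D) (at x) \<Longrightarrow> partial i f x = D (axis i 1)"
  by (simp add: partial_def frechet_derivative_at[symmetric])

lemma partial_const [simp]: "partial i (\<lambda>x. c) x = 0"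
  by (rule partial_has_derivative[of _ "\<lambda>_. 0", simplified]) (rule has_derivative_const)

lemma Ck_const: "Ck k (S :: (real^'n::finite) set) (\<lambda>x. c)"
proof (induction k arbitrary: c)
  case (Suc k)
  have "partial i (\<lambda>x. c) = (\<lambda>x. 0)" for i :: 'n by (rule ext) simp
  then show ?case using Suc[of 0] by simp
qed simp

lemma partial_bounded_linear:
  assumes "bounded_linear L" "f differentiable at x"
  shows "partial i (\<lambda>x. L (f x)) x = L (partial i f x)"
  using partial_has_derivative[OF bounded_linear.has_derivative[OF assms(1) differentiable_imp_has_frechet[OF assms(2)]]]
  by (simp add: partial_def)

lemma Ck_bounded_linear:
  assumes L: "bounded_linear L" and S: "open S" and f: "Ck k S f"
  shows "Ck k S (\<lambda>x. L (f x))"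
  using f
proof (induction k arbitrary: f)
  case 0
  then show ?case using bounded_linear.continuous_on[OF L] by simp
next
  case (Suc k)
  have "Ck k S (partial i (\<lambda>x. L (f x)))" for i
    by (rule Ck_cong[OF S _ Suc.IH[of "partial i f"]])
       (use Suc.prems Ck_differentiable[OF S Suc.prems] in \<open>auto simp: partial_bounded_linear[OF L]\<close>)
  moreover have "(\<lambda>x. L (f x)) differentiable_on S"
    using Suc.prems bounded_linear_imp_differentiable[OF L]
    by (auto simp: differentiable_on_def intro: differentiable_compose[of L f])
  ultimately show ?case by simp
qed

lemma partial_add:
  assumes "f differentiable at x" "g differentiable at x"
  shows "partial i (\<lambda>x. f x + g x) x = partial i f x + partial i g x"
  using partial_has_derivative[OF has_derivative_add[OF differentiable_imp_has_frechet[OF assms(1)] differentiable_imp_has_frechet[OF assms(2)]]]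
  by (simp add: partial_def)

lemma Ck_add:
  assumes S: "open S" and "Ck k S f" "Ck k S g"
  shows "Ck k S (\<lambda>x. f x + g x)"
  using assms(2,3)
proof (induction k arbitrary: f g)
  case 0
  then show ?case by (simp add: continuous_on_add)
next
  case (Suc k)
  have "Ck k S (partial i (\<lambda>x. f x + g x))" for i
    by (rule Ck_cong[OF S _ Suc.IH[of "partial i f" "partial i g"]])
       (use Suc.prems Ck_differentiable[OF S Suc.prems(1)] Ck_differentiable[OF S Suc.prems(2)] in \<open>auto simp: partial_add\<close>)
  then show ?case using Suc.prems by simp
qed

lemma Ck_uminus: "open S \<Longrightarrow> Ck k S f \<Longrightarrow> Ck k S (\<lambda>x. - f x)"
  by (rule Ck_bounded_linear[OF bounded_linear_minus[OF bounded_linear_ident]])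

lemma Ck_diff: "open S \<Longrightarrow> Ck k S f \<Longrightarrow> Ck k S g \<Longrightarrow> Ck k S (\<lambda>x. f x - g x)"
  using Ck_add[of S k f "\<lambda>x. - g x"] Ck_uminus[of S k g] by simp

lemma Ck_sum:
  assumes "open S" "\<And>i. i \<in> I \<Longrightarrow> Ck k S (f i)" shows "Ck k S (\<lambda>x. \<Sum>i\<in>I. f i x)"
  using assms(2) by (induction I rule: infinite_finite_induct) (simp_all add: Ck_const Ck_add[OF assms(1)])

lemma partial_mult:
  fixes f g :: "real^'n::finite \<Rightarrow> real"
  assumes "f differentiable at x" "g differentiable at x"
  shows "partial i (\<lambda>x. f x * g x) x = f x * partial i g x + partial i f x * g x"
  using partial_has_derivative[OF has_derivative_mult[OF differentiable_imp_has_frechet[OF assms(1)] differentiable_imp_has_frechet[OF assms(2)]]]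
  by (simp add: partial_def)

lemma Ck_mult:
  fixes f g :: "real^'n::finite \<Rightarrow> real"
  assumes S: "open S" and "Ck k S f" "Ck k S g"
  shows "Ck k S (\<lambda>x. f x * g x)"
  using assms(2,3)
proof (induction k arbitrary: f g)
  case 0
  then show ?case by (simp add: continuous_on_mult)
next
  case (Suc k)
  have "Ck k S (partial i (\<lambda>x. f x * g x))" for i
  proof (rule Ck_cong[OF S])
    show "Ck k S (\<lambda>x. f x * partial i g x + partial i f x * g x)"
      using Suc.prems by (intro Ck_add[OF S] Suc.IH) (auto intro: Ck_SucD simp del: Ck.simps(2) simp: Ck.simps(2)[of k S f] Ck.simps(2)[of k S g])
  qed (simp add: partial_mult Ck_differentiable[OF S Suc.prems(1)] Ck_differentiable[OF S Suc.prems(2)])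
  then show ?case using Suc.prems by simp
qed

lemma Ck_power:
  fixes f :: "real^'n::finite \<Rightarrow> real"
  assumes "open S" "Ck k S f" shows "Ck k S (\<lambda>x. f x ^ m)"
  by (induction m) (simp_all add: Ck_const Ck_mult[OF assms(1)] assms)

lemma Ck_prod:
  fixes f :: "'i \<Rightarrow> real^'n::finite \<Rightarrow> real"
  assumes "open S" "\<And>i. i \<in> I \<Longrightarrow> Ck k S (f i)" shows "Ck k S (\<lambda>x. \<Prod>i\<in>I. f i x)"
  using assms(2) by (induction I rule: infinite_finite_induct) (simp_all add: Ck_const Ck_mult[OF assms(1)])

lemma partial_compose_real:
  fixes f :: "real^'n::finite \<Rightarrow> real"
  assumes "f differentiable at x" "(h has_real_derivative h') (at (f x))"
  shows "partial i (\<lambda>x. h (f x)) x = h' * partial i f x"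
    and "(\<lambda>x. h (f x)) differentiable at x"
proof -
  have "((\<lambda>x. h (f x)) has_derivative (\<lambda>y. h' * frechet_derivative f (at x) y)) (at x)"
    using has_derivative_compose[OF differentiable_imp_has_frechet[OF assms(1)], of h "\<lambda>y. h' * y"] assms(2)
    by (simp add: has_field_derivative_def)
  from partial_has_derivative[OF this] this
  show "partial i (\<lambda>x. h (f x)) x = h' * partial i f x" "(\<lambda>x. h (f x)) differentiable at x"
    by (auto simp: partial_def differentiable_def)
qed

lemma Ck_inverse:
  fixes f :: "real^'n::finite \<Rightarrow> real"
  assumes S: "open S" and f: "Ck k S f" and nz: "\<And>x. x \<in> S \<Longrightarrow> f x \<noteq> 0"
  shows "Ck k S (\<lambda>x. inverse (f x))"
  using f
proof (induction k)
  case 0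
  then show ?case using nz by (simp add: continuous_on_inverse)
next
  case (Suc k)
  have fd: "f differentiable at x" if "x \<in> S" for x by (rule Ck_differentiable[OF S Suc.prems that])
  note fp = partial_compose_real[OF fd DERIV_inverse[OF nz]]
  have "Ck k S (partial i (\<lambda>x. inverse (f x)))" for i
  proof (rule Ck_cong[OF S])
    show "Ck k S (\<lambda>x. - (inverse (f x) ^ 2) * partial i f x)"
      using Suc.prems by (intro Ck_mult Ck_uminus Ck_power S Suc.IH[OF Ck_SucD[OF Suc.prems]]) simp
  qed (simp add: fp(1) numeral_2_eq_2)
  moreover have "(\<lambda>x. inverse (f x)) differentiable_on S"
    using fp(2) S by (simp add: differentiable_on_eq_differentiable_at)
  ultimately show ?case by simp
qed

lemma Ck_divide:
  fixes f g :: "real^'n::finite \<Rightarrow> real"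
  assumes "open S" "Ck k S f" "Ck k S g" "\<And>x. x \<in> S \<Longrightarrow> g x \<noteq> 0"
  shows "Ck k S (\<lambda>x. f x / g x)"
  unfolding divide_inverse using assms by (intro Ck_mult Ck_inverse)

lemma Ck_sqrt:
  fixes f :: "real^'n::finite \<Rightarrow> real"
  assumes S: "open S" and f: "Ck k S f" and pos: "\<And>x. x \<in> S \<Longrightarrow> f x > 0"
  shows "Ck k S (\<lambda>x. sqrt (f x))"
  using f
proof (induction k)
  case 0
  then show ?case by (simp add: continuous_on_real_sqrt)
next
  case (Suc k)
  have fd: "f differentiable at x" if "x \<in> S" for x by (rule Ck_differentiable[OF S Suc.prems that])
  note fp = partial_compose_real[OF fd DERIV_real_sqrt[OF pos]]
  have "Ck k S (partial i (\<lambda>x. sqrt (f x)))" for i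
  proof (rule Ck_cong[OF S])
    show "Ck k S (\<lambda>x. inverse (sqrt (f x)) / 2 * partial i f x)"
      unfolding divide_inverse using Suc pos
      by (intro Ck_mult Ck_inverse Ck_const S) (force intro: Ck_SucD simp del: Ck.simps(2) simp: Ck.simps(2)[of k S f])+
  qed (simp add: fp(1))
  moreover have "(\<lambda>x. sqrt (f x)) differentiable_on S"
    using fp(2) S by (simp add: differentiable_on_eq_differentiable_at)
  ultimately show ?case by simp
qed

lemma pos_part_square_deriv: "((\<lambda>t. (max 0 t)\<^sup>2) has_real_derivative 2 * max 0 t) (at (t::real))"
proof (cases "t = 0")
  case False
  show ?thesis
  proof (cases "t > 0")
    case True
    have "((\<lambda>t. t\<^sup>2) has_real_derivative 2 * t) (at t)" by (auto intro!: derivative_eq_intros)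
    then have "((\<lambda>t. (max 0 t)\<^sup>2) has_real_derivative 2 * t) (at t)"
      by (rule has_field_derivative_transform_within_open[of _ _ _ "{0<..}"]) (use True in auto)
    then show ?thesis using True by simp
  next
    case neg: False
    have "((\<lambda>t. 0) has_real_derivative 0) (at t)" by (auto intro!: derivative_eq_intros)
    then have "((\<lambda>t. (max 0 t)\<^sup>2) has_real_derivative 0) (at t)"
      by (rule has_field_derivative_transform_within_open[of _ _ _ "{..<0}"]) (use neg False in auto)
    then show ?thesis using neg by simp
  qed
next
  case True
  have "(\<lambda>h. ((max 0 (0 + h))\<^sup>2 - (max 0 0)\<^sup>2) / h) \<midarrow>0\<rightarrow> (0::real)"
  proof (rule Lim_null_comparison)
    show "\<forall>\<^sub>F h in at 0. norm (((max 0 (0 + h))\<^sup>2 - (max 0 0)\<^sup>2) / h) \<le> \<bar>h::real\<bar>"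
      by (rule always_eventually) (auto simp: max_def power2_eq_square)
    show "((\<lambda>h. \<bar>h\<bar>) \<longlongrightarrow> 0) (at (0::real))" using tendsto_rabs[OF tendsto_ident_at, of "0::real" UNIV] by simp
  qed
  then show ?thesis using True by (simp add: DERIV_def)
qed

text \<open>The square removes the kink of the positive part just far enough for \<open>C^1\<close>;
  the cut-off functions \<open>bump\<close> have this form.\<close>

lemma Ck1_pos_part_square:
  fixes f :: "real^'n::finite \<Rightarrow> real"
  assumes S: "open S" and f: "Ck (Suc 0) S f"
  shows "Ck (Suc 0) S (\<lambda>x. (max 0 (f x))\<^sup>2)"
proof -
  have fd: "f differentiable at x" if "x \<in> S" for x by (rule Ck_differentiable[OF S f that])
  note fp = partial_compose_real[OF fd pos_part_square_deriv]
  have "continuous_on S (partial i (\<lambda>x. (max 0 (f x))\<^sup>2))" for i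
  proof -
    have "continuous_on S (\<lambda>x. 2 * max 0 (f x) * partial i f x)"
      using f Ck_imp_continuous_on[OF f] by (intro continuous_intros) auto
    then show ?thesis using continuous_on_cong[of S S "partial i (\<lambda>x. (max 0 (f x))\<^sup>2)"] fp(1) by simp
  qed
  then show ?thesis using fp(2) S by (simp add: differentiable_on_eq_differentiable_at)
qed

lemma frechet_derivative_partial:
  fixes f :: "real^'n::finite \<Rightarrow> 'b::real_normed_vector"
  assumes "f differentiable at x"
  shows "frechet_derivative f (at x) v = (\<Sum>i\<in>UNIV. (v $ i) *\<^sub>R partial i f x)"
proof -
  have L: "linear (frechet_derivative f (at x))" by (rule linear_frechet_derivative[OF assms])
  have "v = (\<Sum>i\<in>UNIV. (v $ i) *\<^sub>R axis i 1)" using basis_expansion[of v] by (simp add: scalar_mult_eq_scaleR)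
  then have "frechet_derivative f (at x) v = frechet_derivative f (at x) (\<Sum>i\<in>UNIV. (v $ i) *\<^sub>R axis i 1)" by simp
  also have "\<dots> = (\<Sum>i\<in>UNIV. (v $ i) *\<^sub>R partial i f x)"
    unfolding partial_def by (simp add: linear_sum[OF L] linear_scale[OF L])
  finally show ?thesis .
qed

section \<open>Determinants and inverse matrices depending on a parameter\<close>

lemma matrix_inv_works:
  fixes A :: "real^'n^'n"
  assumes "det A \<noteq> 0"
  shows "A ** matrix_inv A = mat 1" "matrix_inv A ** A = mat 1"
proof -
  have "\<exists>B. A ** B = mat 1 \<and> B ** A = mat 1"
    using assms by (simp add: invertible_det_nz[symmetric] invertible_def)
  then have "A ** matrix_inv A = mat 1 \<and> matrix_inv A ** A = mat 1"
    unfolding matrix_inv_def by (rule someI_ex)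
  then show "A ** matrix_inv A = mat 1" "matrix_inv A ** A = mat 1" by auto
qed

lemma matrix_inv_unique:
  fixes A :: "real^'n^'n"
  assumes "A ** B = mat 1" shows "matrix_inv A = B"
proof -
  have "det A * det B = 1" using arg_cong[OF assms, of det] by (simp add: det_mul)
  then have "det A \<noteq> 0" by auto
  have "matrix_inv A = matrix_inv A ** (A ** B)" using assms by simp
  also have "\<dots> = B" using matrix_inv_works(2)[OF \<open>det A \<noteq> 0\<close>] by (simp add: matrix_mul_assoc)
  finally show ?thesis .
qed

lemma matrix_inv_symmetric:
  fixes A :: "real^'n^'n"
  assumes "det A \<noteq> 0" "transpose A = A"
  shows "transpose (matrix_inv A) = matrix_inv A"
proof -
  have "transpose (matrix_inv A ** A) = mat 1" using matrix_inv_works(2)[OF assms(1)] by (simp add: transpose_mat)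
  then have "A ** transpose (matrix_inv A) = mat 1" by (simp add: matrix_transpose_mul assms(2))
  then show ?thesis by (rule matrix_inv_unique[symmetric])
qed

text \<open>Writes the entries of the inverse as quotients of determinants, which is how the inverse
  metric inherits the differentiability of the metric.\<close>

lemma matrix_inv_cramer:
  fixes A :: "real^'n^'n"
  assumes "det A \<noteq> 0"
  shows "matrix_inv A $ k $ l = det (\<chi> i j. if j = k then axis l 1 $ i else A $ i $ j) / det A"
proof -
  let ?x = "matrix_inv A *v axis l 1"
  have "A *v ?x = axis l 1" by (simp add: matrix_vector_mul_assoc matrix_inv_works(1)[OF assms])
  then have "?x = (\<chi> k. det (\<chi> i j. if j = k then axis l 1 $ i else A $ i $ j) / det A)"
    using cramer[OF assms] by blast
  then have "?x $ k = det (\<chi> i j. if j = k then axis l 1 $ i else A $ i $ j) / det A" by simp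
  moreover have "?x $ k = matrix_inv A $ k $ l" by (simp add: matrix_vector_mult_basis column_def)
  ultimately show ?thesis by simp
qed

lemma Ck_det:
  fixes A :: "real^'n::finite \<Rightarrow> real^'k::finite^'k"
  assumes S: "open S" and A: "\<And>i j. Ck k S (\<lambda>x. A x $ i $ j)"
  shows "Ck k S (\<lambda>x. det (A x))"
  unfolding det_def by (intro Ck_sum Ck_mult Ck_prod Ck_const S A)

lemma Ck_matrix_inv:
  fixes A :: "real^'n::finite \<Rightarrow> real^'k::finite^'k"
  assumes S: "open S" and A: "\<And>i j. Ck k S (\<lambda>x. A x $ i $ j)" and nz: "\<And>x. x \<in> S \<Longrightarrow> det (A x) \<noteq> 0"
  shows "Ck k S (\<lambda>x. matrix_inv (A x) $ a $ b)"
proof (rule Ck_cong[OF S])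
  show "Ck k S (\<lambda>x. det (\<chi> i j. if j = a then axis b 1 $ i else A x $ i $ j) / det (A x))"
  proof (intro Ck_divide Ck_det S A nz)
    fix i j
    show "Ck k S (\<lambda>x. (\<chi> i j. if j = a then axis b 1 $ i else A x $ i $ j) $ i $ j)"
      by (cases "j = a") (simp_all add: A Ck_const)
  qed
qed (simp add: matrix_inv_cramer nz)

text \<open>In the Leibniz expansion a permutation other than \<open>id\<close> moves at least two
  indices. The product rule differentiates one factor and leaves another off-diagonal entry of the
  identity matrix, so only the trace survives.\<close>

lemma partial_det_at_identity:
  fixes B :: "real^'n::finite \<Rightarrow> real^'k::finite^'k"
  assumes B: "\<And>i j. (\<lambda>x. B x $ i $ j) differentiable at x" and B1: "B x = mat 1"
  shows "partial l (\<lambda>x. det (B x)) x = (\<Sum>i\<in>UNIV. partial l (\<lambda>x. B x $ i $ i) x)"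
proof -
  let ?d = "\<lambda>i j. frechet_derivative (\<lambda>x. B x $ i $ j) (at x)"
  have fd: "((\<lambda>x. B x $ i $ j) has_derivative ?d i j) (at x)" for i j
    by (rule differentiable_imp_has_frechet[OF B])
  have "((\<lambda>x. det (B x)) has_derivative (\<lambda>y. \<Sum>p\<in>{p. p permutes UNIV}. of_int (sign p) *
       (\<Sum>i\<in>UNIV. ?d i (p i) y * (\<Prod>j\<in>UNIV - {i}. B x $ j $ p j)))) (at x)"
    unfolding det_def by (intro has_derivative_sum has_derivative_mult_right has_derivative_prod fd)
  from partial_has_derivative[OF this]
  have "partial l (\<lambda>x. det (B x)) x = (\<Sum>p\<in>{p. p permutes UNIV}. of_int (sign p) *
       (\<Sum>i\<in>UNIV. ?d i (p i) (axis l 1) * (\<Prod>j\<in>UNIV - {i}. B x $ j $ p j)))" .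
  also have "\<dots> = (\<Sum>p\<in>{id}. of_int (sign p) *
       (\<Sum>i\<in>UNIV. ?d i (p i) (axis l 1) * (\<Prod>j\<in>UNIV - {i}. B x $ j $ p j)))"
  proof (rule sum.mono_neutral_right)
    show "finite {p::'k \<Rightarrow> 'k. p permutes UNIV}" by (simp add: finite_permutations)
    show "{id} \<subseteq> {p::'k \<Rightarrow> 'k. p permutes UNIV}" by (simp add: permutes_id)
    show "\<forall>p\<in>{p. p permutes UNIV} - {id}. of_int (sign p) *
       (\<Sum>i\<in>UNIV. ?d i (p i) (axis l 1) * (\<Prod>j\<in>UNIV - {i}. B x $ j $ p j)) = 0"
    proof
      fix p :: "'k \<Rightarrow> 'k" assume "p \<in> {p. p permutes UNIV} - {id}"
      then have p: "p permutes UNIV" "p \<noteq> id" by auto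
      have z: "(\<Prod>j\<in>UNIV - {i}. B x $ j $ p j) = 0" for i
      proof -
        have "\<exists>j. j \<noteq> i \<and> p j \<noteq> j"
        proof (rule ccontr)
          assume "\<not> ?thesis"
          then have fix_other: "\<And>j. j \<noteq> i \<Longrightarrow> p j = j" by blast
          have "p i = i"
          proof (rule ccontr)
            assume "p i \<noteq> i"
            then have "p (p i) = p i" by (rule fix_other)
            then show False using \<open>p i \<noteq> i\<close> permutes_inj[OF p(1)] by (simp add: inj_eq)
          qed
          then have "p j = j" for j using fix_other by (cases "j = i") auto
          then have "p = id" by (auto simp: fun_eq_iff)
          with p(2) show False by simp
        qed
        then obtain j where "j \<in> UNIV - {i}" "B x $ j $ p j = 0" by (auto simp: B1 mat_def)
        then show ?thesis by (intro prod_zero) auto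
      qed
      show "of_int (sign p) * (\<Sum>i\<in>UNIV. ?d i (p i) (axis l 1) * (\<Prod>j\<in>UNIV - {i}. B x $ j $ p j)) = 0"
        by (simp only: z mult_zero_right sum.neutral_const)
    qed
  qed
  also have "\<dots> = (\<Sum>i\<in>UNIV. ?d i i (axis l 1))" by (simp add: B1 mat_def)
  finally show ?thesis by (simp add: partial_def)
qed

lemma partial_sum:
  assumes "\<And>i. i \<in> I \<Longrightarrow> f i differentiable at x"
  shows "partial l (\<lambda>x. \<Sum>i\<in>I. f i x) x = (\<Sum>i\<in>I. partial l (f i) x)"
    and "(\<lambda>x. \<Sum>i\<in>I. f i x) differentiable at x"
proof -
  have "((\<lambda>x. \<Sum>i\<in>I. f i x) has_derivative (\<lambda>y. \<Sum>i\<in>I. frechet_derivative (f i) (at x) y)) (at x)"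
    by (intro has_derivative_sum differentiable_imp_has_frechet assms)
  from partial_has_derivative[OF this] this
  show "partial l (\<lambda>x. \<Sum>i\<in>I. f i x) x = (\<Sum>i\<in>I. partial l (f i) x)"
    "(\<lambda>x. \<Sum>i\<in>I. f i x) differentiable at x" by (auto simp: partial_def differentiable_def)
qed

text \<open>Jacobi's formula. Multiplication by the constant matrix \<open>matrix_inv (A x)\<close>
  moves the base point to the identity.\<close>

lemma partial_det:
  fixes A :: "real^'n::finite \<Rightarrow> real^'k::finite^'k"
  assumes A: "\<And>i j. (\<lambda>x. A x $ i $ j) differentiable at x" and nz: "det (A x) \<noteq> 0"
  shows "partial l (\<lambda>x. det (A x)) x = det (A x) * (\<Sum>i\<in>UNIV. \<Sum>j\<in>UNIV. matrix_inv (A x) $ i $ j * partial l (\<lambda>x. A x $ j $ i) x)"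
proof -
  define C where "C = matrix_inv (A x)"
  define B where "B y = C ** A y" for y
  have AC: "A x ** C = mat 1" and CA: "C ** A x = mat 1" using matrix_inv_works[OF nz] by (auto simp: C_def)
  have dAC: "det (A x) * det C = 1" using arg_cong[OF AC, of det] by (simp add: det_mul)
  have B: "(\<lambda>y. B y $ i $ j) = (\<lambda>y. \<Sum>k\<in>UNIV. C $ i $ k * A y $ k $ j)" for i j
    by (simp add: B_def matrix_matrix_mult_def)
  have term_diff: "(\<lambda>y. c * A y $ i $ j) differentiable at x" for c i j
    using A by (intro differentiable_mult) auto
  have pterm: "partial l (\<lambda>y. c * A y $ i $ j) x = c * partial l (\<lambda>y. A y $ i $ j) x" for c i j
    using partial_mult[of "\<lambda>_. c" x "\<lambda>y. A y $ i $ j" l] A by simp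
  have detB: "det (A y) = det (A x) * det (B y)" for y
    using dAC by (simp add: B_def det_mul)
  have Bd: "(\<lambda>y. B y $ i $ j) differentiable at x" for i j
    unfolding B by (intro partial_sum(2) term_diff)
  have "partial l (\<lambda>y. det (A y)) x = partial l (\<lambda>y. det (A x) * det (B y)) x"
    by (rule arg_cong[of _ _ "\<lambda>h. partial l h x"]) (rule ext, rule detB)
  also have "\<dots> = det (A x) * partial l (\<lambda>y. det (B y)) x"
  proof -
    have "(\<lambda>y. det (B y)) differentiable at x"
      unfolding det_def
    proof (intro partial_sum(2) differentiable_mult differentiable_const)
      fix p :: "'k \<Rightarrow> 'k"
      have "((\<lambda>x. \<Prod>i\<in>UNIV. B x $ i $ p i) has_derivative (\<lambda>y. \<Sum>i\<in>UNIV.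
          frechet_derivative (\<lambda>x. B x $ i $ p i) (at x) y * (\<Prod>j\<in>UNIV - {i}. B x $ j $ p j))) (at x)"
        by (rule has_derivative_prod) (rule differentiable_imp_has_frechet[OF Bd])
      then show "(\<lambda>x. \<Prod>i\<in>UNIV. B x $ i $ p i) differentiable at x" by (rule differentiableI)
    qed
    then show ?thesis using partial_mult[of "\<lambda>_. det (A x)" x "\<lambda>y. det (B y)" l] by simp
  qed
  also have "partial l (\<lambda>y. det (B y)) x = (\<Sum>i\<in>UNIV. partial l (\<lambda>y. B y $ i $ i) x)"
    by (rule partial_det_at_identity[OF Bd]) (simp add: B_def CA)
  also have "\<dots> = (\<Sum>i\<in>UNIV. \<Sum>j\<in>UNIV. C $ i $ j * partial l (\<lambda>x. A x $ j $ i) x)"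
    unfolding B by (simp add: partial_sum(1)[OF term_diff] pterm)
  finally show ?thesis by (simp add: C_def)
qed

section \<open>Symmetry of second partial derivatives\<close>

lemma DERIV_along_axis:
  fixes f :: "real^'n::finite \<Rightarrow> real"
  assumes "f differentiable at (x + t *\<^sub>R axis i 1)"
  shows "((\<lambda>t. f (x + t *\<^sub>R axis i 1)) has_real_derivative partial i f (x + t *\<^sub>R axis i 1)) (at t)"
proof -
  have "((\<lambda>t. x + t *\<^sub>R axis i 1) has_derivative (\<lambda>s. s *\<^sub>R axis i 1)) (at t)"
    by (auto intro!: derivative_eq_intros)
  from has_derivative_compose[OF this differentiable_imp_has_frechet[OF assms]]
  have "((\<lambda>t. f (x + t *\<^sub>R axis i 1)) has_derivative (\<lambda>s. frechet_derivative f (at (x + t *\<^sub>R axis i 1)) (s *\<^sub>R axis i 1))) (at t)" .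
  moreover have "frechet_derivative f (at (x + t *\<^sub>R axis i 1)) (s *\<^sub>R axis i 1) = partial i f (x + t *\<^sub>R axis i 1) * s" for s
    unfolding partial_def using linear_scale[OF linear_frechet_derivative[OF assms]] by simp
  ultimately show ?thesis by (simp add: has_field_derivative_def)
qed

text \<open>The mean value theorem is applied to the difference in direction \<open>j\<close> as a
  function of the step in direction \<open>i\<close>, and then along \<open>j\<close>. The second
  difference does not depend on the order of \<open>i\<close> and \<open>j\<close>, so reading it in
  both orders compares the two mixed derivatives.\<close>

lemma second_difference_mvt:
  fixes f :: "real^'n::finite \<Rightarrow> real"
  assumes f: "Ck (Suc (Suc 0)) (ball x r) f" and h: "0 < h" "2 * h < r"
  shows "\<exists>s t. 0 < s \<and> s < h \<and> 0 < t \<and> t < h \<and>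
    f (x + h *\<^sub>R axis i 1 + h *\<^sub>R axis j 1) - f (x + h *\<^sub>R axis i 1) - f (x + h *\<^sub>R axis j 1) + f x =
    h\<^sup>2 * partial j (partial i f) (x + s *\<^sub>R axis i 1 + t *\<^sub>R axis j 1)"
proof -
  let ?e = "\<lambda>i. axis i (1::real) :: real^'n"
  have inb: "x + s *\<^sub>R ?e i + t *\<^sub>R ?e j \<in> ball x r" if "0 \<le> s" "s \<le> h" "0 \<le> t" "t \<le> h" for s t
  proof -
    have "norm (s *\<^sub>R ?e i + t *\<^sub>R ?e j) \<le> s + t"
      using norm_triangle_ineq[of "s *\<^sub>R ?e i" "t *\<^sub>R ?e j"] that by simp
    moreover have "dist x (x + (s *\<^sub>R ?e i + t *\<^sub>R ?e j)) = norm (s *\<^sub>R ?e i + t *\<^sub>R ?e j)"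
      unfolding dist_norm by (metis add_diff_cancel_left' norm_minus_commute)
    ultimately show ?thesis using that h unfolding mem_ball add.assoc by linarith
  qed
  have fd: "f differentiable at y" if "y \<in> ball x r" for y by (rule Ck_differentiable[OF open_ball f that])
  have pd: "partial i f differentiable at y" if "y \<in> ball x r" for y
    using f that by (intro Ck_differentiable[OF open_ball, where k=0]) auto
  define \<phi> where "\<phi> s = f (x + h *\<^sub>R ?e j + s *\<^sub>R ?e i) - f (x + s *\<^sub>R ?e i)" for s
  have "\<exists>s. 0 < s \<and> s < h \<and> \<phi> h - \<phi> 0 = (h - 0) * (partial i f (x + h *\<^sub>R ?e j + s *\<^sub>R ?e i) - partial i f (x + s *\<^sub>R ?e i))"
  proof (rule MVT2[OF h(1)])
    fix s assume s: "0 \<le> s" "s \<le> h"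
    show "(\<phi> has_real_derivative (partial i f (x + h *\<^sub>R ?e j + s *\<^sub>R ?e i) - partial i f (x + s *\<^sub>R ?e i))) (at s)"
      unfolding \<phi>_def[abs_def]
      using inb[of s h] inb[of s 0] s h by (intro DERIV_diff DERIV_along_axis fd) (auto simp: add_ac)
  qed
  then obtain s where s: "0 < s" "s < h"
    "\<phi> h - \<phi> 0 = h * (partial i f (x + h *\<^sub>R ?e j + s *\<^sub>R ?e i) - partial i f (x + s *\<^sub>R ?e i))" by auto
  define \<psi> where "\<psi> t = partial i f (x + s *\<^sub>R ?e i + t *\<^sub>R ?e j)" for t
  have "\<exists>t. 0 < t \<and> t < h \<and> \<psi> h - \<psi> 0 = (h - 0) * partial j (partial i f) (x + s *\<^sub>R ?e i + t *\<^sub>R ?e j)"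
  proof (rule MVT2[OF h(1)])
    fix t assume t: "0 \<le> t" "t \<le> h"
    show "(\<psi> has_real_derivative partial j (partial i f) (x + s *\<^sub>R ?e i + t *\<^sub>R ?e j)) (at t)"
      unfolding \<psi>_def[abs_def] using inb[of s t] s t by (intro DERIV_along_axis pd) auto
  qed
  then obtain t where t: "0 < t" "t < h" "\<psi> h - \<psi> 0 = h * partial j (partial i f) (x + s *\<^sub>R ?e i + t *\<^sub>R ?e j)" by auto
  have "\<phi> h - \<phi> 0 = h\<^sup>2 * partial j (partial i f) (x + s *\<^sub>R ?e i + t *\<^sub>R ?e j)"
    using s(3) t(3) by (simp add: \<psi>_def power2_eq_square add_ac)
  then show ?thesis using s t by (intro exI[of _ s] exI[of _ t]) (simp add: \<phi>_def add_ac)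
qed

lemma partial_commute:
  fixes f :: "real^'n::finite \<Rightarrow> real"
  assumes S: "open S" "x \<in> S" and f: "Ck (Suc (Suc 0)) S f"
  shows "partial i (partial j f) x = partial j (partial i f) x"
proof (rule ccontr)
  assume ne: "\<not> ?thesis"
  define e where "e = \<bar>partial i (partial j f) x - partial j (partial i f) x\<bar> / 2"
  have e: "e > 0" using ne by (simp add: e_def)
  have "isCont (partial i (partial j f)) x" "isCont (partial j (partial i f)) x"
    using f S by (auto simp: continuous_on_eq_continuous_at)
  note c = this[unfolded continuous_at_eps_delta, rule_format, OF e]
  obtain d1 where d1: "d1 > 0" "\<forall>y. dist y x < d1 \<longrightarrow> dist (partial i (partial j f) y) (partial i (partial j f) x) < e"
    using c(1) by (elim exE conjE)
  obtain d2 where d2: "d2 > 0" "\<forall>y. dist y x < d2 \<longrightarrow> dist (partial j (partial i f) y) (partial j (partial i f) x) < e"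
    using c(2) by (elim exE conjE)
  obtain r where r: "r > 0" "ball x r \<subseteq> S" by (rule openE[OF S])
  \<comment> \<open>Both intermediate points have distance less than \<open>2 * h\<close> from
    \<open>x\<close>, which must stay below all three radii.\<close>
  define h where "h = min r (min d1 d2) / 4"
  have h: "h > 0" "2 * h < r" "2 * h < d1" "2 * h < d2" using r d1(1) d2(1) by (auto simp: h_def)
  have fb: "Ck (Suc (Suc 0)) (ball x r) f" using Ck_subset[OF f r(2)] .
  have near: "dist (x + s *\<^sub>R axis i 1 + t *\<^sub>R axis j 1) x < 2 * h" if "0 < s" "s < h" "0 < t" "t < h" for s t i j
  proof -
    have "norm (s *\<^sub>R axis i (1::real) + t *\<^sub>R axis j 1 :: real^'n) \<le> s + t"
      using norm_triangle_ineq[of "s *\<^sub>R axis i (1::real)" "t *\<^sub>R axis j 1 :: real^'n"] that by simp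
    then show ?thesis using that by (simp add: dist_norm add.assoc)
  qed
  obtain s t where st: "0 < s" "s < h" "0 < t" "t < h"
    and st5: "f (x + h *\<^sub>R axis i 1 + h *\<^sub>R axis j 1) - f (x + h *\<^sub>R axis i 1) - f (x + h *\<^sub>R axis j 1) + f x =
    h\<^sup>2 * partial j (partial i f) (x + s *\<^sub>R axis i 1 + t *\<^sub>R axis j 1)"
    using second_difference_mvt[OF fb h(1,2), of i j] by (elim exE conjE)
  obtain s' t' where st': "0 < s'" "s' < h" "0 < t'" "t' < h"
    and st5': "f (x + h *\<^sub>R axis j 1 + h *\<^sub>R axis i 1) - f (x + h *\<^sub>R axis j 1) - f (x + h *\<^sub>R axis i 1) + f x =
    h\<^sup>2 * partial i (partial j f) (x + s' *\<^sub>R axis j 1 + t' *\<^sub>R axis i 1)"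
    using second_difference_mvt[OF fb h(1,2), of j i] by (elim exE conjE)
  have "h\<^sup>2 * partial j (partial i f) (x + s *\<^sub>R axis i 1 + t *\<^sub>R axis j 1) =
      h\<^sup>2 * partial i (partial j f) (x + s' *\<^sub>R axis j 1 + t' *\<^sub>R axis i 1)"
    using st5 st5' unfolding add.assoc add.commute[of "h *\<^sub>R axis j 1" "h *\<^sub>R axis i 1"] by linarith
  then have "partial j (partial i f) (x + s *\<^sub>R axis i 1 + t *\<^sub>R axis j 1) =
      partial i (partial j f) (x + s' *\<^sub>R axis j 1 + t' *\<^sub>R axis i 1)" using h(1) by simp
  moreover have "dist (partial j (partial i f) (x + s *\<^sub>R axis i 1 + t *\<^sub>R axis j 1)) (partial j (partial i f) x) < e"
    using near[OF st, of i j] h by (intro d2(2)[rule_format]) linarith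
  moreover have "dist (partial i (partial j f) (x + s' *\<^sub>R axis j 1 + t' *\<^sub>R axis i 1)) (partial i (partial j f) x) < e"
    using near[OF st', of j i] h by (intro d1(2)[rule_format]) linarith
  ultimately have "\<bar>partial i (partial j f) x - partial j (partial i f) x\<bar> < e + e"
    unfolding dist_real_def by linarith
  then show False by (simp add: e_def)
qed

section \<open>Square integrable functions\<close>

text \<open>Functions rather than classes, to match the eigenspaces of the statement; for such a
  function \<open>ip M u u = 0\<close> only means that \<open>u\<close> vanishes almost
  everywhere.\<close>

definition l2 :: "'a measure \<Rightarrow> ('a \<Rightarrow> real) \<Rightarrow> bool" where
  "l2 M u \<longleftrightarrow> u \<in> borel_measurable M \<and> integrable M (\<lambda>p. (u p)\<^sup>2)"

definition ip :: "'a measure \<Rightarrow> ('a \<Rightarrow> real) \<Rightarrow> ('a \<Rightarrow> real) \<Rightarrow> real" where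
  "ip M u v = (\<integral>p. u p * v p \<partial>M)"

abbreviation l2_tendsto :: "'a measure \<Rightarrow> (nat \<Rightarrow> 'a \<Rightarrow> real) \<Rightarrow> ('a \<Rightarrow> real) \<Rightarrow> bool" where
  "l2_tendsto M \<phi> u \<equiv> (\<lambda>j. ip M (\<lambda>p. \<phi> j p - u p) (\<lambda>p. \<phi> j p - u p)) \<longlonglongrightarrow> 0"

lemma l2_measurable: "l2 M u \<Longrightarrow> u \<in> borel_measurable M"
  by (simp add: l2_def)

declare l2_measurable [measurable_dest]

lemma l2_mult_integrable:
  assumes "l2 M u" "l2 M v" shows "integrable M (\<lambda>p. u p * v p)"
proof (rule Bochner_Integration.integrable_bound)
  show "integrable M (\<lambda>p. (u p)\<^sup>2 + (v p)\<^sup>2)" using assms by (simp add: l2_def)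
  show "(\<lambda>p. u p * v p) \<in> borel_measurable M" using assms by measurable
  have "\<bar>x * y\<bar> \<le> x\<^sup>2 + y\<^sup>2" for x y :: real
  proof -
    have "2 * (\<bar>x\<bar> * \<bar>y\<bar>) \<le> x\<^sup>2 + y\<^sup>2" using sum_squares_bound[of "\<bar>x\<bar>" "\<bar>y\<bar>"] by simp
    moreover have "0 \<le> \<bar>x\<bar> * \<bar>y\<bar>" by simp
    ultimately show ?thesis unfolding abs_mult by linarith
  qed
  then show "AE p in M. norm (u p * v p) \<le> norm ((u p)\<^sup>2 + (v p)\<^sup>2)" by simp
qed

lemma l2_zero [simp]: "l2 M (\<lambda>p. 0)" by (simp add: l2_def)

lemma l2_add: assumes "l2 M u" "l2 M v" shows "l2 M (\<lambda>p. u p + v p)"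
proof -
  have "integrable M (\<lambda>p. (u p)\<^sup>2 + (v p)\<^sup>2 + 2 * (u p * v p))"
    using assms l2_mult_integrable[OF assms] by (simp add: l2_def)
  moreover have "(\<lambda>p. u p + v p) \<in> borel_measurable M" using assms by measurable
  ultimately show ?thesis by (simp add: l2_def power2_sum algebra_simps)
qed

lemma l2_scale: assumes "l2 M u" shows "l2 M (\<lambda>p. a * u p)"
  unfolding l2_def
proof
  show "(\<lambda>p. a * u p) \<in> borel_measurable M" using assms by measurable
  show "integrable M (\<lambda>p. (a * u p)\<^sup>2)" using assms by (simp add: l2_def power_mult_distrib)
qed

lemma l2_diff: assumes "l2 M u" "l2 M v" shows "l2 M (\<lambda>p. u p - v p)"
  using l2_add[OF assms(1) l2_scale[OF assms(2), of "-1"]] by simp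

lemma l2_sum: assumes "\<And>i. i \<in> I \<Longrightarrow> l2 M (u i)" shows "l2 M (\<lambda>p. \<Sum>i\<in>I. u i p)"
  using assms by (induction I rule: infinite_finite_induct) (simp_all add: l2_add)

lemma l2_bounded_mult:
  assumes "l2 M u" "h \<in> borel_measurable M" "\<And>p. p \<in> space M \<Longrightarrow> \<bar>h p\<bar> \<le> C"
  shows "l2 M (\<lambda>p. h p * u p)"
  unfolding l2_def
proof
  show "(\<lambda>p. h p * u p) \<in> borel_measurable M" using assms by measurable
  show "integrable M (\<lambda>p. (h p * u p)\<^sup>2)"
  proof (rule Bochner_Integration.integrable_bound)
    show "integrable M (\<lambda>p. C\<^sup>2 * (u p)\<^sup>2)" using assms by (simp add: l2_def)
    show "(\<lambda>p. (h p * u p)\<^sup>2) \<in> borel_measurable M" using assms by measurable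
    show "AE p in M. norm ((h p * u p)\<^sup>2) \<le> norm (C\<^sup>2 * (u p)\<^sup>2)"
    proof (rule AE_I2)
      fix p assume "p \<in> space M"
      from assms(3)[OF this] have "(h p)\<^sup>2 \<le> C\<^sup>2"
        by (rule abs_le_square_iff[THEN iffD1, OF order_trans[OF _ abs_ge_self]])
      then show "norm ((h p * u p)\<^sup>2) \<le> norm (C\<^sup>2 * (u p)\<^sup>2)"
        by (simp add: power_mult_distrib mult_right_mono)
    qed
  qed
qed

lemma ip_sym: "ip M u v = ip M v u" by (simp add: ip_def mult.commute)

lemma ip_add_left: "l2 M u \<Longrightarrow> l2 M v \<Longrightarrow> l2 M w \<Longrightarrow> ip M (\<lambda>p. u p + v p) w = ip M u w + ip M v w"
  unfolding ip_def by (simp add: distrib_right l2_mult_integrable)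

lemma ip_diff_left: "l2 M u \<Longrightarrow> l2 M v \<Longrightarrow> l2 M w \<Longrightarrow> ip M (\<lambda>p. u p - v p) w = ip M u w - ip M v w"
  unfolding ip_def by (simp add: left_diff_distrib l2_mult_integrable)

lemma ip_scale_left: "ip M (\<lambda>p. a * u p) w = a * ip M u w"
  unfolding ip_def by (simp add: mult.assoc)

lemma ip_add_right: "l2 M u \<Longrightarrow> l2 M v \<Longrightarrow> l2 M w \<Longrightarrow> ip M w (\<lambda>p. u p + v p) = ip M w u + ip M w v"
  using ip_add_left[of M u v w] by (simp add: ip_sym)

lemma ip_diff_right: "l2 M u \<Longrightarrow> l2 M v \<Longrightarrow> l2 M w \<Longrightarrow> ip M w (\<lambda>p. u p - v p) = ip M w u - ip M w v"
  using ip_diff_left[of M u v w] by (simp add: ip_sym)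

lemma ip_scale_right: "ip M w (\<lambda>p. a * u p) = a * ip M w u"
  using ip_scale_left[of M a u w] by (simp add: ip_sym)

lemma ip_sum_left:
  assumes "\<And>i. i \<in> I \<Longrightarrow> l2 M (u i)" "l2 M w"
  shows "ip M (\<lambda>p. \<Sum>i\<in>I. u i p) w = (\<Sum>i\<in>I. ip M (u i) w)"
  unfolding ip_def using assms by (simp add: sum_distrib_right l2_mult_integrable)

lemma ip_sum_right:
  assumes "\<And>i. i \<in> I \<Longrightarrow> l2 M (u i)" "l2 M w"
  shows "ip M w (\<lambda>p. \<Sum>i\<in>I. u i p) = (\<Sum>i\<in>I. ip M w (u i))"
  using ip_sum_left[OF assms] by (simp add: ip_sym[of M w])

lemma ip_nonneg [simp]: "0 \<le> ip M u u" unfolding ip_def by simp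

lemma ip_zero_left [simp]: "ip M (\<lambda>p. 0) u = 0" by (simp add: ip_def)
lemma ip_zero_right [simp]: "ip M u (\<lambda>p. 0) = 0" by (simp add: ip_def)

lemma ip_cong_AE:
  assumes "AE p in M. u p = u' p" "AE p in M. v p = v' p"
    "l2 M u" "l2 M v" "l2 M u'" "l2 M v'"
  shows "ip M u v = ip M u' v'"
  unfolding ip_def
proof (rule integral_cong_AE)
  show "(\<lambda>p. u p * v p) \<in> borel_measurable M" "(\<lambda>p. u' p * v' p) \<in> borel_measurable M"
    using assms by measurable
  show "AE p in M. u p * v p = u' p * v' p" using assms(1,2) by eventually_elim simp
qed

lemma quadratic_nonneg_discriminant:
  fixes a b c :: real
  assumes "\<And>t. 0 \<le> a + 2 * t * b + t\<^sup>2 * c" "0 \<le> c"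
  shows "b\<^sup>2 \<le> a * c"
proof (cases "c = 0")
  case True
  have "b = 0"
  proof (rule ccontr)
    assume "b \<noteq> 0"
    then show False using assms(1)[of "-(a + 1)/(2*b)"] True by (simp add: field_simps)
  qed
  then show ?thesis using True by simp
next
  case False
  with assms(2) have "c > 0" by simp
  have "0 \<le> a - b\<^sup>2 / c" using assms(1)[of "- b / c"] False
    by (simp add: power2_eq_square field_simps)
  then show ?thesis using \<open>c > 0\<close> by (simp add: field_simps)
qed

lemma ip_expand:
  assumes "l2 M u" "l2 M v"
  shows "ip M (\<lambda>p. u p + t * v p) (\<lambda>p. u p + t * v p) = ip M u u + 2 * t * ip M u v + t\<^sup>2 * ip M v v"
  using assms by (simp add: ip_add_left ip_add_right ip_scale_left ip_scale_right l2_scale l2_add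
      ip_sym[of M v u] power2_eq_square algebra_simps)

lemma ip_Cauchy_Schwarz:
  assumes "l2 M u" "l2 M v" shows "(ip M u v)\<^sup>2 \<le> ip M u u * ip M v v"
proof (rule quadratic_nonneg_discriminant)
  fix t show "0 \<le> ip M u u + 2 * t * ip M u v + t\<^sup>2 * ip M v v"
    unfolding ip_expand[OF assms, of t, symmetric] by (rule ip_nonneg)
qed (rule ip_nonneg)

lemma ip_abs_le:
  assumes "l2 M u" "l2 M v" shows "\<bar>ip M u v\<bar> \<le> sqrt (ip M u u) * sqrt (ip M v v)"
  using ip_Cauchy_Schwarz[OF assms] by (simp add: real_le_rsqrt real_sqrt_mult[symmetric])

lemma ip_add_le:
  assumes "l2 M u" "l2 M v"
  shows "ip M (\<lambda>p. u p + v p) (\<lambda>p. u p + v p) \<le> 2 * ip M u u + 2 * ip M v v"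
proof -
  have "0 \<le> ip M (\<lambda>p. u p + (-1) * v p) (\<lambda>p. u p + (-1) * v p)" by (rule ip_nonneg)
  then show ?thesis using ip_expand[OF assms, of "-1"] ip_expand[OF assms, of 1] by (simp del: ip_nonneg)
qed

lemma ip_diff_le:
  assumes "l2 M u" "l2 M v"
  shows "ip M (\<lambda>p. u p - v p) (\<lambda>p. u p - v p) \<le> 2 * ip M u u + 2 * ip M v v"
  using ip_add_le[OF assms(1) l2_scale[OF assms(2), of "-1"]]
  by (simp add: ip_scale_left[of M "-1", simplified] ip_scale_right[of M _ "-1", simplified])

section \<open>Limits in the mean square\<close>

lemma l2_tendsto_ip_fixed:
  assumes "l2 M u" "\<And>j. l2 M (\<phi> j)" "l2_tendsto M \<phi> u" "l2 M v"
  shows "(\<lambda>j. ip M (\<phi> j) v) \<longlonglongrightarrow> ip M u v"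
proof -
  have "(\<lambda>j. ip M (\<phi> j) v - ip M u v) \<longlonglongrightarrow> 0"
  proof (rule Lim_null_comparison)
    show "\<forall>\<^sub>F j in sequentially. norm (ip M (\<phi> j) v - ip M u v) \<le>
        sqrt (ip M (\<lambda>p. \<phi> j p - u p) (\<lambda>p. \<phi> j p - u p)) * sqrt (ip M v v)"
      using ip_abs_le[OF l2_diff[OF assms(2) assms(1)] assms(4)] assms(1,2,4)
      by (simp add: ip_diff_left)
    show "(\<lambda>j. sqrt (ip M (\<lambda>p. \<phi> j p - u p) (\<lambda>p. \<phi> j p - u p)) * sqrt (ip M v v)) \<longlonglongrightarrow> 0"
      using tendsto_mult[OF tendsto_real_sqrt[OF assms(3)] tendsto_const[of "sqrt (ip M v v)"]] by simp
  qed
  then show ?thesis by (rule LIM_zero_cancel)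
qed

lemma l2_tendsto_ip:
  assumes "l2 M u" "\<And>j. l2 M (\<phi> j)" "l2_tendsto M \<phi> u"
    and "l2 M v" "\<And>j. l2 M (\<psi> j)" "l2_tendsto M \<psi> v"
  shows "(\<lambda>j. ip M (\<phi> j) (\<psi> j)) \<longlonglongrightarrow> ip M u v"
proof -
  let ?d = "\<lambda>j p. \<phi> j p - u p" and ?e = "\<lambda>j p. \<psi> j p - v p"
  have "(\<lambda>j. ip M (?d j) (?e j)) \<longlonglongrightarrow> 0"
  proof (rule Lim_null_comparison)
    show "\<forall>\<^sub>F j in sequentially. norm (ip M (?d j) (?e j)) \<le>
        sqrt (ip M (?d j) (?d j)) * sqrt (ip M (?e j) (?e j))"
      using ip_abs_le[OF l2_diff[OF assms(2) assms(1)] l2_diff[OF assms(5) assms(4)]] by simp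
    show "(\<lambda>j. sqrt (ip M (?d j) (?d j)) * sqrt (ip M (?e j) (?e j))) \<longlonglongrightarrow> 0"
      using tendsto_mult[OF tendsto_real_sqrt[OF assms(3)] tendsto_real_sqrt[OF assms(6)]] by simp
  qed
  moreover have "(\<lambda>j. ip M (\<phi> j) v + ip M (\<psi> j) u - ip M u v) \<longlonglongrightarrow> ip M u v + ip M v u - ip M u v"
    by (intro tendsto_diff tendsto_add tendsto_const l2_tendsto_ip_fixed[OF assms(1-4)] l2_tendsto_ip_fixed[OF assms(4-6,1)])
  ultimately have lim: "(\<lambda>j. ip M (?d j) (?e j) + (ip M (\<phi> j) v + ip M (\<psi> j) u - ip M u v))
      \<longlonglongrightarrow> 0 + (ip M u v + ip M v u - ip M u v)"
    by (rule tendsto_add)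
  have eq: "ip M (?d j) (?e j) + (ip M (\<phi> j) v + ip M (\<psi> j) u - ip M u v) = ip M (\<phi> j) (\<psi> j)" for j
    unfolding ip_diff_left[OF assms(2) assms(1) l2_diff[OF assms(5) assms(4)]]
      ip_diff_right[OF assms(5) assms(4) assms(2)] ip_diff_right[OF assms(5) assms(4) assms(1)]
      ip_sym[of M u "\<psi> j"] by simp
  show ?thesis using lim unfolding eq by (simp add: ip_sym[of M v u])
qed

lemma l2_tendsto_add:
  assumes "l2 M u" "\<And>j. l2 M (\<phi> j)" "l2_tendsto M \<phi> u"
    and "l2 M v" "\<And>j. l2 M (\<psi> j)" "l2_tendsto M \<psi> v"
  shows "l2_tendsto M (\<lambda>j p. \<phi> j p + \<psi> j p) (\<lambda>p. u p + v p)"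
proof (rule Lim_null_comparison)
  let ?d = "\<lambda>j p. \<phi> j p - u p" and ?e = "\<lambda>j p. \<psi> j p - v p"
  have eq: "(\<lambda>p. \<phi> j p + \<psi> j p - (u p + v p)) = (\<lambda>p. ?d j p + ?e j p)" for j by (auto simp: algebra_simps)
  show "\<forall>\<^sub>F j in sequentially. norm (ip M (\<lambda>p. \<phi> j p + \<psi> j p - (u p + v p)) (\<lambda>p. \<phi> j p + \<psi> j p - (u p + v p)))
     \<le> 2 * ip M (?d j) (?d j) + 2 * ip M (?e j) (?e j)"
    unfolding eq using ip_add_le[OF l2_diff[OF assms(2) assms(1)] l2_diff[OF assms(5) assms(4)]]
    by simp
  show "(\<lambda>j. 2 * ip M (?d j) (?d j) + 2 * ip M (?e j) (?e j)) \<longlonglongrightarrow> 0"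
    using tendsto_add[OF tendsto_mult[OF tendsto_const assms(3), of 2] tendsto_mult[OF tendsto_const assms(6), of 2]] by simp
qed

lemma ip_bounded_mult_le:
  assumes "l2 M u" "h \<in> borel_measurable M" "\<And>p. p \<in> space M \<Longrightarrow> \<bar>h p\<bar> \<le> C"
  shows "ip M (\<lambda>p. h p * u p) (\<lambda>p. h p * u p) \<le> C\<^sup>2 * ip M u u"
proof -
  have "ip M (\<lambda>p. h p * u p) (\<lambda>p. h p * u p) \<le> (\<integral>p. C\<^sup>2 * (u p * u p) \<partial>M)"
    unfolding ip_def
  proof (rule integral_mono)
    show "integrable M (\<lambda>p. h p * u p * (h p * u p))"
      using l2_mult_integrable[OF l2_bounded_mult[OF assms] l2_bounded_mult[OF assms]] by simp
    show "integrable M (\<lambda>p. C\<^sup>2 * (u p * u p))" using l2_mult_integrable[OF assms(1) assms(1)] by simp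
    fix p assume "p \<in> space M"
    from assms(3)[OF this] have "(h p)\<^sup>2 \<le> C\<^sup>2" by (rule abs_le_square_iff[THEN iffD1, OF order_trans[OF _ abs_ge_self]])
    then show "h p * u p * (h p * u p) \<le> C\<^sup>2 * (u p * u p)"
      using mult_right_mono[of "(h p)\<^sup>2" "C\<^sup>2" "(u p)\<^sup>2"] by (simp add: power2_eq_square algebra_simps)
  qed
  then show ?thesis by (simp add: ip_def)
qed

lemma l2_tendsto_bounded_mult:
  assumes "l2 M u" "\<And>j. l2 M (\<phi> j)" "l2_tendsto M \<phi> u"
    and "h \<in> borel_measurable M" "\<And>p. p \<in> space M \<Longrightarrow> \<bar>h p\<bar> \<le> C"
  shows "l2_tendsto M (\<lambda>j p. h p * \<phi> j p) (\<lambda>p. h p * u p)"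
proof (rule Lim_null_comparison)
  let ?d = "\<lambda>j p. \<phi> j p - u p"
  have eq: "(\<lambda>p. h p * \<phi> j p - h p * u p) = (\<lambda>p. h p * ?d j p)" for j by (auto simp: algebra_simps)
  show "\<forall>\<^sub>F j in sequentially. norm (ip M (\<lambda>p. h p * \<phi> j p - h p * u p) (\<lambda>p. h p * \<phi> j p - h p * u p))
     \<le> C\<^sup>2 * ip M (?d j) (?d j)"
    unfolding eq using ip_bounded_mult_le[OF l2_diff[OF assms(2) assms(1)] assms(4,5)] by simp
  show "(\<lambda>j. C\<^sup>2 * ip M (?d j) (?d j)) \<longlonglongrightarrow> 0"
    using tendsto_mult[OF tendsto_const assms(3), of "C\<^sup>2"] by simp
qed

lemma l2_tendsto_scale:
  assumes "l2 M u" "\<And>j. l2 M (\<phi> j)" "l2_tendsto M \<phi> u"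
  shows "l2_tendsto M (\<lambda>j p. a * \<phi> j p) (\<lambda>p. a * u p)"
  using l2_tendsto_bounded_mult[OF assms, of "\<lambda>_. a" "\<bar>a\<bar>"] by simp

lemma ip_le_of_near:
  assumes "l2 M a" "l2 M b" "l2 M c"
  shows "ip M (\<lambda>p. a p - c p) (\<lambda>p. a p - c p) \<le>
    2 * ip M (\<lambda>p. a p - b p) (\<lambda>p. a p - b p) + 2 * ip M (\<lambda>p. b p - c p) (\<lambda>p. b p - c p)"
  using ip_add_le[OF l2_diff[OF assms(1,2)] l2_diff[OF assms(2,3)]] by simp

text \<open>Riesz-Fischer: a rapidly converging subsequence has a limit almost everywhere, and
  Fatou's lemma carries the Cauchy estimates over to that limit.\<close>

lemma l2_complete:
  assumes l2: "\<And>j. l2 M (\<phi> j)"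
    and Cauchy: "\<And>e. e > 0 \<Longrightarrow> \<exists>N. \<forall>i\<ge>N. \<forall>j\<ge>N. ip M (\<lambda>p. \<phi> i p - \<phi> j p) (\<lambda>p. \<phi> i p - \<phi> j p) < e"
  shows "\<exists>u. l2 M u \<and> l2_tendsto M \<phi> u"
proof -
  \<comment> \<open>Squared distances below \<open>(1/4)^k\<close> leave room for the weight
    \<open>2^k\<close>: the weighted series still has a finite integral, so almost everywhere the
    increments are at most a constant times \<open>(sqrt (1/2))^k\<close> and the telescoping series
    converges.\<close>
  have "\<exists>N. \<forall>k. (\<forall>i\<ge>N k. \<forall>j\<ge>N k. ip M (\<lambda>p. \<phi> i p - \<phi> j p) (\<lambda>p. \<phi> i p - \<phi> j p) < (1/4)^k)"
    by (rule choice) (simp add: Cauchy)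
  then obtain N where N: "\<And>k i j. i \<ge> N k \<Longrightarrow> j \<ge> N k \<Longrightarrow>
      ip M (\<lambda>p. \<phi> i p - \<phi> j p) (\<lambda>p. \<phi> i p - \<phi> j p) < (1/4)^k" by blast
  define r where "r k = (\<Sum>l\<le>k. N l)" for k
  have rN: "N k \<le> r k" for k unfolding r_def by (simp add: member_le_sum)
  have r_mono: "r k \<le> r (Suc k)" for k unfolding r_def by simp
  have rk: "N k \<le> r (Suc k)" for k using rN[of k] r_mono[of k] by simp
  define d where "d k p = \<phi> (r (Suc k)) p - \<phi> (r k) p" for k p
  have dl2: "l2 M (d k)" for k unfolding d_def by (intro l2_diff l2)
  have d_int: "(\<integral>\<^sup>+p. ennreal (2^k * (d k p)\<^sup>2) \<partial>M) \<le> ennreal ((1/2)^k)" for k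
  proof -
    have "(\<integral>\<^sup>+p. ennreal (2^k * (d k p)\<^sup>2) \<partial>M) = ennreal (\<integral>p. 2^k * (d k p)\<^sup>2 \<partial>M)"
      using dl2[of k] by (intro nn_integral_eq_integral) (auto simp: l2_def)
    also have "(\<integral>p. 2^k * (d k p)\<^sup>2 \<partial>M) = 2^k * ip M (d k) (d k)"
      by (simp add: ip_def power2_eq_square)
    also have "\<dots> \<le> 2^k * (1/4)^k"
      using N[OF rk rN, of k] unfolding d_def by (intro mult_left_mono) auto
    also have "\<dots> = (1/2)^k" by (simp add: power_mult_distrib[symmetric])
    finally show ?thesis by (simp add: ennreal_leI)
  qed
  have "(\<integral>\<^sup>+p. (\<Sum>k. ennreal (2^k * (d k p)\<^sup>2)) \<partial>M) = (\<Sum>k. \<integral>\<^sup>+p. ennreal (2^k * (d k p)\<^sup>2) \<partial>M)"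
    by (intro nn_integral_suminf) (use dl2 in measurable)
  also have "\<dots> \<le> (\<Sum>k. ennreal ((1/2)^k))" by (intro suminf_le d_int) auto
  also have "\<dots> < \<infinity>"
    by (subst suminf_ennreal2) (auto simp: summable_geometric)
  finally have fin: "(\<integral>\<^sup>+p. (\<Sum>k. ennreal (2^k * (d k p)\<^sup>2)) \<partial>M) \<noteq> \<infinity>" by simp
  have ae: "AE p in M. (\<Sum>k. ennreal (2^k * (d k p)\<^sup>2)) \<noteq> \<infinity>"
    by (rule nn_integral_PInf_AE[OF _ fin]) (use dl2 in measurable)
  have conv: "AE p in M. convergent (\<lambda>k. \<phi> (r k) p)"
    using ae
  proof eventually_elim
    case (elim p)
    then have "summable (\<lambda>k. 2^k * (d k p)\<^sup>2)"
      by (intro summable_suminf_not_top) auto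
    then have "(\<lambda>k. 2^k * (d k p)\<^sup>2) \<longlonglongrightarrow> 0" by (rule summable_LIMSEQ_zero)
    then have "Bseq (\<lambda>k. 2^k * (d k p)\<^sup>2)" by (intro convergent_imp_Bseq) (auto simp: convergent_def)
    then obtain C where C: "C > 0" "\<And>k. 2^k * (d k p)\<^sup>2 \<le> C" by (auto simp: Bseq_def)
    have b: "norm (d k p) \<le> sqrt C * (sqrt (1/2))^k" for k
    proof -
      have "(d k p)\<^sup>2 \<le> C * (1/2)^k" using C(2)[of k] by (simp add: field_simps)
      then have "sqrt ((d k p)\<^sup>2) \<le> sqrt (C * (1/2)^k)" by (rule real_sqrt_le_mono)
      then show ?thesis unfolding real_sqrt_abs by (simp add: real_sqrt_mult real_sqrt_power)
    qed
    have "summable (\<lambda>k. sqrt C * (sqrt (1/2))^k)"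
      by (intro summable_mult summable_geometric) (simp add: real_sqrt_divide)
    then have "summable (\<lambda>k. d k p)" by (rule summable_comparison_test') (use b in auto)
    then have "convergent (\<lambda>k. \<Sum>l<k. d l p)" by (simp add: summable_iff_convergent)
    moreover have "(\<Sum>l<k. d l p) = \<phi> (r k) p - \<phi> (r 0) p" for k
      unfolding d_def by (rule sum_lessThan_telescope)
    ultimately have "convergent (\<lambda>k. \<phi> (r k) p - \<phi> (r 0) p)" by simp
    then show ?case using convergent_diff_const_right_iff[of "\<lambda>k. \<phi> (r k) p" "\<phi> (r 0) p"] by simp
  qed
  define u where "u p = lim (\<lambda>k. \<phi> (r k) p)" for p
  have um: "u \<in> borel_measurable M" unfolding u_def
    by (intro borel_measurable_lim_metric l2_measurable l2)
  have lim: "AE p in M. (\<lambda>k. \<phi> (r k) p) \<longlonglongrightarrow> u p"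
    using conv by eventually_elim (simp add: u_def convergent_LIMSEQ_iff)
  have r_ge: "k \<le> l \<Longrightarrow> r k \<le> r l" for k l by (rule lift_Suc_mono_le[of r]) (auto simp: r_mono)
  have fatou: "(\<integral>\<^sup>+p. ennreal ((\<phi> j p - u p)\<^sup>2) \<partial>M) \<le> ennreal ((1/4)^k)" if "j \<ge> N k" for j k
  proof -
    have "(\<integral>\<^sup>+p. ennreal ((\<phi> j p - u p)\<^sup>2) \<partial>M) = (\<integral>\<^sup>+p. liminf (\<lambda>l. ennreal ((\<phi> j p - \<phi> (r l) p)\<^sup>2)) \<partial>M)"
    proof (rule nn_integral_cong_AE)
      show "AE p in M. ennreal ((\<phi> j p - u p)\<^sup>2) = liminf (\<lambda>l. ennreal ((\<phi> j p - \<phi> (r l) p)\<^sup>2))"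
        using lim
      proof eventually_elim
        case (elim p)
        have "(\<lambda>l. ennreal ((\<phi> j p - \<phi> (r l) p)\<^sup>2)) \<longlonglongrightarrow> ennreal ((\<phi> j p - u p)\<^sup>2)"
          by (intro tendsto_ennrealI tendsto_intros elim)
        then show ?case by (metis lim_imp_Liminf trivial_limit_sequentially)
      qed
    qed
    also have "\<dots> \<le> liminf (\<lambda>l. \<integral>\<^sup>+p. ennreal ((\<phi> j p - \<phi> (r l) p)\<^sup>2) \<partial>M)"
      by (rule nn_integral_liminf) (use l2 in measurable)
    also have "\<dots> \<le> limsup (\<lambda>l. \<integral>\<^sup>+p. ennreal ((\<phi> j p - \<phi> (r l) p)\<^sup>2) \<partial>M)"
      by (rule Liminf_le_Limsup) simp
    also have "\<dots> \<le> ennreal ((1/4)^k)"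
    proof (rule Limsup_bounded)
      show "\<forall>\<^sub>F l in sequentially. (\<integral>\<^sup>+p. ennreal ((\<phi> j p - \<phi> (r l) p)\<^sup>2) \<partial>M) \<le> ennreal ((1/4)^k)"
        unfolding eventually_sequentially
      proof (intro exI allI impI)
        fix l assume "k \<le> l"
        then have "N k \<le> r l" using rN[of k] r_ge by (meson order_trans)
        have "l2 M (\<lambda>p. \<phi> j p - \<phi> (r l) p)" by (intro l2_diff l2)
        then have "(\<integral>\<^sup>+p. ennreal ((\<phi> j p - \<phi> (r l) p)\<^sup>2) \<partial>M) = ennreal (\<integral>p. (\<phi> j p - \<phi> (r l) p)\<^sup>2 \<partial>M)"
          by (intro nn_integral_eq_integral) (auto simp: l2_def)
        also have "\<dots> = ennreal (ip M (\<lambda>p. \<phi> j p - \<phi> (r l) p) (\<lambda>p. \<phi> j p - \<phi> (r l) p))"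
          by (simp add: ip_def power2_eq_square)
        also have "\<dots> \<le> ennreal ((1/4)^k)"
          using N[OF that \<open>N k \<le> r l\<close>] by (intro ennreal_leI) simp
        finally show "(\<integral>\<^sup>+p. ennreal ((\<phi> j p - \<phi> (r l) p)\<^sup>2) \<partial>M) \<le> ennreal ((1/4)^k)" .
      qed
    qed
    finally show ?thesis .
  qed
  have dl: "l2 M (\<lambda>p. \<phi> j p - u p)" if "j \<ge> N 0" for j
    unfolding l2_def
  proof
    show m: "(\<lambda>p. \<phi> j p - u p) \<in> borel_measurable M" using um l2[of j] by (auto simp: l2_def)
    show "integrable M (\<lambda>p. (\<phi> j p - u p)\<^sup>2)"
      using m le_less_trans[OF fatou[OF that] ennreal_less_top]
      by (intro integrableI_bounded) auto
  qed
  have ul2: "l2 M u" using l2_diff[OF l2[of "N 0"] dl[of "N 0"]] by simp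
  have "l2_tendsto M \<phi> u"
  proof (rule LIMSEQ_I)
    fix e :: real assume "e > 0"
    then obtain k where k: "(1/4)^k < e" using real_arch_pow_inv[of e "1/4"] by auto
    have "ip M (\<lambda>p. \<phi> j p - u p) (\<lambda>p. \<phi> j p - u p) \<le> (1/4)^k" if "j \<ge> N k" for j
    proof -
      have "l2 M (\<lambda>p. \<phi> j p - u p)" by (intro l2_diff l2 ul2)
      then have "ennreal (\<integral>p. (\<phi> j p - u p)\<^sup>2 \<partial>M) \<le> ennreal ((1/4)^k)"
        using fatou[OF that] nn_integral_eq_integral[of M "\<lambda>p. (\<phi> j p - u p)\<^sup>2"] by (simp add: l2_def)
      then have "(\<integral>p. (\<phi> j p - u p)\<^sup>2 \<partial>M) \<le> (1/4)^k" by (subst (asm) ennreal_le_iff) auto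
      then show ?thesis by (simp add: ip_def power2_eq_square)
    qed
    then have "norm (ip M (\<lambda>p. \<phi> j p - u p) (\<lambda>p. \<phi> j p - u p) - 0) < e" if "j \<ge> N k" for j
      using order.strict_trans1[OF _ k] ip_nonneg[of M "\<lambda>p. \<phi> j p - u p"] that by simp
    then show "\<exists>no. \<forall>n\<ge>no. norm (ip M (\<lambda>p. \<phi> n p - u p) (\<lambda>p. \<phi> n p - u p) - 0) < e" by blast
  qed
  with ul2 show ?thesis by (intro exI[of _ u] conjI)
qed

section \<open>Integration by parts and translations\<close>

lemma nn_integral_lborel_translate:
  fixes f :: "'a::euclidean_space \<Rightarrow> ennreal"
  assumes [measurable]: "f \<in> borel_measurable borel"
  shows "(\<integral>\<^sup>+x. f (a + x) \<partial>lborel) = (\<integral>\<^sup>+x. f x \<partial>lborel)"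
proof -
  have "(\<integral>\<^sup>+x. f x \<partial>lborel) = (\<integral>\<^sup>+x. f x \<partial>distr lborel borel ((+) a))"
    by (simp only: lborel_distr_plus)
  also have "\<dots> = (\<integral>\<^sup>+x. f (a + x) \<partial>lborel)" by (rule nn_integral_distr) simp_all
  finally show ?thesis by simp
qed

lemma integral_lborel_translate:
  fixes f :: "'a::euclidean_space \<Rightarrow> real"
  assumes [measurable]: "f \<in> borel_measurable borel"
  shows "(\<integral>x. f (a + x) \<partial>lborel) = (\<integral>x. f x \<partial>lborel)"
proof -
  have "(\<integral>x. f x \<partial>lborel) = (\<integral>x. f x \<partial>distr lborel borel ((+) a))"
    by (simp only: lborel_distr_plus)
  also have "\<dots> = (\<integral>x. f (a + x) \<partial>lborel)" by (rule integral_distr) simp_all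
  finally show ?thesis by simp
qed

lemma integrable_lborel_translate:
  fixes f :: "'a::euclidean_space \<Rightarrow> real"
  assumes "integrable lborel f" shows "integrable lborel (\<lambda>x. f (a + x))"
proof -
  have "integrable (distr lborel borel ((+) a)) f" using assms by (simp only: lborel_distr_plus)
  then show ?thesis using assms by (subst (asm) integrable_distr_eq) auto
qed

lemma integrable_continuous_compact_support:
  fixes f :: "'a::euclidean_space \<Rightarrow> real"
  assumes "continuous_on UNIV f" "compact K" "\<And>x. x \<notin> K \<Longrightarrow> f x = 0"
  shows "integrable lborel f"
proof -
  have "integrable lborel (\<lambda>x. indicator K x *\<^sub>R f x)"
    using assms by (intro borel_integrable_compact) (auto intro: continuous_on_subset)
  moreover have "(\<lambda>x. indicator K x *\<^sub>R f x) = f" using assms(3) by (auto simp: indicator_def fun_eq_iff)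
  ultimately show ?thesis by simp
qed

lemma continuous_compact_support_bounded:
  fixes f :: "'a::euclidean_space \<Rightarrow> real"
  assumes "continuous_on UNIV f" "compact K" "\<And>x. x \<notin> K \<Longrightarrow> f x = 0"
  obtains C where "0 \<le> C" "\<And>x. \<bar>f x\<bar> \<le> C"
proof -
  have "bounded (f ` K)" using assms by (intro compact_imp_bounded compact_continuous_image) (auto intro: continuous_on_subset)
  then obtain C where C: "C > 0" "\<And>x. x \<in> K \<Longrightarrow> norm (f x) \<le> C" by (auto simp: bounded_pos)
  then have "\<bar>f x\<bar> \<le> C" for x using assms(3)[of x] by (cases "x \<in> K") auto
  then show thesis using that[of C] C(1) by simp
qed

lemma partial_zero_outside:
  fixes f :: "real^'n::finite \<Rightarrow> real"
  assumes "closed K" "\<And>x. x \<notin> K \<Longrightarrow> f x = 0" "x \<notin> K"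
  shows "partial i f x = 0"
proof -
  have "partial i f x = partial i (\<lambda>x. 0) x"
    using assms by (intro partial_cong[of "- K"]) auto
  then show ?thesis by simp
qed

text \<open>By translation invariance every difference quotient of \<open>h\<close> has integral 0,
  and dominated convergence passes this on to the derivative.\<close>

lemma integral_partial_compact_support:
  fixes h :: "real^'n::finite \<Rightarrow> real"
  assumes h: "Ck (Suc 0) UNIV h" and K: "compact K" "\<And>x. x \<notin> K \<Longrightarrow> h x = 0"
  shows "integrable lborel (partial i h)" "(\<integral>x. partial i h x \<partial>lborel) = 0"
proof -
  have cp: "continuous_on UNIV (partial i h)" using h by simp
  have ch: "continuous_on UNIV h" by (rule Ck_imp_continuous_on[OF h])
  have pz: "partial i h x = 0" if "x \<notin> K" for x
    by (rule partial_zero_outside[OF compact_imp_closed[OF K(1)] K(2) that])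
  show "integrable lborel (partial i h)" by (rule integrable_continuous_compact_support[OF cp K(1) pz])
  have hd: "h differentiable at x" for x by (rule Ck_differentiable[OF open_UNIV h UNIV_I])
  have [measurable]: "h \<in> borel_measurable borel" using ch by (rule borel_measurable_continuous_onI)
  have [measurable]: "partial i h \<in> borel_measurable borel" using cp by (rule borel_measurable_continuous_onI)
  have hi: "integrable lborel h" by (rule integrable_continuous_compact_support[OF ch K])
  obtain C where C: "0 \<le> C" "\<And>x. \<bar>partial i h x\<bar> \<le> C"
    by (rule continuous_compact_support_bounded[OF cp K(1) pz], assumption, rule that)
  obtain R where R: "\<And>x. x \<in> K \<Longrightarrow> norm x \<le> R" using compact_imp_bounded[OF K(1)] by (auto simp: bounded_iff)
  let ?t = "\<lambda>k. 1 / real (Suc k)"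
  let ?s = "\<lambda>k x. (h (x + ?t k *\<^sub>R axis i 1) - h x) / ?t k"
  have z: "(\<integral>x. ?s k x \<partial>lborel) = 0" for k
  proof -
    have 1: "(\<integral>x. h (x + ?t k *\<^sub>R axis i 1) \<partial>lborel) = (\<integral>x. h x \<partial>lborel)"
      using integral_lborel_translate[of h "?t k *\<^sub>R axis i 1"] by (simp add: add.commute)
    have 2: "integrable lborel (\<lambda>x. h (x + ?t k *\<^sub>R axis i 1))"
      using integrable_lborel_translate[OF hi, of "?t k *\<^sub>R axis i 1"] by (simp add: add.commute)
    show ?thesis using 1 2 hi by simp
  qed
  have "(\<lambda>k. \<integral>x. ?s k x \<partial>lborel) \<longlonglongrightarrow> (\<integral>x. partial i h x \<partial>lborel)"
  proof (rule integral_dominated_convergence)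
    \<comment> \<open>The steps are at most 1, so all quotients vanish outside the ball of radius
      \<open>R + 1\<close>; inside it the mean value theorem bounds them by
      \<open>C\<close>.\<close>
    show "integrable lborel (\<lambda>x. C * indicator (cball 0 (R + 1)) x :: real)"
      by (intro integrable_mult_right integrable_real_indicator) (auto simp: emeasure_lborel_cball_finite[unfolded infinity_ennreal_def])
    show "AE x in lborel. (\<lambda>k. ?s k x) \<longlonglongrightarrow> partial i h x"
    proof (rule AE_I2)
      fix x
      have "((\<lambda>t. h (x + t *\<^sub>R axis i 1)) has_real_derivative partial i h (x + 0 *\<^sub>R axis i 1)) (at 0)"
        by (rule DERIV_along_axis[OF hd])
      then have "(\<lambda>t. (h (x + (0 + t) *\<^sub>R axis i 1) - h (x + 0 *\<^sub>R axis i 1)) / t) \<midarrow>0\<rightarrow> partial i h (x + 0 *\<^sub>R axis i 1)"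
        by (rule DERIV_D)
      then have "(\<lambda>t. (h (x + t *\<^sub>R axis i 1) - h x) / t) \<midarrow>0\<rightarrow> partial i h x" by simp
      moreover have "filterlim ?t (at 0) sequentially"
        using LIMSEQ_inverse_real_of_nat by (auto simp: filterlim_at inverse_eq_divide)
      ultimately show "(\<lambda>k. ?s k x) \<longlonglongrightarrow> partial i h x" by (rule filterlim_compose)
    qed
    show "AE x in lborel. norm (?s k x) \<le> C * indicator (cball 0 (R + 1)) x" for k
    proof (rule AE_I2)
      fix x
      have t: "0 < ?t k" "?t k \<le> 1" by auto
      show "norm (?s k x) \<le> C * indicator (cball 0 (R + 1)) x"
      proof (cases "x \<in> cball 0 (R + 1)")
        case True
        have "\<exists>s. 0 < s \<and> s < ?t k \<and> h (x + ?t k *\<^sub>R axis i 1) - h (x + 0 *\<^sub>R axis i 1) = (?t k - 0) * partial i h (x + s *\<^sub>R axis i 1)"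
          by (rule MVT2[OF t(1)]) (rule DERIV_along_axis[OF hd])
        then obtain s where "h (x + ?t k *\<^sub>R axis i 1) - h x = ?t k * partial i h (x + s *\<^sub>R axis i 1)" by auto
        then have "?s k x = partial i h (x + s *\<^sub>R axis i 1)" by simp
        then show ?thesis using C(2) True by simp
      next
        case False
        then have nx: "norm x > R + 1" by (simp add: dist_norm)
        then have "x \<notin> K" using R[of x] by auto
        have "norm x \<le> norm (x + ?t k *\<^sub>R axis i 1) + norm (?t k *\<^sub>R axis i 1 :: real^'n)"
          using norm_triangle_ineq4[of "x + ?t k *\<^sub>R axis i 1" "?t k *\<^sub>R axis i 1"] by simp
        moreover have "norm (?t k *\<^sub>R axis i 1 :: real^'n) \<le> 1" by simp
        ultimately have "norm (x + ?t k *\<^sub>R axis i 1) > R" using nx by linarith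
        then have "x + ?t k *\<^sub>R axis i 1 \<notin> K" using R by force
        then show ?thesis using K(2) \<open>x \<notin> K\<close> False by simp
      qed
    qed
  qed simp_all
  then show "(\<integral>x. partial i h x \<partial>lborel) = 0" unfolding z by (simp add: LIMSEQ_const_iff)
qed

lemma Ck_extend_zero:
  fixes f :: "real^'n::finite \<Rightarrow> real"
  assumes U: "open U" and K: "compact K" "K \<subseteq> U" and f: "Ck k U f" "\<And>x. x \<in> U - K \<Longrightarrow> f x = 0"
  shows "Ck k UNIV (\<lambda>x. if x \<in> U then f x else 0)"
proof -
  have "Ck k (U \<union> - K) (\<lambda>x. if x \<in> U then f x else 0)"
  proof (rule Ck_Un)
    show "open (- K)" using compact_imp_closed[OF K(1)] by auto
    then show "Ck k (- K) (\<lambda>x. if x \<in> U then f x else 0)"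
      by (rule Ck_cong[OF _ _ Ck_const[of k "- K" 0]]) (use f(2) in auto)
    show "Ck k U (\<lambda>x. if x \<in> U then f x else 0)" by (rule Ck_cong[OF U _ f(1)]) simp
  qed (rule U)
  moreover have "U \<union> - K = UNIV" using K(2) by auto
  ultimately show ?thesis by simp
qed

text \<open>Only \<open>f\<close> has compact support, and \<open>W\<close> is arbitrary off
  \<open>U\<close>. The function whose derivative integrates to 0 is therefore the product, extended
  by zero.\<close>

lemma integration_by_parts_compact_support:
  fixes f W :: "real^'n::finite \<Rightarrow> real"
  assumes U: "open U" and K: "compact K" "K \<subseteq> U"
    and f: "Ck (Suc 0) U f" "\<And>x. x \<in> U - K \<Longrightarrow> f x = 0" and W: "Ck (Suc 0) U W"
  shows "integrable lborel (\<lambda>x. indicator U x * (f x * partial i W x))"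
    "integrable lborel (\<lambda>x. indicator U x * (partial i f x * W x))"
    "(\<integral>x. indicator U x * (f x * partial i W x) \<partial>lborel) = - (\<integral>x. indicator U x * (partial i f x * W x) \<partial>lborel)"
proof -
  define h where "h x = (if x \<in> U then f x * W x else 0)" for x
  have h: "Ck (Suc 0) UNIV h" unfolding h_def
    by (rule Ck_extend_zero[OF U K Ck_mult[OF U f(1) W]]) (simp add: f(2))
  have hK: "h x = 0" if "x \<notin> K" for x using f(2) that by (auto simp: h_def)
  have pf0: "partial i f x = 0" if "x \<in> U - K" for x
  proof -
    have "open (U - K)" using U compact_imp_closed[OF K(1)] by (rule open_Diff)
    then have "partial i f x = partial i (\<lambda>x. 0) x" using that f(2) by (intro partial_cong[of "U - K"]) auto
    then show ?thesis by simp
  qed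
  have fd: "f differentiable at x" "W differentiable at x" if "x \<in> U" for x
    using Ck_differentiable[OF U f(1) that] Ck_differentiable[OF U W that] by auto
  have ph: "partial i h x = indicator U x * (f x * partial i W x) + indicator U x * (partial i f x * W x)" for x
  proof (cases "x \<in> U")
    case True
    have "partial i h x = partial i (\<lambda>x. f x * W x) x"
      by (rule partial_cong[OF U _ True]) (simp add: h_def)
    then show ?thesis using True by (simp add: partial_mult fd)
  next
    case False
    then have "x \<notin> K" using K(2) by auto
    then show ?thesis using partial_zero_outside[OF compact_imp_closed[OF K(1)] hK] False by simp
  qed
  have int: "integrable lborel (\<lambda>x. indicator U x * (a x * b x))"
    if "continuous_on U a" "continuous_on U b" "\<And>x. x \<in> U - K \<Longrightarrow> a x = 0" for a b :: "real^'n \<Rightarrow> real"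
  proof -
    have "integrable lborel (\<lambda>x. indicator K x *\<^sub>R (a x * b x))"
      using that K by (intro borel_integrable_compact continuous_on_mult) (auto intro: continuous_on_subset)
    moreover have "indicator K x *\<^sub>R (a x * b x) = indicator U x * (a x * b x)" for x
      using that(3)[of x] K(2) by (auto simp: indicator_def)
    ultimately show ?thesis by (simp only:)
  qed
  have cf: "continuous_on U f" "continuous_on U (partial i f)" "continuous_on U W" "continuous_on U (partial i W)"
    using f(1) W Ck_imp_continuous_on[OF f(1)] Ck_imp_continuous_on[OF W] by auto
  show 1: "integrable lborel (\<lambda>x. indicator U x * (f x * partial i W x))" by (rule int[OF cf(1,4) f(2)])
  show 2: "integrable lborel (\<lambda>x. indicator U x * (partial i f x * W x))" by (rule int[OF cf(2,3) pf0])
  have "0 = (\<integral>x. partial i h x \<partial>lborel)" using integral_partial_compact_support(2)[OF h K(1) hK] by simp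
  also have "\<dots> = (\<integral>x. indicator U x * (f x * partial i W x) \<partial>lborel) + (\<integral>x. indicator U x * (partial i f x * W x) \<partial>lborel)"
    unfolding ph using 1 2 by simp
  finally show "(\<integral>x. indicator U x * (f x * partial i W x) \<partial>lborel) = - (\<integral>x. indicator U x * (partial i f x * W x) \<partial>lborel)"
    by simp
qed

definition grad2 :: "(real^'n::finite \<Rightarrow> real) \<Rightarrow> real^'n \<Rightarrow> real" where
  "grad2 f x = (\<Sum>i\<in>UNIV. (partial i f x)\<^sup>2)"

lemma grad2_nonneg: "0 \<le> grad2 f x" by (simp add: grad2_def sum_nonneg)

lemma frechet_derivative_square_le:
  fixes f :: "real^'n::finite \<Rightarrow> real"
  assumes "f differentiable at x"
  shows "(frechet_derivative f (at x) v)\<^sup>2 \<le> (norm v)\<^sup>2 * grad2 f x"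
proof -
  have "frechet_derivative f (at x) v = (\<Sum>i\<in>UNIV. v $ i * partial i f x)"
    using frechet_derivative_partial[OF assms] by simp
  moreover have "(\<Sum>i\<in>UNIV. v $ i * partial i f x)\<^sup>2 \<le> (\<Sum>i\<in>UNIV. (v $ i)\<^sup>2) * (\<Sum>i\<in>UNIV. (partial i f x)\<^sup>2)"
    by (rule Cauchy_Schwarz_ineq_sum)
  moreover have "(norm v)\<^sup>2 = (\<Sum>i\<in>UNIV. (v $ i)\<^sup>2)"
    by (simp add: norm_vec_def L2_set_def sum_nonneg)
  ultimately show ?thesis by (simp add: grad2_def)
qed

text \<open>The fundamental theorem of calculus on the segment, then Cauchy-Schwarz against the
  constant 1 on the unit interval. The bound takes values in \<open>ennreal\<close> so that it can
  be integrated over \<open>x\<close> and the integrals exchanged without integrability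
  conditions.\<close>

lemma square_difference_le:
  fixes f :: "real^'n::finite \<Rightarrow> real"
  assumes f: "Ck (Suc 0) UNIV f"
  shows "ennreal ((f (x + z) - f x)\<^sup>2) \<le> (\<integral>\<^sup>+t. indicator {0..1} t * ennreal ((norm z)\<^sup>2 * grad2 f (x + t *\<^sub>R z)) \<partial>lborel)"
proof -
  have fd: "f differentiable at y" for y by (rule Ck_differentiable[OF open_UNIV f UNIV_I])
  let ?g = "\<lambda>t. frechet_derivative f (at (x + t *\<^sub>R z)) z"
  have der: "((\<lambda>t. f (x + t *\<^sub>R z)) has_real_derivative ?g t) (at t)" for t
  proof -
    have "((\<lambda>t. x + t *\<^sub>R z) has_derivative (\<lambda>s. s *\<^sub>R z)) (at t)"
      by (auto intro!: derivative_eq_intros)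
    from has_derivative_compose[OF this differentiable_imp_has_frechet[OF fd]]
    have "((\<lambda>t. f (x + t *\<^sub>R z)) has_derivative (\<lambda>s. frechet_derivative f (at (x + t *\<^sub>R z)) (s *\<^sub>R z))) (at t)" .
    moreover have "frechet_derivative f (at (x + t *\<^sub>R z)) (s *\<^sub>R z) = ?g t * s" for s
      using linear_scale[OF linear_frechet_derivative[OF fd]] by simp
    ultimately show ?thesis by (simp add: has_field_derivative_def)
  qed
  have cp: "continuous_on UNIV (partial i f)" for i using f by simp
  have cpt: "continuous_on S (\<lambda>t. partial i f (x + t *\<^sub>R z))" for i S
    by (rule continuous_on_compose2[OF cp]) (auto intro!: continuous_intros)
  have cg: "continuous_on S ?g" for S
    unfolding frechet_derivative_partial[OF fd] by (intro continuous_intros cpt)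
  have cG: "continuous_on S (\<lambda>t. grad2 f (x + t *\<^sub>R z))" for S
    unfolding grad2_def by (intro continuous_intros cpt)
  have "(\<integral>t. ?g t * indicator {0..1} t \<partial>lborel) = f (x + 1 *\<^sub>R z) - f (x + 0 *\<^sub>R z)"
    using cg[of UNIV] by (intro integral_FTC_Icc_real zero_le_one der) (simp add: continuous_on_eq_continuous_at)
  then have ftc: "f (x + z) - f x = ip lborel (indicator {0..1}) (\<lambda>t. indicator {0..1} t * ?g t)"
    by (simp add: ip_def mult.assoc[symmetric] mult.commute flip: indicator_inter_arith)
  have l1: "l2 lborel (indicator {0..1::real})"
    by (simp add: l2_def power2_eq_square flip: indicator_inter_arith)
  have int: "integrable lborel (\<lambda>t. indicator {0..1} t *\<^sub>R u t)" if "continuous_on {0..1} u" for u :: "real \<Rightarrow> real"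
    by (rule borel_integrable_compact[OF compact_Icc that])
  have sq: "(indicator {0..1} t * r)\<^sup>2 = indicator {0..1} t *\<^sub>R r\<^sup>2" for r t :: real
    by (simp add: indicator_def)
  have l2g: "l2 lborel (\<lambda>t. indicator {0..1} t * ?g t)"
    unfolding l2_def sq using borel_measurable_integrable[OF int[OF cg]] int[OF continuous_on_power[OF cg, of _ 2]]
    by simp
  have "(f (x + z) - f x)\<^sup>2 \<le> ip lborel (indicator {0..1::real}) (indicator {0..1}) *
      ip lborel (\<lambda>t. indicator {0..1} t * ?g t) (\<lambda>t. indicator {0..1} t * ?g t)"
    unfolding ftc by (rule ip_Cauchy_Schwarz[OF l1 l2g])
  also have "ip lborel (indicator {0..1::real}) (indicator {0..1}) = 1"
    by (simp add: ip_def flip: indicator_inter_arith)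
  also have "1 * ip lborel (\<lambda>t. indicator {0..1} t * ?g t) (\<lambda>t. indicator {0..1} t * ?g t) =
      (\<integral>t. indicator {0..1} t *\<^sub>R (?g t)\<^sup>2 \<partial>lborel)"
    unfolding ip_def power2_eq_square[symmetric] sq by (rule mult_1)
  also have "\<dots> \<le> (\<integral>t. indicator {0..1} t *\<^sub>R ((norm z)\<^sup>2 * grad2 f (x + t *\<^sub>R z)) \<partial>lborel)"
    by (intro integral_mono int continuous_intros cg cG scaleR_left_mono frechet_derivative_square_le fd) auto
  finally have "ennreal ((f (x + z) - f x)\<^sup>2) \<le> ennreal (\<integral>t. indicator {0..1} t *\<^sub>R ((norm z)\<^sup>2 * grad2 f (x + t *\<^sub>R z)) \<partial>lborel)"
    by (rule ennreal_leI)
  also have "\<dots> = (\<integral>\<^sup>+t. ennreal (indicator {0..1} t *\<^sub>R ((norm z)\<^sup>2 * grad2 f (x + t *\<^sub>R z))) \<partial>lborel)"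
    by (rule nn_integral_eq_integral[symmetric, OF int]) (auto intro!: continuous_intros cG simp: grad2_nonneg)
  also have "\<dots> = (\<integral>\<^sup>+t. indicator {0..1} t * ennreal ((norm z)\<^sup>2 * grad2 f (x + t *\<^sub>R z)) \<partial>lborel)"
    by (intro nn_integral_cong) (simp add: indicator_def)
  finally show ?thesis .
qed

text \<open>After the exchange of integrals each \<open>t\<close> contributes the same Dirichlet
  integral, because Lebesgue measure is invariant under the shift by
  \<open>t *\<^sub>R z\<close>.\<close>

lemma translation_estimate:
  fixes f :: "real^'n::finite \<Rightarrow> real"
  assumes f: "Ck (Suc 0) UNIV f"
  shows "(\<integral>\<^sup>+x. ennreal ((f (x + z) - f x)\<^sup>2) \<partial>lborel) \<le> ennreal ((norm z)\<^sup>2) * (\<integral>\<^sup>+x. ennreal (grad2 f x) \<partial>lborel)"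
proof -
  have cp: "continuous_on UNIV (partial i f)" for i using f by simp
  have "continuous_on UNIV (grad2 f)" unfolding grad2_def[abs_def] by (intro continuous_intros cp)
  then have [measurable]: "grad2 f \<in> borel_measurable borel" by (rule borel_measurable_continuous_onI)
  have "(\<integral>\<^sup>+x. ennreal ((f (x + z) - f x)\<^sup>2) \<partial>lborel) \<le>
      (\<integral>\<^sup>+x. \<integral>\<^sup>+t. indicator {0..1} t * ennreal ((norm z)\<^sup>2 * grad2 f (x + t *\<^sub>R z)) \<partial>lborel \<partial>lborel)"
    by (intro nn_integral_mono square_difference_le f)
  also have "\<dots> = (\<integral>\<^sup>+t. \<integral>\<^sup>+x. indicator {0..1} t * ennreal ((norm z)\<^sup>2 * grad2 f (x + t *\<^sub>R z)) \<partial>lborel \<partial>lborel)"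
    by (rule lborel_pair.Fubini'[symmetric]) measurable
  also have "\<dots> = (\<integral>\<^sup>+t. indicator {0..1::real} t * (\<integral>\<^sup>+x. ennreal ((norm z)\<^sup>2 * grad2 f x) \<partial>lborel) \<partial>lborel)"
  proof (rule nn_integral_cong)
    fix t :: real
    have "(\<integral>\<^sup>+x. indicator {0..1} t * ennreal ((norm z)\<^sup>2 * grad2 f (x + t *\<^sub>R z)) \<partial>lborel) =
        indicator {0..1} t * (\<integral>\<^sup>+x. ennreal ((norm z)\<^sup>2 * grad2 f (x + t *\<^sub>R z)) \<partial>lborel)"
      by (rule nn_integral_cmult) measurable
    also have "(\<integral>\<^sup>+x. ennreal ((norm z)\<^sup>2 * grad2 f (x + t *\<^sub>R z)) \<partial>lborel) = (\<integral>\<^sup>+x. ennreal ((norm z)\<^sup>2 * grad2 f x) \<partial>lborel)"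
      using nn_integral_lborel_translate[of "\<lambda>x. ennreal ((norm z)\<^sup>2 * grad2 f x)" "t *\<^sub>R z"] by (simp add: add.commute)
    finally show "(\<integral>\<^sup>+x. indicator {0..1} t * ennreal ((norm z)\<^sup>2 * grad2 f (x + t *\<^sub>R z)) \<partial>lborel) =
        indicator {0..1} t * (\<integral>\<^sup>+x. ennreal ((norm z)\<^sup>2 * grad2 f x) \<partial>lborel)" .
  qed
  also have "\<dots> = (\<integral>\<^sup>+x. ennreal ((norm z)\<^sup>2 * grad2 f x) \<partial>lborel)"
    by (subst nn_integral_multc) (simp_all add: nn_integral_indicator)
  also have "\<dots> = ennreal ((norm z)\<^sup>2) * (\<integral>\<^sup>+x. ennreal (grad2 f x) \<partial>lborel)"
    by (subst nn_integral_cmult[symmetric]) (auto simp: ennreal_mult' intro!: nn_integral_cong)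
  finally show ?thesis .
qed

section \<open>Rellich's inequality\<close>

text \<open>Half-open cubes, so that for fixed \<open>h > 0\<close> every point lies in exactly one
  of them.\<close>

definition cell :: "real \<Rightarrow> ('n \<Rightarrow> int) \<Rightarrow> (real^'n::finite) set" where
  "cell h r = {x. \<forall>i. h * of_int (r i) \<le> x $ i \<and> x $ i < h * (of_int (r i) + 1)}"

lemma cell_sets [measurable]: "cell h r \<in> sets borel"
proof -
  have "cell h r = (\<Inter>i. {x. h * of_int (r i) \<le> x $ i} \<inter> {x. x $ i < h * (of_int (r i) + 1)})"
    by (auto simp: cell_def)
  also have "\<dots> \<in> sets borel"
    by (intro sets.countable_INT'' sets.Int borel_closed borel_open closed_Collect_le open_Collect_less continuous_intros)
       auto
  finally show ?thesis .
qed

lemma cell_index: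
  assumes "h > 0" shows "x \<in> cell h r \<longleftrightarrow> r = (\<lambda>i. \<lfloor>x $ i / h\<rfloor>)"
proof -
  have "(h * of_int k \<le> t \<and> t < h * (of_int k + 1)) \<longleftrightarrow> k = \<lfloor>t / h\<rfloor>" for k and t :: real
    using assms by (simp add: eq_commute[of k] floor_eq_iff field_simps)
  then show ?thesis by (simp add: cell_def fun_eq_iff)
qed

lemma Basis_vec_const: "b \<in> Basis \<Longrightarrow> (\<chi> i. c) \<bullet> b = (c::real)"
  by (auto simp: Basis_vec_def inner_axis)

lemma emeasure_lborel_cube:
  fixes l u :: "real^'n::finite"
  assumes "0 \<le> h" "u - l = (\<chi> i. h)"
  shows "emeasure lborel (box l u) = ennreal (h ^ CARD('n))" "emeasure lborel (cbox l u) = ennreal (h ^ CARD('n))"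
proof -
  have d: "(u - l) \<bullet> b = h" if "b \<in> Basis" for b using assms(2) Basis_vec_const[OF that] by simp
  have le: "l \<bullet> b \<le> u \<bullet> b" if "b \<in> Basis" for b using d[OF that] assms(1) by (simp add: inner_diff_left)
  have "(\<Prod>b\<in>Basis. (u - l) \<bullet> b) = h ^ CARD('n)" by (simp add: d)
  then show "emeasure lborel (box l u) = ennreal (h ^ CARD('n))" "emeasure lborel (cbox l u) = ennreal (h ^ CARD('n))"
    using le by (simp_all add: emeasure_lborel_box emeasure_lborel_cbox)
qed

lemma emeasure_cell:
  fixes r :: "'n::finite \<Rightarrow> int"
  assumes "h > 0"
  shows "emeasure lborel (cell h r :: (real^'n) set) = ennreal (h ^ CARD('n))"
proof (rule antisym)
  let ?l = "\<chi> i. h * of_int (r i) :: real^'n" and ?u = "\<chi> i. h * (of_int (r i) + 1) :: real^'n"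
  have d: "?u - ?l = (\<chi> i. h)" by (simp add: vec_eq_iff algebra_simps)
  have "cell h r \<subseteq> cbox ?l ?u"
    by (rule subsetI) (simp add: cell_def mem_box_cart less_eq_real_def)
  then show "emeasure lborel (cell h r :: (real^'n) set) \<le> ennreal (h ^ CARD('n))"
    using emeasure_mono[of "cell h r" "cbox ?l ?u" lborel] emeasure_lborel_cube(2)[OF _ d] assms by simp
  have "box ?l ?u \<subseteq> cell h r" by (auto simp: cell_def mem_box_cart intro: less_imp_le)
  then show "ennreal (h ^ CARD('n)) \<le> emeasure lborel (cell h r :: (real^'n) set)"
    using emeasure_mono[of "box ?l ?u" "cell h r" lborel] emeasure_lborel_cube(1)[OF _ d] assms by simp
qed

text \<open>The substitution \<open>z = y - x\<close> reduces it to the translation estimate for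
  each \<open>z\<close> in a cube of side \<open>2 * h\<close>. The first factor of the constant is
  the volume of that cube, the second bounds \<open>(norm z)^2\<close> on it.\<close>

lemma difference_double_integral_le:
  fixes f :: "real^'n::finite \<Rightarrow> real"
  assumes f: "Ck (Suc 0) UNIV f" and h: "h > 0"
  shows "(\<integral>\<^sup>+x. \<integral>\<^sup>+y. indicator (box (\<chi> i. - h) (\<chi> i. h)) (y - x) * ennreal ((f y - f x)\<^sup>2) \<partial>lborel \<partial>lborel)
    \<le> ennreal ((2 * h) ^ CARD('n) * (real CARD('n) * h\<^sup>2)) * (\<integral>\<^sup>+x. ennreal (grad2 f x) \<partial>lborel)"
proof -
  let ?Z = "box (\<chi> i. - h) (\<chi> i. h) :: (real^'n) set"
  have [measurable]: "f \<in> borel_measurable borel"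
    using Ck_imp_continuous_on[OF f] by (rule borel_measurable_continuous_onI)
  have [measurable]: "?Z \<in> sets borel" by simp
  have "(\<integral>\<^sup>+y. indicator ?Z (y - x) * ennreal ((f y - f x)\<^sup>2) \<partial>lborel) =
      (\<integral>\<^sup>+z. indicator ?Z z * ennreal ((f (x + z) - f x)\<^sup>2) \<partial>lborel)" for x
    using nn_integral_lborel_translate[of "\<lambda>y. indicator ?Z (y - x) * ennreal ((f y - f x)\<^sup>2)" x] by simp
  then have "(\<integral>\<^sup>+x. \<integral>\<^sup>+y. indicator ?Z (y - x) * ennreal ((f y - f x)\<^sup>2) \<partial>lborel \<partial>lborel) =
      (\<integral>\<^sup>+x. \<integral>\<^sup>+z. indicator ?Z z * ennreal ((f (x + z) - f x)\<^sup>2) \<partial>lborel \<partial>lborel)" by simp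
  also have "\<dots> = (\<integral>\<^sup>+z. \<integral>\<^sup>+x. indicator ?Z z * ennreal ((f (x + z) - f x)\<^sup>2) \<partial>lborel \<partial>lborel)"
    by (rule lborel_pair.Fubini'[symmetric]) measurable
  also have "\<dots> = (\<integral>\<^sup>+z. indicator ?Z z * (\<integral>\<^sup>+x. ennreal ((f (x + z) - f x)\<^sup>2) \<partial>lborel) \<partial>lborel)"
    by (intro nn_integral_cong nn_integral_cmult) measurable
  also have "\<dots> \<le> (\<integral>\<^sup>+z. (ennreal (real CARD('n) * h\<^sup>2) * (\<integral>\<^sup>+x. ennreal (grad2 f x) \<partial>lborel)) * indicator ?Z z \<partial>lborel)"
  proof (rule nn_integral_mono)
    fix z :: "real^'n"
    show "indicator ?Z z * (\<integral>\<^sup>+x. ennreal ((f (x + z) - f x)\<^sup>2) \<partial>lborel) \<le>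
        (ennreal (real CARD('n) * h\<^sup>2) * (\<integral>\<^sup>+x. ennreal (grad2 f x) \<partial>lborel)) * indicator ?Z z"
    proof (cases "z \<in> ?Z")
      case True
      have "(z $ i)\<^sup>2 \<le> h\<^sup>2" for i
        using True by (intro power2_le_iff_abs_le[THEN iffD2]) (auto simp: mem_box_cart abs_le_iff intro: less_imp_le minus_le_iff[THEN iffD1])
      then have "(\<Sum>i\<in>UNIV. (z $ i)\<^sup>2) \<le> (\<Sum>i\<in>(UNIV::'n set). h\<^sup>2)" by (intro sum_mono)
      moreover have "(norm z)\<^sup>2 = (\<Sum>i\<in>UNIV. (z $ i)\<^sup>2)" by (simp add: norm_vec_def L2_set_def sum_nonneg)
      ultimately have "ennreal ((norm z)\<^sup>2) \<le> ennreal (real CARD('n) * h\<^sup>2)" by (intro ennreal_leI) simp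
      then have "(\<integral>\<^sup>+x. ennreal ((f (x + z) - f x)\<^sup>2) \<partial>lborel) \<le> ennreal (real CARD('n) * h\<^sup>2) * (\<integral>\<^sup>+x. ennreal (grad2 f x) \<partial>lborel)"
        by (intro order_trans[OF translation_estimate[OF f]] mult_right_mono) auto
      then show ?thesis using True by simp
    qed simp
  qed
  also have "\<dots> = (ennreal (real CARD('n) * h\<^sup>2) * (\<integral>\<^sup>+x. ennreal (grad2 f x) \<partial>lborel)) * emeasure lborel ?Z"
    by (subst nn_integral_cmult_indicator) auto
  also have "emeasure lborel ?Z = ennreal ((2 * h) ^ CARD('n))"
    by (rule emeasure_lborel_cube(1)) (use h in \<open>auto simp: vec_eq_iff\<close>)
  finally show ?thesis using h by (simp add: ennreal_mult mult_ac)
qed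

text \<open>The variance on a cell as a double integral over pairs of points. This trades the
  deviation from the mean for differences of values, to which translation estimates apply.\<close>

lemma cell_variance:
  fixes f :: "'a::euclidean_space \<Rightarrow> real"
  assumes [measurable]: "Q \<in> sets borel" and q: "emeasure lborel Q = ennreal q" "0 \<le> q"
    and f: "integrable lborel f" "integrable lborel (\<lambda>x. (f x)\<^sup>2)"
  defines "a \<equiv> \<integral>x. indicator Q x * f x \<partial>lborel" and "b \<equiv> \<integral>x. indicator Q x * (f x)\<^sup>2 \<partial>lborel"
  shows "(\<integral>\<^sup>+x. \<integral>\<^sup>+y. indicator Q x * indicator Q y * ennreal ((f y - f x)\<^sup>2) \<partial>lborel \<partial>lborel) = ennreal (2 * (q * b - a\<^sup>2))"
    and "a\<^sup>2 \<le> q * b"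
proof -
  have [measurable]: "f \<in> borel_measurable borel" using f(1) by auto
  have i: "integrable lborel (\<lambda>x. indicator Q x * f x)" "integrable lborel (\<lambda>x. indicator Q x * (f x)\<^sup>2)"
    "integrable lborel (\<lambda>x. indicator Q x :: real)"
    using q integrable_real_mult_indicator[of Q lborel, OF _ f(1)] integrable_real_mult_indicator[of Q lborel, OF _ f(2)]
    by (simp_all add: mult.commute)
  have m: "measure lborel Q = q" using q by (simp add: measure_def)
  have inner: "(\<integral>\<^sup>+y. indicator Q y * ennreal ((f y - f x)\<^sup>2) \<partial>lborel) = ennreal (b - 2 * f x * a + (f x)\<^sup>2 * q)"
    "0 \<le> b - 2 * f x * a + (f x)\<^sup>2 * q" for x
  proof -
    have eq: "(\<lambda>y. indicator Q y * (f y - f x)\<^sup>2) =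
        (\<lambda>y. indicator Q y * (f y)\<^sup>2 - 2 * f x * (indicator Q y * f y) + (f x)\<^sup>2 * indicator Q y)"
      by (auto simp: power2_diff algebra_simps)
    have int: "integrable lborel (\<lambda>y. indicator Q y * (f y - f x)\<^sup>2)" unfolding eq using i by simp
    have val: "(\<integral>y. indicator Q y * (f y - f x)\<^sup>2 \<partial>lborel) = b - 2 * f x * a + (f x)\<^sup>2 * q"
      unfolding eq using i by (simp add: a_def b_def m)
    have "(\<integral>\<^sup>+y. indicator Q y * ennreal ((f y - f x)\<^sup>2) \<partial>lborel) = (\<integral>\<^sup>+y. ennreal (indicator Q y * (f y - f x)\<^sup>2) \<partial>lborel)"
      by (intro nn_integral_cong) (simp add: indicator_def)
    also have "\<dots> = ennreal (b - 2 * f x * a + (f x)\<^sup>2 * q)"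
      using nn_integral_eq_integral[OF int] val by simp
    finally show "(\<integral>\<^sup>+y. indicator Q y * ennreal ((f y - f x)\<^sup>2) \<partial>lborel) = ennreal (b - 2 * f x * a + (f x)\<^sup>2 * q)" .
    show "0 \<le> b - 2 * f x * a + (f x)\<^sup>2 * q" unfolding val[symmetric] by (intro integral_nonneg_AE) simp
  qed
  have eq: "(\<lambda>x. indicator Q x * (b - 2 * f x * a + (f x)\<^sup>2 * q)) =
        (\<lambda>x. b * indicator Q x - 2 * a * (indicator Q x * f x) + q * (indicator Q x * (f x)\<^sup>2))"
    by (auto simp: algebra_simps)
  have int: "integrable lborel (\<lambda>x. indicator Q x * (b - 2 * f x * a + (f x)\<^sup>2 * q))" unfolding eq using i by simp
  have "(\<integral>x. indicator Q x * (b - 2 * f x * a + (f x)\<^sup>2 * q) \<partial>lborel) = b * q - 2 * a * a + q * b"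
    unfolding eq using i by (simp add: a_def[symmetric] b_def[symmetric] m)
  then have val: "(\<integral>x. indicator Q x * (b - 2 * f x * a + (f x)\<^sup>2 * q) \<partial>lborel) = 2 * (q * b - a\<^sup>2)"
    by (simp add: power2_eq_square algebra_simps)
  have "0 \<le> (\<integral>x. indicator Q x * (b - 2 * f x * a + (f x)\<^sup>2 * q) \<partial>lborel)"
    using inner(2) by (intro integral_nonneg_AE) simp
  then show "a\<^sup>2 \<le> q * b" unfolding val by simp
  have "(\<integral>\<^sup>+x. \<integral>\<^sup>+y. indicator Q x * indicator Q y * ennreal ((f y - f x)\<^sup>2) \<partial>lborel \<partial>lborel) =
      (\<integral>\<^sup>+x. indicator Q x * (\<integral>\<^sup>+y. indicator Q y * ennreal ((f y - f x)\<^sup>2) \<partial>lborel) \<partial>lborel)"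
    by (intro nn_integral_cong) (simp add: mult.assoc nn_integral_cmult)
  also have "\<dots> = (\<integral>\<^sup>+x. ennreal (indicator Q x * (b - 2 * f x * a + (f x)\<^sup>2 * q)) \<partial>lborel)"
    unfolding inner(1) by (intro nn_integral_cong) (simp add: indicator_def)
  also have "\<dots> = ennreal (2 * (q * b - a\<^sup>2))"
    unfolding val[symmetric] by (intro nn_integral_eq_integral int) (simp add: inner(2))
  finally show "(\<integral>\<^sup>+x. \<integral>\<^sup>+y. indicator Q x * indicator Q y * ennreal ((f y - f x)\<^sup>2) \<partial>lborel \<partial>lborel) = ennreal (2 * (q * b - a\<^sup>2))" .
qed

text \<open>A Poincare inequality on all cells at once: two points of one cell differ by a vector of
  \<open>box (\<chi> i. - h) (\<chi> i. h)\<close>, so the double integrals over the cells are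
  together dominated by the one over all close pairs. The constant is the one found there divided by
  twice the volume of a cell; the sum over \<open>R\<close> is the contribution of the
  means.\<close>

lemma cells_variance_le:
  fixes f :: "real^'n::finite \<Rightarrow> real"
  assumes f: "Ck (Suc 0) UNIV f" and K: "compact K" "\<And>x. x \<notin> K \<Longrightarrow> f x = 0" and h: "h > 0"
    and R: "finite R" "\<And>x. x \<in> K \<Longrightarrow> (\<lambda>i. \<lfloor>x $ i / h\<rfloor>) \<in> R"
  shows "(\<integral>x. (f x)\<^sup>2 \<partial>lborel) \<le> 2 ^ CARD('n) * real CARD('n) * h\<^sup>2 / 2 * (\<integral>x. grad2 f x \<partial>lborel) +
    (\<Sum>r\<in>R. (\<integral>x. indicator (cell h r) x / sqrt (h ^ CARD('n)) * f x \<partial>lborel)\<^sup>2)"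
proof -
  let ?q = "h ^ CARD('n)"
  have q: "?q > 0" using h by simp
  have cf: "continuous_on UNIV f" by (rule Ck_imp_continuous_on[OF f])
  have cp: "continuous_on UNIV (partial i f)" for i using f by simp
  have [measurable]: "f \<in> borel_measurable borel" using cf by (rule borel_measurable_continuous_onI)
  have pz: "partial i f x = 0" if "x \<notin> K" for i x
    by (rule partial_zero_outside[OF compact_imp_closed[OF K(1)] K(2) that])
  have fi: "integrable lborel f" by (rule integrable_continuous_compact_support[OF cf K])
  have f2i: "integrable lborel (\<lambda>x. (f x)\<^sup>2)"
    by (rule integrable_continuous_compact_support[OF _ K(1)]) (auto intro!: continuous_intros cf simp: K(2))
  have gi: "integrable lborel (grad2 f)"
    by (rule integrable_continuous_compact_support[OF _ K(1)]) (auto intro!: continuous_intros cp simp: grad2_def[abs_def] pz)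
  define a where "a r = (\<integral>x. indicator (cell h r) x * f x \<partial>lborel)" for r :: "'n \<Rightarrow> int"
  define b where "b r = (\<integral>x. indicator (cell h r) x * (f x)\<^sup>2 \<partial>lborel)" for r :: "'n \<Rightarrow> int"
  note cv = cell_variance[OF cell_sets emeasure_cell[OF h] less_imp_le[OF q] fi f2i, folded a_def b_def]
  let ?E = "\<integral>x. grad2 f x \<partial>lborel"
  have "ennreal (\<Sum>r\<in>R. 2 * (?q * b r - (a r)\<^sup>2)) = (\<Sum>r\<in>R. ennreal (2 * (?q * b r - (a r)\<^sup>2)))"
    using cv(2) by (intro sum_ennreal[symmetric]) simp
  also have "\<dots> = (\<integral>\<^sup>+x. \<integral>\<^sup>+y. (\<Sum>r\<in>R. indicator (cell h r) x * indicator (cell h r) y * ennreal ((f y - f x)\<^sup>2)) \<partial>lborel \<partial>lborel)"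
    unfolding cv(1)[symmetric] by (simp add: nn_integral_sum)
  also have "\<dots> \<le> (\<integral>\<^sup>+x. \<integral>\<^sup>+y. indicator (box (\<chi> i. - h) (\<chi> i. h)) (y - x) * ennreal ((f y - f x)\<^sup>2) \<partial>lborel \<partial>lborel)"
  proof (intro nn_integral_mono)
    fix x y :: "real^'n"
    let ?r = "\<lambda>i. \<lfloor>x $ i / h\<rfloor>"
    have "(\<Sum>r\<in>R. indicator (cell h r) x * indicator (cell h r) y * ennreal ((f y - f x)\<^sup>2)) =
        (\<Sum>r\<in>R \<inter> {?r}. indicator (cell h r) x * indicator (cell h r) y * ennreal ((f y - f x)\<^sup>2))"
      by (intro sum.mono_neutral_right) (auto simp: R(1) indicator_def cell_index[OF h])
    also have "\<dots> \<le> indicator (cell h ?r) x * indicator (cell h ?r) y * ennreal ((f y - f x)\<^sup>2)"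
      by (cases "?r \<in> R") auto
    also have "\<dots> \<le> indicator (box (\<chi> i. - h) (\<chi> i. h)) (y - x) * ennreal ((f y - f x)\<^sup>2)"
    proof (cases "x \<in> cell h ?r \<and> y \<in> cell h ?r")
      case True
      have "y - x \<in> box (\<chi> i. - h) (\<chi> i. h)"
        unfolding mem_box_cart
      proof
        fix i
        have "h * of_int (?r i) \<le> x $ i" "x $ i < h * (of_int (?r i) + 1)"
          "h * of_int (?r i) \<le> y $ i" "y $ i < h * (of_int (?r i) + 1)"
          using True by (auto simp: cell_def)
        then show "(\<chi> i. - h) $ i < (y - x) $ i \<and> (y - x) $ i < (\<chi> i. h) $ i"
          by (simp add: distrib_left)
      qed
      then show ?thesis by (simp add: indicator_def)
    next
      case False
      then show ?thesis by (auto simp: indicator_def)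
    qed
    finally show "(\<Sum>r\<in>R. indicator (cell h r) x * indicator (cell h r) y * ennreal ((f y - f x)\<^sup>2)) \<le>
      indicator (box (\<chi> i. - h) (\<chi> i. h)) (y - x) * ennreal ((f y - f x)\<^sup>2)" .
  qed
  also have "\<dots> \<le> ennreal ((2 * h) ^ CARD('n) * (real CARD('n) * h\<^sup>2)) * (\<integral>\<^sup>+x. ennreal (grad2 f x) \<partial>lborel)"
    by (rule difference_double_integral_le[OF f h])
  also have "(\<integral>\<^sup>+x. ennreal (grad2 f x) \<partial>lborel) = ennreal ?E"
    by (rule nn_integral_eq_integral[OF gi]) (simp add: grad2_nonneg)
  also have "ennreal ((2 * h) ^ CARD('n) * (real CARD('n) * h\<^sup>2)) * ennreal ?E =
      ennreal ((2 * h) ^ CARD('n) * (real CARD('n) * h\<^sup>2) * ?E)"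
    using h by (simp add: ennreal_mult grad2_nonneg)
  finally have "(\<Sum>r\<in>R. 2 * (?q * b r - (a r)\<^sup>2)) \<le> (2 * h) ^ CARD('n) * (real CARD('n) * h\<^sup>2) * ?E"
    using h by (subst (asm) ennreal_le_iff) (auto simp: grad2_nonneg)
  moreover have "(\<Sum>r\<in>R. 2 * (?q * b r - (a r)\<^sup>2)) = 2 * ?q * (\<Sum>r\<in>R. b r - (a r)\<^sup>2 / ?q)"
    unfolding sum_distrib_left using h by (intro sum.cong refl) (simp add: right_diff_distrib)
  moreover have "(2 * h) ^ CARD('n) * (real CARD('n) * h\<^sup>2) * ?E = 2 * ?q * (2 ^ CARD('n) * real CARD('n) * h\<^sup>2 / 2 * ?E)"
    by (simp add: power_mult_distrib)
  ultimately have "2 * ?q * (\<Sum>r\<in>R. b r - (a r)\<^sup>2 / ?q) \<le> 2 * ?q * (2 ^ CARD('n) * real CARD('n) * h\<^sup>2 / 2 * ?E)"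
    by linarith
  then have 1: "(\<Sum>r\<in>R. b r - (a r)\<^sup>2 / ?q) \<le> 2 ^ CARD('n) * real CARD('n) * h\<^sup>2 / 2 * ?E"
    by (rule mult_left_le_imp_le) (use h in simp)
  have "(\<integral>x. (f x)\<^sup>2 \<partial>lborel) = (\<integral>x. (\<Sum>r\<in>R. indicator (cell h r) x * (f x)\<^sup>2) \<partial>lborel)"
  proof (rule Bochner_Integration.integral_cong[OF refl])
    fix x :: "real^'n"
    show "(f x)\<^sup>2 = (\<Sum>r\<in>R. indicator (cell h r) x * (f x)\<^sup>2)"
    proof (cases "x \<in> K")
      case True
      have "(\<Sum>r\<in>R. indicator (cell h r) x * (f x)\<^sup>2) = (\<Sum>r\<in>{\<lambda>i. \<lfloor>x $ i / h\<rfloor>}. indicator (cell h r) x * (f x)\<^sup>2)"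
        using R True by (intro sum.mono_neutral_right) (auto simp: indicator_def cell_index[OF h])
      then show ?thesis by (simp add: indicator_def cell_index[OF h])
    qed (simp add: K(2))
  qed
  also have "\<dots> = (\<Sum>r\<in>R. b r)"
    unfolding b_def using f2i
    by (intro Bochner_Integration.integral_sum) (simp add: mult.commute[of "indicator _ _"] integrable_real_mult_indicator)
  finally have 2: "(\<integral>x. (f x)\<^sup>2 \<partial>lborel) = (\<Sum>r\<in>R. b r)" .
  have 3: "(\<integral>x. indicator (cell h r) x / sqrt ?q * f x \<partial>lborel)\<^sup>2 = (a r)\<^sup>2 / ?q" for r
  proof -
    have "(\<integral>x. indicator (cell h r) x / sqrt ?q * f x \<partial>lborel) = (\<integral>x. (1 / sqrt ?q) * (indicator (cell h r) x * f x) \<partial>lborel)"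
      by simp
    also have "\<dots> = (1 / sqrt ?q) * a r" unfolding a_def by (rule integral_mult_right_zero)
    finally have t: "(\<integral>x. indicator (cell h r) x / sqrt ?q * f x \<partial>lborel) = (1 / sqrt ?q) * a r" .
    show ?thesis unfolding t power_mult_distrib power_divide using h by simp
  qed
  show ?thesis unfolding 2 3 using 1 by (simp add: sum_subtractf)
qed

text \<open>Only finitely many cells meet \<open>K\<close>, and the functionals are the integrals
  over these cells divided by the square root of the cell volume. They depend on \<open>K\<close>
  and \<open>e\<close> alone, not on \<open>f\<close>; this uniformity is the compactness.\<close>

proposition rellich_inequality:
  fixes K :: "(real^'n::finite) set"
  assumes K: "compact K" and e: "e > 0"
  shows "\<exists>N (g :: nat \<Rightarrow> real^'n \<Rightarrow> real). (\<forall>r<N. g r \<in> borel_measurable borel \<and> (\<exists>C. \<forall>x. \<bar>g r x\<bar> \<le> C)) \<and>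
    (\<forall>f. Ck (Suc 0) UNIV f \<longrightarrow> (\<forall>x. x \<notin> K \<longrightarrow> f x = 0) \<longrightarrow>
      (\<integral>x. (f x)\<^sup>2 \<partial>lborel) \<le> e * (\<integral>x. grad2 f x \<partial>lborel) + (\<Sum>r<N. (\<integral>x. g r x * f x \<partial>lborel)\<^sup>2))"
proof -
  let ?c = "2 ^ CARD('n) * real CARD('n)"
  \<comment> \<open>Makes the constant \<open>?c * h^2 / 2\<close> of the Poincare inequality equal
    to \<open>e / 2\<close>.\<close>
  define h where "h = sqrt (e / ?c)"
  have c: "?c > 0" by simp
  then have h: "h > 0" using e by (simp add: h_def)
  have hc: "?c * h\<^sup>2 / 2 \<le> e" using e c by (simp add: h_def)
  let ?idx = "\<lambda>x i. \<lfloor>x $ i / h\<rfloor>"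
  define R where "R = ?idx ` K"
  have "finite R"
  proof -
    obtain B where B: "\<And>x. x \<in> K \<Longrightarrow> norm x \<le> B" using compact_imp_bounded[OF K] by (auto simp: bounded_iff)
    have "R \<subseteq> PiE UNIV (\<lambda>i. {\<lfloor>- B / h\<rfloor>..\<lfloor>B / h\<rfloor>})"
    proof (clarsimp simp: R_def PiE_def Pi_def, intro conjI)
      fix x i assume "x \<in> K"
      then have "\<bar>x $ i\<bar> \<le> B" using B[of x] component_le_norm_cart[of x i] by linarith
      then have "- B \<le> x $ i" "x $ i \<le> B" by auto
      then show "\<lfloor>- (B / h)\<rfloor> \<le> \<lfloor>x $ i / h\<rfloor>" "\<lfloor>x $ i / h\<rfloor> \<le> \<lfloor>B / h\<rfloor>"
        using h by (auto intro!: floor_mono simp: field_simps)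
    qed
    then show ?thesis by (rule finite_subset) (auto intro: finite_PiE)
  qed
  then obtain s where s: "bij_betw s {..<card R} R"
    using ex_bij_betw_nat_finite[of R] by (auto simp: atLeast0LessThan)
  define g :: "nat \<Rightarrow> real^'n \<Rightarrow> real" where "g r x = indicator (cell h (s r)) x / sqrt (h ^ CARD('n))" for r x
  show ?thesis
  proof (intro exI[of _ "card R"] exI[of _ g] conjI allI impI)
    fix r
    show "g r \<in> borel_measurable borel" unfolding g_def[abs_def] by measurable
    have "\<bar>g r x\<bar> \<le> 1 / sqrt (h ^ CARD('n))" for x using h by (simp add: g_def indicator_def)
    then show "\<exists>C. \<forall>x. \<bar>g r x\<bar> \<le> C" by blast
  next
    fix f :: "real^'n \<Rightarrow> real" assume f: "Ck (Suc 0) UNIV f" and fK: "\<forall>x. x \<notin> K \<longrightarrow> f x = 0"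
    have "(\<integral>x. (f x)\<^sup>2 \<partial>lborel) \<le> ?c * h\<^sup>2 / 2 * (\<integral>x. grad2 f x \<partial>lborel) +
      (\<Sum>r\<in>R. (\<integral>x. indicator (cell h r) x / sqrt (h ^ CARD('n)) * f x \<partial>lborel)\<^sup>2)"
      using fK by (intro cells_variance_le[OF f K _ h \<open>finite R\<close>]) (auto simp: R_def)
    also have "(\<Sum>r\<in>R. (\<integral>x. indicator (cell h r) x / sqrt (h ^ CARD('n)) * f x \<partial>lborel)\<^sup>2) = (\<Sum>r<card R. (\<integral>x. g r x * f x \<partial>lborel)\<^sup>2)"
      unfolding g_def by (rule sum.reindex_bij_betw[OF s, symmetric])
    also have "?c * h\<^sup>2 / 2 * (\<integral>x. grad2 f x \<partial>lborel) \<le> e * (\<integral>x. grad2 f x \<partial>lborel)"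
      by (intro mult_right_mono hc integral_nonneg_AE) (simp add: grad2_nonneg)
    finally show "(\<integral>x. (f x)\<^sup>2 \<partial>lborel) \<le> e * (\<integral>x. grad2 f x \<partial>lborel) + (\<Sum>r<card R. (\<integral>x. g r x * f x \<partial>lborel)\<^sup>2)" by simp
  qed
qed

section \<open>Change of variables for arbitrary finite index types\<close>

text \<open>The library proves the change of variables formula for vectors whose index type is a
  well-order. An arbitrary finite index type is transported to a copy that carries such an order.\<close>

typedef 'a wo = "UNIV :: 'a set" morphisms unwo wo by simp

lemma unwo_wo [simp]: "unwo (wo x) = x" "wo (unwo y) = y"
  by (simp_all add: wo_inverse unwo_inverse)

lemma bij_unwo: "bij unwo" "bij wo"
  by (rule bij_betw_byWitness[of _ wo] bij_betw_byWitness[of _ unwo]; auto)+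

definition wo_rank :: "'a::finite \<Rightarrow> nat" where
  "wo_rank = (SOME f. inj f)"

lemma inj_wo_rank: "inj (wo_rank :: 'a::finite \<Rightarrow> nat)"
proof -
  obtain f :: "'a \<Rightarrow> nat" and n where "f ` UNIV = {i. i < n} \<and> inj f"
    using finite_imp_inj_to_nat_seg[OF finite[of "UNIV :: 'a set"]] by (elim exE)
  then have "\<exists>f :: 'a \<Rightarrow> nat. inj f" by (elim conjE) (rule exI)
  then show ?thesis unfolding wo_rank_def by (rule someI_ex)
qed

instance wo :: (finite) finite
proof
  have "surj (wo :: 'a \<Rightarrow> 'a wo)" by (rule bij_is_surj[OF bij_unwo(2)])
  then show "finite (UNIV :: 'a wo set)" using finite_imageI[OF finite[of "UNIV :: 'a set"], of wo] by simp
qed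

instantiation wo :: (finite) wellorder
begin

definition less_eq_wo :: "'a wo \<Rightarrow> 'a wo \<Rightarrow> bool" where
  "x \<le> y \<longleftrightarrow> wo_rank (unwo x) \<le> wo_rank (unwo y)"

definition less_wo :: "'a wo \<Rightarrow> 'a wo \<Rightarrow> bool" where
  "x < y \<longleftrightarrow> wo_rank (unwo x) < wo_rank (unwo y)"

instance
proof
  fix x y z :: "'a wo" and P :: "'a wo \<Rightarrow> bool"
  show "x < y \<longleftrightarrow> x \<le> y \<and> \<not> y \<le> x" "x \<le> x" "x \<le> y \<or> y \<le> x"
    by (auto simp: less_eq_wo_def less_wo_def)
  show "x \<le> z" if "x \<le> y" "y \<le> z" using that by (auto simp: less_eq_wo_def)
  show "x = y" if "x \<le> y" "y \<le> x"
  proof -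
    have "wo_rank (unwo x) = wo_rank (unwo y)" using that by (simp add: less_eq_wo_def)
    then have "unwo x = unwo y" by (rule injD[OF inj_wo_rank])
    then show ?thesis by (simp add: unwo_inject)
  qed
  show "P x" if less: "\<And>x. (\<And>y. y < x \<Longrightarrow> P y) \<Longrightarrow> P x"
  proof (rule measure_induct_rule[of "\<lambda>x. wo_rank (unwo x)" P x])
    fix x :: "'a wo" assume "\<And>y. wo_rank (unwo y) < wo_rank (unwo x) \<Longrightarrow> P y"
    then show "P x" by - (rule less, simp only: less_wo_def)
  qed
qed

end

text \<open>Conjugation turns a product of transpositions into a product of equally many
  transpositions. Renaming rows and columns simultaneously thus permutes the Leibniz terms of a
  determinant and keeps their signs.\<close>

lemma sign_conj_wo:
  fixes p :: "'a::finite \<Rightarrow> 'a"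
  assumes "p permutes UNIV"
  shows "sign (wo \<circ> p \<circ> unwo) = sign p"
proof -
  have "swapidseq n (wo \<circ> p \<circ> unwo)" if "swapidseq n p" for n and p :: "'a \<Rightarrow> 'a"
    using that
  proof induction
    case id
    have "wo \<circ> id \<circ> unwo = (id :: 'a wo \<Rightarrow> _)" by (rule ext) simp
    then show ?case by (simp only: swapidseq.id)
  next
    case (comp_Suc n p a b)
    have eq: "wo \<circ> (Transposition.transpose a b \<circ> p) \<circ> unwo = Transposition.transpose (wo a) (wo b) \<circ> (wo \<circ> p \<circ> unwo)"
      by (auto simp: fun_eq_iff Transposition.transpose_def wo_inject)
    have "wo a \<noteq> wo b" using comp_Suc by (simp add: wo_inject)
    then show ?case unfolding eq by (rule swapidseq.comp_Suc[OF comp_Suc.IH])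
  qed
  moreover obtain n where n: "swapidseq n p"
    using permutes_imp_permutation[OF finite assms] by (auto simp: permutation_def)
  ultimately have "evenperm (wo \<circ> p \<circ> unwo) = evenperm p"
    using evenperm_unique[of n p "even n"] evenperm_unique[of n "wo \<circ> p \<circ> unwo" "even n"] by simp
  then show ?thesis by (simp add: sign_def)
qed

lemma det_reindex_wo:
  fixes A :: "real^'n::finite^'n"
  shows "det (\<chi> i j. A $ unwo i $ unwo j) = det A"
proof -
  let ?c = "\<lambda>p :: 'n \<Rightarrow> 'n. wo \<circ> p \<circ> unwo"
  have bij: "bij_betw ?c {p. p permutes UNIV} {p. p permutes UNIV}"
  proof (rule bij_betw_byWitness[where f'="\<lambda>q. unwo \<circ> q \<circ> wo"])
    show "\<forall>p\<in>{p. p permutes UNIV}. unwo \<circ> ?c p \<circ> wo = p" by (auto simp: fun_eq_iff)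
    show "\<forall>q\<in>{q. q permutes UNIV}. ?c (unwo \<circ> q \<circ> wo) = q" by (auto simp: fun_eq_iff)
    show "?c ` {p. p permutes UNIV} \<subseteq> {p. p permutes UNIV}"
      using bij_unwo by (auto intro!: bij_imp_permutes bij_comp simp: permutes_bij)
    show "(\<lambda>q. unwo \<circ> q \<circ> wo) ` {p. p permutes UNIV} \<subseteq> {p. p permutes UNIV}"
      using bij_unwo by (auto intro!: bij_imp_permutes bij_comp simp: permutes_bij)
  qed
  have "det (\<chi> i j. A $ unwo i $ unwo j) = (\<Sum>q\<in>{q. q permutes UNIV}. of_int (sign q) * (\<Prod>i\<in>UNIV. A $ unwo i $ unwo (q i)))"
    by (simp add: det_def)
  also have "\<dots> = (\<Sum>p\<in>{p. p permutes UNIV}. of_int (sign (?c p)) * (\<Prod>i\<in>UNIV. A $ unwo i $ unwo (?c p i)))"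
    by (rule sum.reindex_bij_betw[OF bij, symmetric])
  also have "\<dots> = (\<Sum>p\<in>{p. p permutes UNIV}. of_int (sign p) * (\<Prod>i\<in>UNIV. A $ i $ p i))"
  proof (rule sum.cong[OF refl])
    fix p :: "'n \<Rightarrow> 'n" assume "p \<in> {p. p permutes UNIV}"
    then have "sign (?c p) = sign p" by (simp add: sign_conj_wo)
    moreover have "(\<Prod>i\<in>UNIV. A $ unwo i $ unwo (?c p i)) = (\<Prod>i\<in>UNIV. A $ i $ p i)"
      using prod.reindex_bij_betw[OF bij_unwo(1), of "\<lambda>i. A $ i $ p i"] by (simp add: wo_inverse)
    ultimately show "of_int (sign (?c p)) * (\<Prod>i\<in>UNIV. A $ unwo i $ unwo (?c p i)) = of_int (sign p) * (\<Prod>i\<in>UNIV. A $ i $ p i)" by simp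
  qed
  finally show ?thesis by (simp add: det_def)
qed

definition vec_wo :: "real^'n::finite \<Rightarrow> real^'n wo" where "vec_wo x = (\<chi> i. x $ unwo i)"
definition vec_unwo :: "real^'n::finite wo \<Rightarrow> real^'n" where "vec_unwo y = (\<chi> i. y $ wo i)"

lemma vec_wo_inverse [simp]: "vec_unwo (vec_wo x) = x" "vec_wo (vec_unwo y) = y"
  by (simp_all add: vec_wo_def vec_unwo_def vec_eq_iff wo_inverse unwo_inverse)

lemma linear_vec_wo: "bounded_linear vec_wo" "bounded_linear vec_unwo"
  by (auto intro!: linear_conv_bounded_linear[THEN iffD1] linearI simp: vec_wo_def vec_unwo_def vec_eq_iff)

lemma vec_wo_measurable [measurable]: "vec_wo \<in> borel_measurable borel" "vec_unwo \<in> borel_measurable borel"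
  using linear_vec_wo by (auto intro: borel_measurable_continuous_onI linear_continuous_on)

text \<open>Renaming coordinates maps boxes to boxes with the same side lengths, and Lebesgue
  measure is determined by its values on boxes.\<close>

lemma lborel_distr_vec_wo: "distr lborel borel vec_unwo = (lborel :: (real^'n::finite) measure)"
proof (rule lborel_eqI[symmetric])
  fix l u :: "real^'n"
  assume le: "\<And>b. b \<in> Basis \<Longrightarrow> l \<bullet> b \<le> u \<bullet> b"
  have le': "l $ i \<le> u $ i" for i using le[of "axis i 1"] by (simp add: inner_axis axis_in_Basis_iff)
  have pre: "vec_unwo -` box l u = box (vec_wo l) (vec_wo u)"
  proof (intro set_eqI)
    fix y :: "real^'n wo"
    have "(\<forall>i. l $ i < y $ wo i \<and> y $ wo i < u $ i) \<longleftrightarrow> (\<forall>i. l $ unwo i < y $ i \<and> y $ i < u $ unwo i)"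
    proof (intro iffI allI)
      fix i assume "\<forall>i. l $ i < y $ wo i \<and> y $ wo i < u $ i"
      from spec[OF this, of "unwo i"] show "l $ unwo i < y $ i \<and> y $ i < u $ unwo i" by simp
    next
      fix i assume "\<forall>i. l $ unwo i < y $ i \<and> y $ i < u $ unwo i"
      from spec[OF this, of "wo i"] show "l $ i < y $ wo i \<and> y $ wo i < u $ i" by simp
    qed
    then show "y \<in> vec_unwo -` box l u \<longleftrightarrow> y \<in> box (vec_wo l) (vec_wo u)"
      by (simp add: mem_box_cart vec_wo_def vec_unwo_def)
  qed
  have lew: "vec_wo l \<bullet> b \<le> vec_wo u \<bullet> b" if "b \<in> Basis" for b
    using that le' by (auto simp: Basis_vec_def inner_axis vec_wo_def)
  have Bprod: "(\<Prod>b\<in>Basis. v \<bullet> b) = (\<Prod>i\<in>UNIV. v $ i)" for v :: "real^'k::finite"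
  proof -
    have "bij_betw (\<lambda>i. axis i 1 :: real^'k) UNIV Basis"
      by (auto simp: bij_betw_def inj_on_def axis_eq_axis Basis_vec_def)
    from prod.reindex_bij_betw[OF this, of "\<lambda>b. v \<bullet> b"] show ?thesis by (simp add: inner_axis)
  qed
  have "emeasure (distr lborel borel vec_unwo) (box l u) = emeasure lborel (box (vec_wo l) (vec_wo u))"
    by (subst emeasure_distr) (auto simp: pre)
  also have "\<dots> = (\<Prod>b\<in>Basis. (vec_wo u - vec_wo l) \<bullet> b)" by (rule emeasure_lborel_box[OF lew])
  also have "\<dots> = (\<Prod>i\<in>UNIV. (u - l) $ unwo i)" by (simp add: Bprod vec_wo_def)
  also have "\<dots> = (\<Prod>b\<in>Basis. (u - l) \<bullet> b)"
    unfolding Bprod using prod.reindex_bij_betw[OF bij_unwo(1), of "\<lambda>i. (u - l) $ i"] by simp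
  finally show "emeasure (distr lborel borel vec_unwo) (box l u) = (\<Prod>b\<in>Basis. (u - l) \<bullet> b)" .
qed simp

text \<open>The change of variables formula used here equates the statements that the image has a
  given finite measure and that the integral has this value; the infinite value needs an extra
  argument.\<close>

lemma emeasure_differentiable_image_wo:
  fixes g :: "real^'m::{finite,wellorder} \<Rightarrow> real^'m::_"
  assumes S [measurable]: "S \<in> sets borel" and gS [measurable]: "g ` S \<in> sets borel"
    and der: "\<And>x. x \<in> S \<Longrightarrow> (g has_derivative g' x) (at x within S)" and inj: "inj_on g S"
    and m [measurable]: "(\<lambda>x. indicator S x * \<bar>det (matrix (g' x))\<bar>) \<in> borel_measurable borel"
  shows "emeasure lborel (g ` S) = (\<integral>\<^sup>+x. ennreal (indicator S x * \<bar>det (matrix (g' x))\<bar>) \<partial>lborel)"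
proof -
  let ?f = "\<lambda>x. indicator S x * \<bar>det (matrix (g' x))\<bar>"
  have Sl: "S \<in> sets lebesgue" using S by simp
  note eq = has_measure_differentiable_image[OF Sl der inj]
  have hi: "((\<lambda>x. \<bar>det (matrix (g' x))\<bar>) has_integral m) S \<longleftrightarrow> (?f has_integral m) UNIV" for m
  proof -
    have "?f = (\<lambda>x. if x \<in> S then \<bar>det (matrix (g' x))\<bar> else 0)" by (auto simp: indicator_def)
    then show ?thesis using has_integral_restrict_UNIV[of S "\<lambda>x. \<bar>det (matrix (g' x))\<bar>" m] by simp
  qed
  show ?thesis
  proof (cases "g ` S \<in> lmeasurable")
    case True
    then have "(?f has_integral (measure lebesgue (g ` S))) UNIV" using eq hi by blast
    then have "(\<integral>\<^sup>+x. ennreal (?f x) \<partial>lborel) = ennreal (measure lebesgue (g ` S))"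
      by (intro nn_integral_has_integral_lborel m) auto
    moreover have "emeasure lborel (g ` S) = ennreal (measure lebesgue (g ` S))"
      using emeasure_eq_measure2[OF True] by simp
    ultimately show ?thesis by simp
  next
    \<comment> \<open>A Borel image outside \<open>lmeasurable\<close> has infinite measure. The
      integral is infinite as well, since a finite value would be a finite measure of the
      image.\<close>
    case False
    then have inf: "emeasure lborel (g ` S) = \<infinity>"
      using gS fmeasurableI[of "g ` S" lebesgue] by (auto simp: less_top[symmetric])
    have "(\<integral>\<^sup>+x. ennreal (?f x) \<partial>lborel) = \<infinity>"
    proof (rule ccontr)
      assume "\<not> ?thesis"
      then have "integrable lborel ?f" by (intro integrableI_bounded) (auto simp: less_top abs_mult)
      then have "(?f has_integral (integral\<^sup>L lborel ?f)) UNIV" by (rule has_integral_integral_lborel)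
      then show False using eq hi False by blast
    qed
    then show ?thesis using inf by simp
  qed
qed

text \<open>The map is conjugated with \<open>vec_wo\<close>, which preserves Lebesgue measure as
  well as the Jacobian determinant.\<close>

lemma emeasure_differentiable_image:
  fixes g :: "real^'n::finite \<Rightarrow> real^'n"
  assumes S [measurable]: "S \<in> sets borel" and gS [measurable]: "g ` S \<in> sets borel"
    and der: "\<And>x. x \<in> S \<Longrightarrow> (g has_derivative g' x) (at x within S)" and inj: "inj_on g S"
    and m [measurable]: "(\<lambda>x. indicator S x * \<bar>det (matrix (g' x))\<bar>) \<in> borel_measurable borel"
  shows "emeasure lborel (g ` S) = (\<integral>\<^sup>+x. ennreal (indicator S x * \<bar>det (matrix (g' x))\<bar>) \<partial>lborel)"
proof -
  let ?S = "vec_unwo -` S" and ?h = "vec_wo \<circ> g \<circ> vec_unwo" and ?h' = "\<lambda>y. vec_wo \<circ> g' (vec_unwo y) \<circ> vec_unwo"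
  have S': "?S \<in> sets borel" using measurable_sets[OF vec_wo_measurable(2) S] by simp
  have im: "?h ` ?S = vec_unwo -` (g ` S)"
  proof (intro set_eqI iffI)
    fix y assume "y \<in> vec_unwo -` (g ` S)"
    then obtain x where x: "x \<in> S" "vec_unwo y = g x" by auto
    have "y = vec_wo (vec_unwo y)" by simp
    also have "\<dots> = ?h (vec_wo x)" unfolding x(2) by simp
    finally have "y = ?h (vec_wo x)" .
    then show "y \<in> ?h ` ?S" using x by (auto intro!: image_eqI[of _ _ "vec_wo x"])
  qed auto
  have im': "?h ` ?S \<in> sets borel" unfolding im using measurable_sets[OF vec_wo_measurable(2) gS] by simp
  have der': "(?h has_derivative ?h' y) (at y within ?S)" if "y \<in> ?S" for y
  proof -
    have 1: "(vec_unwo has_derivative vec_unwo) (at y within ?S)"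
      by (rule bounded_linear_imp_has_derivative[OF linear_vec_wo(2)])
    have 2: "(g has_derivative g' (vec_unwo y)) (at (vec_unwo y) within vec_unwo ` ?S)"
      by (rule has_derivative_subset[OF der]) (use that in auto)
    have 3: "(vec_wo has_derivative vec_wo) (at ((g \<circ> vec_unwo) y) within (g \<circ> vec_unwo) ` ?S)"
      by (rule bounded_linear_imp_has_derivative[OF linear_vec_wo(1)])
    show ?thesis using diff_chain_within[OF diff_chain_within[OF 1 2] 3] by (simp only: comp_assoc)
  qed
  have inj': "inj_on ?h ?S"
  proof (rule inj_onI)
    fix x y assume xy: "x \<in> ?S" "y \<in> ?S" "?h x = ?h y"
    from arg_cong[OF xy(3), of vec_unwo] have "g (vec_unwo x) = g (vec_unwo y)" by simp
    then have "vec_unwo x = vec_unwo y" using inj xy by (auto dest: inj_onD)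
    from arg_cong[OF this, of vec_wo] show "x = y" by simp
  qed
  have mat: "det (matrix (?h' y)) = det (matrix (g' (vec_unwo y)))" for y
  proof -
    have ax: "vec_unwo (axis j 1) = axis (unwo j) 1" for j
    proof -
      have "wo i = j \<longleftrightarrow> i = unwo j" for i by auto
      then show ?thesis by (simp add: vec_unwo_def vec_eq_iff axis_def)
    qed
    have "matrix (?h' y) = (\<chi> i j. matrix (g' (vec_unwo y)) $ unwo i $ unwo j)"
      by (simp add: matrix_def ax vec_wo_def)
    then show ?thesis by (simp add: det_reindex_wo)
  qed
  have m': "(\<lambda>y. indicator ?S y * \<bar>det (matrix (?h' y))\<bar>) = (\<lambda>y. (\<lambda>x. indicator S x * \<bar>det (matrix (g' x))\<bar>) (vec_unwo y))"
    unfolding mat by (auto simp: indicator_def)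
  have "emeasure lborel (g ` S) = emeasure (distr lborel borel vec_unwo) (g ` S)" by (simp only: lborel_distr_vec_wo)
  also have "\<dots> = emeasure lborel (?h ` ?S)" unfolding im by (subst emeasure_distr) auto
  also have "\<dots> = (\<integral>\<^sup>+y. ennreal (indicator ?S y * \<bar>det (matrix (?h' y))\<bar>) \<partial>lborel)"
    by (rule emeasure_differentiable_image_wo[OF S' im' der' inj']) (unfold m', measurable)
  also have "\<dots> = (\<integral>\<^sup>+x. ennreal (indicator S x * \<bar>det (matrix (g' x))\<bar>) \<partial>distr lborel borel vec_unwo)"
    unfolding fun_cong[OF m'] by (subst nn_integral_distr) auto
  finally show ?thesis by (simp only: lborel_distr_vec_wo)
qed

section \<open>The Riemannian measure\<close>

text \<open>The segment from the identity to \<open>B\<close> consists of positive definite and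
  hence invertible matrices, so the determinant cannot change sign along it.\<close>

lemma pos_def_det_pos:
  fixes B :: "real^'n::finite^'n"
  assumes "\<And>v. v \<noteq> 0 \<Longrightarrow> 0 < v \<bullet> (B *v v)"
  shows "0 < det B"
proof (rule ccontr)
  assume neg: "\<not> 0 < det B"
  define C where "C t = (1 - t) *\<^sub>R mat 1 + t *\<^sub>R B" for t :: real
  have pd: "0 < v \<bullet> (C t *v v)" if "0 \<le> t" "t \<le> 1" "v \<noteq> 0" for t v
  proof -
    have eq: "v \<bullet> (C t *v v) = (1 - t) * (v \<bullet> v) + t * (v \<bullet> (B *v v))"
      by (simp add: C_def matrix_vector_mult_add_rdistrib scaleR_matrix_vector_assoc[symmetric] inner_add_right)
    have "0 < v \<bullet> v" "0 < v \<bullet> (B *v v)" using that assms by auto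
    then show ?thesis unfolding eq using that
      by (cases "t = 0") (auto intro!: add_nonneg_pos)
  qed
  have nz: "det (C t) \<noteq> 0" if "0 \<le> t" "t \<le> 1" for t
  proof
    assume "det (C t) = 0"
    then have "\<not> invertible (C t)" by (simp add: invertible_det_nz)
    then have "\<not> inj ((*v) (C t))" by (simp add: invertible_left_inverse matrix_left_invertible_injective)
    then obtain x y where xy: "x \<noteq> y" "C t *v x = C t *v y" by (auto simp: inj_def)
    then have "C t *v (x - y) = 0" by (simp add: matrix_vector_mult_diff_distrib)
    then show False using pd[OF that, of "x - y"] xy(1) by simp
  qed
  have cont: "continuous_on {0..1} (\<lambda>t. det (C t))"
    unfolding det_def C_def by (intro continuous_intros)
  have "det (C 1) \<le> 0" "0 \<le> det (C 0)" using neg by (simp_all add: C_def)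
  then obtain t where "0 \<le> t" "t \<le> 1" "det (C t) = 0"
    using IVT2'[of "\<lambda>t. det (C t)" 1 0 0] cont by auto
  with nz show False by blast
qed

locale riemannian =
  fixes A :: "('a::{t2_space, second_countable_topology}, 'n::finite) chart set"
    and G :: "('a, 'n) chart \<Rightarrow> 'a \<Rightarrow> real^'n^'n"
  assumes riemannian_manifold: "riemannian_manifold A G"
begin

abbreviation img :: "('a, 'n) chart \<Rightarrow> (real^'n) set" where "img c \<equiv> coord c ` dom_of c"

lemma
  assumes "c \<in> A"
  shows open_dom: "open (dom_of c)" and open_img: "open (img c)"
    and chart_homeo: "homeomorphism (dom_of c) (img c) (coord c) (param c)"
  using riemannian_manifold assms by (auto simp: riemannian_manifold_def smooth_manifold_def)

lemma
  assumes "c \<in> A"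
  shows param_coord: "p \<in> dom_of c \<Longrightarrow> param c (coord c p) = p"
    and coord_param: "x \<in> img c \<Longrightarrow> coord c (param c x) = x"
    and param_in_dom: "x \<in> img c \<Longrightarrow> param c x \<in> dom_of c"
    and continuous_on_coord: "continuous_on (dom_of c) (coord c)"
    and continuous_on_param: "continuous_on (img c) (param c)"
  using chart_homeo[OF assms] by (auto simp: homeomorphism_def)

lemma chart_cover: "\<exists>c\<in>A. p \<in> dom_of c"
  using riemannian_manifold by (auto simp: riemannian_manifold_def smooth_manifold_def)

lemma chart_at_in: "chart_at A p \<in> A" "p \<in> dom_of (chart_at A p)"
proof -
  have "\<exists>c. c \<in> A \<and> p \<in> dom_of c" using chart_cover by blast
  then have "chart_at A p \<in> A \<and> p \<in> dom_of (chart_at A p)" unfolding chart_at_def by (rule someI_ex)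
  then show "chart_at A p \<in> A" "p \<in> dom_of (chart_at A p)" by auto
qed

lemma G_Ck: assumes "c \<in> A" shows "Ck k (img c) (\<lambda>x. G c (param c x) $ i $ j)"
proof -
  have "Ck k (img c) (G c \<circ> param c)"
    using riemannian_manifold assms by (auto simp: riemannian_manifold_def riemannian_metric_def smooth_on_iff)
  from Ck_bounded_linear[OF bounded_linear_vec_nth open_img[OF assms] this, of i]
  have "Ck k (img c) (\<lambda>x. (G c \<circ> param c) x $ i)" .
  from Ck_bounded_linear[OF bounded_linear_vec_nth open_img[OF assms] this, of j] show ?thesis by simp
qed

lemma G_sym: "c \<in> A \<Longrightarrow> p \<in> dom_of c \<Longrightarrow> transpose (G c p) = G c p"
  and G_pos: "c \<in> A \<Longrightarrow> p \<in> dom_of c \<Longrightarrow> v \<noteq> 0 \<Longrightarrow> 0 < v \<bullet> (G c p *v v)"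
  using riemannian_manifold by (auto simp: riemannian_manifold_def riemannian_metric_def)

lemma det_G_pos: "c \<in> A \<Longrightarrow> p \<in> dom_of c \<Longrightarrow> 0 < det (G c p)"
  by (intro pos_def_det_pos G_pos)

definition rho :: "('a, 'n) chart \<Rightarrow> real^'n \<Rightarrow> real" where
  "rho c x = sqrt (det (G c (param c x)))"

lemma rho_pos: "c \<in> A \<Longrightarrow> x \<in> img c \<Longrightarrow> 0 < rho c x"
  unfolding rho_def by (simp add: det_G_pos param_in_dom)

lemma rho_Ck: assumes "c \<in> A" shows "Ck k (img c) (rho c)"
  unfolding rho_def[abs_def]
  by (intro Ck_sqrt Ck_det G_Ck open_img assms det_G_pos param_in_dom)

lemma continuous_on_rho: "c \<in> A \<Longrightarrow> continuous_on (img c) (rho c)"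
  using Ck_imp_continuous_on[OF rho_Ck] .

definition trans_map :: "('a, 'n) chart \<Rightarrow> ('a, 'n) chart \<Rightarrow> real^'n \<Rightarrow> real^'n" where
  "trans_map c d = coord d \<circ> param c"

abbreviation overlap :: "('a, 'n) chart \<Rightarrow> ('a, 'n) chart \<Rightarrow> (real^'n) set" where
  "overlap c d \<equiv> coord c ` (dom_of c \<inter> dom_of d)"

definition jac :: "('a, 'n) chart \<Rightarrow> ('a, 'n) chart \<Rightarrow> real^'n \<Rightarrow> real^'n^'n" where
  "jac c d x = matrix (frechet_derivative (trans_map c d) (at x))"

lemma coord_image: assumes "c \<in> A" "B \<subseteq> dom_of c" shows "coord c ` B = img c \<inter> param c -` B"
  using assms param_coord[OF assms(1)] coord_param[OF assms(1)] by (force simp: image_iff)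

lemma open_coord_image: assumes "c \<in> A" "open B" "B \<subseteq> dom_of c" shows "open (coord c ` B)"
  unfolding coord_image[OF assms(1,3)]
  using continuous_on_param[OF assms(1)] open_img[OF assms(1)] assms(2) by (rule continuous_open_preimage)

lemma open_overlap: "c \<in> A \<Longrightarrow> d \<in> A \<Longrightarrow> open (overlap c d)"
  by (intro open_coord_image open_Int open_dom) auto

lemma trans_Ck: "c \<in> A \<Longrightarrow> d \<in> A \<Longrightarrow> Ck k (overlap c d) (trans_map c d)"
  using riemannian_manifold by (auto simp: riemannian_manifold_def smooth_manifold_def smooth_on_iff trans_map_def)

lemma trans_differentiable:
  assumes "c \<in> A" "d \<in> A" "x \<in> overlap c d" shows "trans_map c d differentiable at x"
  by (rule Ck_differentiable[OF open_overlap[OF assms(1,2)] trans_Ck[OF assms(1,2)] assms(3)])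

lemma param_trans: "c \<in> A \<Longrightarrow> d \<in> A \<Longrightarrow> x \<in> overlap c d \<Longrightarrow> param d (trans_map c d x) = param c x"
  by (auto simp: trans_map_def param_coord)

lemma overlap_param: "c \<in> A \<Longrightarrow> x \<in> overlap c d \<Longrightarrow> x \<in> img c \<and> param c x \<in> dom_of c \<and> param c x \<in> dom_of d"
  by (auto simp: param_coord)

lemma G_trans:
  assumes "c \<in> A" "d \<in> A" "p \<in> dom_of c" "p \<in> dom_of d"
  shows "G c p = transpose (jac c d (coord c p)) ** G d p ** jac c d (coord c p)"
proof -
  have "\<forall>c\<in>A. \<forall>d\<in>A. \<forall>p\<in>dom_of c \<inter> dom_of d.
        let J = matrix (frechet_derivative (coord d \<circ> param c) (at (coord c p)))
        in G c p = transpose J ** G d p ** J"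
    using riemannian_manifold unfolding riemannian_manifold_def riemannian_metric_def by (elim conjE)
  from this[THEN bspec, OF assms(1), THEN bspec, OF assms(2), THEN bspec, OF IntI[OF assms(3,4)]]
  show ?thesis unfolding Let_def jac_def trans_map_def .
qed

lemma rho_trans:
  assumes "c \<in> A" "d \<in> A" "x \<in> overlap c d"
  shows "rho c x = \<bar>det (jac c d x)\<bar> * rho d (trans_map c d x)"
proof -
  note o = overlap_param[OF assms(1,3)]
  have "det (G c (param c x)) = (det (jac c d x))\<^sup>2 * det (G d (param c x))"
    using G_trans[OF assms(1,2), of "param c x"] o coord_param[OF assms(1), of x]
    by (simp add: det_mul det_transpose power2_eq_square)
  then show ?thesis unfolding rho_def param_trans[OF assms] by (simp add: real_sqrt_mult)
qed

lemma jac_nth: "jac c d x $ i $ j = partial j (trans_map c d) x $ i"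
  by (simp add: jac_def matrix_def partial_def)

lemma continuous_on_det_jac:
  assumes "c \<in> A" "d \<in> A" shows "continuous_on (overlap c d) (\<lambda>x. det (jac c d x))"
proof -
  have "continuous_on (overlap c d) (partial j (trans_map c d))" for j
    using trans_Ck[OF assms, of "Suc 0"] by simp
  then show ?thesis unfolding det_def jac_nth
    by (intro continuous_on_sum continuous_on_mult continuous_on_const continuous_on_prod continuous_on_component)
qed

lemma coord_image_borel:
  assumes "c \<in> A" "B \<in> sets borel" "B \<subseteq> dom_of c" shows "coord c ` B \<in> sets borel"
proof -
  have "param c \<in> borel_measurable (restrict_space borel (img c))"
    by (rule borel_measurable_continuous_on_restrict[OF continuous_on_param[OF assms(1)]])
  from measurable_sets[OF this assms(2)]
  have "param c -` B \<inter> img c \<in> sets (restrict_space borel (img c))" by (simp add: space_restrict_space)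
  then have "param c -` B \<inter> img c \<in> sets borel"
    using open_img[OF assms(1)] by (subst (asm) sets_restrict_space_iff) auto
  then show ?thesis unfolding coord_image[OF assms(1,3)] by (simp add: Int_commute)
qed

text \<open>A Borel measure on the whole manifold, concentrated on the domain of \<open>c\<close>.
  The measures of different charts can then be compared and added.\<close>

definition chart_measure :: "('a, 'n) chart \<Rightarrow> 'a measure" where
  "chart_measure c = distr (density (restrict_space lborel (img c)) (\<lambda>x. ennreal (rho c x))) borel (param c)"

lemma param_measurable [measurable]:
  assumes "c \<in> A" shows "param c \<in> measurable (restrict_space lborel (img c)) borel"
proof -
  have "param c \<in> borel_measurable (restrict_space borel (img c))"
    by (rule borel_measurable_continuous_on_restrict[OF continuous_on_param[OF assms]])
  moreover have "sets (restrict_space lborel (img c)) = sets (restrict_space borel (img c))"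
    by (simp add: sets_restrict_space)
  ultimately show ?thesis by (simp cong: measurable_cong_sets)
qed

lemma rho_measurable [measurable]:
  assumes "c \<in> A" shows "rho c \<in> measurable (restrict_space lborel (img c)) borel"
proof -
  have "rho c \<in> borel_measurable (restrict_space borel (img c))"
    by (rule borel_measurable_continuous_on_restrict[OF continuous_on_rho[OF assms]])
  moreover have "sets (restrict_space lborel (img c)) = sets (restrict_space borel (img c))"
    by (simp add: sets_restrict_space)
  ultimately show ?thesis by (simp cong: measurable_cong_sets)
qed

lemma img_sets [measurable]: "c \<in> A \<Longrightarrow> img c \<in> sets borel" "c \<in> A \<Longrightarrow> dom_of c \<in> sets borel"
  using open_img open_dom by auto

lemma emeasure_chart_measure:
  assumes c: "c \<in> A" and B: "B \<in> sets borel"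
  shows "emeasure (chart_measure c) B = (\<integral>\<^sup>+x\<in>coord c ` (B \<inter> dom_of c). ennreal (rho c x) \<partial>lborel)"
proof -
  note [measurable] = param_measurable[OF c] rho_measurable[OF c] B
  have pB: "param c -` B \<inter> img c \<in> sets (restrict_space lborel (img c))"
    using measurable_sets[OF param_measurable[OF c] B] by (simp add: space_restrict_space)
  have "emeasure (chart_measure c) B = emeasure (density (restrict_space lborel (img c)) (\<lambda>x. ennreal (rho c x))) (param c -` B \<inter> img c)"
    unfolding chart_measure_def by (subst emeasure_distr) (auto simp: space_restrict_space)
  also have "\<dots> = (\<integral>\<^sup>+x. ennreal (rho c x) * indicator (param c -` B \<inter> img c) x \<partial>restrict_space lborel (img c))"
    by (rule emeasure_density[OF _ pB]) measurable
  also have "\<dots> = (\<integral>\<^sup>+x. ennreal (rho c x) * indicator (param c -` B \<inter> img c) x * indicator (img c) x \<partial>lborel)"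
    by (rule nn_integral_restrict_space) (use c in auto)
  also have "\<dots> = (\<integral>\<^sup>+x\<in>coord c ` (B \<inter> dom_of c). ennreal (rho c x) \<partial>lborel)"
  proof (rule nn_integral_cong)
    fix x
    have "x \<in> coord c ` (B \<inter> dom_of c) \<longleftrightarrow> x \<in> param c -` B \<inter> img c"
      using coord_image[OF c, of "B \<inter> dom_of c"] param_in_dom[OF c] by auto
    then show "ennreal (rho c x) * indicator (param c -` B \<inter> img c) x * indicator (img c) x =
        ennreal (rho c x) * indicator (coord c ` (B \<inter> dom_of c)) x" by (auto simp: indicator_def)
  qed
  finally show ?thesis .
qed

text \<open>The transition map carries the measure with density \<open>|det J|\<close> to Lebesgue
  measure on the other side of the overlap, and by \<open>rho_trans\<close> the factor
  \<open>|det J|\<close> is the quotient of the two volume densities.\<close>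

lemma nn_integral_trans:
  assumes c: "c \<in> A" and d: "d \<in> A" and B: "B \<in> sets borel" "B \<subseteq> dom_of c" "B \<subseteq> dom_of d"
  shows "(\<integral>\<^sup>+x\<in>coord c ` B. ennreal (rho c x) \<partial>lborel) = (\<integral>\<^sup>+x\<in>coord d ` B. ennreal (rho d x) \<partial>lborel)"
proof -
  let ?V = "overlap c d" and ?t = "trans_map c d"
  have V: "open ?V" and W: "open (overlap d c)" by (intro open_overlap c d)+
  \<comment> \<open>A Borel map on the whole space; its value outside of the overlap is immaterial
    because the density vanishes there.\<close>
  define t0 where "t0 x = (if x \<in> ?V then ?t x else 0)" for x
  have ct: "continuous_on ?V ?t" by (rule Ck_imp_continuous_on[OF trans_Ck[OF c d]])
  have "(\<lambda>x. indicator ?V x *\<^sub>R ?t x) \<in> borel_measurable borel"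
    using V ct by (intro borel_measurable_continuous_on_indicator) auto
  moreover have "(\<lambda>x. indicator ?V x *\<^sub>R ?t x) = t0" by (auto simp: t0_def fun_eq_iff)
  ultimately have [measurable]: "t0 \<in> borel_measurable borel" by simp
  have [measurable]: "?V \<in> sets borel" "overlap d c \<in> sets borel" using V W by auto
  have [measurable]: "(\<lambda>x. indicator ?V x * \<bar>det (jac c d x)\<bar>) \<in> borel_measurable borel"
    using borel_measurable_continuous_on_indicator[of ?V "\<lambda>x. \<bar>det (jac c d x)\<bar>"] continuous_on_det_jac[OF c d]
    by (simp add: continuous_on_rabs)
  let ?N = "distr (density lborel (\<lambda>x. ennreal (indicator ?V x * \<bar>det (jac c d x)\<bar>))) borel t0"
  have tV: "?t ` ?V = overlap d c" unfolding trans_map_def by (force simp: param_coord[OF c])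
  have injt: "inj_on ?t ?V"
  proof (rule inj_onI)
    fix x y assume xy: "x \<in> ?V" "y \<in> ?V" "?t x = ?t y"
    have "param c x = param c y"
      using arg_cong[OF xy(3), of "param d"] by (simp only: param_trans[OF c d xy(1)] param_trans[OF c d xy(2)])
    from arg_cong[OF this, of "coord c"] show "x = y"
      using overlap_param[OF c xy(1)] overlap_param[OF c xy(2)] by (simp add: coord_param[OF c])
  qed
  have N: "density lborel (indicator (overlap d c)) = ?N"
  proof (rule measure_eqI)
    fix E :: "(real^'n) set" assume "E \<in> sets (density lborel (indicator (overlap d c)))"
    then have [measurable]: "E \<in> sets borel" by simp
    let ?S = "?V \<inter> t0 -` E"
    have S: "?S \<in> sets borel" using measurable_sets[of t0 borel borel E] by auto
    have im: "f ` (V \<inter> g -` E) = f ` V \<inter> E" if "\<And>x. x \<in> V \<Longrightarrow> g x = f x" for f g :: "real^'n \<Rightarrow> real^'n" and V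
      using that by auto
    have tS: "?t ` ?S = overlap d c \<inter> E"
      using im[of ?V t0 ?t] by (simp only: tV t0_def if_True)
    have ind: "ennreal (indicator V x * r) * indicator W x = ennreal (indicator (V \<inter> W) x * r)"
      for V W :: "(real^'n) set" and x r by (simp add: indicator_def)
    have "emeasure ?N E = (\<integral>\<^sup>+x. ennreal (indicator ?V x * \<bar>det (jac c d x)\<bar>) * indicator (t0 -` E) x \<partial>lborel)"
      using measurable_sets_borel[of t0 borel E] by (simp add: emeasure_distr emeasure_density)
    also have "\<dots> = (\<integral>\<^sup>+x. ennreal (indicator ?S x * \<bar>det (jac c d x)\<bar>) \<partial>lborel)"
      by (simp only: ind)
    also have "\<dots> = emeasure lborel (?t ` ?S)"
      unfolding jac_def
    proof (rule emeasure_differentiable_image[symmetric, OF S])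
      show "?t ` ?S \<in> sets borel" unfolding tS by measurable
      show "(?t has_derivative frechet_derivative ?t (at x)) (at x within ?S)" if "x \<in> ?S" for x
        by (rule has_derivative_at_withinI[OF differentiable_imp_has_frechet[OF trans_differentiable[OF c d IntD1[OF that]]]])
      show "inj_on ?t ?S" by (rule inj_on_subset[OF injt Int_lower1])
      have "(\<lambda>x. indicator ?S x * (indicator ?V x * \<bar>det (jac c d x)\<bar>)) \<in> borel_measurable borel"
        using S by measurable
      moreover have "(\<lambda>x. indicator ?S x * (indicator ?V x * \<bar>det (jac c d x)\<bar>)) = (\<lambda>x. indicator ?S x * \<bar>det (jac c d x)\<bar>)"
        by (simp only: mult.assoc[symmetric] indicator_inter_arith[symmetric] Int_left_absorb Int_assoc Int_commute[of _ ?V])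
      ultimately show "(\<lambda>x. indicator ?S x * \<bar>det (matrix (frechet_derivative ?t (at x)))\<bar>) \<in> borel_measurable borel"
        by (simp only: jac_def)
    qed
    also have "\<dots> = emeasure (density lborel (indicator (overlap d c))) E"
      unfolding tS by (subst emeasure_density) (auto simp: indicator_inter_arith[symmetric])
    finally show "emeasure (density lborel (indicator (overlap d c))) E = emeasure ?N E" by simp
  qed simp
  have dB: "coord d ` B \<in> sets borel" by (intro coord_image_borel d B)
  let ?f = "\<lambda>y. ennreal (indicator (coord d ` B) y * rho d y)"
  have fm [measurable]: "?f \<in> borel_measurable borel"
    using borel_measurable_continuous_on_indicator[OF dB continuous_on_subset[OF continuous_on_rho[OF d] image_mono[OF B(3)]]] by simp
  have "(\<integral>\<^sup>+x\<in>coord d ` B. ennreal (rho d x) \<partial>lborel) = (\<integral>\<^sup>+y. indicator (overlap d c) y * ?f y \<partial>lborel)"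
    by (intro nn_integral_cong) (use B in \<open>auto simp: indicator_def\<close>)
  also have "\<dots> = (\<integral>\<^sup>+y. ?f y \<partial>density lborel (indicator (overlap d c)))"
    by (rule nn_integral_density[symmetric]) auto
  also have "\<dots> = (\<integral>\<^sup>+x. ?f (t0 x) \<partial>density lborel (\<lambda>x. ennreal (indicator ?V x * \<bar>det (jac c d x)\<bar>)))"
    unfolding N by (rule nn_integral_distr) auto
  also have "\<dots> = (\<integral>\<^sup>+x. ennreal (indicator ?V x * \<bar>det (jac c d x)\<bar>) * ?f (t0 x) \<partial>lborel)"
    by (rule nn_integral_density) auto
  also have "\<dots> = (\<integral>\<^sup>+x\<in>coord c ` B. ennreal (rho c x) \<partial>lborel)"
  proof (rule nn_integral_cong)
    fix x
    show "ennreal (indicator ?V x * \<bar>det (jac c d x)\<bar>) * ?f (t0 x) = ennreal (rho c x) * indicator (coord c ` B) x"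
    proof (cases "x \<in> ?V")
      case True
      have "?t x \<in> coord d ` B \<longleftrightarrow> param c x \<in> B"
        using coord_image[OF d B(3)] param_trans[OF c d True] overlap_param[OF c True] tV True by (auto simp: trans_map_def)
      moreover have "x \<in> coord c ` B \<longleftrightarrow> param c x \<in> B"
        using coord_image[OF c B(2)] overlap_param[OF c True] by auto
      ultimately show ?thesis
        using True rho_trans[OF c d True] by (auto simp: t0_def indicator_def ennreal_mult'[symmetric])
    next
      case False
      then have "x \<notin> coord c ` B" using B by auto
      then show ?thesis using False by simp
    qed
  qed
  finally show ?thesis by simp
qed

lemma sets_chart_measure [simp]: "sets (chart_measure c) = sets borel"
  by (simp add: chart_measure_def)

lemma chart_measure_eq:
  assumes "c \<in> A" "d \<in> A" "B \<in> sets borel" "B \<subseteq> dom_of c" "B \<subseteq> dom_of d"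
  shows "emeasure (chart_measure c) B = emeasure (chart_measure d) B"
proof -
  have "B \<inter> dom_of c = B" "B \<inter> dom_of d = B" using assms by auto
  then show ?thesis
    using nn_integral_trans[OF assms] assms(1-3) by (simp add: emeasure_chart_measure)
qed

definition is_volume :: "'a measure \<Rightarrow> bool" where
  "is_volume \<mu> \<longleftrightarrow> sets \<mu> = sets borel \<and>
     (\<forall>c\<in>A. \<forall>B\<in>sets borel. B \<subseteq> dom_of c \<longrightarrow> emeasure \<mu> B = emeasure (chart_measure c) B)"

lemma riemannian_volume_eq: "riemannian_volume A G = (THE \<mu>. is_volume \<mu>)"
proof -
  have "is_volume \<mu> \<longleftrightarrow> sets \<mu> = sets borel \<and>
     (\<forall>c\<in>A. \<forall>B\<in>sets borel. B \<subseteq> dom_of c \<longrightarrow>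
        emeasure \<mu> B = (\<integral>\<^sup>+x\<in>coord c ` B. ennreal (sqrt (det (G c (param c x)))) \<partial>lborel))" for \<mu>
  proof -
    have "emeasure (chart_measure c) B = (\<integral>\<^sup>+x\<in>coord c ` B. ennreal (sqrt (det (G c (param c x)))) \<partial>lborel)"
      if "c \<in> A" "B \<in> sets borel" "B \<subseteq> dom_of c" for c B
      using emeasure_chart_measure[OF that(1,2)] that(3) by (simp add: rho_def Int_absorb2)
    then show ?thesis unfolding is_volume_def by (intro conj_cong ball_cong imp_cong refl) simp
  qed
  then show ?thesis unfolding riemannian_volume_def by (simp only:)
qed

text \<open>The Lindelof property, from second countability: a measure can be glued from the charts
  by a series only if countably many of them suffice.\<close>

lemma chart_sequence:
  obtains c :: "nat \<Rightarrow> ('a, 'n) chart" where "\<And>i. c i \<in> A" "(\<Union>i. dom_of (c i)) = UNIV"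
proof -
  obtain F' where F': "F' \<subseteq> dom_of ` A" "countable F'" "\<Union>F' = \<Union>(dom_of ` A)"
  proof -
    have "open S" if "S \<in> dom_of ` A" for S using that by (rule imageE) (simp add: open_dom)
    then show thesis by (rule Lindelof[of "dom_of ` A", OF _ that])
  qed
  have un: "\<Union>F' = UNIV" using F'(3) chart_cover by auto
  then have "F' \<noteq> {}" by auto
  let ?D = "from_nat_into F'"
  have D: "?D i \<in> F'" for i by (rule from_nat_into[OF \<open>F' \<noteq> {}\<close>])
  have "\<forall>i. \<exists>c. c \<in> A \<and> dom_of c = ?D i" using D F'(1) by blast
  from choice[OF this] obtain c where c: "\<forall>i. c i \<in> A \<and> dom_of (c i) = ?D i" by (elim exE)
  have "(\<Union>i. dom_of (c i)) = (\<Union>i. ?D i)" using c by simp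
  also have "\<dots> = \<Union>F'" using range_from_nat_into[OF \<open>F' \<noteq> {}\<close> F'(2)] by simp
  finally show thesis using that[of c] c un by simp
qed

lemma emeasure_suminf_disjointed:
  fixes D :: "nat \<Rightarrow> 'b::topological_space set"
  assumes "sets \<mu> = sets borel" "B \<in> sets borel" "\<And>i. D i \<in> sets borel" "disjoint_family D" "(\<Union>i. D i) = UNIV"
  shows "emeasure \<mu> B = (\<Sum>i. emeasure \<mu> (B \<inter> D i))"
proof -
  have "emeasure \<mu> B = emeasure \<mu> (\<Union>i. B \<inter> D i)" using assms(5) by (simp add: Int_UN_distrib[symmetric])
  also have "\<dots> = (\<Sum>i. emeasure \<mu> (B \<inter> D i))"
  proof (intro suminf_emeasure[symmetric])
    show "disjoint_family (\<lambda>i. B \<inter> D i)" using assms(4) unfolding disjoint_family_on_def by blast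
  qed (use assms in auto)
  finally show ?thesis .
qed

text \<open>The volume is a definite description, so nothing can be said of it before unique
  existence is known. Countably many chart domains are made disjoint; splitting a Borel set along
  the pieces gives both a formula that defines a volume and the reason why there is no
  other.\<close>

lemma is_volume_ex1: "\<exists>!\<mu>. is_volume \<mu>"
proof -
  obtain c where c: "\<And>i::nat. c i \<in> A" "(\<Union>i. dom_of (c i)) = UNIV" by (rule chart_sequence, rule that)
  define E where "E = disjointed (\<lambda>i. dom_of (c i))"
  have E: "\<And>i. E i \<in> sets borel" "disjoint_family E" "(\<Union>i. E i) = UNIV" "\<And>i. E i \<subseteq> dom_of (c i)"
  proof -
    show "E i \<in> sets borel" for i unfolding E_def disjointed_def using img_sets(2)[OF c(1)] by auto
    show "disjoint_family E" "(\<Union>i. E i) = UNIV"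
      unfolding E_def using c(2) by (simp_all add: disjoint_family_disjointed UN_disjointed_eq)
    show "\<And>i. E i \<subseteq> dom_of (c i)" unfolding E_def by (rule disjointed_subset)
  qed
  define m where "m B = (\<Sum>i. emeasure (chart_measure (c i)) (B \<inter> E i))" for B
  define \<mu> where "\<mu> = measure_of UNIV (sets borel) m"
  have sets_\<mu>: "sets \<mu> = sets borel" 
    unfolding \<mu>_def using sets.sets_measure_of_eq[of "borel :: 'a measure" m] by simp
  have \<mu>m: "emeasure \<mu> B = m B" if B: "B \<in> sets borel" for B
  proof (rule emeasure_measure_of[OF \<mu>_def])
    show "positive (sets \<mu>) m" by (simp add: positive_def m_def)
    show "countably_additive (sets \<mu>) m"
      unfolding countably_additive_def
    proof (intro allI impI)
      fix F :: "nat \<Rightarrow> 'a set"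
      assume F: "range F \<subseteq> sets \<mu>" "disjoint_family F" "\<Union> (range F) \<in> sets \<mu>"
      \<comment> \<open>The inner series is written as an integral over the counting measure, so
        that the two summations can be exchanged.\<close>
      have "(\<Sum>n. m (F n)) = (\<Sum>n. \<integral>\<^sup>+i. emeasure (chart_measure (c i)) (F n \<inter> E i) \<partial>count_space UNIV)"
        by (simp add: m_def nn_integral_count_space_nat)
      also have "\<dots> = (\<integral>\<^sup>+i. (\<Sum>n. emeasure (chart_measure (c i)) (F n \<inter> E i)) \<partial>count_space UNIV)"
        by (rule nn_integral_suminf[symmetric]) simp
      also have "\<dots> = (\<integral>\<^sup>+i. emeasure (chart_measure (c i)) (\<Union>(range F) \<inter> E i) \<partial>count_space UNIV)"
      proof (rule nn_integral_cong)
        fix i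
        have "(\<Sum>n. emeasure (chart_measure (c i)) (F n \<inter> E i)) = emeasure (chart_measure (c i)) (\<Union>n. F n \<inter> E i)"
          using F E(1) by (intro suminf_emeasure) (auto simp: sets_\<mu> disjoint_family_on_def)
        also have "(\<Union>n. F n \<inter> E i) = \<Union>(range F) \<inter> E i" by auto
        finally show "(\<Sum>n. emeasure (chart_measure (c i)) (F n \<inter> E i)) = emeasure (chart_measure (c i)) (\<Union>(range F) \<inter> E i)" .
      qed
      also have "\<dots> = m (\<Union>(range F))" by (simp add: m_def nn_integral_count_space_nat)
      finally show "(\<Sum>n. m (F n)) = m (\<Union>(range F))" .
    qed
    show "B \<in> sets \<mu>" using B sets_\<mu> by simp
  qed simp
  have "is_volume \<mu>"
    unfolding is_volume_def
  proof (intro conjI ballI impI sets_\<mu>)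
    fix d B assume d: "d \<in> A" and B: "B \<in> sets borel" "B \<subseteq> dom_of d"
    have "emeasure \<mu> B = (\<Sum>i. emeasure (chart_measure (c i)) (B \<inter> E i))" by (simp add: \<mu>m[OF B(1)] m_def)
    also have "\<dots> = (\<Sum>i. emeasure (chart_measure d) (B \<inter> E i))"
      by (intro suminf_cong chart_measure_eq c d sets.Int B E) (use B E(4) in auto)
    also have "\<dots> = emeasure (chart_measure d) B"
      by (rule emeasure_suminf_disjointed[OF sets_chart_measure B(1) E(1-3), symmetric])
    finally show "emeasure \<mu> B = emeasure (chart_measure d) B" .
  qed
  moreover have "\<mu>' = \<mu>" if \<mu>': "is_volume \<mu>'" for \<mu>'
  proof (rule measure_eqI)
    have s: "sets \<mu>' = sets borel" using \<mu>' by (simp add: is_volume_def)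
    then show "sets \<mu>' = sets \<mu>" using sets_\<mu> by simp
    fix B assume "B \<in> sets \<mu>'"
    then have B: "B \<in> sets borel" using s by simp
    have "emeasure \<mu>' B = (\<Sum>i. emeasure \<mu>' (B \<inter> E i))"
      by (rule emeasure_suminf_disjointed[OF s B E(1-3)])
    also have "\<dots> = (\<Sum>i. emeasure (chart_measure (c i)) (B \<inter> E i))"
    proof (rule suminf_cong)
      fix i
      have "B \<inter> E i \<in> sets borel" "B \<inter> E i \<subseteq> dom_of (c i)" using B E(1,4)[of i] by auto
      then show "emeasure \<mu>' (B \<inter> E i) = emeasure (chart_measure (c i)) (B \<inter> E i)"
        using \<mu>' c(1)[of i] by (simp add: is_volume_def)
    qed
    also have "\<dots> = emeasure \<mu> B" by (simp add: \<mu>m[OF B] m_def)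
    finally show "emeasure \<mu>' B = emeasure \<mu> B" .
  qed
  ultimately show ?thesis by (rule ex1I)
qed

abbreviation vol :: "'a measure" where "vol \<equiv> riemannian_volume A G"

lemma is_volume_vol: "is_volume vol"
  unfolding riemannian_volume_eq by (rule theI'[OF is_volume_ex1])

lemma sets_vol [simp, measurable_cong]: "sets vol = sets borel"
  using is_volume_vol by (simp add: is_volume_def)

lemma space_vol [simp]: "space vol = UNIV"
  using sets_eq_imp_space_eq[OF sets_vol] by simp

lemma emeasure_vol: "c \<in> A \<Longrightarrow> B \<in> sets borel \<Longrightarrow> B \<subseteq> dom_of c \<Longrightarrow> emeasure vol B = emeasure (chart_measure c) B"
  using is_volume_vol by (simp add: is_volume_def)

lemma density_vol_chart:
  assumes c: "c \<in> A" shows "density vol (indicator (dom_of c)) = chart_measure c"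
proof (rule measure_eqI)
  fix B assume "B \<in> sets (density vol (indicator (dom_of c)))"
  then have B: "B \<in> sets borel" by simp
  note [measurable] = img_sets(2)[OF c]
  have Bd: "B \<inter> dom_of c \<in> sets borel" using B img_sets(2)[OF c] by simp
  have "emeasure (density vol (indicator (dom_of c))) B = (\<integral>\<^sup>+p. indicator (B \<inter> dom_of c) p \<partial>vol)"
    using B by (subst emeasure_density) (auto simp del: nn_integral_indicator intro!: nn_integral_cong split: split_indicator)
  also have "\<dots> = emeasure vol (B \<inter> dom_of c)" using Bd by simp
  also have "\<dots> = emeasure (chart_measure c) (B \<inter> dom_of c)" by (rule emeasure_vol[OF c Bd]) auto
  also have "\<dots> = emeasure (chart_measure c) B"
    using B Bd by (simp add: emeasure_chart_measure[OF c])
  finally show "emeasure (density vol (indicator (dom_of c))) B = emeasure (chart_measure c) B" .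
qed simp

lemma
  fixes h :: "'a \<Rightarrow> real"
  assumes c: "c \<in> A" and h [measurable]: "h \<in> borel_measurable borel" and supp: "\<And>p. p \<notin> dom_of c \<Longrightarrow> h p = 0"
  shows integrable_chart: "integrable vol h \<longleftrightarrow> integrable lborel (\<lambda>x. indicator (img c) x * (rho c x * h (param c x)))"
    and integral_chart: "(\<integral>p. h p \<partial>vol) = (\<integral>x. indicator (img c) x * (rho c x * h (param c x)) \<partial>lborel)"
proof -
  note [measurable] = img_sets[OF c] param_measurable[OF c] rho_measurable[OF c]
  have hd: "(\<lambda>p. indicator (dom_of c) p * h p) = h" using supp by (auto simp: indicator_def fun_eq_iff)
  have ind: "(\<lambda>p. ennreal (indicator (dom_of c) p)) = indicator (dom_of c)" by (auto simp: indicator_def)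
  have img_ne: "img c \<inter> space lborel \<in> sets lborel" using img_sets(1)[OF c] by simp
  have rho_ae: "AE x in restrict_space lborel (img c). 0 \<le> rho c x"
    by (rule AE_I2) (auto simp: space_restrict_space less_imp_le rho_pos[OF c])
  have "integrable vol h \<longleftrightarrow> integrable (density vol (\<lambda>p. ennreal (indicator (dom_of c) p))) h"
    by (subst integrable_density) (simp_all add: hd)
  also have "\<dots> \<longleftrightarrow> integrable (chart_measure c) h" unfolding ind density_vol_chart[OF c] ..
  also have "\<dots> \<longleftrightarrow> integrable (density (restrict_space lborel (img c)) (\<lambda>x. ennreal (rho c x))) (\<lambda>x. h (param c x))"
    unfolding chart_measure_def by (rule integrable_distr_eq) simp_all
  also have "\<dots> \<longleftrightarrow> integrable (restrict_space lborel (img c)) (\<lambda>x. rho c x *\<^sub>R h (param c x))"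
    by (rule integrable_density[OF _ _ rho_ae]) simp_all
  also have "\<dots> \<longleftrightarrow> integrable lborel (\<lambda>x. indicator (img c) x * (rho c x * h (param c x)))"
    using integrable_restrict_space[OF img_ne, of "\<lambda>x. rho c x *\<^sub>R h (param c x)"] by simp
  finally show "integrable vol h \<longleftrightarrow> integrable lborel (\<lambda>x. indicator (img c) x * (rho c x * h (param c x)))" .
  have "(\<integral>p. h p \<partial>vol) = (\<integral>p. h p \<partial>density vol (\<lambda>p. ennreal (indicator (dom_of c) p)))"
    by (subst integral_density) (simp_all add: hd)
  also have "\<dots> = (\<integral>p. h p \<partial>chart_measure c)" unfolding ind density_vol_chart[OF c] ..
  also have "\<dots> = (\<integral>x. h (param c x) \<partial>density (restrict_space lborel (img c)) (\<lambda>x. ennreal (rho c x)))"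
    unfolding chart_measure_def by (rule integral_distr) simp_all
  also have "\<dots> = (\<integral>x. rho c x *\<^sub>R h (param c x) \<partial>restrict_space lborel (img c))"
    by (rule integral_density[OF _ _ rho_ae]) simp_all
  also have "\<dots> = (\<integral>x. indicator (img c) x * (rho c x * h (param c x)) \<partial>lborel)"
    using integral_restrict_space[OF img_ne, of "\<lambda>x. rho c x *\<^sub>R h (param c x)"] by simp
  finally show "(\<integral>p. h p \<partial>vol) = (\<integral>x. indicator (img c) x * (rho c x * h (param c x)) \<partial>lborel)" .
qed

text \<open>The volume is locally finite: each point has a neighbourhood that a chart maps into a
  ball on whose closure the density is bounded.\<close>

lemma emeasure_vol_compact_finite:
  assumes "compact K" shows "emeasure vol K < \<infinity>"
proof -
  have "\<exists>N. open N \<and> p \<in> N \<and> emeasure vol N < \<infinity>" for p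
  proof -
    obtain c where c: "c \<in> A" "p \<in> dom_of c" using chart_cover by blast
    have "coord c p \<in> img c" using c by simp
    then obtain r where r: "r > 0" "cball (coord c p) r \<subseteq> img c"
      using open_img[OF c(1)] open_contains_cball by blast
    let ?B = "ball (coord c p) r"
    let ?N = "dom_of c \<inter> coord c -` ?B"
    have oN: "open ?N" by (intro continuous_open_preimage continuous_on_coord open_dom c open_ball)
    have "bounded (rho c ` cball (coord c p) r)"
      by (intro compact_imp_bounded compact_continuous_image continuous_on_subset[OF continuous_on_rho[OF c(1)] r(2)] compact_cball)
    then obtain C where "\<forall>y\<in>rho c ` cball (coord c p) r. norm y \<le> C" by (auto simp: bounded_iff)
    then have C: "norm (rho c x) \<le> C" if "x \<in> cball (coord c p) r" for x using that by blast
    have cN: "coord c ` (?N \<inter> dom_of c) \<subseteq> ?B" by auto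
    have "emeasure vol ?N = (\<integral>\<^sup>+x\<in>coord c ` (?N \<inter> dom_of c). ennreal (rho c x) \<partial>lborel)"
      using emeasure_vol[OF c(1) borel_open[OF oN]] emeasure_chart_measure[OF c(1) borel_open[OF oN]] by simp
    also have "\<dots> \<le> (\<integral>\<^sup>+x. ennreal C * indicator ?B x \<partial>lborel)"
    proof (rule nn_integral_mono)
      fix x
      show "ennreal (rho c x) * indicator (coord c ` (?N \<inter> dom_of c)) x \<le> ennreal C * indicator ?B x"
      proof (cases "x \<in> coord c ` (?N \<inter> dom_of c)")
        case True
        then have "x \<in> ?B" using cN by blast
        moreover have "rho c x \<le> C" using C[of x] \<open>x \<in> ?B\<close> by auto
        ultimately show ?thesis using True by (simp add: ennreal_leI)
      qed simp
    qed
    also have "\<dots> = ennreal C * emeasure lborel ?B" by (rule nn_integral_cmult_indicator) simp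
    also have "\<dots> < \<infinity>" using emeasure_lborel_ball_finite[of "coord c p" r] by (simp add: ennreal_mult_less_top)
    finally have "emeasure vol ?N < \<infinity>" .
    then show ?thesis using oN c(2) r(1) by (intro exI[of _ ?N]) auto
  qed
  then have "\<forall>p. \<exists>N. open N \<and> p \<in> N \<and> emeasure vol N < \<infinity>" by blast
  from choice[OF this] obtain N where N: "\<And>p. open (N p)" "\<And>p. p \<in> N p" "\<And>p. emeasure vol (N p) < \<infinity>" by blast
  obtain P where P: "P \<subseteq> K" "finite P" "K \<subseteq> (\<Union>p\<in>P. N p)"
    using compactE_image[OF assms, of K N] N by blast
  have "emeasure vol K \<le> emeasure vol (\<Union>p\<in>P. N p)"
    using P N by (intro emeasure_mono) auto
  also have "\<dots> \<le> (\<Sum>p\<in>P. emeasure vol (N p))"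
    using P(2) N(1) by (intro emeasure_subadditive_finite) auto
  also have "\<dots> < \<infinity>" using P(2) N(3) by simp
  finally show ?thesis .
qed

end

section \<open>The Laplacian in coordinates\<close>

lemma partial_vec_nth:
  fixes Y :: "real^'n::finite \<Rightarrow> real^'m::finite"
  assumes "Y differentiable at x"
  shows "partial i (\<lambda>x. Y x $ a) x = partial i Y x $ a"
  by (rule partial_bounded_linear[OF bounded_linear_vec_nth assms])

text \<open>Riemannian geometry on an open subset of Euclidean space. Every chart provides an
  instance, and the pointwise identities are proved here before any change of charts is
  considered.\<close>

locale coord_metric =
  fixes U :: "(real^'n::finite) set" and g :: "real^'n \<Rightarrow> real^'n^'n"
  assumes open_U: "open U" and g_Ck: "Ck k U (\<lambda>x. g x $ i $ j)"
    and g_sym: "x \<in> U \<Longrightarrow> transpose (g x) = g x"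
    and g_pos: "x \<in> U \<Longrightarrow> v \<noteq> 0 \<Longrightarrow> 0 < v \<bullet> (g x *v v)"
    and g_det: "x \<in> U \<Longrightarrow> 0 < det (g x)"
begin

definition r :: "real^'n \<Rightarrow> real" where "r x = sqrt (det (g x))"
definition gi :: "'n \<Rightarrow> 'n \<Rightarrow> real^'n \<Rightarrow> real" where "gi i j x = matrix_inv (g x) $ i $ j"
definition gp :: "(real^'n \<Rightarrow> real) \<Rightarrow> (real^'n \<Rightarrow> real) \<Rightarrow> real^'n \<Rightarrow> real" where
  "gp f h x = (\<Sum>i\<in>UNIV. \<Sum>j\<in>UNIV. gi i j x * partial i f x * partial j h x)"
text \<open>The volume density times a component of the gradient. With it \<open>r * lap f\<close>
  is an ordinary Euclidean divergence.\<close>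

definition Fl :: "(real^'n \<Rightarrow> real) \<Rightarrow> 'n \<Rightarrow> real^'n \<Rightarrow> real" where
  "Fl f i x = r x * (\<Sum>j\<in>UNIV. gi i j x * partial j f x)"
definition lap :: "(real^'n \<Rightarrow> real) \<Rightarrow> real^'n \<Rightarrow> real" where
  "lap f x = (\<Sum>i\<in>UNIV. partial i (Fl f i) x) / r x"

lemma r_pos: "x \<in> U \<Longrightarrow> 0 < r x" by (simp add: r_def g_det)

lemma r_Ck: "Ck k U r" unfolding r_def[abs_def] by (intro Ck_sqrt Ck_det g_Ck open_U g_det)

lemma gi_Ck: "Ck k U (gi i j)"
  unfolding gi_def[abs_def] by (rule Ck_matrix_inv[OF open_U g_Ck]) (use g_det in force)

lemma gi_sym: assumes "x \<in> U" shows "gi i j x = gi j i x"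
proof -
  have "transpose (matrix_inv (g x)) = matrix_inv (g x)"
    using g_det[OF assms] by (intro matrix_inv_symmetric g_sym assms) simp
  then have "transpose (matrix_inv (g x)) $ j $ i = matrix_inv (g x) $ j $ i" by simp
  then show ?thesis by (simp add: gi_def transpose_def)
qed

lemma Ck_partial: "Ck (Suc k) U f \<Longrightarrow> Ck k U (partial i f)" by simp

lemma Fl_Ck: "Ck (Suc k) U f \<Longrightarrow> Ck k U (Fl f i)"
  unfolding Fl_def[abs_def] by (intro Ck_mult Ck_sum r_Ck gi_Ck open_U Ck_partial)

lemma lap_Ck: assumes "Ck (Suc (Suc k)) U f" shows "Ck k U (lap f)"
  unfolding lap_def[abs_def]
  by (intro Ck_divide Ck_sum open_U r_Ck Ck_partial Fl_Ck assms) (use r_pos in force)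

lemma gp_Ck: "Ck (Suc k) U f \<Longrightarrow> Ck (Suc k) U h \<Longrightarrow> Ck k U (gp f h)"
  unfolding gp_def[abs_def] by (intro Ck_sum Ck_mult open_U gi_Ck Ck_partial)

lemma diff1: "Ck (Suc k) U f \<Longrightarrow> x \<in> U \<Longrightarrow> f differentiable at x"
  by (rule Ck_differentiable[OF open_U])

lemma diff_Fl: "Ck (Suc (Suc 0)) U f \<Longrightarrow> x \<in> U \<Longrightarrow> Fl f i differentiable at x"
  by (rule diff1[OF Fl_Ck])

lemma partial_cong_U: "(\<And>x. x \<in> U \<Longrightarrow> f x = h x) \<Longrightarrow> x \<in> U \<Longrightarrow> partial i f x = partial i h x"
  by (rule partial_cong[OF open_U])

lemma gp_sym: "x \<in> U \<Longrightarrow> gp f h x = gp h f x"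
  unfolding gp_def by (subst sum.swap) (simp add: gi_sym mult_ac)

lemma gp_mult:
  assumes "f1 differentiable at x" "f2 differentiable at x"
  shows "gp (\<lambda>x. f1 x * f2 x) h x = f1 x * gp f2 h x + f2 x * gp f1 h x"
  unfolding gp_def partial_mult[OF assms]
  by (simp add: sum.distrib[symmetric] sum_distrib_left algebra_simps)

lemma lap_add:
  assumes f: "Ck (Suc (Suc 0)) U f" and h: "Ck (Suc (Suc 0)) U h" and x: "x \<in> U"
  shows "lap (\<lambda>x. f x + h x) x = lap f x + lap h x"
proof -
  have "Fl (\<lambda>x. f x + h x) i y = Fl f i y + Fl h i y" if "y \<in> U" for i y
    using that diff1[OF f] diff1[OF h] by (simp add: Fl_def partial_add distrib_left sum.distrib)
  then have "partial i (Fl (\<lambda>x. f x + h x) i) x = partial i (\<lambda>x. Fl f i x + Fl h i x) x" for i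
    by (rule partial_cong_U[OF _ x])
  then show ?thesis
    by (simp add: lap_def partial_add[OF diff_Fl[OF f x] diff_Fl[OF h x]] sum.distrib add_divide_distrib)
qed

lemma partial_cmult:
  fixes f :: "real^'n \<Rightarrow> real"
  assumes "f differentiable at x" shows "partial i (\<lambda>x. a * f x) x = a * partial i f x"
  using partial_mult[of "\<lambda>_. a" x f i] assms by simp

lemma lap_scale:
  assumes f: "Ck (Suc (Suc 0)) U f" and x: "x \<in> U"
  shows "lap (\<lambda>x. a * f x) x = a * lap f x"
proof -
  have "Fl (\<lambda>x. a * f x) i y = a * Fl f i y" if "y \<in> U" for i y
    using that diff1[OF f] by (simp add: Fl_def partial_cmult sum_distrib_left mult_ac)
  then have "partial i (Fl (\<lambda>x. a * f x) i) x = partial i (\<lambda>x. a * Fl f i x) x" for i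
    by (rule partial_cong_U[OF _ x])
  then show ?thesis
    by (simp add: lap_def partial_cmult[OF diff_Fl[OF f x]] sum_distrib_left)
qed

lemma gp_Fl: "x \<in> U \<Longrightarrow> r x * gp f h x = (\<Sum>i\<in>UNIV. partial i f x * Fl h i x)"
  unfolding gp_def Fl_def by (simp add: sum_distrib_left mult_ac)

lemma lap_mult:
  assumes f: "Ck (Suc (Suc 0)) U f" and h: "Ck (Suc (Suc 0)) U h" and x: "x \<in> U"
  shows "lap (\<lambda>x. f x * h x) x = f x * lap h x + h x * lap f x + 2 * gp f h x"
proof -
  note fd = diff1[OF f x] and hd = diff1[OF h x]
  have "Fl (\<lambda>x. f x * h x) i y = f y * Fl h i y + h y * Fl f i y" if "y \<in> U" for i y
    using diff1[OF f that] diff1[OF h that]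
    by (simp add: Fl_def partial_mult distrib_left sum.distrib sum_distrib_left mult_ac)
  then have "partial i (Fl (\<lambda>x. f x * h x) i) x = partial i (\<lambda>x. f x * Fl h i x + h x * Fl f i x) x" for i
    by (rule partial_cong_U[OF _ x])
  also have "\<dots> i = (f x * partial i (Fl h i) x + partial i f x * Fl h i x) + (h x * partial i (Fl f i) x + partial i h x * Fl f i x)" for i
    using fd hd diff_Fl[OF f x] diff_Fl[OF h x]
    by (subst partial_add) (simp_all add: partial_mult differentiable_mult)
  finally have "(\<Sum>i\<in>UNIV. partial i (Fl (\<lambda>x. f x * h x) i) x) =
      f x * (\<Sum>i\<in>UNIV. partial i (Fl h i) x) + h x * (\<Sum>i\<in>UNIV. partial i (Fl f i) x) + r x * gp f h x + r x * gp h f x"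
    by (simp add: gp_Fl[OF x] sum.distrib sum_distrib_left)
  then show ?thesis using r_pos[OF x] by (simp add: lap_def gp_sym[OF x, of h f] add_divide_distrib)
qed

text \<open>The density \<open>r\<close> cancels the denominator of \<open>lap\<close>, and what
  remains is Euclidean integration by parts for each component of the flux
  \<open>Fl h\<close>.\<close>

lemma green:
  assumes K: "compact K" "K \<subseteq> U" and f: "Ck (Suc 0) U f" "\<And>x. x \<in> U - K \<Longrightarrow> f x = 0" and h: "Ck (Suc (Suc 0)) U h"
  shows "integrable lborel (\<lambda>x. indicator U x * (r x * (f x * lap h x)))"
    "integrable lborel (\<lambda>x. indicator U x * (r x * gp f h x))"
    "(\<integral>x. indicator U x * (r x * (f x * lap h x)) \<partial>lborel) = - (\<integral>x. indicator U x * (r x * gp f h x) \<partial>lborel)"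
proof -
  note ibp = integration_by_parts_compact_support[OF open_U K f Fl_Ck[OF h]]
  have 1: "indicator U x * (r x * (f x * lap h x)) = (\<Sum>i\<in>UNIV. indicator U x * (f x * partial i (Fl h i) x))" for x
    using r_pos[of x] by (cases "x \<in> U") (simp_all add: lap_def sum_distrib_left[symmetric])
  have 2: "indicator U x * (r x * gp f h x) = (\<Sum>i\<in>UNIV. indicator U x * (partial i f x * Fl h i x))" for x
    by (cases "x \<in> U") (simp_all add: gp_Fl)
  show "integrable lborel (\<lambda>x. indicator U x * (r x * (f x * lap h x)))" unfolding 1 by (intro Bochner_Integration.integrable_sum ibp)
  show "integrable lborel (\<lambda>x. indicator U x * (r x * gp f h x))" unfolding 2 by (intro Bochner_Integration.integrable_sum ibp)
  show "(\<integral>x. indicator U x * (r x * (f x * lap h x)) \<partial>lborel) = - (\<integral>x. indicator U x * (r x * gp f h x) \<partial>lborel)"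
  proof -
    have "(\<integral>x. (\<Sum>i\<in>UNIV. indicator U x * (f x * partial i (Fl h i) x)) \<partial>lborel) =
        (\<Sum>i\<in>UNIV. \<integral>x. indicator U x * (f x * partial i (Fl h i) x) \<partial>lborel)"
      by (rule Bochner_Integration.integral_sum) (rule ibp(1))
    also have "\<dots> = (\<Sum>i\<in>UNIV. - (\<integral>x. indicator U x * (partial i f x * Fl h i x) \<partial>lborel))"
      by (rule sum.cong[OF refl]) (rule ibp(3))
    also have "\<dots> = - (\<integral>x. (\<Sum>i\<in>UNIV. indicator U x * (partial i f x * Fl h i x)) \<partial>lborel)"
      unfolding sum_negf by (rule arg_cong[of _ _ uminus], rule Bochner_Integration.integral_sum[symmetric]) (rule ibp(2))
    finally show ?thesis unfolding 1 2 .
  qed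
qed

lemma gp_vec: "gp f h x = (\<chi> i. partial i f x) \<bullet> (matrix_inv (g x) *v (\<chi> j. partial j h x))"
  by (simp add: gp_def gi_def inner_vec_def matrix_vector_mult_def sum_distrib_left mult_ac)

text \<open>Let \<open>v\<close> be the Euclidean and \<open>w\<close> the Riemannian gradient of
  \<open>f\<close>, so that \<open>g x *v w = v\<close>. Cauchy-Schwarz for the metric, applied to
  \<open>v\<close> and \<open>w\<close>, bounds \<open>(v \<bullet> v)^2\<close> by
  \<open>v \<bullet> (g x *v v)\<close>, which is at most \<open>B * (v \<bullet> v)\<close>, times
  \<open>gp f f x\<close>. The bound \<open>B\<close> on the entries of the metric over
  \<open>K\<close> does not involve \<open>f\<close>.\<close>

lemma grad2_le_gp:
  assumes K: "compact K" "K \<subseteq> U"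
  obtains C where "0 < C" "\<And>f x. x \<in> K \<Longrightarrow> grad2 f x \<le> C * gp f f x"
proof -
  have cg: "continuous_on K (\<lambda>x. g x $ i $ j)" for i j
    by (rule continuous_on_subset[OF Ck_imp_continuous_on[OF g_Ck[of 0]] K(2)])
  have "continuous_on K (\<lambda>x. \<Sum>i\<in>UNIV. \<Sum>j\<in>UNIV. \<bar>g x $ i $ j\<bar>)" by (intro continuous_intros cg)
  then have "bounded ((\<lambda>x. \<Sum>i\<in>UNIV. \<Sum>j\<in>UNIV. \<bar>g x $ i $ j\<bar>) ` K)"
    using K(1) by (intro compact_imp_bounded compact_continuous_image)
  then obtain B where "\<forall>y\<in>(\<lambda>x. \<Sum>i\<in>UNIV. \<Sum>j\<in>UNIV. \<bar>g x $ i $ j\<bar>) ` K. norm y \<le> B" by (auto simp: bounded_iff)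
  then have B: "(\<Sum>i\<in>UNIV. \<Sum>j\<in>UNIV. \<bar>g x $ i $ j\<bar>) \<le> B" if "x \<in> K" for x using that by fastforce
  define C where "C = \<bar>B\<bar> + 1"
  have "grad2 f x \<le> C * gp f f x" if x: "x \<in> K" for f x
  proof -
    have xU: "x \<in> U" using K(2) x by auto
    have nz: "det (g x) \<noteq> 0" using g_det[OF xU] by simp
    define v where "v = (\<chi> i. partial i f x)"
    define w where "w = matrix_inv (g x) *v v"
    have gw: "g x *v w = v" unfolding w_def by (simp add: matrix_vector_mul_assoc matrix_inv_works(1)[OF nz])
    have gpvw: "gp f f x = v \<bullet> w" by (simp add: gp_vec v_def w_def)
    have vv: "grad2 f x = v \<bullet> v" by (simp add: grad2_def v_def inner_vec_def power2_eq_square)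
    have sym: "a \<bullet> (g x *v b) = b \<bullet> (g x *v a)" for a b
      using dot_lmul_matrix[of a "g x" b] g_sym[OF xU] by (metis inner_commute transpose_matrix_vector)
    have psd: "0 \<le> a \<bullet> (g x *v a)" for a using g_pos[OF xU, of a] by (cases "a = 0") auto
    have cs: "(v \<bullet> (g x *v w))\<^sup>2 \<le> (v \<bullet> (g x *v v)) * (w \<bullet> (g x *v w))"
    proof (rule quadratic_nonneg_discriminant)
      fix t
      have "(v + t *\<^sub>R w) \<bullet> (g x *v (v + t *\<^sub>R w)) = v \<bullet> (g x *v v) + 2 * t * (v \<bullet> (g x *v w)) + t\<^sup>2 * (w \<bullet> (g x *v w))"
        using sym[of v w]
        by (simp add: matrix_vector_right_distrib matrix_vector_mult_scaleR inner_add_left inner_add_right power2_eq_square algebra_simps)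
      then show "0 \<le> v \<bullet> (g x *v v) + 2 * t * (v \<bullet> (g x *v w)) + t\<^sup>2 * (w \<bullet> (g x *v w))" using psd by metis
    qed (rule psd)
    have vgv: "v \<bullet> (g x *v v) \<le> B * (v \<bullet> v)"
    proof -
      have "v \<bullet> (g x *v v) = (\<Sum>i\<in>UNIV. \<Sum>j\<in>UNIV. g x $ i $ j * (v $ i * v $ j))"
        by (simp add: inner_vec_def matrix_vector_mult_def sum_distrib_left mult_ac)
      also have "\<dots> \<le> (\<Sum>i\<in>UNIV. \<Sum>j\<in>UNIV. \<bar>g x $ i $ j\<bar> * (v \<bullet> v))"
      proof (intro sum_mono)
        fix i j
        have "\<bar>v $ i\<bar> \<le> norm v" "\<bar>v $ j\<bar> \<le> norm v" by (rule component_le_norm_cart)+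
        then have "\<bar>v $ i * v $ j\<bar> \<le> v \<bullet> v"
          unfolding abs_mult by (metis mult_mono' abs_ge_zero power2_eq_square power2_norm_eq_inner)
        then have "\<bar>g x $ i $ j * (v $ i * v $ j)\<bar> \<le> \<bar>g x $ i $ j\<bar> * (v \<bullet> v)"
          unfolding abs_mult[of "g x $ i $ j"] by (intro mult_left_mono) auto
        then show "g x $ i $ j * (v $ i * v $ j) \<le> \<bar>g x $ i $ j\<bar> * (v \<bullet> v)" by linarith
      qed
      also have "\<dots> = (\<Sum>i\<in>UNIV. \<Sum>j\<in>UNIV. \<bar>g x $ i $ j\<bar>) * (v \<bullet> v)" by (simp add: sum_distrib_right)
      also have "\<dots> \<le> B * (v \<bullet> v)" using B[OF x] by (intro mult_right_mono) auto
      finally show ?thesis .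
    qed
    have gp0: "0 \<le> v \<bullet> w" using psd[of w] unfolding gw by (simp add: inner_commute)
    have "(v \<bullet> v)\<^sup>2 \<le> (v \<bullet> (g x *v v)) * (v \<bullet> w)" using cs unfolding gw by (simp add: inner_commute)
    also have "\<dots> \<le> (C * (v \<bullet> v)) * (v \<bullet> w)"
      using vgv by (intro mult_right_mono gp0 order_trans[OF vgv]) (auto simp: C_def intro: mult_right_mono)
    finally have "(v \<bullet> v) * (v \<bullet> v) \<le> (v \<bullet> v) * (C * (v \<bullet> w))" by (simp add: power2_eq_square mult_ac)
    then have "v \<bullet> v \<le> C * (v \<bullet> w)"
    proof (cases "v = 0")
      case False
      then have "v \<bullet> v > 0" by simp
      then show ?thesis using \<open>(v \<bullet> v) * (v \<bullet> v) \<le> (v \<bullet> v) * (C * (v \<bullet> w))\<close> by (simp only: mult_le_cancel_left_pos)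
    qed (simp add: gp0 C_def)
    then show ?thesis unfolding vv gpvw .
  qed
  moreover have "0 < C" by (simp add: C_def)
  ultimately show thesis using that by blast
qed

lemma gp_nonneg: assumes "x \<in> U" shows "0 \<le> gp f f x"
proof -
  obtain C where C: "0 < C" "\<And>f y. y \<in> {x} \<Longrightarrow> grad2 f y \<le> C * gp f f y"
    using grad2_le_gp[of "{x}"] assms by auto
  have "0 \<le> C * gp f f x" using order_trans[OF grad2_nonneg C(2)] by simp
  then show ?thesis using C(1) by (simp add: zero_le_mult_iff)
qed

end

text \<open>The closest point can be moved within the subspace by \<open>s\<close> and by
  \<open>- s\<close>; the variational inequality holds in both directions and so becomes an
  equation.\<close>

lemma subspace_orthogonal_projection:
  fixes S :: "'a::euclidean_space set"
  assumes S: "subspace S" and s: "s \<in> S"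
  shows "(w - closest_point S w) \<bullet> s = 0" "closest_point S w \<in> S"
proof -
  have cl: "closed S" "convex S" "S \<noteq> {}"
    using subspace_0[OF S] by (auto simp: closed_subspace subspace_imp_convex S)
  show cp: "closest_point S w \<in> S" by (rule closest_point_in_set[OF cl(1,3)])
  have "(w - closest_point S w) \<bullet> ((closest_point S w + s) - closest_point S w) \<le> 0"
    by (rule closest_point_dot[OF cl(2,1)]) (intro subspace_add S cp s)
  moreover have "(w - closest_point S w) \<bullet> ((closest_point S w - s) - closest_point S w) \<le> 0"
    by (rule closest_point_dot[OF cl(2,1)]) (intro subspace_diff S cp s)
  ultimately show "(w - closest_point S w) \<bullet> s = 0" by simp
qed

section \<open>Coordinate functions of an isometric immersion\<close>

locale coord_immersion = coord_metric U g for U :: "(real^'n::finite) set" and g +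
  fixes Y :: "real^'n \<Rightarrow> real^'m::finite"
  assumes Y_Ck: "Ck k U Y" and g_Y: "x \<in> U \<Longrightarrow> g x $ i $ j = partial i Y x \<bullet> partial j Y x"
begin

abbreviation Yc :: "'m \<Rightarrow> real^'n \<Rightarrow> real" where "Yc a x \<equiv> Y x $ a"

lemma Yc_Ck: "Ck k U (Yc a)"
  by (rule Ck_bounded_linear[OF bounded_linear_vec_nth open_U Y_Ck])

lemma Y_diff: "x \<in> U \<Longrightarrow> Y differentiable at x"
  by (rule diff1[OF Y_Ck])

lemma partial_Yc: "x \<in> U \<Longrightarrow> partial i (Yc a) x = partial i Y x $ a"
  by (rule partial_vec_nth[OF Y_diff])

lemma partial2_Yc: assumes x: "x \<in> U" shows "partial i (partial j (Yc a)) x = partial i (partial j Y) x $ a"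
proof -
  have "partial i (partial j (Yc a)) x = partial i (\<lambda>x. partial j Y x $ a) x"
    by (rule partial_cong_U[OF partial_Yc x])
  also have "\<dots> = partial i (partial j Y) x $ a"
    by (rule partial_vec_nth[OF diff1[OF Ck_partial[OF Y_Ck[of "Suc (Suc 0)"]] x]])
  finally show ?thesis .
qed

lemma g_Yc: "x \<in> U \<Longrightarrow> g x $ i $ j = (\<Sum>a\<in>UNIV. partial i (Yc a) x * partial j (Yc a) x)"
  by (simp add: g_Y inner_vec_def partial_Yc)

lemma gi_g: assumes "x \<in> U" shows "(\<Sum>j\<in>UNIV. gi i j x * g x $ j $ k) = (if i = k then 1 else 0)"
proof -
  have "det (g x) \<noteq> 0" using g_det[OF assms] by simp
  from matrix_inv_works(2)[OF this] have "(matrix_inv (g x) ** g x) $ i $ k = mat 1 $ i $ k" by simp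
  then show ?thesis by (simp add: gi_def matrix_matrix_mult_def mat_def)
qed

text \<open>Since \<open>g\<close> is the Gram matrix of the partial derivatives of
  \<open>Y\<close>, the sum over the coordinates produces \<open>g\<close>, which is contracted with
  its inverse. The gradients of the coordinates thus act like an orthonormal basis of the tangent
  space, although there may be more of them than its dimension; the next two lemmas rest on the same
  contraction.\<close>

lemma sum_gp_Yc_partial:
  assumes "x \<in> U" shows "(\<Sum>a\<in>UNIV. gp (Yc a) f x * partial k (Yc a) x) = partial k f x"
proof -
  have "(\<Sum>a\<in>UNIV. gp (Yc a) f x * partial k (Yc a) x) =
      (\<Sum>a\<in>UNIV. \<Sum>i\<in>UNIV. \<Sum>j\<in>UNIV. gi i j x * partial j f x * (partial i (Yc a) x * partial k (Yc a) x))"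
    by (simp add: gp_def sum_distrib_left sum_distrib_right mult_ac)
  also have "\<dots> = (\<Sum>i\<in>UNIV. \<Sum>j\<in>UNIV. \<Sum>a\<in>UNIV. gi i j x * partial j f x * (partial i (Yc a) x * partial k (Yc a) x))"
    by (subst sum.swap, intro sum.cong refl, subst sum.swap) simp
  also have "\<dots> = (\<Sum>i\<in>UNIV. \<Sum>j\<in>UNIV. gi j i x * g x $ i $ k * partial j f x)"
    by (simp add: sum_distrib_left[symmetric] g_Yc[OF assms, symmetric] gi_sym[OF assms] mult_ac)
  also have "\<dots> = (\<Sum>j\<in>UNIV. (\<Sum>i\<in>UNIV. gi j i x * g x $ i $ k) * partial j f x)"
    by (subst sum.swap) (simp add: sum_distrib_right)
  also have "\<dots> = partial k f x" by (simp add: gi_g[OF assms] if_distrib[of "\<lambda>t. t * _"] cong: if_cong)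
  finally show ?thesis .
qed

lemma sum_gp_Yc_gp_Yc:
  assumes "x \<in> U" shows "(\<Sum>a\<in>UNIV. gp (Yc a) f x * gp (Yc a) h x) = gp f h x"
proof -
  have "(\<Sum>a\<in>UNIV. gp (Yc a) f x * gp (Yc a) h x) =
      (\<Sum>a\<in>UNIV. \<Sum>i\<in>UNIV. \<Sum>j\<in>UNIV. gi i j x * partial j h x * (gp (Yc a) f x * partial i (Yc a) x))"
    by (simp add: gp_def[of "Yc _" h] sum_distrib_left mult_ac)
  also have "\<dots> = (\<Sum>i\<in>UNIV. \<Sum>j\<in>UNIV. \<Sum>a\<in>UNIV. gi i j x * partial j h x * (gp (Yc a) f x * partial i (Yc a) x))"
    by (subst sum.swap, intro sum.cong refl, subst sum.swap) simp
  also have "\<dots> = (\<Sum>i\<in>UNIV. \<Sum>j\<in>UNIV. gi i j x * partial j h x * partial i f x)"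
    by (simp add: sum_distrib_left[symmetric] sum_gp_Yc_partial[OF assms])
  also have "\<dots> = gp f h x" by (simp add: gp_def mult_ac)
  finally show ?thesis .
qed

lemma sum_gp_Yc_Yc:
  assumes "x \<in> U" shows "(\<Sum>a\<in>UNIV. gp (Yc a) (Yc a) x) = real CARD('n)"
proof -
  have "(\<Sum>a\<in>UNIV. gp (Yc a) (Yc a) x) =
      (\<Sum>a\<in>UNIV. \<Sum>i\<in>UNIV. \<Sum>j\<in>UNIV. gi i j x * (partial j (Yc a) x * partial i (Yc a) x))"
    by (simp add: gp_def mult_ac)
  also have "\<dots> = (\<Sum>i\<in>UNIV. \<Sum>j\<in>UNIV. \<Sum>a\<in>UNIV. gi i j x * (partial j (Yc a) x * partial i (Yc a) x))"
    by (subst sum.swap, intro sum.cong refl, subst sum.swap) simp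
  also have "\<dots> = (\<Sum>i\<in>UNIV. \<Sum>j\<in>UNIV. gi i j x * g x $ j $ i)"
    by (simp add: sum_distrib_left[symmetric] g_Yc[OF assms, symmetric])
  also have "\<dots> = real CARD('n)" by (simp add: gi_g[OF assms])
  finally show ?thesis .
qed

text \<open>The flux of \<open>Y\<close> in direction \<open>i\<close>, paired with
  \<open>partial k Y\<close>, is \<open>r\<close> times Kronecker's delta. The divergence of this is
  \<open>partial k r\<close>. The part of it in which the derivative falls on
  \<open>partial k Y\<close> equals \<open>partial k r\<close> as well, by symmetry of second
  derivatives and Jacobi's formula for \<open>det (g x)\<close>, so nothing is left for the
  Laplacian. No Christoffel symbols occur.\<close>

lemma lap_Yc_orthogonal:
  assumes x: "x \<in> U" shows "(\<Sum>a\<in>UNIV. lap (Yc a) x * partial k (Yc a) x) = 0"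
proof -
  let ?p = "\<lambda>i a. partial i (Yc a)"
  have pd: "?p i a differentiable at y" if "y \<in> U" for i a y
    by (rule diff1[OF Ck_partial[OF Yc_Ck[of "Suc (Suc 0)"]] that])
  have Fd: "Fl (Yc a) i differentiable at x" for i a by (rule diff_Fl[OF Yc_Ck x])
  have comm: "partial i (?p k a) x = partial k (?p i a) x" for i a
    by (rule partial_commute[OF open_U x Yc_Ck])
  have FlY: "(\<Sum>a\<in>UNIV. Fl (Yc a) i y * ?p k a y) = r y * (if i = k then 1 else 0)" if y: "y \<in> U" for i y
  proof -
    have "(\<Sum>a\<in>UNIV. Fl (Yc a) i y * ?p k a y) = (\<Sum>a\<in>UNIV. \<Sum>j\<in>UNIV. r y * gi i j y * (?p j a y * ?p k a y))"
      by (simp add: Fl_def sum_distrib_left sum_distrib_right mult_ac)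
    also have "\<dots> = (\<Sum>j\<in>UNIV. r y * gi i j y * g y $ j $ k)"
      by (subst sum.swap) (simp add: sum_distrib_left[symmetric] g_Yc[OF y, symmetric])
    also have "\<dots> = r y * (if i = k then 1 else 0)"
      using gi_g[OF y, of i k] by (simp add: sum_distrib_left[symmetric] mult.assoc)
    finally show ?thesis .
  qed
  have prod: "partial i (\<lambda>x. Fl (Yc a) i x * ?p k a x) x = Fl (Yc a) i x * partial i (?p k a) x + partial i (Fl (Yc a) i) x * ?p k a x" for i a
    by (rule partial_mult[OF Fd pd[OF x]])
  have "(\<Sum>i\<in>UNIV. \<Sum>a\<in>UNIV. partial i (Fl (Yc a) i) x * ?p k a x) =
     (\<Sum>i\<in>UNIV. \<Sum>a\<in>UNIV. partial i (\<lambda>x. Fl (Yc a) i x * ?p k a x) x - Fl (Yc a) i x * partial k (?p i a) x)"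
    unfolding prod by (simp add: comm)
  also have "\<dots> = (\<Sum>i\<in>UNIV. partial i (\<lambda>x. \<Sum>a\<in>UNIV. Fl (Yc a) i x * ?p k a x) x) - (\<Sum>i\<in>UNIV. \<Sum>a\<in>UNIV. Fl (Yc a) i x * partial k (?p i a) x)"
    by (subst partial_sum(1)) (simp_all add: sum_subtractf differentiable_mult Fd pd[OF x])
  also have "(\<Sum>i\<in>UNIV. partial i (\<lambda>x. \<Sum>a\<in>UNIV. Fl (Yc a) i x * ?p k a x) x) = (\<Sum>i\<in>UNIV. if i = k then partial k r x else 0)"
  proof (rule sum.cong[OF refl])
    fix i
    have "partial i (\<lambda>x. \<Sum>a\<in>UNIV. Fl (Yc a) i x * ?p k a x) x = partial i (\<lambda>x. r x * (if i = k then 1 else 0)) x"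
      by (rule partial_cong_U[OF FlY x])
    then show "partial i (\<lambda>x. \<Sum>a\<in>UNIV. Fl (Yc a) i x * ?p k a x) x = (if i = k then partial k r x else 0)"
      by (cases "i = k") simp_all
  qed
  also have "\<dots> = partial k r x" by simp
  also have "(\<Sum>i\<in>UNIV. \<Sum>a\<in>UNIV. Fl (Yc a) i x * partial k (?p i a) x) = partial k r x"
  proof -
    have dg: "partial k (\<lambda>x. g x $ i $ j) x = (\<Sum>a\<in>UNIV. ?p i a x * partial k (?p j a) x + partial k (?p i a) x * ?p j a x)" for i j
    proof -
      have "partial k (\<lambda>x. g x $ i $ j) x = partial k (\<lambda>x. \<Sum>a\<in>UNIV. ?p i a x * ?p j a x) x"
        by (rule partial_cong_U[OF g_Yc x])
      also have "\<dots> = (\<Sum>a\<in>UNIV. partial k (\<lambda>x. ?p i a x * ?p j a x) x)"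
        by (rule partial_sum(1)) (intro differentiable_mult pd x)
      finally show ?thesis by (simp add: partial_mult pd[OF x])
    qed
    \<comment> \<open>Half of the contraction of the inverse metric with the derivative of the
      metric, because \<open>gi\<close> is symmetric.\<close>
    let ?T = "\<Sum>i\<in>UNIV. \<Sum>j\<in>UNIV. gi i j x * (\<Sum>a\<in>UNIV. ?p j a x * partial k (?p i a) x)"
    have T2: "?T = (\<Sum>i\<in>UNIV. \<Sum>j\<in>UNIV. gi i j x * (\<Sum>a\<in>UNIV. partial k (?p j a) x * ?p i a x))"
      by (subst sum.swap) (simp add: gi_sym[OF x] mult_ac)
    have TT: "(\<Sum>i\<in>UNIV. \<Sum>j\<in>UNIV. gi i j x * partial k (\<lambda>x. g x $ j $ i) x) = ?T + ?T"
      by (subst (2) T2) (simp add: dg sum.distrib distrib_left)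
    have pr': "partial k r x = 1 / (2 * r x) * (det (g x) * (\<Sum>i\<in>UNIV. \<Sum>j\<in>UNIV. gi i j x * partial k (\<lambda>x. g x $ j $ i) x))"
    proof -
      have gd: "(\<lambda>x. g x $ i $ j) differentiable at x" for i j by (rule diff1[OF g_Ck x])
      have dd: "(\<lambda>x. det (g x)) differentiable at x" by (rule diff1[OF Ck_det[OF open_U g_Ck] x])
      have "partial k r x = (inverse (sqrt (det (g x))) / 2) * partial k (\<lambda>x. det (g x)) x"
        unfolding r_def[abs_def] by (rule partial_compose_real(1)[OF dd DERIV_real_sqrt[OF g_det[OF x]]])
      also have "partial k (\<lambda>x. det (g x)) x = det (g x) * (\<Sum>i\<in>UNIV. \<Sum>j\<in>UNIV. gi i j x * partial k (\<lambda>x. g x $ j $ i) x)"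
        unfolding gi_def by (rule partial_det[OF gd less_imp_neq[OF g_det[OF x], symmetric]])
      moreover have "inverse (sqrt (det (g x))) / 2 = 1 / (2 * r x)" unfolding r_def by (simp add: inverse_eq_divide)
      ultimately show ?thesis by (simp only:)
    qed
    have dr: "det (g x) = r x * r x" using g_det[OF x] by (simp add: r_def)
    have "1 / (2 * R) * (R * R * (t + t)) = R * t" if "R > 0" for R t :: real using that by (simp add: field_simps)
    from this[OF r_pos[OF x], of ?T] have pr: "partial k r x = r x * ?T" by (simp only: pr' TT dr)
    have "(\<Sum>i\<in>UNIV. \<Sum>a\<in>UNIV. Fl (Yc a) i x * partial k (?p i a) x) =
        (\<Sum>i\<in>UNIV. \<Sum>a\<in>UNIV. \<Sum>j\<in>UNIV. r x * (gi i j x * (?p j a x * partial k (?p i a) x)))"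
      by (simp add: Fl_def sum_distrib_left sum_distrib_right mult_ac)
    also have "\<dots> = r x * ?T"
      unfolding sum_distrib_left by (intro sum.cong refl sum.swap)
    finally show ?thesis unfolding pr .
  qed
  finally have z: "(\<Sum>i\<in>UNIV. \<Sum>a\<in>UNIV. partial i (Fl (Yc a) i) x * ?p k a x) = 0" by (simp only: diff_self)
  have "(\<Sum>a\<in>UNIV. lap (Yc a) x * ?p k a x) = (\<Sum>a\<in>UNIV. \<Sum>i\<in>UNIV. partial i (Fl (Yc a) i) x * ?p k a x) / r x"
    by (simp add: lap_def sum_distrib_right sum_divide_distrib)
  also have "\<dots> = 0" by (subst sum.swap) (simp only: z div_0)
  finally show ?thesis .
qed

lemma sum_lap_Yc_gp:
  assumes x: "x \<in> U" shows "(\<Sum>a\<in>UNIV. lap (Yc a) x * gp (Yc a) f x) = 0"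
proof -
  have "(\<Sum>a\<in>UNIV. lap (Yc a) x * gp (Yc a) f x) =
      (\<Sum>a\<in>UNIV. \<Sum>i\<in>UNIV. \<Sum>j\<in>UNIV. gi i j x * partial j f x * (lap (Yc a) x * partial i (Yc a) x))"
    by (simp add: gp_def sum_distrib_left mult_ac)
  also have "\<dots> = (\<Sum>i\<in>UNIV. \<Sum>j\<in>UNIV. \<Sum>a\<in>UNIV. gi i j x * partial j f x * (lap (Yc a) x * partial i (Yc a) x))"
    by (subst sum.swap, intro sum.cong refl, subst sum.swap) simp
  also have "\<dots> = 0"
    by (simp add: sum_distrib_left[symmetric] lap_Yc_orthogonal[OF x])
  finally show ?thesis .
qed

text \<open>Both sides are orthogonal to the tangent space, and their difference lies in it: the
  Laplacian is the contracted second derivative plus first order terms, and each second derivative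
  differs from its normal part by a tangent vector.\<close>

lemma lap_Yc_normal:
  assumes x: "x \<in> U"
  defines "S \<equiv> span (range (\<lambda>k. partial k Y x))"
  shows "(\<chi> a. lap (Yc a) x) = (\<Sum>i\<in>UNIV. \<Sum>j\<in>UNIV. gi i j x *\<^sub>R
     (partial i (partial j Y) x - closest_point S (partial i (partial j Y) x)))"
proof -
  let ?w = "\<lambda>i j. partial i (partial j Y) x"
  define L where "L = (\<chi> a. lap (Yc a) x)"
  define N where "N = (\<Sum>i\<in>UNIV. \<Sum>j\<in>UNIV. gi i j x *\<^sub>R (?w i j - closest_point S (?w i j)))"
  have S: "subspace S" unfolding S_def by (rule subspace_span)
  have pS: "partial k Y x \<in> S" for k unfolding S_def by (rule span_base) simp
  have pd: "partial i (Yc a) differentiable at x" for i a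
    by (rule diff1[OF Ck_partial[OF Yc_Ck[of "Suc (Suc 0)"]] x])
  have rgd: "(\<lambda>x. r x * gi i j x) differentiable at x" for i j
    by (intro differentiable_mult diff1[OF r_Ck x] diff1[OF gi_Ck x])
  \<comment> \<open>The coefficients of the first order part of the Laplacian.\<close>
  define b where "b j = (\<Sum>i\<in>UNIV. partial i (\<lambda>x. r x * gi i j x) x) / r x" for j
  have La: "lap (Yc a) x = (\<Sum>i\<in>UNIV. \<Sum>j\<in>UNIV. gi i j x * (?w i j $ a)) + (\<Sum>j\<in>UNIV. b j * (partial j Y x $ a))" for a
  proof -
    have Fleq: "Fl (Yc a) i = (\<lambda>x. \<Sum>j\<in>UNIV. (r x * gi i j x) * partial j (Yc a) x)" for i
      by (simp add: Fl_def fun_eq_iff sum_distrib_left mult.assoc)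
    have "partial i (Fl (Yc a) i) x = (\<Sum>j\<in>UNIV. r x * gi i j x * (?w i j $ a) + partial i (\<lambda>x. r x * gi i j x) x * (partial j Y x $ a))" for i
      unfolding Fleq
      by (subst partial_sum(1)) (simp_all add: differentiable_mult rgd pd partial_mult[OF rgd pd] partial2_Yc[OF x] partial_Yc[OF x])
    then have "lap (Yc a) x = (\<Sum>i\<in>UNIV. \<Sum>j\<in>UNIV. (r x * gi i j x * (?w i j $ a))) / r x + (\<Sum>i\<in>UNIV. \<Sum>j\<in>UNIV. partial i (\<lambda>x. r x * gi i j x) x * (partial j Y x $ a)) / r x"
      by (simp add: lap_def sum.distrib add_divide_distrib)
    also have "(\<Sum>i\<in>UNIV. \<Sum>j\<in>UNIV. (r x * gi i j x * (?w i j $ a))) / r x = (\<Sum>i\<in>UNIV. \<Sum>j\<in>UNIV. gi i j x * (?w i j $ a))"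
      using r_pos[OF x] by (simp add: sum_divide_distrib)
    also have "(\<Sum>i\<in>UNIV. \<Sum>j\<in>UNIV. partial i (\<lambda>x. r x * gi i j x) x * (partial j Y x $ a)) / r x = (\<Sum>j\<in>UNIV. b j * (partial j Y x $ a))"
      by (subst sum.swap) (simp add: b_def sum_divide_distrib sum_distrib_right)
    finally show ?thesis .
  qed
  have "L = (\<Sum>i\<in>UNIV. \<Sum>j\<in>UNIV. gi i j x *\<^sub>R ?w i j) + (\<Sum>j\<in>UNIV. b j *\<^sub>R partial j Y x)"
    by (simp add: L_def vec_eq_iff La)
  then have "L - N = (\<Sum>i\<in>UNIV. \<Sum>j\<in>UNIV. gi i j x *\<^sub>R closest_point S (?w i j)) + (\<Sum>j\<in>UNIV. b j *\<^sub>R partial j Y x)"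
    by (simp add: N_def scaleR_diff_right sum_subtractf)
  then have LN: "L - N \<in> S"
    by (simp only:) (intro subspace_add subspace_sum subspace_scale S pS subspace_orthogonal_projection(2)[OF S pS])
  have "N \<bullet> s = 0" if "s \<in> S" for s
    unfolding N_def by (simp only: inner_sum_left inner_scaleR_left subspace_orthogonal_projection(1)[OF S that] mult_zero_right sum.neutral_const)
  moreover have "L \<bullet> s = 0" if "s \<in> S" for s
  proof -
    have "L \<bullet> partial k Y x = 0" for k
      using lap_Yc_orthogonal[OF x, of k] by (simp only: L_def inner_vec_def partial_Yc[OF x] vec_lambda_beta inner_real_def)
    then have "\<And>y. y \<in> range (\<lambda>k. partial k Y x) \<Longrightarrow> orthogonal L y" by (auto simp: orthogonal_def)
    from orthogonal_to_span[OF that[unfolded S_def] this] show ?thesis by (simp add: orthogonal_def)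
  qed
  ultimately have "(L - N) \<bullet> (L - N) = 0" using LN by (simp only: inner_diff_left diff_self)
  then have "L = N" by (simp only: inner_eq_zero_iff right_minus_eq)
  then show ?thesis unfolding L_def N_def .
qed

end

section \<open>Change of charts\<close>

lemma partial_compose:
  fixes f :: "real^'n::finite \<Rightarrow> real" and t :: "real^'l::finite \<Rightarrow> real^'n"
  assumes t: "t differentiable at x" and f: "f differentiable at (t x)"
  shows "partial i (\<lambda>x. f (t x)) x = (\<Sum>j\<in>UNIV. partial i t x $ j * partial j f (t x))"
    and "(\<lambda>x. f (t x)) differentiable at x"
proof -
  have d: "((\<lambda>x. f (t x)) has_derivative (\<lambda>v. frechet_derivative f (at (t x)) (frechet_derivative t (at x) v))) (at x)"
    by (rule has_derivative_compose[OF differentiable_imp_has_frechet[OF t] differentiable_imp_has_frechet[OF f]])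
  show "partial i (\<lambda>x. f (t x)) x = (\<Sum>j\<in>UNIV. partial i t x $ j * partial j f (t x))"
    using partial_has_derivative[OF d, of i] frechet_derivative_partial[OF f, of "partial i t x"]
    by (simp add: partial_def[of i t])
  show "(\<lambda>x. f (t x)) differentiable at x" using d by (rule differentiableI)
qed

lemma Ck_compose:
  fixes f :: "real^'n::finite \<Rightarrow> real" and t :: "real^'l::finite \<Rightarrow> real^'n"
  assumes U: "open U" and V: "open V" and tU: "t ` U \<subseteq> V" and t: "Ck k U t" and f: "Ck k V f"
  shows "Ck k U (\<lambda>x. f (t x))"
  using t f
proof (induction k arbitrary: f)
  case 0
  then show ?case using continuous_on_compose2[of V f U t] tU by simp
next
  case (Suc k)
  have td: "t differentiable at x" if "x \<in> U" for x by (rule Ck_differentiable[OF U Suc.prems(1) that])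
  have fd: "f differentiable at (t x)" if "x \<in> U" for x
    by (rule Ck_differentiable[OF V Suc.prems(2)]) (use that tU in blast)
  have "Ck k U (partial i (\<lambda>x. f (t x)))" for i
  proof (rule Ck_cong[OF U])
    show "(\<Sum>j\<in>UNIV. partial i t x $ j * partial j f (t x)) = partial i (\<lambda>x. f (t x)) x" if "x \<in> U" for x
      by (rule partial_compose(1)[OF td[OF that] fd[OF that], symmetric])
    have ti: "Ck k U (partial i t)" and fj: "Ck k V (partial j f)" for j using Suc.prems by simp_all
    show "Ck k U (\<lambda>x. \<Sum>j\<in>UNIV. partial i t x $ j * partial j f (t x))"
      by (intro Ck_sum Ck_mult U Suc.IH[OF Ck_SucD[OF Suc.prems(1)] fj] Ck_bounded_linear[OF bounded_linear_vec_nth U ti])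
  qed
  moreover have "(\<lambda>x. f (t x)) differentiable_on U"
    using partial_compose(2)[OF td fd] by (simp add: differentiable_on_eq_differentiable_at[OF U])
  ultimately show ?case by simp
qed

context riemannian
begin

definition gm :: "('a, 'n) chart \<Rightarrow> real^'n \<Rightarrow> real^'n^'n" where "gm c x = G c (param c x)"

lemma chart_metric: assumes c: "c \<in> A" shows "coord_metric (img c) (gm c)"
proof
  show "open (img c)" by (rule open_img[OF c])
  show "Ck k (img c) (\<lambda>x. gm c x $ i $ j)" for k i j unfolding gm_def by (rule G_Ck[OF c])
  show "transpose (gm c x) = gm c x" if "x \<in> img c" for x
    unfolding gm_def by (rule G_sym[OF c param_in_dom[OF c that]])
  show "0 < v \<bullet> (gm c x *v v)" if "x \<in> img c" "v \<noteq> 0" for x v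
    unfolding gm_def by (rule G_pos[OF c param_in_dom[OF c that(1)] that(2)])
  show "0 < det (gm c x)" if "x \<in> img c" for x
    unfolding gm_def by (rule det_G_pos[OF c param_in_dom[OF c that]])
qed

definition CkM :: "nat \<Rightarrow> ('a \<Rightarrow> real) \<Rightarrow> bool" where
  "CkM k u \<longleftrightarrow> (\<forall>c\<in>A. Ck k (img c) (u \<circ> param c))"

definition lapc :: "('a, 'n) chart \<Rightarrow> ('a \<Rightarrow> real) \<Rightarrow> 'a \<Rightarrow> real" where
  "lapc c u p = coord_metric.lap (gm c) (u \<circ> param c) (coord c p)"

definition gpc :: "('a, 'n) chart \<Rightarrow> ('a \<Rightarrow> real) \<Rightarrow> ('a \<Rightarrow> real) \<Rightarrow> 'a \<Rightarrow> real" where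
  "gpc c u v p = coord_metric.gp (gm c) (u \<circ> param c) (v \<circ> param c) (coord c p)"

lemma smooth_map_iff_CkM: "smooth_map A u \<longleftrightarrow> (\<forall>k. CkM k u)"
  by (auto simp: smooth_map_def CkM_def smooth_on_iff)

lemma CkM_chart: "CkM k u \<Longrightarrow> c \<in> A \<Longrightarrow> Ck k (img c) (u \<circ> param c)"
  by (simp add: CkM_def)

lemma CkM_differentiable: "CkM (Suc k) u \<Longrightarrow> c \<in> A \<Longrightarrow> p \<in> dom_of c \<Longrightarrow> (u \<circ> param c) differentiable at (coord c p)"
  by (rule Ck_differentiable[OF open_img CkM_chart]) auto

lemma divergence_gradient:
  assumes c: "c \<in> A" and p: "p \<in> dom_of c"
  shows "divergence_in G c (gradient_in G c u) p = lapc c u p"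
proof -
  interpret C: coord_metric "img c" "gm c" by (rule chart_metric[OF c])
  have x: "coord c p \<in> img c" using p by simp
  have "((\<lambda>q. sqrt (det (G c q)) * gradient_in G c u q $ i) \<circ> param c) y = C.Fl (u \<circ> param c) i y" if "y \<in> img c" for y i
    by (simp add: C.Fl_def C.r_def C.gi_def gradient_in_def gm_def matrix_vector_mult_def cpartial_def coord_param[OF c that])
  from C.partial_cong_U[OF this x]
  have "cpartial c i (\<lambda>q. sqrt (det (G c q)) * gradient_in G c u q $ i) p = partial i (C.Fl (u \<circ> param c) i) (coord c p)" for i
    unfolding cpartial_def .
  then show ?thesis by (simp add: divergence_in_def lapc_def C.lap_def C.r_def gm_def param_coord[OF c p])
qed

lemma laplacian_chart_at: "laplacian A G u p = lapc (chart_at A p) u p"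
  unfolding laplacian_def Let_def by (rule divergence_gradient[OF chart_at_in])

lemma chart_change:
  assumes c: "c \<in> A" and d: "d \<in> A" and x: "x \<in> overlap c d"
  shows "(u \<circ> param d) (trans_map c d x) = (u \<circ> param c) x"
  using param_trans[OF c d x] by simp

lemma partial_chart_change:
  assumes c: "c \<in> A" and d: "d \<in> A" and p: "p \<in> dom_of c" "p \<in> dom_of d"
    and u: "(u \<circ> param d) differentiable at (coord d p)"
  shows "(\<chi> i. partial i (u \<circ> param c) (coord c p)) = transpose (jac c d (coord c p)) *v (\<chi> j. partial j (u \<circ> param d) (coord d p))"
proof -
  have x: "coord c p \<in> overlap c d" using p by auto
  have y: "trans_map c d (coord c p) = coord d p" by (simp add: trans_map_def param_coord[OF c p(1)])
  have "partial i (u \<circ> param c) (coord c p) = partial i (\<lambda>x. (u \<circ> param d) (trans_map c d x)) (coord c p)" for i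
    by (rule partial_cong[OF open_overlap[OF c d] chart_change[OF c d, symmetric] x])
  also have "\<dots> i = (\<Sum>j\<in>UNIV. partial i (trans_map c d) (coord c p) $ j * partial j (u \<circ> param d) (coord d p))" for i
    using partial_compose(1)[OF trans_differentiable[OF c d x], of "u \<circ> param d" i] u unfolding y by simp
  finally show ?thesis by (simp add: vec_eq_iff matrix_vector_mult_def transpose_def jac_nth)
qed

text \<open>The transformation law of the metric gives
  \<open>matrix_inv (G d p) = J ** matrix_inv (G c p) ** transpose J\<close>; its outer factors are
  those by which the coordinate gradients change.\<close>

lemma gpc_chart_change:
  assumes c: "c \<in> A" and d: "d \<in> A" and p: "p \<in> dom_of c" "p \<in> dom_of d"
    and u: "(u \<circ> param d) differentiable at (coord d p)" and v: "(v \<circ> param d) differentiable at (coord d p)"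
  shows "gpc c u v p = gpc d u v p"
proof -
  interpret C: coord_metric "img c" "gm c" by (rule chart_metric[OF c])
  interpret D: coord_metric "img d" "gm d" by (rule chart_metric[OF d])
  define J a b where "J = jac c d (coord c p)" and "a = (\<chi> j. partial j (u \<circ> param d) (coord d p))"
    and "b = (\<chi> j. partial j (v \<circ> param d) (coord d p))"
  have GJ: "G c p = transpose J ** G d p ** J" unfolding J_def by (rule G_trans[OF c d p])
  have "det (G c p) = det J * det J * det (G d p)" unfolding GJ by (simp add: det_mul det_transpose)
  then have dJ: "det J \<noteq> 0" and dG: "det (G c p) \<noteq> 0" using det_G_pos[OF c p(1)] by auto
  have dJt: "det (transpose J) \<noteq> 0" using dJ by (simp add: det_transpose)
  let ?I = "matrix_inv (G c p)"
  have "transpose J ** (G d p ** (J ** ?I ** transpose J)) = G c p ** ?I ** transpose J"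
    unfolding GJ by (simp add: matrix_mul_assoc)
  also have "\<dots> = transpose J ** mat 1" using matrix_inv_works(1)[OF dG] by simp
  finally have "matrix_inv (transpose J) ** (transpose J ** (G d p ** (J ** ?I ** transpose J))) = matrix_inv (transpose J) ** (transpose J ** mat 1)"
    by (rule arg_cong)
  then have "G d p ** (J ** ?I ** transpose J) = mat 1"
    unfolding matrix_mul_assoc[of "matrix_inv (transpose J)" "transpose J"] matrix_inv_works(2)[OF dJt] by simp
  then have inv: "matrix_inv (G d p) = J ** ?I ** transpose J" by (rule matrix_inv_unique)
  have "gpc c u v p = (transpose J *v a) \<bullet> (?I *v (transpose J *v b))"
    unfolding gpc_def C.gp_vec partial_chart_change[OF c d p u] partial_chart_change[OF c d p v]
    by (simp add: gm_def param_coord[OF c p(1)] J_def a_def b_def)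
  also have "\<dots> = a \<bullet> (J *v (?I *v (transpose J *v b)))"
    using dot_lmul_matrix[of a J "?I *v (transpose J *v b)"] by simp
  also have "\<dots> = gpc d u v p"
    unfolding gpc_def D.gp_vec by (simp add: gm_def param_coord[OF d p(2)] inv a_def b_def matrix_vector_mul_assoc matrix_mul_assoc del: transpose_matrix_vector)
  finally show ?thesis .
qed

text \<open>The domain of another chart is covered by two open sets: on the overlap \<open>b\<close>
  is composed with the transition map, and off \<open>K\<close> it is zero.\<close>

lemma CkM_extend:
  assumes c: "c \<in> A" and K: "compact K" "K \<subseteq> dom_of c" and b: "\<And>p. p \<notin> K \<Longrightarrow> b p = 0" and bc: "Ck k (img c) (b \<circ> param c)"
  shows "CkM k b"
  unfolding CkM_def
proof
  fix d assume d: "d \<in> A"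
  have cl: "closed K" by (rule compact_imp_closed[OF K(1)])
  let ?V = "overlap d c" and ?W = "coord d ` (dom_of d - K)"
  have un: "img d = ?V \<union> ?W" using K(2) by auto
  have oV: "open ?V" by (rule open_overlap[OF d c])
  have oW: "open ?W" by (rule open_coord_image[OF d open_Diff[OF open_dom[OF d] cl]]) auto
  have "Ck k ?V (\<lambda>x. (b \<circ> param c) (trans_map d c x))"
  proof (rule Ck_compose[OF oV open_img[OF c] _ trans_Ck[OF d c] bc])
    show "trans_map d c ` ?V \<subseteq> img c" by (auto simp: trans_map_def param_coord[OF d])
  qed
  then have "Ck k ?V (b \<circ> param d)"
    by (rule Ck_cong[OF oV, rotated]) (rule chart_change[OF d c])
  moreover have "Ck k ?W (b \<circ> param d)"
    by (rule Ck_cong[OF oW _ Ck_const[of k _ 0]]) (auto simp: param_coord[OF d] b)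
  ultimately show "Ck k (img d) (b \<circ> param d)" unfolding un by (intro Ck_Un oV oW)
qed

end

lemma integral_pos_continuous_at_point:
  fixes F :: "'b::euclidean_space \<Rightarrow> real"
  assumes F: "integrable lborel F" "\<And>x. 0 \<le> F x" and V: "open V" "continuous_on V F" "z \<in> V" "F z > 0"
  shows "(\<integral>x. F x \<partial>lborel) > 0"
proof (rule ccontr)
  assume "\<not> (\<integral>x. F x \<partial>lborel) > 0"
  moreover have "(\<integral>x. F x \<partial>lborel) \<ge> 0" by (rule Bochner_Integration.integral_nonneg) (rule F(2))
  ultimately have "(\<integral>x. F x \<partial>lborel) = 0" by simp
  then have ae: "AE x in lborel. F x = 0" using integral_nonneg_eq_0_iff_AE[OF F(1)] F(2) by simp
  let ?W = "V \<inter> F -` {0<..}"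
  have oW: "open ?W" by (rule continuous_open_preimage[OF V(2,1)]) simp
  have "?W \<in> null_sets lborel"
    using oW ae by (intro AE_iff_null_sets[THEN iffD2]) (auto elim!: eventually_mono)
  then have "negligible ?W" by (simp add: negligible_iff_null_sets null_sets_completionI)
  moreover have "?W \<noteq> {}" using V by auto
  ultimately show False using open_not_negligible[OF oW] by simp
qed

lemma Ck_id: "Ck k S (\<lambda>x :: real^'n::finite. x)"
proof (cases k)
  case (Suc l)
  have "partial i (\<lambda>x :: real^'n. x) = (\<lambda>x. axis i 1)" for i
    by (rule ext, rule partial_has_derivative) (rule has_derivative_ident)
  then show ?thesis using Suc by (simp add: Ck_const differentiable_on_def)
qed simp

text \<open>Class \<open>C^1\<close> is all that Green's formula and the localisation ask of a
  cut-off, so the squared positive part of a polynomial can take the place of a smooth bump.\<close>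

definition bump :: "real^'n::finite \<Rightarrow> real \<Rightarrow> real^'n \<Rightarrow> real" where
  "bump z s x = (max 0 (s\<^sup>2 - (\<Sum>i\<in>UNIV. (x $ i - z $ i)\<^sup>2)))\<^sup>2"

lemma bump_nonneg: "0 \<le> bump z s x" by (simp add: bump_def)

lemma bump_pos: "0 < s \<Longrightarrow> 0 < bump z s z" by (simp add: bump_def)

lemma bump_zero: assumes "0 < s" "x \<notin> cball z s" shows "bump z s x = 0"
proof -
  have "(\<Sum>i\<in>UNIV. (x $ i - z $ i)\<^sup>2) = (dist z x)\<^sup>2"
    by (simp add: dist_vec_def L2_set_def dist_real_def sum_nonneg power2_commute)
  moreover have "s\<^sup>2 \<le> (dist z x)\<^sup>2" using assms by (intro power_mono) auto
  ultimately show ?thesis by (simp add: bump_def)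
qed

lemma bump_Ck: "open S \<Longrightarrow> Ck (Suc 0) S (bump z s)"
  unfolding bump_def[abs_def]
  by (intro Ck1_pos_part_square Ck_diff Ck_const Ck_sum Ck_power Ck_bounded_linear[OF bounded_linear_vec_nth] Ck_id)

context riemannian
begin

section \<open>Green's formula in a chart and chart independence of the Laplacian\<close>

lemma continuous_on_chart:
  assumes "c \<in> A" "continuous_on (img c) f" shows "continuous_on (dom_of c) (\<lambda>p. f (coord c p))"
  using assms(2) continuous_on_coord[OF assms(1)] by (rule continuous_on_compose2) auto

lemma borel_chart:
  fixes h :: "'a \<Rightarrow> real"
  assumes c: "c \<in> A" and h: "continuous_on (dom_of c) h" "\<And>p. p \<notin> dom_of c \<Longrightarrow> h p = 0"
  shows "h \<in> borel_measurable borel"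
proof -
  have "(\<lambda>p. indicator (dom_of c) p *\<^sub>R h p) \<in> borel_measurable borel"
    by (rule borel_measurable_continuous_on_indicator) (use img_sets(2)[OF c] h(1) in auto)
  moreover have "(\<lambda>p. indicator (dom_of c) p *\<^sub>R h p) = h" using h(2) by (auto simp: indicator_def fun_eq_iff)
  ultimately show ?thesis by simp
qed

lemma continuous_on_lapc:
  assumes c: "c \<in> A" and u: "Ck (Suc (Suc 0)) (img c) (u \<circ> param c)"
  shows "continuous_on (dom_of c) (lapc c u)"
proof -
  interpret C: coord_metric "img c" "gm c" by (rule chart_metric[OF c])
  show ?thesis unfolding lapc_def[abs_def]
    by (rule continuous_on_chart[OF c Ck_imp_continuous_on[OF C.lap_Ck[OF u]]])
qed

lemma continuous_on_gpc:
  assumes c: "c \<in> A" and u: "Ck (Suc 0) (img c) (u \<circ> param c)" and v: "Ck (Suc 0) (img c) (v \<circ> param c)"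
  shows "continuous_on (dom_of c) (gpc c u v)"
proof -
  interpret C: coord_metric "img c" "gm c" by (rule chart_metric[OF c])
  show ?thesis unfolding gpc_def[abs_def]
    by (rule continuous_on_chart[OF c Ck_imp_continuous_on[OF C.gp_Ck[OF u v]]])
qed

lemma continuous_on_of_chart:
  assumes c: "c \<in> A" and u: "continuous_on (img c) (u \<circ> param c)"
  shows "continuous_on (dom_of c) u"
proof -
  have "continuous_on (dom_of c) (\<lambda>p. (u \<circ> param c) (coord c p))" by (rule continuous_on_chart[OF c u])
  then show ?thesis by (simp add: param_coord[OF c] cong: continuous_on_cong)
qed

lemma gpc_zero_outside:
  assumes c: "c \<in> A" and p: "p \<in> dom_of c" and K: "closed K" "p \<notin> K" and b: "\<And>q. q \<notin> K \<Longrightarrow> b q = 0"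
  shows "gpc c b v p = 0"
proof -
  interpret C: coord_metric "img c" "gm c" by (rule chart_metric[OF c])
  let ?W = "coord c ` (dom_of c - K)"
  have oW: "open ?W" by (rule open_coord_image[OF c open_Diff[OF open_dom[OF c] K(1)]]) auto
  have "partial i (b \<circ> param c) (coord c p) = partial i (\<lambda>x. 0) (coord c p)" for i
    by (rule partial_cong[OF oW]) (use p K in \<open>auto simp: param_coord[OF c] b\<close>)
  then have "partial i (b \<circ> param c) (coord c p) = 0" for i by simp
  then show ?thesis unfolding gpc_def C.gp_def by simp
qed

lemma green_chart:
  assumes c: "c \<in> A" and K: "compact K" "K \<subseteq> dom_of c" and b0: "\<And>p. p \<notin> K \<Longrightarrow> b p = 0"
    and b: "Ck (Suc 0) (img c) (b \<circ> param c)" and u: "Ck (Suc (Suc 0)) (img c) (u \<circ> param c)"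
  shows "integrable vol (\<lambda>p. b p * lapc c u p)"
    and "integrable vol (\<lambda>p. indicator (dom_of c) p * gpc c b u p)"
    and "(\<integral>p. b p * lapc c u p \<partial>vol) = - (\<integral>p. indicator (dom_of c) p * gpc c b u p \<partial>vol)"
proof -
  interpret C: coord_metric "img c" "gm c" by (rule chart_metric[OF c])
  have off: "b p = 0" if "p \<notin> dom_of c" for p using that K(2) b0 by blast
  let ?h1 = "\<lambda>p. b p * lapc c u p" and ?h2 = "\<lambda>p. indicator (dom_of c) p * gpc c b u p"
  have "continuous_on (dom_of c) ?h1"
    by (intro continuous_on_mult continuous_on_lapc c u continuous_on_of_chart Ck_imp_continuous_on[OF b])
  from borel_chart[OF c this] have m1: "?h1 \<in> borel_measurable borel" by (simp add: off)
  have "continuous_on (dom_of c) ?h2"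
    using continuous_on_gpc[OF c b Ck_SucD[OF u]] by (simp cong: continuous_on_cong)
  from borel_chart[OF c this] have m2: "?h2 \<in> borel_measurable borel" by simp
  have o1: "?h1 p = 0" and o2: "?h2 p = 0" if "p \<notin> dom_of c" for p using that off by auto
  have K': "compact (coord c ` K)" "coord c ` K \<subseteq> img c"
    using K by (auto intro: compact_continuous_image continuous_on_subset[OF continuous_on_coord[OF c]])
  have bz: "(b \<circ> param c) x = 0" if "x \<in> img c - coord c ` K" for x
  proof -
    have "param c x \<notin> K"
    proof
      assume "param c x \<in> K"
      then have "coord c (param c x) \<in> coord c ` K" by (rule imageI)
      then show False using that coord_param[OF c, of x] by simp
    qed
    then show ?thesis by (simp add: b0)
  qed
  note gr = C.green[OF K' b bz u]
  have e1: "indicator (img c) x * (rho c x * (b (param c x) * lapc c u (param c x))) =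
      indicator (img c) x * (C.r x * ((b \<circ> param c) x * C.lap (u \<circ> param c) x))" for x
    by (cases "x \<in> img c") (simp_all add: rho_def C.r_def gm_def lapc_def coord_param[OF c])
  have e2: "indicator (img c) x * (rho c x * (indicator (dom_of c) (param c x) * gpc c b u (param c x))) =
      indicator (img c) x * (C.r x * C.gp (b \<circ> param c) (u \<circ> param c) x)" for x
    by (cases "x \<in> img c") (simp_all add: rho_def C.r_def gm_def gpc_def coord_param[OF c] param_in_dom[OF c])
  have i1: "integrable lborel (\<lambda>x. indicator (img c) x * (rho c x * ?h1 (param c x)))"
    unfolding e1 by (rule gr(1))
  have i2: "integrable lborel (\<lambda>x. indicator (img c) x * (rho c x * ?h2 (param c x)))"
    unfolding e2 by (rule gr(2))
  show "integrable vol ?h1" using i1 integrable_chart[of c ?h1, OF c m1 o1] by blast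
  show "integrable vol ?h2" using i2 integrable_chart[of c ?h2, OF c m2 o2] by blast
  have "(\<integral>p. ?h1 p \<partial>vol) = (\<integral>x. indicator (img c) x * (rho c x * ?h1 (param c x)) \<partial>lborel)"
    by (rule integral_chart[of c ?h1, OF c m1 o1])
  also have "\<dots> = - (\<integral>x. indicator (img c) x * (rho c x * ?h2 (param c x)) \<partial>lborel)"
    unfolding e1 e2 by (rule gr(3))
  also have "\<dots> = - (\<integral>p. ?h2 p \<partial>vol)" 
    by (rule arg_cong[of _ _ uminus], rule integral_chart[of c ?h2, OF c m2 o2, symmetric])
  finally show "(\<integral>p. ?h1 p \<partial>vol) = - (\<integral>p. ?h2 p \<partial>vol)" .
qed

text \<open>The Laplacian is determined by Green's formula with compactly supported test functions, whose two
  sides do not depend on the chart. The test function is the difference of the two Laplacians times a bump.\<close>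

lemma lapc_chart_change:
  assumes c: "c \<in> A" and d: "d \<in> A" and p: "p \<in> dom_of c" "p \<in> dom_of d" and u: "CkM (Suc (Suc (Suc 0))) u"
  shows "lapc c u p = lapc d u p"
proof (rule ccontr)
  assume ne: "lapc c u p \<noteq> lapc d u p"
  interpret C: coord_metric "img c" "gm c" by (rule chart_metric[OF c])
  interpret D: coord_metric "img d" "gm d" by (rule chart_metric[OF d])
  define w where "w q = lapc c u q - lapc d u q" for q
  let ?V = "overlap c d" and ?z = "coord c p"
  have oV: "open ?V" by (rule open_overlap[OF c d])
  have zV: "?z \<in> ?V" using p by auto
  obtain s where s: "s > 0" "cball ?z s \<subseteq> ?V" using oV zV open_contains_cball by blast
  define \<beta> where "\<beta> = bump ?z s"
  have \<beta>0: "\<beta> x = 0" if "x \<notin> cball ?z s" for x unfolding \<beta>_def by (rule bump_zero[OF s(1) that])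
  have \<beta>z: "\<beta> ?z > 0" unfolding \<beta>_def by (rule bump_pos[OF s(1)])
  have \<beta>C: "Ck (Suc 0) S \<beta>" if "open S" for S unfolding \<beta>_def by (rule bump_Ck[OF that])
  define K where "K = param c ` cball ?z s"
  have inV: "x \<in> img c" "param c x \<in> dom_of c" "param c x \<in> dom_of d" if "x \<in> ?V" for x
    using overlap_param[OF c that] by auto
  have K: "compact K" "K \<subseteq> dom_of c" "K \<subseteq> dom_of d"
  proof -
    have "cball ?z s \<subseteq> img c" using s(2) by blast
    then show "compact K" unfolding K_def
      by (intro compact_continuous_image continuous_on_subset[OF continuous_on_param[OF c]]) auto
    show "K \<subseteq> dom_of c" "K \<subseteq> dom_of d" unfolding K_def using s(2) inV by blast+
  qed
  define b where "b q = (if q \<in> dom_of c then \<beta> (coord c q) * w q else 0)" for q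
  have b0: "b q = 0" if "q \<notin> K" for q
  proof (cases "q \<in> dom_of c")
    case True
    have "coord c q \<notin> cball ?z s"
    proof
      assume "coord c q \<in> cball ?z s"
      then have "param c (coord c q) \<in> K" unfolding K_def by (rule imageI)
      then show False using that True by (simp add: param_coord[OF c])
    qed
    then show ?thesis by (simp add: b_def \<beta>0)
  qed (simp add: b_def)
  \<comment> \<open>The test function has to be \<open>C^1\<close> and contains the Laplacian of
    \<open>u\<close>, which costs two derivatives; this is why \<open>u\<close> is of class
    \<open>C^3\<close>.\<close>
  have wV: "Ck (Suc 0) ?V (w \<circ> param c)"
  proof (rule Ck_cong[OF oV])
    have tV: "trans_map c d ` ?V \<subseteq> img d" by (auto simp: trans_map_def param_coord[OF c])
    have sub: "?V \<subseteq> img c" by auto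
    show "Ck (Suc 0) ?V (\<lambda>x. C.lap (u \<circ> param c) x - D.lap (u \<circ> param d) (trans_map c d x))"
      by (intro Ck_diff oV Ck_subset[OF C.lap_Ck[OF CkM_chart[OF u c]] sub]
          Ck_compose[OF oV open_img[OF d] tV trans_Ck[OF c d] D.lap_Ck[OF CkM_chart[OF u d]]])
    show "C.lap (u \<circ> param c) x - D.lap (u \<circ> param d) (trans_map c d x) = (w \<circ> param c) x" if "x \<in> ?V" for x
      using inV(1)[OF that] by (simp add: w_def lapc_def trans_map_def coord_param[OF c])
  qed
  have bC: "Ck (Suc 0) (img c) (b \<circ> param c)"
  proof (rule Ck_cong[OF open_img[OF c]])
    show "(if x \<in> ?V then \<beta> x * (w \<circ> param c) x else 0) = (b \<circ> param c) x" if "x \<in> img c" for x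
    proof (cases "x \<in> ?V")
      case False
      then have "\<beta> x = 0" using \<beta>0 s(2) by blast
      then show ?thesis using False that by (simp add: b_def coord_param[OF c])
    qed (simp add: that b_def coord_param[OF c] param_in_dom[OF c])
    have "Ck (Suc 0) UNIV (\<lambda>x. if x \<in> ?V then \<beta> x * (w \<circ> param c) x else 0)"
      by (rule Ck_extend_zero[OF oV compact_cball s(2) Ck_mult[OF oV \<beta>C[OF oV] wV]]) (simp add: \<beta>0)
    then show "Ck (Suc 0) (img c) (\<lambda>x. if x \<in> ?V then \<beta> x * (w \<circ> param c) x else 0)"
      by (rule Ck_subset) simp
  qed
  have bM: "CkM (Suc 0) b" by (rule CkM_extend[OF c K(1,2) b0 bC])
  have u2: "Ck (Suc (Suc 0)) (img e) (u \<circ> param e)" if "e \<in> A" for e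
    using Ck_SucD[OF CkM_chart[OF u that]] .
  note gc = green_chart[where b=b, OF c K(1,2) b0 bC u2[OF c]]
  note gd = green_chart[where b=b, OF d K(1,3) b0 CkM_chart[OF bM d] u2[OF d]]
  \<comment> \<open>The pairing of gradients is already known to be invariant, so the right-hand
    sides of Green's formula in the two charts agree.\<close>
  have eq: "indicator (dom_of c) q * gpc c b u q = indicator (dom_of d) q * gpc d b u q" for q
  proof (cases "q \<in> dom_of c \<and> q \<in> dom_of d")
    case True
    have "gpc c b u q = gpc d b u q"
      by (rule gpc_chart_change[OF c d _ _ CkM_differentiable[OF bM d] CkM_differentiable[OF u d]]) (use True in auto)
    then show ?thesis using True by simp
  next
    case False
    then have "q \<notin> K" using K by blast
    then have "q \<in> dom_of c \<Longrightarrow> gpc c b u q = 0" "q \<in> dom_of d \<Longrightarrow> gpc d b u q = 0"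
      using gpc_zero_outside[where b=b, OF c _ compact_imp_closed[OF K(1)] _ b0] gpc_zero_outside[where b=b, OF d _ compact_imp_closed[OF K(1)] _ b0] by blast+
    then show ?thesis by (auto simp: indicator_def)
  qed
  have "(\<integral>q. b q * w q \<partial>vol) = (\<integral>q. b q * lapc c u q - b q * lapc d u q \<partial>vol)"
    by (simp add: w_def right_diff_distrib)
  also have "\<dots> = (\<integral>q. b q * lapc c u q \<partial>vol) - (\<integral>q. b q * lapc d u q \<partial>vol)"
    by (rule Bochner_Integration.integral_diff[OF gc(1) gd(1)])
  also have "\<dots> = 0" using gc(3) gd(3) unfolding eq by simp
  finally have z: "(\<integral>q. b q * w q \<partial>vol) = 0" .
  have i: "integrable vol (\<lambda>q. b q * w q)"
    using Bochner_Integration.integrable_diff[OF gc(1) gd(1)] by (simp add: w_def right_diff_distrib)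
  then have m: "(\<lambda>q. b q * w q) \<in> borel_measurable borel" using borel_measurable_integrable by simp
  have off: "b q * w q = 0" if "q \<notin> dom_of c" for q using that by (simp add: b_def)
  let ?F = "\<lambda>x. indicator (img c) x * (rho c x * (b (param c x) * w (param c x)))"
  \<comment> \<open>The integrand is a square with a nonnegative weight, and at \<open>p\<close> it
    is positive by the assumption to be refuted, while its integral is the difference of the two
    sides of Green's formula, which is 0.\<close>
  have Feq: "?F x = (rho c x * \<beta> x) * ((w \<circ> param c) x)\<^sup>2" if "x \<in> ?V" for x
    using inV[OF that] by (simp add: b_def coord_param[OF c] power2_eq_square)
  have "(\<integral>x. ?F x \<partial>lborel) > 0"
  proof (rule integral_pos_continuous_at_point[OF _ _ oV _ zV])
    show "integrable lborel ?F" using i integrable_chart[OF c m off] by blast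
    show "0 \<le> ?F x" for x
      using rho_pos[OF c, of x] by (cases "x \<in> img c") (auto simp: b_def \<beta>_def bump_nonneg mult.assoc intro!: mult_nonneg_nonneg)
    have "continuous_on ?V (\<lambda>x. (rho c x * \<beta> x) * ((w \<circ> param c) x)\<^sup>2)"
      by (intro continuous_on_mult continuous_on_power continuous_on_subset[OF continuous_on_rho[OF c]]
          Ck_imp_continuous_on[OF \<beta>C[OF oV]] Ck_imp_continuous_on[OF wV]) auto
    then show "continuous_on ?V ?F" by (rule continuous_on_eq) (rule Feq[symmetric])
    show "?F ?z > 0" unfolding Feq[OF zV]
      using rho_pos[OF c, of ?z] \<beta>z ne p by (simp add: w_def param_coord[OF c])
  qed
  moreover have "(\<integral>x. ?F x \<partial>lborel) = 0" using integral_chart[OF c m off] z by simp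
  ultimately show False by simp
qed

end

section \<open>Laplacian and gradient pairing on the manifold\<close>

context coord_metric
begin

lemma gp_diff_scaled:
  assumes f: "f differentiable at x" and h: "h differentiable at x"
  shows "gp (\<lambda>y. a * f y - b * h y) (\<lambda>y. a * f y - b * h y) x =
    a * a * gp f f x - a * b * gp f h x - a * b * gp h f x + b * b * gp h h x"
proof -
  have fa: "(\<lambda>y. a * f y) differentiable at x" and hb: "(\<lambda>y. (- b) * h y) differentiable at x"
    by (intro differentiable_mult differentiable_const f h)+
  have "partial i (\<lambda>y. a * f y + (- b) * h y) x = a * partial i f x + (- b) * partial i h x" for i
    by (simp only: partial_add[OF fa hb] partial_cmult[OF f] partial_cmult[OF h])
  then have pd: "partial i (\<lambda>y. a * f y - b * h y) x = a * partial i f x - b * partial i h x" for i by simp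
  then have "gp (\<lambda>y. a * f y - b * h y) (\<lambda>y. a * f y - b * h y) x =
    (\<Sum>i\<in>UNIV. \<Sum>j\<in>UNIV. a * a * (gi i j x * partial i f x * partial j f x) - a * b * (gi i j x * partial i f x * partial j h x)
      - a * b * (gi i j x * partial i h x * partial j f x) + b * b * (gi i j x * partial i h x * partial j h x))"
    unfolding gp_def pd by (intro sum.cong refl) (simp add: algebra_simps)
  also have "\<dots> = a * a * gp f f x - a * b * gp f h x - a * b * gp h f x + b * b * gp h h x"
    unfolding gp_def by (simp only: sum.distrib sum_subtractf sum_distrib_left)
  finally show ?thesis .
qed

text \<open>The mixed term in the expansion is absorbed by positivity of \<open>gp\<close> on the
  function \<open>h x * f - f x * h\<close>. It bounds the energy of a localised function
  \<open>b * \<phi>\<close> by that of \<open>\<phi>\<close>.\<close>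

lemma gp_mult_self_le:
  assumes x: "x \<in> U" and f: "f differentiable at x" and h: "h differentiable at x"
  shows "gp (\<lambda>y. f y * h y) (\<lambda>y. f y * h y) x \<le> 2 * (f x)\<^sup>2 * gp h h x + 2 * (h x)\<^sup>2 * gp f f x"
proof -
  let ?P = "\<lambda>y. f y * h y"
  have "gp ?P ?P x = f x * gp h ?P x + h x * gp f ?P x" by (rule gp_mult[OF f h])
  also have "gp h ?P x = gp ?P h x" by (rule gp_sym[OF x])
  also have "gp ?P h x = f x * gp h h x + h x * gp f h x" by (rule gp_mult[OF f h])
  also have "gp f ?P x = gp ?P f x" by (rule gp_sym[OF x])
  also have "gp ?P f x = f x * gp h f x + h x * gp f f x" by (rule gp_mult[OF f h])
  also have "gp h f x = gp f h x" by (rule gp_sym[OF x])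
  also have "f x * (f x * gp h h x + h x * gp f h x) + h x * (f x * gp f h x + h x * gp f f x) =
      f x * f x * gp h h x + 2 * (f x * h x * gp f h x) + h x * h x * gp f f x"
    by (simp add: algebra_simps)
  finally have 1: "gp (\<lambda>y. f y * h y) (\<lambda>y. f y * h y) x = \<dots>" .
  have "0 \<le> gp (\<lambda>y. h x * f y - f x * h y) (\<lambda>y. h x * f y - f x * h y) x" by (rule gp_nonneg[OF x])
  also have "\<dots> = h x * h x * gp f f x - 2 * (f x * h x * gp f h x) + f x * f x * gp h h x"
    unfolding gp_diff_scaled[OF f h] gp_sym[OF x, of h f] by (simp add: algebra_simps)
  finally show ?thesis unfolding 1 by (simp add: power2_eq_square)
qed

lemma gp_sum:
  assumes "\<And>s. s \<in> S \<Longrightarrow> f s differentiable at x"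
  shows "gp (\<lambda>y. \<Sum>s\<in>S. f s y) h x = (\<Sum>s\<in>S. gp (f s) h x)"
proof -
  have ps: "partial i (\<lambda>y. \<Sum>s\<in>S. f s y) x = (\<Sum>s\<in>S. partial i (f s) x)" for i
    by (rule partial_sum(1)) (rule assms)
  have "gp (\<lambda>y. \<Sum>s\<in>S. f s y) h x = (\<Sum>i\<in>UNIV. \<Sum>j\<in>UNIV. \<Sum>s\<in>S. gi i j x * partial i (f s) x * partial j h x)"
    unfolding gp_def ps by (simp only: sum_distrib_left sum_distrib_right)
  also have "\<dots> = (\<Sum>i\<in>UNIV. \<Sum>s\<in>S. \<Sum>j\<in>UNIV. gi i j x * partial i (f s) x * partial j h x)"
    by (intro sum.cong refl) (rule sum.swap)
  also have "\<dots> = (\<Sum>s\<in>S. gp (f s) h x)" unfolding gp_def by (rule sum.swap)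
  finally show ?thesis .
qed

lemma gp_cong:
  assumes "\<And>y. y \<in> U \<Longrightarrow> f y = f' y" "\<And>y. y \<in> U \<Longrightarrow> h y = h' y" "x \<in> U"
  shows "gp f h x = gp f' h' x"
  unfolding gp_def using partial_cong_U[OF assms(1,3)] partial_cong_U[OF assms(2,3)] by simp

end

context riemannian
begin

lemma CkM_mono: "CkM k u \<Longrightarrow> j \<le> k \<Longrightarrow> CkM j u"
  unfolding CkM_def using Ck_mono by blast

lemma CkM_const: "CkM k (\<lambda>p. a)" by (simp add: CkM_def o_def Ck_const)

lemma CkM_add: "CkM k u \<Longrightarrow> CkM k v \<Longrightarrow> CkM k (\<lambda>p. u p + v p)"
  unfolding CkM_def o_def by (intro ballI, rule Ck_add[OF open_img], assumption, erule (1) bspec, erule (1) bspec)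

lemma CkM_mult: "CkM k u \<Longrightarrow> CkM k v \<Longrightarrow> CkM k (\<lambda>p. u p * v p)"
  unfolding CkM_def o_def by (intro ballI, rule Ck_mult[OF open_img], assumption, erule (1) bspec, erule (1) bspec)

lemma CkM_sum: "(\<And>s. s \<in> S \<Longrightarrow> CkM k (u s)) \<Longrightarrow> CkM k (\<lambda>p. \<Sum>s\<in>S. u s p)"
  unfolding CkM_def o_def by (intro ballI, rule Ck_sum[OF open_img], assumption, blast)

lemma CkM_continuous: assumes u: "CkM k u" shows "continuous_on UNIV u"
proof -
  have "continuous_on (\<Union>c\<in>A. dom_of c) u"
    by (intro continuous_on_open_UN open_dom continuous_on_of_chart Ck_imp_continuous_on[OF CkM_chart[OF u]])
  moreover have "(\<Union>c\<in>A. dom_of c) = UNIV" using chart_cover by blast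
  ultimately show ?thesis by simp
qed

definition grp :: "('a \<Rightarrow> real) \<Rightarrow> ('a \<Rightarrow> real) \<Rightarrow> 'a \<Rightarrow> real" where
  "grp u v p = gpc (chart_at A p) u v p"

abbreviation Lap :: "('a \<Rightarrow> real) \<Rightarrow> 'a \<Rightarrow> real" where "Lap \<equiv> laplacian A G"

text \<open>The chart selected by \<open>Lap\<close> varies with the point. Regularity can be read
  off only after the Laplacian has been expressed in one chart on a whole neighbourhood.\<close>

lemma Lap_chart: "CkM 3 u \<Longrightarrow> c \<in> A \<Longrightarrow> p \<in> dom_of c \<Longrightarrow> Lap u p = lapc c u p"
  unfolding laplacian_chart_at by (rule lapc_chart_change[OF chart_at_in(1) _ chart_at_in(2)]) (simp_all add: numeral_3_eq_3 del: Ck.simps)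

lemma grp_chart: "CkM (Suc 0) u \<Longrightarrow> CkM (Suc 0) v \<Longrightarrow> c \<in> A \<Longrightarrow> p \<in> dom_of c \<Longrightarrow> grp u v p = gpc c u v p"
  unfolding grp_def by (rule gpc_chart_change[OF chart_at_in(1) _ chart_at_in(2)]) (rule CkM_differentiable | assumption)+

lemma CkM_Lap:
  assumes u: "CkM 3 u" and uk: "CkM (Suc (Suc k)) u" shows "CkM k (Lap u)"
  unfolding CkM_def
proof
  fix c assume c: "c \<in> A"
  interpret C: coord_metric "img c" "gm c" by (rule chart_metric[OF c])
  show "Ck k (img c) (Lap u \<circ> param c)"
  proof (rule Ck_cong[OF open_img[OF c] _ C.lap_Ck[OF CkM_chart[OF uk c]]])
    show "C.lap (u \<circ> param c) x = (Lap u \<circ> param c) x" if "x \<in> img c" for x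
      using Lap_chart[OF u c param_in_dom[OF c that]] by (simp add: lapc_def coord_param[OF c that])
  qed
qed

lemma CkM_grp:
  assumes u: "CkM (Suc k) u" and v: "CkM (Suc k) v" shows "CkM k (grp u v)"
  unfolding CkM_def
proof
  fix c assume c: "c \<in> A"
  interpret C: coord_metric "img c" "gm c" by (rule chart_metric[OF c])
  have uv: "CkM (Suc 0) u" "CkM (Suc 0) v" using u v CkM_mono by auto
  show "Ck k (img c) (grp u v \<circ> param c)"
  proof (rule Ck_cong[OF open_img[OF c] _ C.gp_Ck[OF CkM_chart[OF u c] CkM_chart[OF v c]]])
    show "C.gp (u \<circ> param c) (v \<circ> param c) x = (grp u v \<circ> param c) x" if "x \<in> img c" for x
      using grp_chart[OF uv c param_in_dom[OF c that]] by (simp add: gpc_def coord_param[OF c that])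
  qed
qed

lemma smooth_CkM: "smooth_map A u \<Longrightarrow> CkM k u" by (simp add: smooth_map_iff_CkM)

lemma smooth_Lap: "smooth_map A u \<Longrightarrow> smooth_map A (Lap u)"
  unfolding smooth_map_iff_CkM by (blast intro: CkM_Lap)

lemma smooth_mult: "smooth_map A (u :: 'a \<Rightarrow> real) \<Longrightarrow> smooth_map A v \<Longrightarrow> smooth_map A (\<lambda>p. u p * v p)"
  by (simp add: smooth_map_iff_CkM CkM_mult)

lemma smooth_add: "smooth_map A (u :: 'a \<Rightarrow> real) \<Longrightarrow> smooth_map A v \<Longrightarrow> smooth_map A (\<lambda>p. u p + v p)"
  by (simp add: smooth_map_iff_CkM CkM_add)

lemma smooth_const: "smooth_map A (\<lambda>p. a :: real)"
  unfolding smooth_map_iff_CkM by (blast intro: CkM_const)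

lemma
  shows grp_sym: "grp u v p = grp v u p" and grp_nonneg: "0 \<le> grp u u p"
proof -
  let ?c = "chart_at A p"
  interpret C: coord_metric "img ?c" "gm ?c" by (rule chart_metric[OF chart_at_in(1)])
  have x: "coord ?c p \<in> img ?c" using chart_at_in(2) by simp
  show "grp u v p = grp v u p" unfolding grp_def gpc_def by (rule C.gp_sym[OF x])
  show "0 \<le> grp u u p" unfolding grp_def gpc_def by (rule C.gp_nonneg[OF x])
qed

lemma grp_mult_self_le:
  assumes u: "CkM (Suc 0) u" and v: "CkM (Suc 0) v"
  shows "grp (\<lambda>q. u q * v q) (\<lambda>q. u q * v q) p \<le> 2 * (u p)\<^sup>2 * grp v v p + 2 * (v p)\<^sup>2 * grp u u p"
proof -
  let ?c = "chart_at A p"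
  interpret C: coord_metric "img ?c" "gm ?c" by (rule chart_metric[OF chart_at_in(1)])
  have x: "coord ?c p \<in> img ?c" using chart_at_in(2) by simp
  from C.gp_mult_self_le[OF x CkM_differentiable[OF u chart_at_in] CkM_differentiable[OF v chart_at_in]]
  show ?thesis unfolding grp_def gpc_def o_def by (simp only: param_coord[OF chart_at_in])
qed

lemma grp_sum:
  assumes "\<And>s. s \<in> S \<Longrightarrow> CkM (Suc 0) (f s)"
  shows "grp (\<lambda>p. \<Sum>s\<in>S. f s p) v p = (\<Sum>s\<in>S. grp (f s) v p)"
proof -
  let ?c = "chart_at A p"
  interpret C: coord_metric "img ?c" "gm ?c" by (rule chart_metric[OF chart_at_in(1)])
  from C.gp_sum[of S "\<lambda>s. f s \<circ> param ?c", OF CkM_differentiable[OF assms chart_at_in]]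
  show ?thesis unfolding grp_def gpc_def by (simp add: o_def)
qed

lemma Lap_add:
  assumes u: "CkM (Suc (Suc 0)) u" and v: "CkM (Suc (Suc 0)) v"
  shows "Lap (\<lambda>p. u p + v p) = (\<lambda>p. Lap u p + Lap v p)"
proof
  fix p
  let ?c = "chart_at A p"
  interpret C: coord_metric "img ?c" "gm ?c" by (rule chart_metric[OF chart_at_in(1)])
  have x: "coord ?c p \<in> img ?c" using chart_at_in(2) by simp
  from C.lap_add[OF CkM_chart[OF u chart_at_in(1)] CkM_chart[OF v chart_at_in(1)] x]
  show "Lap (\<lambda>p. u p + v p) p = Lap u p + Lap v p" unfolding laplacian_chart_at lapc_def by (simp add: o_def)
qed

lemma Lap_scale:
  assumes u: "CkM (Suc (Suc 0)) u"
  shows "Lap (\<lambda>p. a * u p) = (\<lambda>p. a * Lap u p)"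
proof
  fix p
  let ?c = "chart_at A p"
  interpret C: coord_metric "img ?c" "gm ?c" by (rule chart_metric[OF chart_at_in(1)])
  have x: "coord ?c p \<in> img ?c" using chart_at_in(2) by simp
  from C.lap_scale[OF CkM_chart[OF u chart_at_in(1)] x]
  show "Lap (\<lambda>p. a * u p) p = a * Lap u p" unfolding laplacian_chart_at lapc_def by (simp add: o_def)
qed

lemma Lap_mult:
  assumes u: "CkM (Suc (Suc 0)) u" and v: "CkM (Suc (Suc 0)) v"
  shows "Lap (\<lambda>p. u p * v p) p = u p * Lap v p + v p * Lap u p + 2 * grp u v p"
proof -
  let ?c = "chart_at A p"
  interpret C: coord_metric "img ?c" "gm ?c" by (rule chart_metric[OF chart_at_in(1)])
  have x: "coord ?c p \<in> img ?c" using chart_at_in(2) by simp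
  from C.lap_mult[OF CkM_chart[OF u chart_at_in(1)] CkM_chart[OF v chart_at_in(1)] x]
  show ?thesis unfolding laplacian_chart_at lapc_def grp_def gpc_def
    by (simp add: o_def param_coord[OF chart_at_in])
qed

lemma grp_mult:
  assumes u: "CkM (Suc 0) u" and v: "CkM (Suc 0) v"
  shows "grp w (\<lambda>q. u q * v q) p = u p * grp w v p + v p * grp w u p"
proof -
  let ?c = "chart_at A p"
  interpret C: coord_metric "img ?c" "gm ?c" by (rule chart_metric[OF chart_at_in(1)])
  from C.gp_mult[OF CkM_differentiable[OF u chart_at_in] CkM_differentiable[OF v chart_at_in]]
  show ?thesis unfolding grp_sym[of w] unfolding grp_def gpc_def by (simp add: o_def param_coord[OF chart_at_in])
qed

section \<open>Localisation to charts and Green's formula on the manifold\<close>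

lemma grp_zero_outside:
  assumes "closed K" "p \<notin> K" "\<And>q. q \<notin> K \<Longrightarrow> b q = 0" shows "grp b v p = 0"
  unfolding grp_def by (rule gpc_zero_outside[OF chart_at_in assms])

lemma Lap_zero_outside:
  assumes K: "closed K" "p \<notin> K" and u: "\<And>q. q \<notin> K \<Longrightarrow> u q = 0" shows "Lap u p = 0"
proof -
  let ?c = "chart_at A p"
  interpret C: coord_metric "img ?c" "gm ?c" by (rule chart_metric[OF chart_at_in(1)])
  let ?W = "coord ?c ` (dom_of ?c - K)"
  have oW: "open ?W" by (rule open_coord_image[OF chart_at_in(1) open_Diff[OF open_dom[OF chart_at_in(1)] K(1)]]) auto
  have z0: "(u \<circ> param ?c) y = 0" if "y \<in> ?W" for y using that by (auto simp: param_coord[OF chart_at_in(1)] u)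
  have z: "partial i (u \<circ> param ?c) y = 0" if "y \<in> ?W" for i y
  proof -
    have "partial i (u \<circ> param ?c) y = partial i (\<lambda>x. 0) y" by (rule partial_cong[OF oW z0 that])
    then show ?thesis by simp
  qed
  have "C.Fl (u \<circ> param ?c) i y = 0" if "y \<in> ?W" for i y
    unfolding C.Fl_def by (simp only: z[OF that] mult_zero_right sum.neutral_const)
  then have "partial i (C.Fl (u \<circ> param ?c) i) (coord ?c p) = 0" for i
    using partial_cong[OF oW, of "C.Fl (u \<circ> param ?c) i" "\<lambda>x. 0" "coord ?c p" i] K chart_at_in(2)[of p] by auto
  then show ?thesis unfolding laplacian_chart_at lapc_def C.lap_def by simp
qed

text \<open>Takes the place of a partition of unity: the functions are not normalised, but their sum
  is positive on \<open>K\<close>, so the user can divide by it.\<close>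

lemma chart_bumps:
  assumes K: "compact K"
  obtains S and c :: "'a \<Rightarrow> ('a, 'n) chart" and B :: "'a \<Rightarrow> 'a set" and b :: "'a \<Rightarrow> 'a \<Rightarrow> real"
  where "finite S" "\<And>s. c s \<in> A" "\<And>s. compact (B s)" "\<And>s. B s \<subseteq> dom_of (c s)"
    "\<And>s. CkM (Suc 0) (b s)" "\<And>s p. 0 \<le> b s p" "\<And>s p. p \<notin> B s \<Longrightarrow> b s p = 0"
    "\<And>p. p \<in> K \<Longrightarrow> \<exists>s\<in>S. 0 < b s p"
proof -
  define Q where "Q s B b \<longleftrightarrow> compact B \<and> B \<subseteq> dom_of (chart_at A s) \<and> CkM (Suc 0) b \<and> (\<forall>p. 0 \<le> b p) \<and> (\<forall>p. p \<notin> B \<longrightarrow> b p = 0) \<and> 0 < b s" for s B b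
  have ex: "\<forall>s. \<exists>B b. Q s B b"
  proof
    fix s
    define c where "c = chart_at A s"
    have c: "c \<in> A" "s \<in> dom_of c" unfolding c_def by (rule chart_at_in)+
    let ?z = "coord c s"
    obtain t where t: "t > 0" "cball ?z t \<subseteq> img c"
      using open_img[OF c(1)] c(2) open_contains_cball by blast
    define \<beta> where "\<beta> x = bump ?z t x" for x
    define B where "B = param c ` cball ?z t"
    define b where "b q = (if q \<in> dom_of c then \<beta> (coord c q) else 0)" for q
    have "compact B" unfolding B_def
      by (intro compact_continuous_image continuous_on_subset[OF continuous_on_param[OF c(1)] t(2)]) auto
    moreover have BD: "B \<subseteq> dom_of c" unfolding B_def using t(2) param_in_dom[OF c(1)] by blast
    moreover have b0: "b q = 0" if "q \<notin> B" for q
    proof (cases "q \<in> dom_of c")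
      case True
      have "coord c q \<notin> cball ?z t"
      proof
        assume "coord c q \<in> cball ?z t"
        then have "param c (coord c q) \<in> B" unfolding B_def by (rule imageI)
        then show False using that True by (simp add: param_coord[OF c(1)])
      qed
      from bump_zero[OF t(1) this] show ?thesis by (simp add: b_def \<beta>_def)
    qed (simp add: b_def)
    moreover have "CkM (Suc 0) b"
    proof (rule CkM_extend[OF c(1) \<open>compact B\<close> BD b0])
      show "Ck (Suc 0) (img c) (b \<circ> param c)"
      proof (rule Ck_cong[OF open_img[OF c(1)]])
        show "Ck (Suc 0) (img c) \<beta>" unfolding \<beta>_def[abs_def] by (rule bump_Ck[OF open_img[OF c(1)]])
        show "\<beta> x = (b \<circ> param c) x" if "x \<in> img c" for x
          using that by (simp add: b_def param_in_dom[OF c(1)] coord_param[OF c(1)])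
      qed
    qed
    moreover have "0 \<le> b p" for p by (simp add: b_def \<beta>_def bump_nonneg)
    moreover have "0 < b s" using c(2) bump_pos[OF t(1)] by (simp add: b_def \<beta>_def)
    ultimately show "\<exists>B b. Q s B b" unfolding Q_def c_def[symmetric] by (intro exI[of _ B] exI[of _ b]) blast
  qed
  from choice[OF ex] obtain B where B: "\<forall>s. \<exists>b. Q s (B s) b" by (elim exE)
  from choice[OF B] obtain b where b: "\<forall>s. Q s (B s) (b s)" by (elim exE)
  note b = b[unfolded Q_def]
  let ?N = "\<lambda>s. {p. 0 < b s p}"
  have oN: "open (?N s)" for s
    using open_Collect_less[of "\<lambda>p. 0" "b s"] CkM_continuous[of "Suc 0" "b s"] b by simp
  have KN: "K \<subseteq> (\<Union>s\<in>K. ?N s)" using b by blast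
  obtain S where S: "S \<subseteq> K" "finite S" "K \<subseteq> (\<Union>s\<in>S. ?N s)"
    using compactE_image[OF K oN KN] by blast
  show thesis
    by (rule that[of S "chart_at A" B b]) (use S b chart_at_in(1) in blast)+
qed

text \<open>At a zero of \<open>h\<close> the function \<open>f\<close> vanishes too, and the
  quotient is 0 by convention. The open sets where \<open>h\<close> is nonzero and where the point
  is off \<open>K\<close> cover the manifold.\<close>

lemma CkM_divide_support:
  assumes K: "closed K" and f: "CkM k f" "\<And>p. p \<notin> K \<Longrightarrow> f p = 0" and h: "CkM k h" "\<And>p. p \<in> K \<Longrightarrow> h p \<noteq> 0"
  shows "CkM k (\<lambda>p. f p / h p)"
  unfolding CkM_def
proof
  fix c assume c: "c \<in> A"
  have oh: "open {p. h p \<noteq> 0}"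
    using open_Collect_neq[of h "\<lambda>p. 0"] CkM_continuous[OF h(1)] by simp
  let ?V = "coord c ` (dom_of c \<inter> {p. h p \<noteq> 0})" and ?W = "coord c ` (dom_of c - K)"
  have un: "img c = ?V \<union> ?W" using h(2) by auto
  have oV: "open ?V" by (rule open_coord_image[OF c open_Int[OF open_dom[OF c] oh]]) auto
  have oW: "open ?W" by (rule open_coord_image[OF c open_Diff[OF open_dom[OF c] K]]) auto
  have "Ck k ?V (\<lambda>x. (f \<circ> param c) x / (h \<circ> param c) x)"
    by (rule Ck_divide[OF oV Ck_subset[OF CkM_chart[OF f(1) c]] Ck_subset[OF CkM_chart[OF h(1) c]]])
      (auto simp: param_coord[OF c])
  then have "Ck k ?V ((\<lambda>p. f p / h p) \<circ> param c)" by (simp add: o_def)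
  moreover have "Ck k ?W ((\<lambda>p. f p / h p) \<circ> param c)"
    by (rule Ck_cong[OF oW _ Ck_const[of k _ 0]]) (auto simp: param_coord[OF c] f(2))
  ultimately show "Ck k (img c) ((\<lambda>p. f p / h p) \<circ> param c)" unfolding un by (intro Ck_Un oV oW)
qed

text \<open>With \<open>h\<close> the sum of the cut-offs, \<open>f\<close> is the sum of the
  functions \<open>b s * (f / h)\<close>, each supported in one chart. The pieces can be added
  because Laplacian and pairing do not depend on the chart.\<close>

theorem green_formula:
  assumes K: "compact K" and f0: "\<And>p. p \<notin> K \<Longrightarrow> f p = 0" and f: "CkM (Suc 0) f" and u: "CkM 3 u"
  shows "integrable vol (\<lambda>p. f p * Lap u p)"
    and "integrable vol (grp f u)"
    and "(\<integral>p. f p * Lap u p \<partial>vol) = - (\<integral>p. grp f u p \<partial>vol)"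
proof -
  obtain S :: "'a set" and c B b where S: "finite S" and c: "\<And>s. c s \<in> A" and B: "\<And>s. compact (B s)" "\<And>s. B s \<subseteq> dom_of (c s)"
    and b: "\<And>s. CkM (Suc 0) (b s)" "\<And>s p. 0 \<le> b s p" "\<And>s p. p \<notin> B s \<Longrightarrow> b s p = 0"
    and pos: "\<And>p. p \<in> K \<Longrightarrow> \<exists>s\<in>S. 0 < b s p"
    by (rule chart_bumps[OF K], rule that) (assumption+)
  define h where "h p = (\<Sum>s\<in>S. b s p)" for p
  have hpos: "h p \<noteq> 0" if p: "p \<in> K" for p
  proof -
    obtain s where s: "s \<in> S" "0 < b s p" using pos[OF p] by blast
    have "0 < h p" unfolding h_def by (rule sum_pos2[where f="\<lambda>s. b s p", OF S s]) (rule b(2))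
    then show ?thesis by simp
  qed
  have hC: "CkM (Suc 0) h" unfolding h_def[abs_def] by (intro CkM_sum b(1))
  define q where "q p = f p / h p" for p
  have qC: "CkM (Suc 0) q" unfolding q_def[abs_def] by (rule CkM_divide_support[OF compact_imp_closed[OF K] f f0 hC hpos])
  let ?f = "\<lambda>s p. b s p * q p"
  have fC: "CkM (Suc 0) (?f s)" for s by (intro CkM_mult b(1) qC)
  have fz: "?f s p = 0" if "p \<notin> B s" for s p using b(3)[OF that] by simp
  have fsum: "f p = (\<Sum>s\<in>S. ?f s p)" for p
  proof (cases "p \<in> K")
    case True
    have "(\<Sum>s\<in>S. ?f s p) = h p * q p" by (simp only: h_def sum_distrib_right)
    then show ?thesis using hpos[OF True] by (simp add: q_def)
  qed (simp add: q_def f0)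
  have u1: "CkM (Suc 0) u" and u2: "CkM (Suc (Suc 0)) u" using CkM_mono[OF u] by simp_all
  have e1: "?f s p * lapc (c s) u p = ?f s p * Lap u p" for s p
  proof (cases "p \<in> B s")
    case True
    then show ?thesis using Lap_chart[OF u c[of s], of p] B(2)[of s] by auto
  qed (simp add: b(3))
  have e2: "indicator (dom_of (c s)) p * gpc (c s) (?f s) u p = grp (?f s) u p" for s p
  proof (cases "p \<in> dom_of (c s)")
    case True
    then show ?thesis using grp_chart[OF fC u1 c True] by simp
  next
    case False
    then have "p \<notin> B s" using B(2) by blast
    from grp_zero_outside[where b="?f s", OF compact_imp_closed[OF B(1)] this fz] False show ?thesis by simp
  qed
  have g1: "integrable vol (\<lambda>p. ?f s p * Lap u p)" and g2: "integrable vol (grp (?f s) u)"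
    and g3: "(\<integral>p. ?f s p * Lap u p \<partial>vol) = - (\<integral>p. grp (?f s) u p \<partial>vol)" for s
  proof -
    have "integrable vol (\<lambda>p. ?f s p * lapc (c s) u p)"
      by (rule green_chart(1)[OF c B fz CkM_chart[OF fC c] CkM_chart[OF u2 c]])
    then show "integrable vol (\<lambda>p. ?f s p * Lap u p)" unfolding e1 .
    have "integrable vol (\<lambda>p. indicator (dom_of (c s)) p * gpc (c s) (?f s) u p)"
      by (rule green_chart(2)[OF c B fz CkM_chart[OF fC c] CkM_chart[OF u2 c]])
    then show "integrable vol (grp (?f s) u)" unfolding e2 .
    have "(\<integral>p. ?f s p * lapc (c s) u p \<partial>vol) = - (\<integral>p. indicator (dom_of (c s)) p * gpc (c s) (?f s) u p \<partial>vol)"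
      by (rule green_chart(3)[OF c B fz CkM_chart[OF fC c] CkM_chart[OF u2 c]])
    then show "(\<integral>p. ?f s p * Lap u p \<partial>vol) = - (\<integral>p. grp (?f s) u p \<partial>vol)" unfolding e1 e2 .
  qed
  have fe: "f = (\<lambda>p. \<Sum>s\<in>S. ?f s p)" using fsum by (rule ext)
  have s1: "f p * Lap u p = (\<Sum>s\<in>S. ?f s p * Lap u p)" for p by (subst fsum) (simp only: sum_distrib_right)
  have s2: "grp f u p = (\<Sum>s\<in>S. grp (?f s) u p)" for p by (subst fe) (rule grp_sum[OF fC])
  have s2': "grp f u = (\<lambda>p. \<Sum>s\<in>S. grp (?f s) u p)" by (rule ext) (rule s2)
  show "integrable vol (\<lambda>p. f p * Lap u p)" unfolding s1 by (intro Bochner_Integration.integrable_sum g1)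
  show "integrable vol (grp f u)" unfolding s2' by (intro Bochner_Integration.integrable_sum g2)
  have "(\<integral>p. f p * Lap u p \<partial>vol) = (\<Sum>s\<in>S. \<integral>p. ?f s p * Lap u p \<partial>vol)"
    unfolding s1 by (rule Bochner_Integration.integral_sum) (rule g1)
  also have "\<dots> = - (\<Sum>s\<in>S. \<integral>p. grp (?f s) u p \<partial>vol)" unfolding g3 sum_negf ..
  also have "(\<Sum>s\<in>S. \<integral>p. grp (?f s) u p \<partial>vol) = (\<integral>p. grp f u p \<partial>vol)"
    unfolding s2 by (rule Bochner_Integration.integral_sum[symmetric]) (rule g2)
  finally show "(\<integral>p. f p * Lap u p \<partial>vol) = - (\<integral>p. grp f u p \<partial>vol)" .
qed

end

section \<open>Rellich's inequality in a chart\<close>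

lemma compact_continuous_bounded:
  fixes f :: "'b::topological_space \<Rightarrow> real"
  assumes "compact K" "continuous_on K f"
  obtains C where "0 < C" "\<And>x. x \<in> K \<Longrightarrow> \<bar>f x\<bar> \<le> C"
proof -
  have "bounded (f ` K)" by (intro compact_imp_bounded compact_continuous_image assms)
  then obtain C where "\<forall>y\<in>f ` K. norm y \<le> C" by (auto simp: bounded_iff)
  then have C: "\<bar>f x\<bar> \<le> C" if "x \<in> K" for x using that by fastforce
  show thesis
  proof (rule that)
    show "0 < \<bar>C\<bar> + 1" by simp
    show "\<bar>f x\<bar> \<le> \<bar>C\<bar> + 1" if "x \<in> K" for x using C[OF that] by linarith
  qed
qed

context riemannian
begin

lemma integrable_vol_compact:
  fixes f :: "'a \<Rightarrow> real"
  assumes f: "continuous_on UNIV f" and K: "compact K" "\<And>p. p \<notin> K \<Longrightarrow> f p = 0"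
  shows "integrable vol f"
proof -
  obtain C where C: "0 < C" "\<And>p. p \<in> K \<Longrightarrow> \<bar>f p\<bar> \<le> C"
    by (rule compact_continuous_bounded[OF K(1) continuous_on_subset[OF f subset_UNIV]]) (rule that)
  have Ks: "K \<in> sets vol" using compact_imp_closed[OF K(1)] by simp
  show ?thesis
  proof (rule Bochner_Integration.integrable_bound)
    show "integrable vol (\<lambda>p. C * indicator K p)"
      using emeasure_vol_compact_finite[OF K(1)] Ks by (intro integrable_mult_right integrable_real_indicator)
    show "f \<in> borel_measurable vol" using borel_measurable_continuous_onI[OF f] by simp
    show "AE p in vol. norm (f p) \<le> norm (C * indicator K p)"
      by (rule AE_I2) (use C K(2) in \<open>auto simp: indicator_def\<close>)
  qed
qed

lemma borel_chart_compose:
  fixes g :: "real^'n \<Rightarrow> real"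
  assumes c: "c \<in> A" and g: "g \<in> borel_measurable borel"
  shows "(\<lambda>p. indicator (dom_of c) p * g (coord c p)) \<in> borel_measurable borel"
proof -
  have "coord c \<in> measurable (restrict_space borel (dom_of c)) borel"
    by (rule borel_measurable_continuous_on_restrict[OF continuous_on_coord[OF c]])
  then have "(\<lambda>p. g (coord c p)) \<in> borel_measurable (restrict_space borel (dom_of c))"
    using g by (rule measurable_compose)
  then show ?thesis
    using borel_measurable_restrict_space_iff[of "dom_of c" borel "\<lambda>p. g (coord c p)"] img_sets(2)[OF c] by simp
qed

text \<open>Rellich's inequality carried over from the chart: on the compact image of
  \<open>B\<close> the density is bounded above and below, and \<open>grad2\<close> is dominated by
  \<open>gp\<close>. The functionals are made to act on \<open>\<phi>\<close> instead of
  \<open>b * \<phi>\<close>, so that those of several charts can be collected.\<close>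

lemma chart_compactness:
  assumes c: "c \<in> A" and B: "compact B" "B \<subseteq> dom_of c" and b: "CkM (Suc 0) b" "\<And>p. p \<notin> B \<Longrightarrow> b p = 0"
    and e: "0 < e" and a: "0 < (a :: real)"
  shows "\<exists>N (h :: nat \<Rightarrow> 'a \<Rightarrow> real). (\<forall>r<N. h r \<in> borel_measurable borel \<and> (\<exists>C. \<forall>p. \<bar>h r p\<bar> \<le> C)) \<and>
    (\<forall>\<phi>. CkM (Suc 0) \<phi> \<longrightarrow> a * (\<integral>p. (b p * \<phi> p)\<^sup>2 \<partial>vol) \<le>
       e * (\<integral>p. grp (\<lambda>p. b p * \<phi> p) (\<lambda>p. b p * \<phi> p) p \<partial>vol) + (\<Sum>r<N. (\<integral>p. h r p * \<phi> p \<partial>vol)\<^sup>2))"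
proof -
  interpret C: coord_metric "img c" "gm c" by (rule chart_metric[OF c])
  let ?K = "coord c ` B"
  have K: "compact ?K" "?K \<subseteq> img c"
    using B by (auto intro: compact_continuous_image continuous_on_subset[OF continuous_on_coord[OF c]])
  have bK: "b (param c x) = 0" if "x \<in> img c" "x \<notin> ?K" for x
  proof (rule b(2))
    show "param c x \<notin> B"
    proof
      assume "param c x \<in> B"
      then have "coord c (param c x) \<in> ?K" by (rule imageI)
      then show False using that coord_param[OF c, of x] by simp
    qed
  qed
  obtain R1 where R1: "0 < R1" "\<And>x. x \<in> ?K \<Longrightarrow> \<bar>rho c x\<bar> \<le> R1"
    by (rule compact_continuous_bounded[OF K(1) continuous_on_subset[OF continuous_on_rho[OF c] K(2)]]) (rule that)
  have "continuous_on ?K (\<lambda>x. 1 / rho c x)"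
    by (intro continuous_on_divide continuous_on_const continuous_on_subset[OF continuous_on_rho[OF c] K(2)])
      (use rho_pos[OF c] K(2) in force)
  then obtain R2 where R2: "0 < R2" "\<And>x. x \<in> ?K \<Longrightarrow> \<bar>1 / rho c x\<bar> \<le> R2"
    by (rule compact_continuous_bounded[OF K(1)]) (rule that)
  obtain C where C: "0 < C" "\<And>f x. x \<in> ?K \<Longrightarrow> grad2 f x \<le> C * C.gp f f x"
    by (rule C.grad2_le_gp[OF K]) (rule that)
  have rp: "0 < rho c x" if "x \<in> ?K" for x using rho_pos[OF c] K(2) that by blast
  have R2': "1 \<le> R2 * rho c x" if "x \<in> ?K" for x
    using R2(2)[OF that] rp[OF that] by (simp add: field_simps)
  \<comment> \<open>\<open>R1\<close> pays for the change of measure on the left,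
    \<open>C * R2\<close> for the change of gradient and measure on the right; after both the factor
    of the energy is exactly \<open>e\<close>.\<close>
  define e' where "e' = e / (a * R1 * (C * R2))"
  have e': "0 < e'" using e a R1(1) C(1) R2(1) by (simp add: e'_def)
  obtain N and g :: "nat \<Rightarrow> real^'n \<Rightarrow> real" where
    g: "\<forall>r<N. g r \<in> borel_measurable borel \<and> (\<exists>C. \<forall>x. \<bar>g r x\<bar> \<le> C)"
    and gf: "\<forall>f. Ck (Suc 0) UNIV f \<longrightarrow> (\<forall>x. x \<notin> ?K \<longrightarrow> f x = 0) \<longrightarrow>
      (\<integral>x. (f x)\<^sup>2 \<partial>lborel) \<le> e' * (\<integral>x. grad2 f x \<partial>lborel) + (\<Sum>r<N. (\<integral>x. g r x * f x \<partial>lborel)\<^sup>2)"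
    using rellich_inequality[OF K(1) e'] by (elim exE conjE)
  \<comment> \<open>Division by the density turns the functionals with respect to the volume into
    the Lebesgue integrals of Rellich's inequality.\<close>
  define k where "k p = (if p \<in> dom_of c then b p / rho c (coord c p) else 0)" for p
  define h where "h r p = sqrt (a * R1) * ((indicator (dom_of c) p * g r (coord c p)) * k p)" for r p
  have kc: "continuous_on (dom_of c) k"
  proof (rule continuous_on_eq)
    show "continuous_on (dom_of c) (\<lambda>p. b p / rho c (coord c p))"
      by (intro continuous_on_divide continuous_on_subset[OF CkM_continuous[OF b(1)] subset_UNIV]
          continuous_on_chart[OF c continuous_on_rho[OF c]]) (use rho_pos[OF c] in force)
  qed (simp add: k_def)
  have km: "k \<in> borel_measurable borel" by (rule borel_chart[OF c kc]) (simp add: k_def)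
  obtain Bk where Bk: "0 < Bk" "\<And>p. p \<in> B \<Longrightarrow> \<bar>k p\<bar> \<le> Bk"
    by (rule compact_continuous_bounded[OF B(1) continuous_on_subset[OF kc B(2)]]) (rule that)
  have Bk': "\<bar>k p\<bar> \<le> Bk" for p
    using Bk b(2)[of p] by (cases "p \<in> B") (auto simp: k_def)
  have h1: "h r \<in> borel_measurable borel" if "r < N" for r
    unfolding h_def[abs_def] using borel_chart_compose[OF c, of "g r"] g that
    by (intro borel_measurable_times[OF borel_measurable_const borel_measurable_times[OF _ km]]) auto
  have h2: "\<exists>C. \<forall>p. \<bar>h r p\<bar> \<le> C" if r: "r < N" for r
  proof -
    obtain Cg where Cg: "\<forall>x. \<bar>g r x\<bar> \<le> Cg" using g r by blast
    have "\<bar>h r p\<bar> \<le> sqrt (a * R1) * (Cg * Bk)" for p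
    proof -
      have "\<bar>indicator (dom_of c) p * g r (coord c p)\<bar> \<le> Cg"
        using Cg[rule_format, of "coord c p"] by (auto simp: indicator_def)
      then have "\<bar>indicator (dom_of c) p * g r (coord c p)\<bar> * \<bar>k p\<bar> \<le> Cg * Bk"
        using Bk' by (intro mult_mono) (auto intro: order_trans[OF abs_ge_zero])
      then show ?thesis unfolding h_def abs_mult using a R1(1) by (simp add: mult_left_mono abs_mult)
    qed
    then show ?thesis by blast
  qed
  have main: "a * (\<integral>p. (b p * \<phi> p)\<^sup>2 \<partial>vol) \<le>
       e * (\<integral>p. grp (\<lambda>p. b p * \<phi> p) (\<lambda>p. b p * \<phi> p) p \<partial>vol) + (\<Sum>r<N. (\<integral>p. h r p * \<phi> p \<partial>vol)\<^sup>2)"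
    if \<phi>: "CkM (Suc 0) \<phi>" for \<phi>
  proof -
    let ?u = "\<lambda>p. b p * \<phi> p"
    have uC: "CkM (Suc 0) ?u" by (rule CkM_mult[OF b(1) \<phi>])
    have u0: "?u p = 0" if "p \<notin> B" for p using b(2)[OF that] by simp
    define f where "f x = (if x \<in> img c then (?u \<circ> param c) x else 0)" for x
    have fU: "f x = (?u \<circ> param c) x" if "x \<in> img c" for x using that by (simp add: f_def)
    have f0: "f x = 0" if "x \<notin> ?K" for x using bK[of x] that by (simp add: f_def)
    have z: "(?u \<circ> param c) x = 0" if "x \<in> img c - ?K" for x using bK[of x] that by simp
    have fC: "Ck (Suc 0) UNIV f" unfolding f_def[abs_def]
      by (rule Ck_extend_zero[OF open_img[OF c] K CkM_chart[OF uC c] z])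
    have f2: "integrable lborel (\<lambda>x. (f x)\<^sup>2)"
      by (rule integrable_continuous_compact_support[OF _ K(1)])
        (auto intro!: continuous_on_power Ck_imp_continuous_on[OF fC] simp: f0 simp del: image_eqI)
    have um: "(\<lambda>p. (?u p)\<^sup>2) \<in> borel_measurable borel"
      by (intro borel_measurable_continuous_onI continuous_on_power CkM_continuous[OF uC])
    have uz: "(?u p)\<^sup>2 = 0" if "p \<notin> dom_of c" for p using u0[of p] that B(2) by auto
    have i1: "(\<integral>p. (?u p)\<^sup>2 \<partial>vol) = (\<integral>x. indicator (img c) x * (rho c x * (?u (param c x))\<^sup>2) \<partial>lborel)"
      by (rule integral_chart[OF c um uz])
    have "integrable vol (\<lambda>p. (?u p)\<^sup>2)"
      by (rule integrable_vol_compact[OF _ B(1)]) (auto intro!: continuous_on_power CkM_continuous[OF uC] simp: b(2))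
    then have i1': "integrable lborel (\<lambda>x. indicator (img c) x * (rho c x * (?u (param c x))\<^sup>2))"
      using integrable_chart[OF c um uz] by blast
    have le1: "(\<integral>p. (?u p)\<^sup>2 \<partial>vol) \<le> (\<integral>x. R1 * (f x)\<^sup>2 \<partial>lborel)"
      unfolding i1
    proof (rule integral_mono[OF i1'])
      show "integrable lborel (\<lambda>x. R1 * (f x)\<^sup>2)" using f2 by simp
      show "indicator (img c) x * (rho c x * (?u (param c x))\<^sup>2) \<le> R1 * (f x)\<^sup>2" for x
      proof (cases "x \<in> ?K")
        case True
        then have "rho c x * (f x)\<^sup>2 \<le> R1 * (f x)\<^sup>2" using R1(2)[OF True] by (intro mult_right_mono) auto
        then show ?thesis using True K(2) fU[of x] by (auto simp: indicator_def)
      next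
        case False
        then show ?thesis using bK[of x] R1(1) by (auto simp: indicator_def)
      qed
    qed
    have gm: "grp ?u ?u \<in> borel_measurable borel"
      by (rule borel_measurable_continuous_onI[OF CkM_continuous[OF CkM_grp[OF uC uC]]])
    have gz0: "grp ?u ?u p = 0" if "p \<notin> B" for p
      by (rule grp_zero_outside[where b="?u", OF compact_imp_closed[OF B(1)] that u0])
    have gz: "grp ?u ?u p = 0" if "p \<notin> dom_of c" for p using gz0[of p] that B(2) by blast
    have i2: "(\<integral>p. grp ?u ?u p \<partial>vol) = (\<integral>x. indicator (img c) x * (rho c x * grp ?u ?u (param c x)) \<partial>lborel)"
      by (rule integral_chart[OF c gm gz])
    have "integrable vol (grp ?u ?u)"
      by (rule integrable_vol_compact[OF CkM_continuous[OF CkM_grp[OF uC uC]] B(1) gz0])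
    then have i2': "integrable lborel (\<lambda>x. indicator (img c) x * (rho c x * grp ?u ?u (param c x)))"
      using integrable_chart[OF c gm gz] by blast
    have gpf: "grp ?u ?u (param c x) = C.gp f f x" if "x \<in> img c" for x
    proof -
      have "C.gp f f x = C.gp (?u \<circ> param c) (?u \<circ> param c) x" by (rule C.gp_cong[OF fU fU that])
      then show ?thesis using grp_chart[OF uC uC c param_in_dom[OF c that]]
        by (simp only: gpc_def coord_param[OF c that])
    qed
    have le2: "(\<integral>x. grad2 f x \<partial>lborel) \<le> C * R2 * (\<integral>p. grp ?u ?u p \<partial>vol)"
    proof -
      have "(\<integral>x. grad2 f x \<partial>lborel) \<le> (\<integral>x. C * R2 * (indicator (img c) x * (rho c x * grp ?u ?u (param c x))) \<partial>lborel)"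
      proof (rule integral_mono')
        show "integrable lborel (\<lambda>x. C * R2 * (indicator (img c) x * (rho c x * grp ?u ?u (param c x))))" using i2' by simp
        fix x
        show rhs: "0 \<le> C * R2 * (indicator (img c) x * (rho c x * grp ?u ?u (param c x)))"
          using C(1) R2(1) rho_pos[OF c, of x] grp_nonneg by (cases "x \<in> img c") auto
        show "grad2 f x \<le> C * R2 * (indicator (img c) x * (rho c x * grp ?u ?u (param c x)))"
        proof (cases "x \<in> ?K")
          case True
          then have xU: "x \<in> img c" using K(2) by blast
          have g0: "0 \<le> C * C.gp f f x" using C(1) C.gp_nonneg[OF xU] by simp
          have "grad2 f x \<le> 1 * (C * C.gp f f x)" using C(2)[OF True] by simp
          also have "\<dots> \<le> (R2 * rho c x) * (C * C.gp f f x)" by (rule mult_right_mono[OF R2'[OF True] g0])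
          finally show ?thesis using xU gpf[OF xU] by (simp add: mult_ac)
        next
          case False
          have "partial i f x = 0" for i by (rule partial_zero_outside[OF compact_imp_closed[OF K(1)] f0 False])
          then have "grad2 f x = 0" by (simp add: grad2_def)
          then show ?thesis using rhs by simp
        qed
      qed
      also have "\<dots> = C * R2 * (\<integral>p. grp ?u ?u p \<partial>vol)" unfolding i2 by simp
      finally show ?thesis .
    qed
    have i3: "(\<integral>p. h r p * \<phi> p \<partial>vol) = sqrt (a * R1) * (\<integral>x. g r x * f x \<partial>lborel)" if r: "r < N" for r
    proof -
      have m: "(\<lambda>p. h r p * \<phi> p) \<in> borel_measurable borel"
        using h1[OF r] borel_measurable_continuous_onI[OF CkM_continuous[OF \<phi>]] by simp
      have z: "h r p * \<phi> p = 0" if "p \<notin> dom_of c" for p using that by (simp add: h_def)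
      have eq: "indicator (img c) x * (rho c x * (h r (param c x) * \<phi> (param c x))) = sqrt (a * R1) * (g r x * f x)" for x
        using rho_pos[OF c, of x]
        by (cases "x \<in> img c") (simp_all add: f_def h_def k_def param_in_dom[OF c] coord_param[OF c])
      have "(\<integral>p. h r p * \<phi> p \<partial>vol) = (\<integral>x. indicator (img c) x * (rho c x * (h r (param c x) * \<phi> (param c x))) \<partial>lborel)"
        by (rule integral_chart[OF c m z])
      then show ?thesis unfolding eq by simp
    qed
    have aR: "0 \<le> a * R1" using a R1(1) by simp
    have "a * (\<integral>p. (?u p)\<^sup>2 \<partial>vol) \<le> a * R1 * (\<integral>x. (f x)\<^sup>2 \<partial>lborel)" using le1 a by simp
    also have "\<dots> \<le> a * R1 * (e' * (\<integral>x. grad2 f x \<partial>lborel) + (\<Sum>r<N. (\<integral>x. g r x * f x \<partial>lborel)\<^sup>2))"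
      using gf fC f0 by (intro mult_left_mono aR) blast
    also have "\<dots> \<le> a * R1 * (e' * (C * R2 * (\<integral>p. grp ?u ?u p \<partial>vol)) + (\<Sum>r<N. (\<integral>x. g r x * f x \<partial>lborel)\<^sup>2))"
      by (intro mult_left_mono add_right_mono le2 aR less_imp_le[OF e'])
    also have "\<dots> = e * (\<integral>p. grp ?u ?u p \<partial>vol) + (\<Sum>r<N. (sqrt (a * R1) * (\<integral>x. g r x * f x \<partial>lborel))\<^sup>2)"
    proof -
      have "a * R1 * (e' * (C * R2)) = e" using a R1(1) C(1) R2(1) by (simp add: e'_def)
      then have "a * R1 * (e' * (C * R2 * t)) = e * t" for t by (simp add: mult.assoc[symmetric])
      then show ?thesis using aR by (simp add: distrib_left sum_distrib_left power_mult_distrib)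
    qed
    finally show ?thesis using i3 by simp
  qed
  show ?thesis using h1 h2 main by blast
qed

end

section \<open>The abstract clamped plate problem\<close>

text \<open>Gaussian elimination: an unknown \<open>t\<close> with a nonzero coefficient in the last
  equation is expressed through the others. This supplies the linear algebra for eigenspaces modulo
  null sets without forming a quotient space.\<close>

lemma homogeneous_system_solution:
  fixes a :: "'s \<Rightarrow> nat \<Rightarrow> real"
  assumes "finite S" "d < card S"
  shows "\<exists>c. (\<exists>s\<in>S. c s \<noteq> 0) \<and> (\<forall>j<d. (\<Sum>s\<in>S. c s * a s j) = 0)"
  using assms
proof (induction d arbitrary: S a)
  case 0
  then have "S \<noteq> {}" by auto
  then show ?case by (intro exI[of _ "\<lambda>_. 1"]) auto
next
  case (Suc d)
  show ?case
  proof (cases "\<exists>t\<in>S. a t d \<noteq> 0")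
    case False
    from Suc.IH[OF Suc.prems(1), of a] Suc.prems(2)
    obtain c where c: "\<exists>s\<in>S. c s \<noteq> 0" "\<forall>j<d. (\<Sum>s\<in>S. c s * a s j) = 0" by auto
    have "(\<Sum>s\<in>S. c s * a s d) = 0" using False by simp
    with c show ?thesis by (intro exI[of _ c]) (auto simp: less_Suc_eq)
  next
    case True
    then obtain t where t: "t \<in> S" "a t d \<noteq> 0" by blast
    define S' where "S' = S - {t}"
    have S': "finite S'" "d < card S'" using Suc.prems t by (auto simp: S'_def)
    from Suc.IH[OF S', of "\<lambda>s j. a s j - a s d / a t d * a t j"]
    obtain c where c: "\<exists>s\<in>S'. c s \<noteq> 0"
      "\<forall>j<d. (\<Sum>s\<in>S'. c s * (a s j - a s d / a t d * a t j)) = 0" by auto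
    define c' where "c' s = (if s = t then - (\<Sum>s\<in>S'. c s * a s d) / a t d else c s)" for s
    have split: "(\<Sum>s\<in>S. c' s * a s j) = c' t * a t j + (\<Sum>s\<in>S'. c s * a s j)" for j
    proof -
      have "(\<Sum>s\<in>S. c' s * a s j) = c' t * a t j + (\<Sum>s\<in>S'. c' s * a s j)"
        unfolding S'_def using Suc.prems(1) t by (simp add: sum.remove)
      also have "(\<Sum>s\<in>S'. c' s * a s j) = (\<Sum>s\<in>S'. c s * a s j)"
        by (intro sum.cong) (auto simp: c'_def S'_def)
      finally show ?thesis .
    qed
    have "(\<Sum>s\<in>S. c' s * a s j) = 0" if "j < Suc d" for j
    proof (cases "j = d")
      case True
      then show ?thesis using t unfolding split by (simp add: c'_def)
    next
      case False
      with that have "j < d" by simp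
      with c(2) have "(\<Sum>s\<in>S'. c s * (a s j - a s d / a t d * a t j)) = 0" by blast
      then have "(\<Sum>s\<in>S'. c s * a s j) - (\<Sum>s\<in>S'. c s * a s d) / a t d * a t j = 0"
        by (simp add: right_diff_distrib sum_subtractf sum_distrib_right sum_divide_distrib mult.assoc)
      then show ?thesis unfolding split by (simp add: c'_def)
    qed
    moreover have "\<exists>s\<in>S. c' s \<noteq> 0" using c(1) by (auto simp: c'_def S'_def)
    ultimately show ?thesis by (intro exI[of _ c']) auto
  qed
qed

text \<open>Here \<open>D\<close> is the Laplacian and \<open>T\<close> the space of test functions. The last assumption is Rellich's
  theorem in quantitative form: it says that bounded sequences are precompact, without mentioning limits.\<close>

locale plate =
  fixes M :: "'a measure" and T :: "('a \<Rightarrow> real) set" and D :: "('a \<Rightarrow> real) \<Rightarrow> 'a \<Rightarrow> real"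
  assumes T_l2: "\<phi> \<in> T \<Longrightarrow> l2 M \<phi>"
    and T_zero: "(\<lambda>p. 0) \<in> T"
    and T_add: "\<phi> \<in> T \<Longrightarrow> \<psi> \<in> T \<Longrightarrow> (\<lambda>p. \<phi> p + \<psi> p) \<in> T"
    and T_scale: "\<phi> \<in> T \<Longrightarrow> (\<lambda>p. a * \<phi> p) \<in> T"
    and T_D: "\<phi> \<in> T \<Longrightarrow> D \<phi> \<in> T"
    and D_add: "\<phi> \<in> T \<Longrightarrow> \<psi> \<in> T \<Longrightarrow> D (\<lambda>p. \<phi> p + \<psi> p) = (\<lambda>p. D \<phi> p + D \<psi> p)"
    and D_scale: "\<phi> \<in> T \<Longrightarrow> D (\<lambda>p. a * \<phi> p) = (\<lambda>p. a * D \<phi> p)"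
    and D_sym: "\<phi> \<in> T \<Longrightarrow> \<psi> \<in> T \<Longrightarrow> ip M (D \<phi>) \<psi> = ip M \<phi> (D \<psi>)"
    and compactness: "0 < e \<Longrightarrow> \<exists>m (h :: nat \<Rightarrow> 'a \<Rightarrow> real). (\<forall>r<m. l2 M (h r)) \<and>
      (\<forall>\<phi>\<in>T. ip M \<phi> \<phi> \<le> e * (ip M \<phi> \<phi> + ip M (D \<phi>) (D \<phi>)) + (\<Sum>r<m. (ip M (h r) \<phi>)\<^sup>2))"
begin

text \<open>The graph of the closure of \<open>D\<close>: \<open>u\<close> ranges over the Sobolev
  space of the problem and \<open>w\<close> is its weak Laplacian. Since \<open>w\<close> is only
  determined almost everywhere, it is carried along rather than chosen.\<close>

definition pairs :: "(('a \<Rightarrow> real) \<times> ('a \<Rightarrow> real)) set" where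
  "pairs = {(u, w). l2 M u \<and> l2 M w \<and>
     (\<exists>\<phi>. (\<forall>j. \<phi> j \<in> T) \<and> l2_tendsto M \<phi> u \<and> l2_tendsto M (\<lambda>j. D (\<phi> j)) w)}"

definition eigenspace :: "real \<Rightarrow> ('a \<Rightarrow> real) set" where
  "eigenspace \<mu> = {u. \<exists>w. (u, w) \<in> pairs \<and> (\<forall>\<psi>\<in>T. ip M u (D (D \<psi>)) = \<mu> * ip M u \<psi>)}"

lemma pairs_l2: "(u, w) \<in> pairs \<Longrightarrow> l2 M u" "(u, w) \<in> pairs \<Longrightarrow> l2 M w"
  by (auto simp: pairs_def)

lemma pairsE:
  assumes "(u, w) \<in> pairs"
  obtains \<phi> where "\<And>j. \<phi> j \<in> T" "l2_tendsto M \<phi> u" "l2_tendsto M (\<lambda>j. D (\<phi> j)) w"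
  using assms by (auto simp: pairs_def)

lemma pairsI:
  assumes "l2 M u" "l2 M w" "\<And>j. \<phi> j \<in> T" "l2_tendsto M \<phi> u" "l2_tendsto M (\<lambda>j. D (\<phi> j)) w"
  shows "(u, w) \<in> pairs"
  unfolding pairs_def using assms by (auto intro!: exI[of _ \<phi>])

lemma T_diff: "\<phi> \<in> T \<Longrightarrow> \<psi> \<in> T \<Longrightarrow> (\<lambda>p. \<phi> p - \<psi> p) \<in> T"
  using T_add[of \<phi> "\<lambda>p. -1 * \<psi> p"] T_scale[of \<psi> "-1"] by simp

lemma D_diff: "\<phi> \<in> T \<Longrightarrow> \<psi> \<in> T \<Longrightarrow> D (\<lambda>p. \<phi> p - \<psi> p) = (\<lambda>p. D \<phi> p - D \<psi> p)"
  using D_add[of \<phi> "\<lambda>p. -1 * \<psi> p"] T_scale[of \<psi> "-1"] D_scale[of \<psi> "-1"] by simp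

lemma pairs_T: "\<phi> \<in> T \<Longrightarrow> (\<phi>, D \<phi>) \<in> pairs"
  by (rule pairsI[where \<phi>="\<lambda>_. \<phi>"]) (auto intro: T_l2 T_D)

lemma pairs_add:
  assumes "(u, w) \<in> pairs" "(v, z) \<in> pairs"
  shows "(\<lambda>p. u p + v p, \<lambda>p. w p + z p) \<in> pairs"
proof -
  note l = assms[THEN pairs_l2(1)] assms[THEN pairs_l2(2)]
  obtain \<phi> where \<phi>: "\<And>j. \<phi> j \<in> T" "l2_tendsto M \<phi> u" "l2_tendsto M (\<lambda>j. D (\<phi> j)) w"
    by (rule pairsE[OF assms(1)], rule that)
  obtain \<psi> where \<psi>: "\<And>j. \<psi> j \<in> T" "l2_tendsto M \<psi> v" "l2_tendsto M (\<lambda>j. D (\<psi> j)) z"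
    by (rule pairsE[OF assms(2)], rule that)
  show ?thesis
  proof (rule pairsI[where \<phi>="\<lambda>j p. \<phi> j p + \<psi> j p"])
    show "l2_tendsto M (\<lambda>j. D (\<lambda>p. \<phi> j p + \<psi> j p)) (\<lambda>p. w p + z p)"
      unfolding D_add[OF \<phi>(1) \<psi>(1)]
      by (rule l2_tendsto_add[OF l(3) T_l2[OF T_D[OF \<phi>(1)]] \<phi>(3) l(4) T_l2[OF T_D[OF \<psi>(1)]] \<psi>(3)])
    show "l2_tendsto M (\<lambda>j p. \<phi> j p + \<psi> j p) (\<lambda>p. u p + v p)"
      by (rule l2_tendsto_add[OF l(1) T_l2[OF \<phi>(1)] \<phi>(2) l(2) T_l2[OF \<psi>(1)] \<psi>(2)])
  qed (intro l2_add l T_add \<phi> \<psi>)+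
qed

lemma pairs_scale:
  assumes "(u, w) \<in> pairs" shows "(\<lambda>p. a * u p, \<lambda>p. a * w p) \<in> pairs"
proof -
  note l = assms[THEN pairs_l2(1)] assms[THEN pairs_l2(2)]
  obtain \<phi> where \<phi>: "\<And>j. \<phi> j \<in> T" "l2_tendsto M \<phi> u" "l2_tendsto M (\<lambda>j. D (\<phi> j)) w"
    by (rule pairsE[OF assms(1)], rule that)
  show ?thesis
  proof (rule pairsI[where \<phi>="\<lambda>j p. a * \<phi> j p"])
    show "l2_tendsto M (\<lambda>j. D (\<lambda>p. a * \<phi> j p)) (\<lambda>p. a * w p)"
      unfolding D_scale[OF \<phi>(1)] by (rule l2_tendsto_scale[OF l(2) T_l2[OF T_D[OF \<phi>(1)]] \<phi>(3)])
    show "l2_tendsto M (\<lambda>j p. a * \<phi> j p) (\<lambda>p. a * u p)"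
      by (rule l2_tendsto_scale[OF l(1) T_l2[OF \<phi>(1)] \<phi>(2)])
  qed (intro l2_scale l T_scale \<phi>)+
qed

lemma pairs_zero: "(\<lambda>p. 0, \<lambda>p. 0) \<in> pairs"
  using pairs_scale[OF pairs_T[OF T_zero], of 0] by simp

lemma pairs_diff:
  assumes "(u, w) \<in> pairs" "(v, z) \<in> pairs"
  shows "(\<lambda>p. u p - v p, \<lambda>p. w p - z p) \<in> pairs"
  using pairs_add[OF assms(1) pairs_scale[OF assms(2), of "-1"]] by simp

lemma pairs_sum:
  assumes "\<And>i. i \<in> I \<Longrightarrow> (u i, w i) \<in> pairs"
  shows "(\<lambda>p. \<Sum>i\<in>I. u i p, \<lambda>p. \<Sum>i\<in>I. w i p) \<in> pairs"
  using assms
proof (induction I rule: infinite_finite_induct)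
  case (insert x F)
  then show ?case using pairs_add[of "u x" "w x" "\<lambda>p. \<Sum>i\<in>F. u i p" "\<lambda>p. \<Sum>i\<in>F. w i p"] by simp
qed (simp_all add: pairs_zero)

text \<open>Diagonal argument: the \<open>j\<close>-th pair is replaced by a test function that is
  closer to it than \<open>1 / real (Suc j)\<close> in both components.\<close>

lemma pairs_closed:
  assumes uw: "\<And>j. (u j, w j) \<in> pairs" and l: "l2 M v" "l2 M z"
    and lim: "l2_tendsto M u v" "l2_tendsto M w z"
  shows "(v, z) \<in> pairs"
proof -
  have "\<exists>\<phi>\<in>T. ip M (\<lambda>p. \<phi> p - u j p) (\<lambda>p. \<phi> p - u j p) < 1 / real (Suc j) \<and>
      ip M (\<lambda>p. D \<phi> p - w j p) (\<lambda>p. D \<phi> p - w j p) < 1 / real (Suc j)" for j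
  proof -
    obtain \<phi> where \<phi>: "\<And>i. \<phi> i \<in> T" "l2_tendsto M \<phi> (u j)" "l2_tendsto M (\<lambda>i. D (\<phi> i)) (w j)"
      by (rule pairsE[OF uw[of j]], rule that)
    have "0 < 1 / real (Suc j)" by simp
    from order_tendstoD(2)[OF \<phi>(2) this] order_tendstoD(2)[OF \<phi>(3) this]
    have "\<forall>\<^sub>F i in sequentially. ip M (\<lambda>p. \<phi> i p - u j p) (\<lambda>p. \<phi> i p - u j p) < 1 / real (Suc j) \<and>
      ip M (\<lambda>p. D (\<phi> i) p - w j p) (\<lambda>p. D (\<phi> i) p - w j p) < 1 / real (Suc j)"
      by (rule eventually_conj)
    then obtain i where "ip M (\<lambda>p. \<phi> i p - u j p) (\<lambda>p. \<phi> i p - u j p) < 1 / real (Suc j) \<and>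
      ip M (\<lambda>p. D (\<phi> i) p - w j p) (\<lambda>p. D (\<phi> i) p - w j p) < 1 / real (Suc j)"
      by (auto simp: eventually_sequentially)
    then show ?thesis using \<phi>(1) by (intro bexI[of _ "\<phi> i"])
  qed
  then have "\<forall>j. \<exists>\<phi>. \<phi> \<in> T \<and> ip M (\<lambda>p. \<phi> p - u j p) (\<lambda>p. \<phi> p - u j p) < 1 / real (Suc j) \<and>
      ip M (\<lambda>p. D \<phi> p - w j p) (\<lambda>p. D \<phi> p - w j p) < 1 / real (Suc j)" by (simp add: Bex_def)
  from choice[OF this] obtain \<phi> where \<phi>: "\<And>j. \<phi> j \<in> T"
     "\<And>j. ip M (\<lambda>p. \<phi> j p - u j p) (\<lambda>p. \<phi> j p - u j p) < 1 / real (Suc j)"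
     "\<And>j. ip M (\<lambda>p. D (\<phi> j) p - w j p) (\<lambda>p. D (\<phi> j) p - w j p) < 1 / real (Suc j)" by auto
  have inv: "(\<lambda>j. 1 / real (Suc j)) \<longlonglongrightarrow> 0" using LIMSEQ_inverse_real_of_nat by (simp add: inverse_eq_divide)
  have *: "l2_tendsto M a v'" if "\<And>j. l2 M (a j)" "\<And>j. l2 M (b j)" "l2 M v'"
    "\<And>j. ip M (\<lambda>p. a j p - b j p) (\<lambda>p. a j p - b j p) < 1 / real (Suc j)" "l2_tendsto M b v'" for a b v'
  proof (rule Lim_null_comparison)
    let ?b = "\<lambda>j. 2 * (1 / real (Suc j)) + 2 * ip M (\<lambda>p. b j p - v' p) (\<lambda>p. b j p - v' p)"
    have "ip M (\<lambda>p. a j p - v' p) (\<lambda>p. a j p - v' p) \<le> ?b j" for j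
      using ip_le_of_near[OF that(1)[of j] that(2)[of j] that(3)] that(4)[of j] by linarith
    then show "\<forall>\<^sub>F j in sequentially. norm (ip M (\<lambda>p. a j p - v' p) (\<lambda>p. a j p - v' p)) \<le> ?b j" by simp
    have "?b \<longlonglongrightarrow> 2 * 0 + 2 * 0" by (intro tendsto_add tendsto_mult tendsto_const inv that(5))
    then show "?b \<longlonglongrightarrow> 0" by simp
  qed
  show ?thesis
  proof (rule pairsI[where \<phi>=\<phi>])
    show "l2_tendsto M \<phi> v"
      by (rule *[OF T_l2[OF \<phi>(1)] pairs_l2(1)[OF uw] l(1) \<phi>(2) lim(1)])
    show "l2_tendsto M (\<lambda>j. D (\<phi> j)) z"
      by (rule *[OF T_l2[OF T_D[OF \<phi>(1)]] pairs_l2(2)[OF uw] l(2) \<phi>(3) lim(2)])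
  qed (intro l \<phi>)+
qed

lemma ip_pair_D:
  assumes "(u, w) \<in> pairs" "\<psi> \<in> T" shows "ip M w \<psi> = ip M u (D \<psi>)"
proof -
  note l = assms(1)[THEN pairs_l2(1)] assms(1)[THEN pairs_l2(2)]
  obtain \<phi> where \<phi>: "\<And>j. \<phi> j \<in> T" "l2_tendsto M \<phi> u" "l2_tendsto M (\<lambda>j. D (\<phi> j)) w"
    by (rule pairsE[OF assms(1)], rule that)
  have "(\<lambda>j. ip M (D (\<phi> j)) \<psi>) \<longlonglongrightarrow> ip M w \<psi>"
    by (rule l2_tendsto_ip_fixed[OF l(2) T_l2[OF T_D[OF \<phi>(1)]] \<phi>(3) T_l2[OF assms(2)]])
  moreover have "(\<lambda>j. ip M (D (\<phi> j)) \<psi>) \<longlonglongrightarrow> ip M u (D \<psi>)"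
    unfolding D_sym[OF \<phi>(1) assms(2)]
    by (rule l2_tendsto_ip_fixed[OF l(1) T_l2[OF \<phi>(1)] \<phi>(2) T_l2[OF T_D[OF assms(2)]]])
  ultimately show ?thesis by (rule LIMSEQ_unique)
qed

text \<open>Against a test function one Laplacian can be moved onto \<open>u\<close> by
  \<open>ip_pair_D\<close>. The resulting identity involves only the test function and its image
  under \<open>D\<close>, so it survives the limit that defines a pair.\<close>

lemma eigen_ip:
  assumes "u \<in> eigenspace \<mu>" "(u, w) \<in> pairs" "(v, z) \<in> pairs"
  shows "ip M w z = \<mu> * ip M u v"
proof -
  note l = assms(2,3)[THEN pairs_l2(1)] assms(2,3)[THEN pairs_l2(2)]
  obtain \<phi> where \<phi>: "\<And>j. \<phi> j \<in> T" "l2_tendsto M \<phi> v" "l2_tendsto M (\<lambda>j. D (\<phi> j)) z"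
    by (rule pairsE[OF assms(3)], rule that)
  have "ip M w (D (\<phi> j)) = \<mu> * ip M u (\<phi> j)" for j
    using assms(1) ip_pair_D[OF assms(2) T_D[OF \<phi>(1)]] \<phi>(1) by (auto simp: eigenspace_def)
  moreover have "(\<lambda>j. ip M w (D (\<phi> j))) \<longlonglongrightarrow> ip M w z"
    unfolding ip_sym[of M w]
    by (rule l2_tendsto_ip_fixed[OF l(4) T_l2[OF T_D[OF \<phi>(1)]] \<phi>(3) l(3)])
  moreover have "(\<lambda>j. \<mu> * ip M u (\<phi> j)) \<longlonglongrightarrow> \<mu> * ip M u v"
    unfolding ip_sym[of M u]
    by (intro tendsto_mult tendsto_const l2_tendsto_ip_fixed[OF l(2) T_l2[OF \<phi>(1)] \<phi>(2) l(1)])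
  ultimately show ?thesis by (simp add: LIMSEQ_unique)
qed

lemma eigenspace_l2: "u \<in> eigenspace \<mu> \<Longrightarrow> l2 M u"
  by (auto simp: eigenspace_def dest: pairs_l2)

lemma eigenspaceE:
  assumes "u \<in> eigenspace \<mu>" obtains w where "(u, w) \<in> pairs"
  using assms by (auto simp: eigenspace_def)

lemma eigenspace_orthogonal:
  assumes "u \<in> eigenspace \<mu>" "v \<in> eigenspace \<nu>" "\<mu> \<noteq> \<nu>"
  shows "ip M u v = 0"
proof -
  obtain w where w: "(u, w) \<in> pairs" by (rule eigenspaceE[OF assms(1)])
  obtain z where z: "(v, z) \<in> pairs" by (rule eigenspaceE[OF assms(2)])
  have "\<mu> * ip M u v = \<nu> * ip M u v"
    using eigen_ip[OF assms(1) w z] eigen_ip[OF assms(2) z w] by (simp add: ip_sym)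
  with assms(3) show ?thesis by simp
qed

lemma eigenspace_lincomb:
  assumes "\<And>j. j \<in> I \<Longrightarrow> e j \<in> eigenspace \<mu>"
  shows "(\<lambda>p. \<Sum>j\<in>I. c j * e j p) \<in> eigenspace \<mu>"
proof -
  have "\<exists>w. \<forall>j\<in>I. (e j, w j) \<in> pairs" using assms by (intro bchoice) (auto simp: eigenspace_def)
  then obtain w where w: "\<And>j. j \<in> I \<Longrightarrow> (e j, w j) \<in> pairs" by blast
  have "(\<lambda>p. \<Sum>j\<in>I. c j * e j p, \<lambda>p. \<Sum>j\<in>I. c j * w j p) \<in> pairs"
    by (intro pairs_sum pairs_scale w)
  moreover have "ip M (\<lambda>p. \<Sum>j\<in>I. c j * e j p) (D (D \<psi>)) = \<mu> * ip M (\<lambda>p. \<Sum>j\<in>I. c j * e j p) \<psi>"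
    if "\<psi> \<in> T" for \<psi>
  proof -
    have l: "l2 M (\<lambda>p. c j * e j p)" if "j \<in> I" for j by (intro l2_scale pairs_l2(1)[OF w] that)
    have "ip M (\<lambda>p. \<Sum>j\<in>I. c j * e j p) (D (D \<psi>)) = (\<Sum>j\<in>I. c j * ip M (e j) (D (D \<psi>)))"
      by (subst ip_sum_left) (auto simp: l ip_scale_left T_l2 T_D that)
    also have "\<dots> = (\<Sum>j\<in>I. \<mu> * (c j * ip M (e j) \<psi>))"
      using assms that by (intro sum.cong) (auto simp: eigenspace_def)
    also have "\<dots> = \<mu> * ip M (\<lambda>p. \<Sum>j\<in>I. c j * e j p) \<psi>"
      by (subst ip_sum_left) (auto simp: l ip_scale_left T_l2 that sum_distrib_left)
    finally show ?thesis .
  qed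
  ultimately show ?thesis by (auto simp: eigenspace_def)
qed

lemma pairs_compactness:
  assumes "0 < e"
  shows "\<exists>m (h :: nat \<Rightarrow> 'a \<Rightarrow> real). (\<forall>r<m. l2 M (h r)) \<and>
      (\<forall>u w. (u, w) \<in> pairs \<longrightarrow> ip M u u \<le> e * (ip M u u + ip M w w) + (\<Sum>r<m. (ip M (h r) u)\<^sup>2))"
proof -
  from compactness[OF assms] obtain m and h :: "nat \<Rightarrow> 'a \<Rightarrow> real"
    where mh: "(\<forall>r<m. l2 M (h r)) \<and> (\<forall>\<phi>\<in>T. ip M \<phi> \<phi> \<le> e * (ip M \<phi> \<phi> + ip M (D \<phi>) (D \<phi>)) +
      (\<Sum>r<m. (ip M (h r) \<phi>)\<^sup>2))" by (elim exE)
  have h: "\<And>r. r < m \<Longrightarrow> l2 M (h r)"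
    "\<And>\<phi>. \<phi> \<in> T \<Longrightarrow> ip M \<phi> \<phi> \<le> e * (ip M \<phi> \<phi> + ip M (D \<phi>) (D \<phi>)) + (\<Sum>r<m. (ip M (h r) \<phi>)\<^sup>2)"
    using mh by simp_all
  have "ip M u u \<le> e * (ip M u u + ip M w w) + (\<Sum>r<m. (ip M (h r) u)\<^sup>2)" if uw: "(u, w) \<in> pairs" for u w
  proof -
    note l = uw[THEN pairs_l2(1)] uw[THEN pairs_l2(2)]
    obtain \<phi> where \<phi>: "\<And>j. \<phi> j \<in> T" "l2_tendsto M \<phi> u" "l2_tendsto M (\<lambda>j. D (\<phi> j)) w"
      by (rule pairsE[OF uw], rule that)
    have a: "(\<lambda>j. ip M (\<phi> j) (\<phi> j)) \<longlonglongrightarrow> ip M u u"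
      by (rule l2_tendsto_ip[OF l(1) T_l2[OF \<phi>(1)] \<phi>(2) l(1) T_l2[OF \<phi>(1)] \<phi>(2)])
    have b: "(\<lambda>j. ip M (D (\<phi> j)) (D (\<phi> j))) \<longlonglongrightarrow> ip M w w"
      by (rule l2_tendsto_ip[OF l(2) T_l2[OF T_D[OF \<phi>(1)]] \<phi>(3) l(2) T_l2[OF T_D[OF \<phi>(1)]] \<phi>(3)])
    have c: "(\<lambda>j. ip M (h r) (\<phi> j)) \<longlonglongrightarrow> ip M (h r) u" if "r < m" for r
      unfolding ip_sym[of M "h r"] by (rule l2_tendsto_ip_fixed[OF l(1) T_l2[OF \<phi>(1)] \<phi>(2) h(1)[OF that]])
    have d: "(\<lambda>j. e * (ip M (\<phi> j) (\<phi> j) + ip M (D (\<phi> j)) (D (\<phi> j))) + (\<Sum>r<m. (ip M (h r) (\<phi> j))\<^sup>2))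
        \<longlonglongrightarrow> e * (ip M u u + ip M w w) + (\<Sum>r<m. (ip M (h r) u)\<^sup>2)"
      using c by (intro tendsto_add tendsto_mult tendsto_const a b tendsto_sum tendsto_power) auto
    show ?thesis by (rule LIMSEQ_le[OF a d]) (use h(2) \<phi>(1) in auto)
  qed
  with h(1) show ?thesis by (intro exI[of _ m] exI[of _ h] conjI allI impI)
qed

text \<open>A subsequence along which countably many functionals converge, namely those belonging to
  the precisions \<open>1 / real (Suc n)\<close>, is Cauchy, because the compactness inequality
  applies to differences of its members.\<close>

lemma pairs_bounded_subseq_Cauchy:
  assumes vw: "\<And>j. (v j, w j) \<in> pairs" and bd: "\<And>j. ip M (v j) (v j) \<le> B" "\<And>j. ip M (w j) (w j) \<le> B"
  shows "\<exists>r. strict_mono (r :: nat \<Rightarrow> nat) \<and>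
     (\<forall>e>0. \<exists>N. \<forall>i\<ge>N. \<forall>j\<ge>N. ip M (\<lambda>p. v (r i) p - v (r j) p) (\<lambda>p. v (r i) p - v (r j) p) < e)"
proof -
  have "\<forall>n. \<exists>mh. (\<forall>r<fst mh. l2 M (snd mh r)) \<and> (\<forall>u w. (u, w) \<in> pairs \<longrightarrow>
      ip M u u \<le> 1 / real (Suc n) * (ip M u u + ip M w w) + (\<Sum>r<fst mh. (ip M (snd mh (r::nat)) u)\<^sup>2))"
    (is "\<forall>n. \<exists>mh. ?P n mh")
  proof
    fix n
    from pairs_compactness[of "1 / real (Suc n)"] obtain m h where "?P n (m, h)" by auto
    then show "\<exists>mh. ?P n mh" by (rule exI)
  qed
  from choice[OF this] obtain mh where "\<forall>n. ?P n (mh n)" by (elim exE)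
  then have mh: "\<And>n r. r < fst (mh n) \<Longrightarrow> l2 M (snd (mh n) r)"
     "\<And>n u w. (u, w) \<in> pairs \<Longrightarrow> ip M u u \<le> 1 / real (Suc n) * (ip M u u + ip M w w) +
        (\<Sum>r<fst (mh n). (ip M (snd (mh n) (r::nat)) u)\<^sup>2)" by simp_all
  \<comment> \<open>The values of all functionals, indexed by precision and number, form one point
    in a product of compact intervals; sequential compactness of the product spares a diagonal
    subsequence.\<close>
  define F where "F j = (\<lambda>(n, r). if r < fst (mh n) then ip M (snd (mh n) r) (v j) else 0)" for j
  define C where "C = (\<lambda>(n, r). if r < fst (mh n) then sqrt (ip M (snd (mh n) r) (snd (mh n) r)) * sqrt B else 0)"
  have FC: "F j \<in> Pi\<^sub>E UNIV (\<lambda>x. {- C x..C x})" for j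
  proof (rule PiE_I)
    fix x :: "nat \<times> nat"
    obtain n r where x: "x = (n, r)" by force
    have "\<bar>ip M (snd (mh n) r) (v j)\<bar> \<le> sqrt (ip M (snd (mh n) r) (snd (mh n) r)) * sqrt B" if "r < fst (mh n)"
      using ip_abs_le[OF mh(1)[OF that] pairs_l2(1)[OF vw[of j]]]
        mult_left_mono[OF real_sqrt_le_mono[OF bd(1)[of j]], of "sqrt (ip M (snd (mh n) r) (snd (mh n) r))"]
      by simp
    then show "F j x \<in> {- C x..C x}" by (auto simp: x F_def C_def abs_le_iff)
  qed auto
  have "compact (Pi\<^sub>E UNIV (\<lambda>x. {- C x..C x}))"
    using compactin_PiE[of "\<lambda>_. euclidean" UNIV "\<lambda>x. {- C x..C x}"]
    by (simp add: euclidean_product_topology)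
  then have "seq_compact (Pi\<^sub>E UNIV (\<lambda>x. {- C x..C x}))" by (rule compact_imp_seq_compact)
  then obtain L r where r: "strict_mono r" "(F \<circ> r) \<longlonglongrightarrow> L"
    using FC unfolding seq_compact_def by meson
  have Fconv: "(\<lambda>j. F (r j) x) \<longlonglongrightarrow> L x" for x
    using continuous_on_tendsto_compose[OF continuous_on_product_coordinates r(2), of x] by simp
  have ipdiff: "ip M (snd (mh n) s) (\<lambda>p. v (r i) p - v (r j) p) = F (r i) (n, s) - F (r j) (n, s)"
    if "s < fst (mh n)" for n s i j
    using that by (simp add: F_def ip_diff_right[OF pairs_l2(1)[OF vw] pairs_l2(1)[OF vw] mh(1)])
  have "\<exists>N. \<forall>i\<ge>N. \<forall>j\<ge>N. ip M (\<lambda>p. v (r i) p - v (r j) p) (\<lambda>p. v (r i) p - v (r j) p) < e" if "e > 0" for e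
  proof -
    \<comment> \<open>A difference of two members has both squared norms at most
      \<open>4 * B\<close>, so the first term of the inequality falls below
      \<open>e / 2\<close>.\<close>
    obtain n where n: "1 / real (Suc n) * (8 * B) < e / 2"
    proof -
      obtain n where "16 * B / e < real n" using reals_Archimedean2 by blast
      then have "16 * B < e * real n" using \<open>e > 0\<close> by (simp add: field_simps)
      also have "\<dots> \<le> e * real (Suc n)" using \<open>e > 0\<close> by (intro mult_left_mono) auto
      finally have "1 / real (Suc n) * (8 * B) < e / 2" by (simp add: field_simps)
      then show thesis by (rule that)
    qed
    let ?m = "fst (mh n)"
    \<comment> \<open>With this tolerance each of the \<open>?m\<close> squares is at most
      \<open>e / (2 * (real ?m + 1))\<close>, and together they stay within
      \<open>e / 2\<close>.\<close>
    have "\<exists>N. \<forall>j\<ge>N. \<bar>F (r j) (n, s) - L (n, s)\<bar> < sqrt (e / (2 * (real ?m + 1))) / 2" for s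
      using LIMSEQ_D[OF Fconv, of "sqrt (e / (2 * (real ?m + 1))) / 2"] that by auto
    then obtain N where N: "\<And>s j. j \<ge> N s \<Longrightarrow> \<bar>F (r j) (n, s) - L (n, s)\<bar> < sqrt (e / (2 * (real ?m + 1))) / 2"
      by metis
    have "ip M (\<lambda>p. v (r i) p - v (r j) p) (\<lambda>p. v (r i) p - v (r j) p) < e"
      if ij: "i \<ge> (\<Sum>s<?m. N s)" "j \<ge> (\<Sum>s<?m. N s)" for i j
    proof -
      have pr: "(\<lambda>p. v (r i) p - v (r j) p, \<lambda>p. w (r i) p - w (r j) p) \<in> pairs"
        by (intro pairs_diff vw)
      have 1: "ip M (\<lambda>p. v (r i) p - v (r j) p) (\<lambda>p. v (r i) p - v (r j) p) \<le> 4 * B"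
        using ip_diff_le[OF pairs_l2(1)[OF vw] pairs_l2(1)[OF vw], of "r i" "r j"] bd(1)[of "r i"] bd(1)[of "r j"] by linarith
      have 2: "ip M (\<lambda>p. w (r i) p - w (r j) p) (\<lambda>p. w (r i) p - w (r j) p) \<le> 4 * B"
        using ip_diff_le[OF pairs_l2(2)[OF vw] pairs_l2(2)[OF vw], of "r i" "r j"] bd(2)[of "r i"] bd(2)[of "r j"] by linarith
      have 3: "(ip M (snd (mh n) s) (\<lambda>p. v (r i) p - v (r j) p))\<^sup>2 \<le> e / (2 * (real ?m + 1))" if "s < ?m" for s
      proof -
        have "N s \<le> (\<Sum>s<?m. N s)" using that by (intro member_le_sum) auto
        then have "N s \<le> i" "N s \<le> j" using ij by auto
        from N[OF this(1)] N[OF this(2)]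
        have "\<bar>F (r i) (n, s) - F (r j) (n, s)\<bar> \<le> sqrt (e / (2 * (real ?m + 1)))" by linarith
        then have "(F (r i) (n, s) - F (r j) (n, s))\<^sup>2 \<le> (sqrt (e / (2 * (real ?m + 1))))\<^sup>2"
          by (metis abs_ge_zero power2_abs power_mono)
        then show ?thesis unfolding ipdiff[OF that] using \<open>e > 0\<close> by simp
      qed
      have "(\<Sum>s<?m. (ip M (snd (mh n) s) (\<lambda>p. v (r i) p - v (r j) p))\<^sup>2) \<le> (\<Sum>s<?m. e / (2 * (real ?m + 1)))"
        by (intro sum_mono 3) simp
      also have "\<dots> \<le> e / 2" using \<open>e > 0\<close> by (simp add: field_simps)
      finally have 4: "(\<Sum>s<?m. (ip M (snd (mh n) s) (\<lambda>p. v (r i) p - v (r j) p))\<^sup>2) \<le> e / 2" .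
      have "1 / real (Suc n) * (ip M (\<lambda>p. v (r i) p - v (r j) p) (\<lambda>p. v (r i) p - v (r j) p) +
          ip M (\<lambda>p. w (r i) p - w (r j) p) (\<lambda>p. w (r i) p - w (r j) p)) \<le> 1 / real (Suc n) * (8 * B)"
        using 1 2 by (intro mult_left_mono) auto
      with mh(2)[OF pr, of n] 4 n show ?thesis by linarith
    qed
    then show ?thesis by (intro exI[of _ "\<Sum>s<?m. N s"]) auto
  qed
  with r(1) show ?thesis by (intro exI[of _ r] conjI) auto
qed

end

section \<open>The variational principle for the gap above finitely many eigenfunctions\<close>

context plate
begin

text \<open>Direct method: if the inequality failed, the infimum of the quotient over pairs
  orthogonal to all \<open>u i\<close> would lie below \<open>L\<close>. The infimum is attained,
  and a minimizer is an eigenfunction with that eigenvalue, which \<open>gap\<close>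
  forbids.\<close>

lemma variational_principle:
  fixes K :: "'k set"
  assumes K: "finite K"
    and uw: "\<And>i. i \<in> K \<Longrightarrow> (u i, w i) \<in> pairs" and ue: "\<And>i. i \<in> K \<Longrightarrow> u i \<in> eigenspace (l i)"
    and on: "\<And>i j. i \<in> K \<Longrightarrow> j \<in> K \<Longrightarrow> ip M (u i) (u j) = (if i = j then 1 else 0)"
    and gap: "\<And>\<mu> v. \<mu> < L \<Longrightarrow> v \<in> eigenspace \<mu> \<Longrightarrow> (\<And>i. i \<in> K \<Longrightarrow> ip M v (u i) = 0) \<Longrightarrow> ip M v v = 0"
    and vz: "(v, z) \<in> pairs" "\<And>i. i \<in> K \<Longrightarrow> ip M v (u i) = 0"
  shows "L * ip M v v \<le> ip M z z"
proof (rule ccontr)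
  assume "\<not> ?thesis"
  then have less: "ip M z z < L * ip M v v" by simp
  define V where "V = {(v, z) \<in> pairs. \<forall>i\<in>K. ip M v (u i) = 0}"
  have V_pairs: "(v, z) \<in> pairs" if "(v, z) \<in> V" for v z using that by (simp add: V_def)
  have V_orth: "ip M v (u i) = 0" if "(v, z) \<in> V" "i \<in> K" for v z i using that by (simp add: V_def)
  have ul: "l2 M (u i)" if "i \<in> K" for i by (rule pairs_l2(1)[OF uw[OF that]])
  have V_add: "(\<lambda>p. a p + b p, \<lambda>p. c p + d p) \<in> V" if "(a, c) \<in> V" "(b, d) \<in> V" for a b c d
    using that ul by (auto simp: V_def ip_add_left pairs_l2(1) intro!: pairs_add)
  have V_scale: "(\<lambda>p. t * a p, \<lambda>p. t * c p) \<in> V" if "(a, c) \<in> V" for a c t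
    using that by (auto simp: V_def ip_scale_left intro!: pairs_scale)
  define S where "S = {ip M z z | v z. (v, z) \<in> V \<and> ip M v v = 1}"
  define \<mu> where "\<mu> = Inf S"
  have bdd: "bdd_below S" unfolding S_def by (rule bdd_belowI[of _ 0]) auto
  have normalize: "ip M z z / ip M v v \<in> S" if "(v, z) \<in> V" "ip M v v \<noteq> 0" for v z
  proof -
    let ?t = "1 / sqrt (ip M v v)"
    have t2: "?t * ?t = 1 / ip M v v" by (simp add: real_sqrt_mult_self)
    have "ip M (\<lambda>p. ?t * v p) (\<lambda>p. ?t * v p) = ?t * ?t * ip M v v"
      by (simp only: ip_scale_left ip_scale_right mult.assoc)
    then have 1: "ip M (\<lambda>p. ?t * v p) (\<lambda>p. ?t * v p) = 1" using t2 that(2) by simp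
    have "ip M (\<lambda>p. ?t * z p) (\<lambda>p. ?t * z p) = ?t * ?t * ip M z z"
      by (simp only: ip_scale_left ip_scale_right mult.assoc)
    then have 2: "ip M z z / ip M v v = ip M (\<lambda>p. ?t * z p) (\<lambda>p. ?t * z p)" using t2 by simp
    show ?thesis unfolding S_def 2 using V_scale[OF that(1), of ?t] 1 by blast
  qed
  have vpos: "ip M v v > 0"
  proof -
    have "ip M v v \<noteq> 0" using less ip_nonneg[of M z] by (auto simp del: ip_nonneg)
    then show ?thesis using ip_nonneg[of M v] by (simp add: less_eq_real_def del: ip_nonneg)
  qed
  have vV: "(v, z) \<in> V" using vz by (auto simp: V_def)
  have ne: "S \<noteq> {}" using normalize[OF vV] vpos by auto
  have "\<mu> \<le> ip M z z / ip M v v" unfolding \<mu>_def using normalize[OF vV] vpos bdd by (intro cInf_lower) auto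
  also have "\<dots> < L" using less vpos by (simp add: field_simps)
  finally have \<mu>L: "\<mu> < L" .
  have lower: "\<mu> * ip M v v \<le> ip M z z" if "(v, z) \<in> V" for v z
  proof (cases "ip M v v = 0")
    case False
    then have pos: "ip M v v > 0" using ip_nonneg[of M v] by (simp add: less_eq_real_def del: ip_nonneg)
    have "\<mu> \<le> ip M z z / ip M v v" unfolding \<mu>_def by (intro cInf_lower normalize that False bdd)
    then show ?thesis using pos by (simp add: field_simps)
  qed simp
  have "\<exists>vz. vz \<in> V \<and> ip M (fst vz) (fst vz) = 1 \<and> ip M (snd vz) (snd vz) < \<mu> + 1 / real (Suc j)" for j
  proof -
    have "Inf S < \<mu> + 1 / real (Suc j)" unfolding \<mu>_def by simp
    then obtain x where "x \<in> S" "x < \<mu> + 1 / real (Suc j)" using cInf_lessD[OF ne] by blast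
    then show ?thesis by (auto simp: S_def)
  qed
  then obtain vz where vz': "\<And>j. vz j \<in> V" "\<And>j. ip M (fst (vz j)) (fst (vz j)) = 1"
      "\<And>j. ip M (snd (vz j)) (snd (vz j)) < \<mu> + 1 / real (Suc j)" by metis
  define a where "a j = fst (vz j)" for j
  define b where "b j = snd (vz j)" for j
  have ab: "(a j, b j) \<in> V" "ip M (a j) (a j) = 1" "ip M (b j) (b j) < \<mu> + 1 / real (Suc j)" for j
    using vz' by (simp_all add: a_def b_def)
  note al = pairs_l2(1)[OF V_pairs[OF ab(1)]] and bl = pairs_l2(2)[OF V_pairs[OF ab(1)]]
  have \<mu>0: "\<mu> \<ge> 0" unfolding \<mu>_def using ne by (intro cInf_greatest) (auto simp: S_def)
  have bB: "ip M (b j) (b j) \<le> \<mu> + 1" for j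
  proof -
    have "1 / real (Suc j) \<le> 1" by simp
    then show ?thesis using ab(3)[of j] by linarith
  qed
  obtain r :: "nat \<Rightarrow> nat" where r: "strict_mono r"
    "\<And>e. e > 0 \<Longrightarrow> \<exists>N. \<forall>i\<ge>N. \<forall>j\<ge>N. ip M (\<lambda>p. a (r i) p - a (r j) p) (\<lambda>p. a (r i) p - a (r j) p) < e"
  proof -
    have "ip M (a j) (a j) \<le> \<mu> + 1" for j unfolding ab(2) using \<mu>0 by simp
    from pairs_bounded_subseq_Cauchy[of a b, OF V_pairs[OF ab(1)] this bB] show thesis
      by (elim exE conjE) (rule that, assumption, erule allE, erule impE)
  qed
  \<comment> \<open>The parallelogram law, with \<open>lower\<close> applied to the sum of two
    members, makes the second components Cauchy as soon as the first are. The limit therefore lies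
    in the closed graph, and weak convergence can be avoided.\<close>
  have bdiff: "ip M (\<lambda>p. b (r i) p - b (r j) p) (\<lambda>p. b (r i) p - b (r j) p) \<le>
     2 / real (Suc i) + 2 / real (Suc j) + \<mu> * ip M (\<lambda>p. a (r i) p - a (r j) p) (\<lambda>p. a (r i) p - a (r j) p)" for i j
  proof -
    have pl: "ip M (\<lambda>p. x p - y p) (\<lambda>p. x p - y p) = 2 * ip M x x + 2 * ip M y y - ip M (\<lambda>p. x p + y p) (\<lambda>p. x p + y p)"
      if "l2 M x" "l2 M y" for x y using ip_expand[OF that, of "-1"] ip_expand[OF that, of 1] by simp
    have "\<mu> * ip M (\<lambda>p. a (r i) p + a (r j) p) (\<lambda>p. a (r i) p + a (r j) p)
        \<le> ip M (\<lambda>p. b (r i) p + b (r j) p) (\<lambda>p. b (r i) p + b (r j) p)"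
      by (intro lower V_add ab)
    moreover have "ip M (\<lambda>p. a (r i) p + a (r j) p) (\<lambda>p. a (r i) p + a (r j) p) =
        4 - ip M (\<lambda>p. a (r i) p - a (r j) p) (\<lambda>p. a (r i) p - a (r j) p)"
      unfolding pl[OF al al] ab(2) by simp
    moreover have "ip M (b (r i)) (b (r i)) \<le> \<mu> + 1 / real (Suc i)" for i
    proof -
      have "1 / real (Suc (r i)) \<le> 1 / real (Suc i)"
        using seq_suble[OF r(1), of i] by (intro divide_left_mono) auto
      then show ?thesis using ab(3)[of "r i"] by linarith
    qed
    from add_mono[OF this[of i] this[of j]] have "2 * ip M (b (r i)) (b (r i)) + 2 * ip M (b (r j)) (b (r j)) \<le> 4 * \<mu> + 2 / real (Suc i) + 2 / real (Suc j)"
      by simp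
    ultimately show ?thesis unfolding pl[OF bl bl] by (simp add: algebra_simps)
  qed
  have bC: "\<exists>N. \<forall>i\<ge>N. \<forall>j\<ge>N. ip M (\<lambda>p. b (r i) p - b (r j) p) (\<lambda>p. b (r i) p - b (r j) p) < e" if e: "e > 0" for e
  proof -
    obtain N1 where N1: "\<And>i j. i \<ge> N1 \<Longrightarrow> j \<ge> N1 \<Longrightarrow>
        ip M (\<lambda>p. a (r i) p - a (r j) p) (\<lambda>p. a (r i) p - a (r j) p) < e / (2 * (\<mu> + 1))"
      using r(2)[of "e / (2 * (\<mu> + 1))"] e \<mu>0 by auto
    obtain N2 where N2: "8 / e < real N2" using reals_Archimedean2 by blast
    have inv: "2 / real (Suc i) < e / 4" if "i \<ge> N2" for i
    proof -
      have "8 / e < real (Suc i)" using N2 that by linarith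
      then show ?thesis using e by (simp add: field_simps)
    qed
    have "ip M (\<lambda>p. b (r i) p - b (r j) p) (\<lambda>p. b (r i) p - b (r j) p) < e"
      if ij: "i \<ge> max N1 N2" "j \<ge> max N1 N2" for i j
    proof -
      have "\<mu> * ip M (\<lambda>p. a (r i) p - a (r j) p) (\<lambda>p. a (r i) p - a (r j) p) \<le> \<mu> * (e / (2 * (\<mu> + 1)))"
        using N1[of i j] ij \<mu>0 by (intro mult_left_mono) auto
      also have "\<dots> \<le> e / 2" using \<mu>0 e by (simp add: field_simps)
      finally have "\<mu> * ip M (\<lambda>p. a (r i) p - a (r j) p) (\<lambda>p. a (r i) p - a (r j) p) \<le> e / 2" .
      then show ?thesis using bdiff[of i j] inv[of i] inv[of j] ij by linarith
    qed
    then show ?thesis by (intro exI[of _ "max N1 N2"]) blast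
  qed
  obtain v0 where v0: "l2 M v0" "l2_tendsto M (\<lambda>j. a (r j)) v0"
    using l2_complete[of M "\<lambda>j. a (r j)", OF al r(2)] by auto
  obtain z0 where z0: "l2 M z0" "l2_tendsto M (\<lambda>j. b (r j)) z0"
    using l2_complete[of M "\<lambda>j. b (r j)", OF bl bC] by auto
  have vz0: "(v0, z0) \<in> pairs"
    by (rule pairs_closed[OF V_pairs[OF ab(1)] v0(1) z0(1) v0(2) z0(2)])
  have orth0: "ip M v0 (u i) = 0" if "i \<in> K" for i
  proof -
    have "(\<lambda>j. ip M (a (r j)) (u i)) \<longlonglongrightarrow> ip M v0 (u i)"
      by (rule l2_tendsto_ip_fixed[OF v0(1) al v0(2) ul[OF that]])
    then show ?thesis unfolding V_orth[OF ab(1) that] by (simp add: LIMSEQ_const_iff)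
  qed
  have v0V: "(v0, z0) \<in> V" using vz0 orth0 by (simp add: V_def)
  have norm1: "ip M v0 v0 = 1"
    using l2_tendsto_ip[OF v0(1) al v0(2) v0(1) al v0(2)] unfolding ab(2) by (simp add: LIMSEQ_const_iff)
  have "ip M z0 z0 \<le> \<mu>"
  proof (rule LIMSEQ_le)
    show "(\<lambda>j. ip M (b (r j)) (b (r j))) \<longlonglongrightarrow> ip M z0 z0"
      by (rule l2_tendsto_ip[OF z0(1) bl z0(2) z0(1) bl z0(2)])
    have "(\<lambda>j. \<mu> + 1 / real (Suc j)) \<longlonglongrightarrow> \<mu> + 0"
      using LIMSEQ_inverse_real_of_nat by (intro tendsto_add tendsto_const) (simp add: inverse_eq_divide)
    then show "(\<lambda>j. \<mu> + 1 / real (Suc (r j))) \<longlonglongrightarrow> \<mu>"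
      using LIMSEQ_subseq_LIMSEQ[OF _ r(1)] by (auto simp: o_def)
    show "\<exists>N. \<forall>n\<ge>N. ip M (b (r n)) (b (r n)) \<le> \<mu> + 1 / real (Suc (r n))"
      using ab(3) less_imp_le by blast
  qed
  with lower[OF v0V] norm1 have z\<mu>: "ip M z0 z0 = \<mu>" by simp
  \<comment> \<open>First variation: the polynomial in \<open>t\<close> is nonnegative and has
    constant term 0, so its linear coefficient vanishes.\<close>
  have var: "ip M z0 y = \<mu> * ip M v0 x" if "(x, y) \<in> V" for x y
  proof -
    note xl = pairs_l2(1)[OF V_pairs[OF that]] and yl = pairs_l2(2)[OF V_pairs[OF that]]
    have "(ip M z0 y - \<mu> * ip M v0 x)\<^sup>2 \<le> 0 * (ip M y y - \<mu> * ip M x x)"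
    proof (rule quadratic_nonneg_discriminant)
      fix t
      have "(\<lambda>p. v0 p + t * x p, \<lambda>p. z0 p + t * y p) \<in> V" by (intro V_add V_scale v0V that)
      from lower[OF this] show "0 \<le> 0 + 2 * t * (ip M z0 y - \<mu> * ip M v0 x) + t\<^sup>2 * (ip M y y - \<mu> * ip M x x)"
        unfolding ip_expand[OF v0(1) xl] ip_expand[OF z0(1) yl] z\<mu> norm1 by (simp add: algebra_simps)
      show "0 \<le> ip M y y - \<mu> * ip M x x" using lower[OF that] by simp
    qed
    then show ?thesis by simp
  qed
  \<comment> \<open>A test function need not be orthogonal to the \<open>u i\<close>. The part
    removed by projection contributes nothing, since \<open>v0\<close> is orthogonal to
    \<open>u i\<close> and, by the equation for \<open>u i\<close>, also \<open>z0\<close> to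
    \<open>w i\<close>.\<close>
  have "ip M v0 (D (D \<psi>)) = \<mu> * ip M v0 \<psi>" if \<psi>: "\<psi> \<in> T" for \<psi>
  proof -
    let ?c = "\<lambda>i. ip M \<psi> (u i)"
    have cl: "l2 M (\<lambda>p. ?c i * u i p)" "l2 M (\<lambda>p. ?c i * w i p)" if "i \<in> K" for i
      by (intro l2_scale pairs_l2(1)[OF uw[OF that]] pairs_l2(2)[OF uw[OF that]])+
    have "(\<lambda>p. \<psi> p - (\<Sum>i\<in>K. ?c i * u i p), \<lambda>p. D \<psi> p - (\<Sum>i\<in>K. ?c i * w i p)) \<in> pairs"
      by (intro pairs_diff pairs_T \<psi> pairs_sum pairs_scale uw)
    moreover have "ip M (\<lambda>p. \<psi> p - (\<Sum>i\<in>K. ?c i * u i p)) (u j) = 0" if "j \<in> K" for j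
    proof -
      have "ip M (\<lambda>p. \<psi> p - (\<Sum>i\<in>K. ?c i * u i p)) (u j) = ?c j - (\<Sum>i\<in>K. ?c i * ip M (u i) (u j))"
        using that cl \<psi> by (simp add: ip_diff_left T_l2 l2_sum ul ip_sum_left ip_scale_left)
      also have "(\<Sum>i\<in>K. ?c i * ip M (u i) (u j)) = (\<Sum>i\<in>K. if i = j then ?c j else 0)"
        by (intro sum.cong) (auto simp: on that)
      finally show ?thesis using K that by simp
    qed
    ultimately have "(\<lambda>p. \<psi> p - (\<Sum>i\<in>K. ?c i * u i p), \<lambda>p. D \<psi> p - (\<Sum>i\<in>K. ?c i * w i p)) \<in> V"
      by (simp add: V_def)
    from var[OF this] have "ip M z0 (D \<psi>) - (\<Sum>i\<in>K. ?c i * ip M z0 (w i)) =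
        \<mu> * (ip M v0 \<psi> - (\<Sum>i\<in>K. ?c i * ip M v0 (u i)))"
      using cl \<psi> v0(1) z0(1)
      by (simp add: ip_diff_right T_l2 T_D l2_sum ip_sum_right ip_scale_right)
    moreover have "ip M z0 (w i) = 0" if "i \<in> K" for i
      using eigen_ip[OF ue[OF that] uw[OF that] vz0] orth0[OF that] by (simp add: ip_sym)
    ultimately have "ip M z0 (D \<psi>) = \<mu> * ip M v0 \<psi>" using orth0 by simp
    then show ?thesis using ip_pair_D[OF vz0 T_D[OF \<psi>]] by simp
  qed
  then have "v0 \<in> eigenspace \<mu>" using vz0 by (auto simp: eigenspace_def)
  from gap[OF \<mu>L this orth0] norm1 show False by simp
qed

section \<open>Multiplicities and orthonormal eigenfunctions\<close>

definition multiplicity :: "real \<Rightarrow> nat \<Rightarrow> bool" where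
  "multiplicity \<mu> d \<longleftrightarrow> (\<exists>e :: nat \<Rightarrow> 'a \<Rightarrow> real. (\<forall>j<d. e j \<in> eigenspace \<mu>) \<and>
     (\<forall>a. (AE p in M. (\<Sum>j<d. a j * e j p) = 0) \<longrightarrow> (\<forall>j<d. a j = 0)) \<and>
     (\<forall>u\<in>eigenspace \<mu>. \<exists>a. AE p in M. u p = (\<Sum>j<d. a j * e j p)))"

lemma ip_eq_0_AE:
  assumes "l2 M u" "ip M u u = 0" shows "AE p in M. u p = 0"
proof -
  have "AE p in M. u p * u p = 0"
    using assms integral_nonneg_eq_0_iff_AE[of M "\<lambda>p. u p * u p"] l2_mult_integrable[OF assms(1) assms(1)]
    by (simp add: ip_def)
  then show ?thesis by simp
qed

lemma orthonormal_lincomb_ip: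
  fixes S :: "'k set"
  assumes "finite S" "\<And>s. s \<in> S \<Longrightarrow> l2 M (u s)"
    and on: "\<And>i j. i \<in> S \<Longrightarrow> j \<in> S \<Longrightarrow> ip M (u i) (u j) = (if i = j then 1 else 0)" and "t \<in> S"
  shows "ip M (\<lambda>p. \<Sum>s\<in>S. c s * u s p) (u t) = c t"
proof -
  have "ip M (\<lambda>p. \<Sum>s\<in>S. c s * u s p) (u t) = (\<Sum>s\<in>S. c s * ip M (u s) (u t))"
    using assms by (subst ip_sum_left) (auto simp: ip_scale_left l2_scale)
  also have "\<dots> = (\<Sum>s\<in>S. if s = t then c s else 0)"
    using assms by (intro sum.cong) auto
  finally show ?thesis using assms by simp
qed

text \<open>More than \<open>d\<close> functions expressed by \<open>d\<close> generators satisfy a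
  nontrivial linear relation almost everywhere, which orthonormality excludes.\<close>

lemma multiplicity_orthonormal_card_le:
  fixes S :: "'k set"
  assumes mult: "multiplicity \<mu> d" and S: "finite S" and e: "\<And>s. s \<in> S \<Longrightarrow> u s \<in> eigenspace \<mu>"
    and on: "\<And>i j. i \<in> S \<Longrightarrow> j \<in> S \<Longrightarrow> ip M (u i) (u j) = (if i = j then 1 else 0)"
  shows "card S \<le> d"
proof (rule ccontr)
  assume "\<not> ?thesis"
  then have d: "d < card S" by simp
  obtain b where "\<forall>u\<in>eigenspace \<mu>. \<exists>a. AE p in M. u p = (\<Sum>j<d. a j * b j p)"
    using mult unfolding multiplicity_def by blast
  then have "\<forall>s\<in>S. \<exists>a. AE p in M. u s p = (\<Sum>j<d. a j * b j p)" using e by blast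
  from bchoice[OF this] obtain a where a: "\<forall>s\<in>S. AE p in M. u s p = (\<Sum>j<d. a s j * b j p)" by (elim exE)
  obtain c where c: "\<exists>s\<in>S. c s \<noteq> 0" "\<And>j. j < d \<Longrightarrow> (\<Sum>s\<in>S. c s * a s j) = 0"
    using homogeneous_system_solution[OF S d, of a] by blast
  have ul: "l2 M (u s)" if "s \<in> S" for s by (rule eigenspace_l2[OF e[OF that]])
  have "AE p in M. \<forall>s\<in>S. u s p = (\<Sum>j<d. a s j * b j p)"
    using a S by (subst AE_ball_countable) (auto intro: countable_finite)
  then have z: "AE p in M. (\<Sum>s\<in>S. c s * u s p) = 0"
  proof eventually_elim
    case (elim p)
    then have "(\<Sum>s\<in>S. c s * u s p) = (\<Sum>s\<in>S. \<Sum>j<d. c s * a s j * b j p)"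
      by (intro sum.cong) (simp_all add: sum_distrib_left mult.assoc)
    also have "\<dots> = (\<Sum>j<d. (\<Sum>s\<in>S. c s * a s j) * b j p)"
      by (subst sum.swap) (simp add: sum_distrib_right)
    also have "\<dots> = 0" using c(2) by simp
    finally show ?case .
  qed
  obtain t where t: "t \<in> S" "c t \<noteq> 0" using c(1) by blast
  have "ip M (\<lambda>p. \<Sum>s\<in>S. c s * u s p) (u t) = ip M (\<lambda>p. 0) (u t)"
    by (rule ip_cong_AE[OF z]) (auto intro!: l2_sum l2_scale ul t)
  with orthonormal_lincomb_ip[OF S ul on t(1), of c] t(2) show False by simp
qed

text \<open>Orthogonality to \<open>S\<close> imposes fewer than \<open>d\<close> linear conditions
  on the \<open>d\<close> coefficients of a combination of the basis; independence makes the
  solution nonzero, so it can be normalised.\<close>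

lemma multiplicity_orthogonal_element:
  fixes S :: "'k set"
  assumes mult: "multiplicity \<mu> d" and S: "finite S" "card S < d" and ul: "\<And>s. s \<in> S \<Longrightarrow> l2 M (u s)"
  shows "\<exists>v\<in>eigenspace \<mu>. ip M v v = 1 \<and> (\<forall>s\<in>S. ip M v (u s) = 0)"
proof -
  obtain b where b: "\<And>j. j < d \<Longrightarrow> b j \<in> eigenspace \<mu>"
    "\<And>a. (AE p in M. (\<Sum>j<d. a j * b j p) = 0) \<Longrightarrow> (\<forall>j<d. a j = 0)"
    using mult unfolding multiplicity_def by blast
  have bl: "l2 M (b j)" if "j < d" for j by (rule eigenspace_l2[OF b(1)[OF that]])
  obtain h where h: "bij_betw h {..<card S} S" using ex_bij_betw_nat_finite[OF S(1)] by (auto simp: atLeast0LessThan)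
  obtain c where c: "\<exists>j\<in>{..<d}. c j \<noteq> 0" "\<And>i. i < card S \<Longrightarrow> (\<Sum>j<d. c j * ip M (b j) (u (h i))) = 0"
    using homogeneous_system_solution[of "{..<d}" "card S" "\<lambda>j i. ip M (b j) (u (h i))"] S(2) by auto
  define v where "v p = (\<Sum>j<d. c j * b j p)" for p
  have vE: "v \<in> eigenspace \<mu>" unfolding v_def using b(1) by (intro eigenspace_lincomb) auto
  have vl: "l2 M v" by (rule eigenspace_l2[OF vE])
  have "ip M v v \<noteq> 0"
  proof
    assume "ip M v v = 0"
    from ip_eq_0_AE[OF vl this] have "AE p in M. (\<Sum>j<d. c j * b j p) = 0" by (simp add: v_def)
    from b(2)[OF this] c(1) show False by auto
  qed
  then have pos: "ip M v v > 0" using ip_nonneg[of M v] by (simp add: less_eq_real_def del: ip_nonneg)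
  have orth: "ip M v (u s) = 0" if "s \<in> S" for s
  proof -
    obtain i where i: "i < card S" "s = h i" using h \<open>s \<in> S\<close> by (auto simp: bij_betw_def)
    have "ip M v (u s) = (\<Sum>j<d. c j * ip M (b j) (u s))"
      unfolding v_def using bl ul[OF that] by (subst ip_sum_left) (auto simp: ip_scale_left l2_scale)
    with c(2)[OF i(1)] i(2) show ?thesis by simp
  qed
  let ?t = "1 / sqrt (ip M v v)"
  show ?thesis
  proof (intro bexI[of _ "\<lambda>p. ?t * v p"] conjI ballI)
    show "(\<lambda>p. ?t * v p) \<in> eigenspace \<mu>"
      using eigenspace_lincomb[of "{()}" "\<lambda>_. v" \<mu> "\<lambda>_. ?t"] vE by simp
    have "ip M (\<lambda>p. ?t * v p) (\<lambda>p. ?t * v p) = ?t * ?t * ip M v v"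
      by (simp only: ip_scale_left ip_scale_right mult.assoc)
    then show "ip M (\<lambda>p. ?t * v p) (\<lambda>p. ?t * v p) = 1" using pos by (simp add: real_sqrt_mult_self)
  qed (simp only: ip_scale_left orth mult_zero_right)
qed

lemma finite_spectrum_level:
  fixes ev :: "nat \<Rightarrow> real"
  assumes "filterlim ev at_top sequentially" shows "finite {i. 1 \<le> i \<and> ev i = \<mu>}"
proof -
  have "\<forall>\<^sub>F i in sequentially. \<mu> < ev i" using assms by (simp add: filterlim_at_top_dense)
  then obtain N where "\<And>i. i \<ge> N \<Longrightarrow> \<mu> < ev i" by (auto simp: eventually_sequentially)
  then have "{i. 1 \<le> i \<and> ev i = \<mu>} \<subseteq> {..<N}" by (auto simp: not_less[symmetric])
  then show ?thesis using finite_subset by blast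
qed

text \<open>For index \<open>Suc k\<close> only the earlier functions with the same eigenvalue have
  to be avoided, since eigenfunctions for different eigenvalues are orthogonal anyway. Their number
  is less than the multiplicity, in which \<open>Suc k\<close> itself is counted.\<close>

lemma orthonormal_eigenfunctions:
  fixes ev :: "nat \<Rightarrow> real"
  assumes lim: "filterlim ev at_top sequentially"
    and mult: "\<And>\<mu>. multiplicity \<mu> (card {i. 1 \<le> i \<and> ev i = \<mu>})"
  shows "\<exists>u. (\<forall>i\<in>{1..k}. u i \<in> eigenspace (ev i)) \<and>
     (\<forall>i\<in>{1..k}. \<forall>j\<in>{1..k}. ip M (u i) (u j) = (if i = j then 1 else 0))"
proof (induction k)
  case 0
  then show ?case by simp
next
  case (Suc k)
  then obtain u where u: "\<And>i. i \<in> {1..k} \<Longrightarrow> u i \<in> eigenspace (ev i)"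
    "\<And>i j. i \<in> {1..k} \<Longrightarrow> j \<in> {1..k} \<Longrightarrow> ip M (u i) (u j) = (if i = j then 1 else 0)" by blast
  let ?\<mu> = "ev (Suc k)"
  define S where "S = {i\<in>{1..k}. ev i = ?\<mu>}"
  have "card S < card {i. 1 \<le> i \<and> ev i = ?\<mu>}"
  proof (rule psubset_card_mono)
    show "finite {i. 1 \<le> i \<and> ev i = ?\<mu>}" by (rule finite_spectrum_level[OF lim])
    have "Suc k \<in> {i. 1 \<le> i \<and> ev i = ?\<mu>}" "Suc k \<notin> S" "S \<subseteq> {i. 1 \<le> i \<and> ev i = ?\<mu>}" by (auto simp: S_def)
    then show "S \<subset> {i. 1 \<le> i \<and> ev i = ?\<mu>}" by blast
  qed
  then obtain v where v: "v \<in> eigenspace ?\<mu>" "ip M v v = 1" "\<And>s. s \<in> S \<Longrightarrow> ip M v (u s) = 0"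
    using multiplicity_orthogonal_element[OF mult, of S ?\<mu> u] u(1) eigenspace_l2 by (auto simp: S_def)
  have orth: "ip M v (u i) = 0" if "i \<in> {1..k}" for i
  proof (cases "ev i = ?\<mu>")
    case True
    then show ?thesis using v(3) that by (auto simp: S_def)
  next
    case False
    then show ?thesis using eigenspace_orthogonal[OF v(1) u(1)[OF that]] by simp
  qed
  have "ip M (u i) v = 0" if "i \<in> {1..k}" for i using orth[OF that] by (simp add: ip_sym)
  then show ?case using u v orth
    by (intro exI[of _ "u(Suc k := v)"]) (auto simp: le_Suc_eq)
qed

text \<open>All indices of a value below \<open>ev (Suc k)\<close> are at most \<open>k\<close>, so
  the given \<open>u i\<close> already exhaust its eigenspace and a further normalised element would
  exceed the multiplicity. The same count with multiplicity 0 handles values that are not in the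
  list.\<close>

lemma spectral_gap:
  fixes ev :: "nat \<Rightarrow> real"
  assumes mono: "\<And>i. 1 \<le> i \<Longrightarrow> ev i \<le> ev (Suc i)"
    and mult: "\<And>\<mu>. multiplicity \<mu> (card {i. 1 \<le> i \<and> ev i = \<mu>})"
    and u: "\<And>i. i \<in> {1..k} \<Longrightarrow> u i \<in> eigenspace (ev i)"
      "\<And>i j. i \<in> {1..k} \<Longrightarrow> j \<in> {1..k} \<Longrightarrow> ip M (u i) (u j) = (if i = j then 1 else 0)"
    and \<mu>: "\<mu> < ev (Suc k)" and v: "v \<in> eigenspace \<mu>" "\<And>i. i \<in> {1..k} \<Longrightarrow> ip M v (u i) = 0"
  shows "ip M v v = 0"
proof (rule ccontr)
  assume nz: "ip M v v \<noteq> 0"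
  then have pos: "ip M v v > 0" using ip_nonneg[of M v] by (simp add: less_eq_real_def del: ip_nonneg)
  let ?t = "1 / sqrt (ip M v v)"
  define v' where "v' p = ?t * v p" for p
  have v': "v' \<in> eigenspace \<mu>"
    unfolding v'_def using eigenspace_lincomb[of "{()}" "\<lambda>_. v" \<mu> "\<lambda>_. ?t"] v(1) by simp
  have "ip M v' v' = ?t * ?t * ip M v v"
    unfolding v'_def by (simp only: ip_scale_left ip_scale_right mult.assoc)
  then have v'1: "ip M v' v' = 1" using pos by (simp add: real_sqrt_mult_self)
  have v'o: "ip M v' (u i) = 0" "ip M (u i) v' = 0" if "i \<in> {1..k}" for i
    using v(2)[OF that] unfolding v'_def by (simp_all only: ip_scale_left ip_scale_right ip_sym[of M "u i" v] mult_zero_right)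
  have mono': "ev i \<le> ev j" if "1 \<le> i" "i \<le> j" for i j
    using that(2,1) by (induction rule: dec_induct) (auto intro!: order_trans[OF _ mono])
  let ?S = "{i. 1 \<le> i \<and> ev i = \<mu>}"
  have Sk: "?S \<subseteq> {1..k}"
  proof
    fix i assume i: "i \<in> ?S"
    have "\<not> Suc k \<le> i" using mono'[of "Suc k" i] i \<mu> by auto
    then show "i \<in> {1..k}" using i by simp
  qed
  then have fin: "finite ?S" by (rule finite_subset) simp
  \<comment> \<open>\<open>None\<close> is the index of the supposed additional element.\<close>
  define w where "w i = (case i of None \<Rightarrow> v' | Some i \<Rightarrow> u i)" for i
  have "card (insert None (Some ` ?S)) \<le> card ?S"
  proof (rule multiplicity_orthonormal_card_le[OF mult[of \<mu>]])
    show "finite (insert None (Some ` ?S))" using fin by simp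
    fix s assume s: "s \<in> insert None (Some ` ?S)"
    show "w s \<in> eigenspace \<mu>"
    proof (cases s)
      case (Some i)
      then have "i \<in> {1..k}" "ev i = \<mu>" using s Sk by auto
      then show ?thesis using u(1)[of i] Some by (simp add: w_def)
    qed (simp add: w_def v')
    fix t assume t: "t \<in> insert None (Some ` ?S)"
    show "ip M (w s) (w t) = (if s = t then 1 else 0)"
      using s t Sk u(2) v'1 v'o by (cases s; cases t) (auto simp: w_def subset_iff)
  qed
  then show False using fin by (simp add: card_image)
qed

end

text \<open>In the application \<open>a\<close> and \<open>b\<close> are \<open>a\<^sub>i\<^sub>j\<close> and \<open>b\<^sub>i\<^sub>j\<close>, and the hypothesis \<open>c\<^sup>2 \<le> d * h\<close> is the condition on
  couples.\<close>

lemma couple_discriminant: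
  fixes a b s c d h :: real
  assumes s: "s > 0" and d: "0 < d" and c: "c\<^sup>2 \<le> d * h"
  shows "c * a * b \<le> s / 2 * h * a\<^sup>2 + d * b\<^sup>2 / (2 * s)"
proof -
  have h: "h \<ge> 0"
  proof (rule ccontr)
    assume "\<not> h \<ge> 0"
    then have "d * h < 0" using d by (simp add: mult_pos_neg)
    with c show False using zero_le_power2[of c] by linarith
  qed
  have "0 \<le> (s * c * a - d * b)\<^sup>2" by simp
  then have 1: "2 * s * d * (c * a * b) \<le> s\<^sup>2 * (c\<^sup>2 * a\<^sup>2) + d\<^sup>2 * b\<^sup>2"
    by (simp add: power2_eq_square algebra_simps)
  have "s\<^sup>2 * (c\<^sup>2 * a\<^sup>2) \<le> s\<^sup>2 * (d * h * a\<^sup>2)"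
    by (intro mult_left_mono mult_right_mono c) auto
  with 1 have "2 * s * d * (c * a * b) \<le> s\<^sup>2 * (d * h * a\<^sup>2) + d\<^sup>2 * b\<^sup>2" by linarith
  also have "s\<^sup>2 * (d * h * a\<^sup>2) + d\<^sup>2 * b\<^sup>2 = 2 * s * d * (s / 2 * h * a\<^sup>2 + d * b\<^sup>2 / (2 * s))"
    using s by (simp add: distrib_left power2_eq_square)
  finally have "2 * s * d * (c * a * b) \<le> 2 * s * d * (s / 2 * h * a\<^sup>2 + d * b\<^sup>2 / (2 * s))" .
  then show ?thesis using s d by (simp add: mult_le_cancel_left_pos)
qed

text \<open>\<open>N i\<close> stands for the squared norm of the trial function and
  \<open>\<tau> i - (\<Sum>j\<in>K. (b i j)\<^sup>2)\<close> for that of the projected half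
  commutator; \<open>cs\<close> is Cauchy-Schwarz for the two, \<open>gap\<close> the variational
  principle, \<open>bessel\<close> Bessel's inequality. The parameter \<open>s\<close> is the one to
  be optimized.\<close>

lemma couple_inequality:
  fixes a b :: "'k \<Rightarrow> 'k \<Rightarrow> real" and l f g N w t \<tau> :: "'k \<Rightarrow> real"
  assumes "finite K" and s: "s > 0"
    and lL: "\<And>i. i \<in> K \<Longrightarrow> l i < L" and fg: "\<And>i. i \<in> K \<Longrightarrow> 0 < f i" "\<And>i. i \<in> K \<Longrightarrow> 0 < g i"
    and fgc: "\<And>i j. i \<in> K \<Longrightarrow> j \<in> K \<Longrightarrow> (f i - f j)\<^sup>2 \<le>
       ((f i)\<^sup>2 / (g i * (L - l i)) + (f j)\<^sup>2 / (g j * (L - l j))) * ((g j - g i) * (l i - l j))"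
    and a: "\<And>i j. i \<in> K \<Longrightarrow> j \<in> K \<Longrightarrow> a i j = a j i" and b: "\<And>i j. i \<in> K \<Longrightarrow> j \<in> K \<Longrightarrow> b i j = - b j i"
    and N: "\<And>i. i \<in> K \<Longrightarrow> 0 \<le> N i"
    and gap: "\<And>i. i \<in> K \<Longrightarrow> (L - l i) * N i \<le> w i + (\<Sum>j\<in>K. (l i - l j) * (a i j)\<^sup>2)"
    and cs: "\<And>i. i \<in> K \<Longrightarrow> (t i + 2 * (\<Sum>j\<in>K. a i j * b i j))\<^sup>2 \<le> 4 * (N i * (\<tau> i - (\<Sum>j\<in>K. (b i j)\<^sup>2)))"
    and bessel: "\<And>i. i \<in> K \<Longrightarrow> (\<Sum>j\<in>K. (b i j)\<^sup>2) \<le> \<tau> i"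
  shows "(\<Sum>i\<in>K. f i * t i) \<le> s * (\<Sum>i\<in>K. g i * w i) + (\<Sum>i\<in>K. (f i)\<^sup>2 / (g i * (L - l i)) * \<tau> i) / s"
proof -
  define F where "F i = (f i)\<^sup>2 / (g i * (L - l i))" for i
  have F: "0 < F i" if "i \<in> K" for i using fg[OF that] lL[OF that] by (simp add: F_def)
  have amgm: "4 * (x * y) \<le> (x + y)\<^sup>2" for x y :: real
    using zero_le_power2[of "x - y"] by (simp add: power2_eq_square algebra_simps)
  let ?B = "\<lambda>i. \<Sum>j\<in>K. (b i j)\<^sup>2"
  have 1: "f i * (t i + 2 * (\<Sum>j\<in>K. a i j * b i j)) \<le>
      s * g i * (w i + (\<Sum>j\<in>K. (l i - l j) * (a i j)\<^sup>2)) + F i * (\<tau> i - ?B i) / s" if i: "i \<in> K" for i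
  proof -
    have pos: "0 < g i * (L - l i)" using fg[OF i] lL[OF i] by simp
    \<comment> \<open>Up to the factor 4, the product \<open>?p * ?q\<close> is what Cauchy-Schwarz
      allows: \<open>F i\<close> is built to cancel \<open>g i * (L - l i)\<close>, and
      \<open>s\<close> cancels as well.\<close>
    let ?p = "s * (g i * (L - l i)) * N i" and ?q = "F i * (\<tau> i - ?B i) / s"
    have "(f i * (t i + 2 * (\<Sum>j\<in>K. a i j * b i j)))\<^sup>2 \<le> (f i)\<^sup>2 * (4 * (N i * (\<tau> i - ?B i)))"
      unfolding power_mult_distrib by (intro mult_left_mono cs i) auto
    also have "\<dots> = 4 * (?p * ?q)"
    proof -
      have "F i * (g i * (L - l i)) = (f i)\<^sup>2" using fg(2)[OF i] lL[OF i] by (simp add: F_def)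
      moreover have "?p * ?q = F i * (g i * (L - l i)) * (N i * (\<tau> i - ?B i))" using s by simp
      ultimately show ?thesis by simp
    qed
    also have "\<dots> \<le> (?p + ?q)\<^sup>2"
      by (rule amgm)
    finally have sq: "(f i * (t i + 2 * (\<Sum>j\<in>K. a i j * b i j)))\<^sup>2 \<le> (?p + ?q)\<^sup>2" .
    have "0 \<le> ?p + ?q" using pos s N[OF i] F[OF i] bessel[OF i] by (intro add_nonneg_nonneg) auto
    with sq have "f i * (t i + 2 * (\<Sum>j\<in>K. a i j * b i j)) \<le> ?p + ?q" by (rule power2_le_imp_le)
    moreover have "?p \<le> s * g i * (w i + (\<Sum>j\<in>K. (l i - l j) * (a i j)\<^sup>2))"
    proof -
      have "?p = s * g i * ((L - l i) * N i)" by simp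
      also have "\<dots> \<le> s * g i * (w i + (\<Sum>j\<in>K. (l i - l j) * (a i j)\<^sup>2))"
        using s fg(2)[OF i] by (intro mult_left_mono gap i) auto
      finally show ?thesis .
    qed
    ultimately show ?thesis by linarith
  qed
  \<comment> \<open>Symmetrising in \<open>i\<close> and \<open>j\<close> turns the factors
    \<open>f i\<close> and \<open>g i\<close> into differences, because \<open>a\<close> is
    symmetric and \<open>b\<close> antisymmetric. Each symmetrised pair is then nonnegative by the
    condition on the couple.\<close>
  have swap: "(\<Sum>i\<in>K. \<Sum>j\<in>K. h i j) = (\<Sum>i\<in>K. \<Sum>j\<in>K. (h i j + h j i) / 2)" for h :: "'k \<Rightarrow> 'k \<Rightarrow> real"
  proof -
    have "(\<Sum>i\<in>K. \<Sum>j\<in>K. h i j) = (\<Sum>i\<in>K. \<Sum>j\<in>K. h j i)" by (rule sum.swap)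
    then show ?thesis by (simp add: sum.distrib add_divide_distrib sum_divide_distrib[symmetric])
  qed
  let ?h = "\<lambda>i j. 2 * f i * a i j * b i j - s * g i * (l i - l j) * (a i j)\<^sup>2 + F i * (b i j)\<^sup>2 / s"
  have pair: "0 \<le> (?h i j + ?h j i) / 2" if "i \<in> K" "j \<in> K" for i j
  proof -
    have "- (f i - f j) * a i j * b i j \<le> s / 2 * ((g j - g i) * (l i - l j)) * (a i j)\<^sup>2 + (F i + F j) * (b i j)\<^sup>2 / (2 * s)"
      using fgc[OF that] F[OF that(1)] F[OF that(2)]
      by (intro couple_discriminant s) (auto simp: F_def power2_commute)
    moreover have "(?h i j + ?h j i) / 2 = (f i - f j) * a i j * b i j +
        s / 2 * ((g j - g i) * (l i - l j)) * (a i j)\<^sup>2 + (F i + F j) * (b i j)\<^sup>2 / (2 * s)"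
      unfolding a[OF that(2,1)] b[OF that(2,1)] using s by (simp add: field_simps)
    ultimately show ?thesis by linarith
  qed
  have "0 \<le> (\<Sum>i\<in>K. \<Sum>j\<in>K. ?h i j)" unfolding swap[of ?h] by (intro sum_nonneg pair)
  moreover have "(\<Sum>i\<in>K. \<Sum>j\<in>K. ?h i j) = (\<Sum>i\<in>K. f i * (2 * (\<Sum>j\<in>K. a i j * b i j)) -
      s * g i * (\<Sum>j\<in>K. (l i - l j) * (a i j)\<^sup>2) + F i * ?B i / s)"
    by (intro sum.cong refl) (simp add: sum.distrib sum_subtractf sum_distrib_left sum_divide_distrib mult.assoc mult.left_commute)
  ultimately have 2: "0 \<le> (\<Sum>i\<in>K. f i * (2 * (\<Sum>j\<in>K. a i j * b i j)) -
      s * g i * (\<Sum>j\<in>K. (l i - l j) * (a i j)\<^sup>2) + F i * ?B i / s)" by simp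
  have "(\<Sum>i\<in>K. f i * (t i + 2 * (\<Sum>j\<in>K. a i j * b i j))) \<le>
      (\<Sum>i\<in>K. s * g i * (w i + (\<Sum>j\<in>K. (l i - l j) * (a i j)\<^sup>2)) + F i * (\<tau> i - ?B i) / s)"
    by (intro sum_mono 1)
  with 2 have "(\<Sum>i\<in>K. f i * t i) \<le> (\<Sum>i\<in>K. s * g i * w i + F i * \<tau> i / s)"
    by (simp add: sum.distrib sum_subtractf algebra_simps diff_divide_distrib)
  also have "\<dots> = s * (\<Sum>i\<in>K. g i * w i) + (\<Sum>i\<in>K. F i * \<tau> i) / s"
    by (simp add: sum.distrib sum_distrib_left sum_divide_distrib mult.assoc)
  finally show ?thesis by (simp add: F_def)
qed

text \<open>\<open>X \<alpha>\<close> is a coordinate of the immersion and \<open>m \<alpha>\<close> stands for \<open>2 |grad (X \<alpha>)|\<^sup>2\<close>, so that the gradient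
  does not occur.\<close>

locale plate_immersion = plate M T D for M :: "'a measure" and T D +
  fixes X :: "'m::finite \<Rightarrow> 'a \<Rightarrow> real" and m :: "'m \<Rightarrow> 'a \<Rightarrow> real" and n \<delta> :: real
  assumes X_meas: "X \<alpha> \<in> borel_measurable M" and X_bdd: "\<exists>C. \<forall>\<alpha>. \<forall>p\<in>space M. \<bar>X \<alpha> p\<bar> \<le> C"
    and m_meas: "m \<alpha> \<in> borel_measurable M" and m_nonneg: "p \<in> space M \<Longrightarrow> 0 \<le> m \<alpha> p"
    and m_sum: "p \<in> space M \<Longrightarrow> (\<Sum>\<alpha>\<in>UNIV. m \<alpha> p) = 2 * n"
    and X_T: "\<phi> \<in> T \<Longrightarrow> (\<lambda>p. X \<alpha> p * \<phi> p) \<in> T"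
    and D_X2: "\<phi> \<in> T \<Longrightarrow> p \<in> space M \<Longrightarrow>
      D (\<lambda>p. X \<alpha> p * (X \<alpha> p * \<phi> p)) p - 2 * X \<alpha> p * D (\<lambda>p. X \<alpha> p * \<phi> p) p + X \<alpha> p * X \<alpha> p * D \<phi> p = m \<alpha> p * \<phi> p"
    and n_pos: "0 < n" and \<delta>_nonneg: "0 \<le> \<delta>"
    and commutator_bound: "\<phi> \<in> T \<Longrightarrow>
      (\<Sum>\<alpha>\<in>UNIV. ip M (\<lambda>p. D (\<lambda>p. X \<alpha> p * \<phi> p) p - X \<alpha> p * D \<phi> p) (\<lambda>p. D (\<lambda>p. X \<alpha> p * \<phi> p) p - X \<alpha> p * D \<phi> p))
        \<le> - 4 * ip M \<phi> (D \<phi>) + n\<^sup>2 * \<delta> * ip M \<phi> \<phi>"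
begin

definition P :: "'m \<Rightarrow> ('a \<Rightarrow> real) \<Rightarrow> 'a \<Rightarrow> real" where
  "P \<alpha> \<phi> p = D (\<lambda>p. X \<alpha> p * \<phi> p) p - X \<alpha> p * D \<phi> p"

lemma X_mult_l2: "l2 M u \<Longrightarrow> l2 M (\<lambda>p. X \<alpha> p * u p)"
  using X_bdd l2_bounded_mult[OF _ X_meas] by blast

lemma m_bdd: "p \<in> space M \<Longrightarrow> \<bar>m \<alpha> p\<bar> \<le> 2 * n"
  using member_le_sum[of \<alpha> UNIV "\<lambda>\<alpha>. m \<alpha> p"] m_nonneg m_sum by simp

lemma m_mult_l2: "l2 M u \<Longrightarrow> l2 M (\<lambda>p. m \<alpha> p * u p)"
  using l2_bounded_mult[OF _ m_meas m_bdd] by blast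

lemma P_T: "\<phi> \<in> T \<Longrightarrow> P \<alpha> \<phi> \<in> T"
  unfolding P_def by (intro T_diff T_D X_T)

lemma P_diff: "\<phi> \<in> T \<Longrightarrow> \<psi> \<in> T \<Longrightarrow> P \<alpha> (\<lambda>p. \<phi> p - \<psi> p) = (\<lambda>p. P \<alpha> \<phi> p - P \<alpha> \<psi> p)"
  using D_diff[OF X_T X_T, of \<phi> \<psi> \<alpha> \<alpha>] by (auto simp: P_def D_diff right_diff_distrib fun_eq_iff)

lemma P_bound: "\<phi> \<in> T \<Longrightarrow> (\<Sum>\<alpha>\<in>UNIV. ip M (P \<alpha> \<phi>) (P \<alpha> \<phi>)) \<le> - 4 * ip M \<phi> (D \<phi>) + n\<^sup>2 * \<delta> * ip M \<phi> \<phi>"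
  unfolding P_def[abs_def] by (rule commutator_bound)

lemma ip_X_left: "ip M (\<lambda>p. X \<alpha> p * u p) v = ip M u (\<lambda>p. X \<alpha> p * v p)"
  by (simp add: ip_def mult.left_commute mult.assoc)

lemma P_skew: assumes "\<phi> \<in> T" "\<psi> \<in> T" shows "ip M (P \<alpha> \<phi>) \<psi> = - ip M \<phi> (P \<alpha> \<psi>)"
proof -
  have "ip M (P \<alpha> \<phi>) \<psi> = ip M (D (\<lambda>p. X \<alpha> p * \<phi> p)) \<psi> - ip M (\<lambda>p. X \<alpha> p * D \<phi> p) \<psi>"
    unfolding P_def by (intro ip_diff_left T_l2 T_D X_T assms)
  also have "\<dots> = ip M \<phi> (\<lambda>p. X \<alpha> p * D \<psi> p) - ip M \<phi> (D (\<lambda>p. X \<alpha> p * \<psi> p))"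
    by (simp add: D_sym assms X_T ip_X_left)
  also have "\<dots> = - ip M \<phi> (P \<alpha> \<psi>)"
    unfolding P_def by (subst ip_diff_right) (auto intro!: T_l2 T_D X_T assms)
  finally show ?thesis .
qed

text \<open>The commutator \<open>P\<close> involves first derivatives, which \<open>pairs\<close> does not record; \<open>q\<close> is its limit
  along the approximating test functions.\<close>

definition triples :: "(('a \<Rightarrow> real) \<times> ('a \<Rightarrow> real) \<times> ('m \<Rightarrow> 'a \<Rightarrow> real)) set" where
  "triples = {(u, w, q). l2 M u \<and> l2 M w \<and> (\<forall>\<alpha>. l2 M (q \<alpha>)) \<and> (\<exists>\<phi>. (\<forall>j. \<phi> j \<in> T) \<and> l2_tendsto M \<phi> u \<and>
     l2_tendsto M (\<lambda>j. D (\<phi> j)) w \<and> (\<forall>\<alpha>. l2_tendsto M (\<lambda>j. P \<alpha> (\<phi> j)) (q \<alpha>)))}"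

lemma triplesE:
  assumes "(u, w, q) \<in> triples"
  obtains \<phi> where "\<And>j. \<phi> j \<in> T" "l2_tendsto M \<phi> u" "l2_tendsto M (\<lambda>j. D (\<phi> j)) w"
    "\<And>\<alpha>. l2_tendsto M (\<lambda>j. P \<alpha> (\<phi> j)) (q \<alpha>)"
  using assms by (auto simp: triples_def)

lemma triples_l2: assumes "(u, w, q) \<in> triples" shows "l2 M u" "l2 M w" "l2 M (q \<alpha>)"
  using assms by (auto simp: triples_def)

lemma l2_tendsto_Cauchy:
  assumes "l2 M u" "\<And>j. l2 M (\<phi> j)" "l2_tendsto M \<phi> u" "e > 0"
  shows "\<exists>N. \<forall>i\<ge>N. \<forall>j\<ge>N. ip M (\<lambda>p. \<phi> i p - \<phi> j p) (\<lambda>p. \<phi> i p - \<phi> j p) < e"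
proof -
  have "e / 4 > 0" using assms by simp
  from LIMSEQ_D[OF assms(3) this] obtain N where
    N: "\<And>j. j \<ge> N \<Longrightarrow> ip M (\<lambda>p. \<phi> j p - u p) (\<lambda>p. \<phi> j p - u p) < e / 4" by auto
  have eq: "ip M (\<lambda>p. u p - \<phi> j p) (\<lambda>p. u p - \<phi> j p) = ip M (\<lambda>p. \<phi> j p - u p) (\<lambda>p. \<phi> j p - u p)" for j
    by (simp add: ip_def algebra_simps)
  show ?thesis
  proof (intro exI[of _ N] allI impI)
    fix i j assume "N \<le> i" "N \<le> j"
    then show "ip M (\<lambda>p. \<phi> i p - \<phi> j p) (\<lambda>p. \<phi> i p - \<phi> j p) < e"
      using N[of i] N[of j] ip_le_of_near[OF assms(2)[of i] assms(1) assms(2)[of j]] unfolding eq by linarith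
  qed
qed

text \<open>The commutator bound, applied to differences of test functions, is controlled by the
  functions and their images under \<open>D\<close>; convergence of these two makes the sequence of
  commutators Cauchy.\<close>

lemma triples_exist:
  assumes "(u, w) \<in> pairs" shows "\<exists>q. (u, w, q) \<in> triples"
proof -
  note l = assms[THEN pairs_l2(1)] assms[THEN pairs_l2(2)]
  obtain \<phi> where \<phi>: "\<And>j. \<phi> j \<in> T" "l2_tendsto M \<phi> u" "l2_tendsto M (\<lambda>j. D (\<phi> j)) w"
    by (rule pairsE[OF assms], rule that)
  have "\<exists>q. l2 M q \<and> l2_tendsto M (\<lambda>j. P \<alpha> (\<phi> j)) q" for \<alpha>
  proof (rule l2_complete)
    show "l2 M (P \<alpha> (\<phi> j))" for j by (intro T_l2 P_T \<phi>)
    fix e :: real assume "e > 0"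
    \<comment> \<open>4 for the cross term, \<open>n^2 * \<delta>\<close> for the other one, and 1
      to spare for a strict inequality.\<close>
    define C where "C = 5 + n\<^sup>2 * \<delta>"
    have C: "C > 0" using \<delta>_nonneg by (simp add: C_def add_pos_nonneg)
    have "e / C > 0" using C \<open>e > 0\<close> by simp
    obtain N1 where N1: "\<And>i j. i \<ge> N1 \<Longrightarrow> j \<ge> N1 \<Longrightarrow> ip M (\<lambda>p. \<phi> i p - \<phi> j p) (\<lambda>p. \<phi> i p - \<phi> j p) < e / C"
      using l2_tendsto_Cauchy[OF l(1) T_l2[OF \<phi>(1)] \<phi>(2) \<open>e / C > 0\<close>] by auto
    obtain N2 where N2: "\<And>i j. i \<ge> N2 \<Longrightarrow> j \<ge> N2 \<Longrightarrow> ip M (\<lambda>p. D (\<phi> i) p - D (\<phi> j) p) (\<lambda>p. D (\<phi> i) p - D (\<phi> j) p) < e / C"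
      using l2_tendsto_Cauchy[OF l(2) T_l2[OF T_D[OF \<phi>(1)]] \<phi>(3) \<open>e / C > 0\<close>] by auto
    show "\<exists>N. \<forall>i\<ge>N. \<forall>j\<ge>N. ip M (\<lambda>p. P \<alpha> (\<phi> i) p - P \<alpha> (\<phi> j) p) (\<lambda>p. P \<alpha> (\<phi> i) p - P \<alpha> (\<phi> j) p) < e"
    proof (intro exI[of _ "max N1 N2"] allI impI)
      fix i j assume ij: "max N1 N2 \<le> i" "max N1 N2 \<le> j"
      let ?d = "\<lambda>p. \<phi> i p - \<phi> j p"
      have dT: "?d \<in> T" by (intro T_diff \<phi>)
      have "ip M (P \<alpha> ?d) (P \<alpha> ?d) \<le> (\<Sum>\<alpha>\<in>UNIV. ip M (P \<alpha> ?d) (P \<alpha> ?d))"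
        using member_le_sum[of \<alpha> UNIV "\<lambda>\<alpha>. ip M (P \<alpha> ?d) (P \<alpha> ?d)"] by simp
      also have "\<dots> \<le> - 4 * ip M ?d (D ?d) + n\<^sup>2 * \<delta> * ip M ?d ?d" by (rule P_bound[OF dT])
      also have "\<dots> < e"
      proof -
        have a: "ip M ?d ?d < e / C" using N1 ij by simp
        have b: "ip M (D ?d) (D ?d) < e / C" using N2 ij by (simp add: D_diff \<phi>(1))
        have "\<bar>ip M ?d (D ?d)\<bar> \<le> sqrt (ip M ?d ?d) * sqrt (ip M (D ?d) (D ?d))"
          by (intro ip_abs_le T_l2 T_D dT)
        also have "\<dots> \<le> sqrt (e / C) * sqrt (e / C)"
          using a b \<open>e / C > 0\<close> by (intro mult_mono real_sqrt_le_mono) (auto intro: less_imp_le)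
        also have "\<dots> = e / C" using real_sqrt_mult_self[of "e / C"] \<open>e / C > 0\<close> by (simp only: abs_of_pos)
        finally have "- 4 * ip M ?d (D ?d) \<le> 4 * (e / C)" by linarith
        moreover have "n\<^sup>2 * \<delta> * ip M ?d ?d \<le> n\<^sup>2 * \<delta> * (e / C)" using a \<delta>_nonneg by (intro mult_left_mono) auto
        moreover have "4 * (e / C) + n\<^sup>2 * \<delta> * (e / C) = C * (e / C) - e / C"
          by (simp add: C_def distrib_right left_diff_distrib[symmetric] del: times_divide_eq_right)
        moreover have "C * (e / C) = e" using C by simp
        ultimately show ?thesis using \<open>e / C > 0\<close> by linarith
      qed
      finally show "ip M (\<lambda>p. P \<alpha> (\<phi> i) p - P \<alpha> (\<phi> j) p) (\<lambda>p. P \<alpha> (\<phi> i) p - P \<alpha> (\<phi> j) p) < e"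
        by (simp add: P_diff \<phi>(1))
    qed
  qed
  then have "\<forall>\<alpha>. \<exists>q. l2 M q \<and> l2_tendsto M (\<lambda>j. P \<alpha> (\<phi> j)) q" by simp
  from choice[OF this] obtain q where q: "\<forall>\<alpha>. l2 M (q \<alpha>) \<and> l2_tendsto M (\<lambda>j. P \<alpha> (\<phi> j)) (q \<alpha>)" by (elim exE)
  have "(u, w, q) \<in> triples"
    unfolding triples_def using q \<phi> l by (simp, intro exI[of _ \<phi>]) simp
  then show ?thesis by - (rule exI[of _ q])
qed

text \<open>The second multiplication by \<open>X \<alpha>\<close> brings in the double commutator
  \<open>m \<alpha>\<close>. The second pair allows the eigenvalue equation to be tested with the
  square of the coordinate times \<open>u\<close>, which is how the Laplacian of
  \<open>X \<alpha>\<close> times \<open>u\<close> gets its norm.\<close>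

lemma triples_X_pairs:
  assumes "(u, w, q) \<in> triples"
  shows "(\<lambda>p. X \<alpha> p * u p, \<lambda>p. X \<alpha> p * w p + q \<alpha> p) \<in> pairs"
    and "(\<lambda>p. X \<alpha> p * (X \<alpha> p * u p), \<lambda>p. X \<alpha> p * (X \<alpha> p * w p) + (2 * (X \<alpha> p * q \<alpha> p) + m \<alpha> p * u p)) \<in> pairs"
proof -
  note l = triples_l2[OF assms]
  obtain \<phi> where \<phi>: "\<And>j. \<phi> j \<in> T" "l2_tendsto M \<phi> u" "l2_tendsto M (\<lambda>j. D (\<phi> j)) w"
    "\<And>\<alpha>. l2_tendsto M (\<lambda>j. P \<alpha> (\<phi> j)) (q \<alpha>)" by (rule triplesE[OF assms], rule that)
  obtain C where C: "\<And>p. p \<in> space M \<Longrightarrow> \<bar>X \<alpha> p\<bar> \<le> C" using X_bdd by blast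
  have Xt: "l2_tendsto M (\<lambda>j p. X \<alpha> p * a j p) (\<lambda>p. X \<alpha> p * b p)"
    if "l2 M b" "\<And>j. l2 M (a j)" "l2_tendsto M a b" for a b
    by (rule l2_tendsto_bounded_mult[OF that X_meas C])
  have P_eq: "D (\<lambda>p. X \<alpha> p * \<phi> j p) = (\<lambda>p. X \<alpha> p * D (\<phi> j) p + P \<alpha> (\<phi> j) p)" for j
    by (auto simp: P_def)
  note Tl = T_l2[OF \<phi>(1)] and Dl = T_l2[OF T_D[OF \<phi>(1)]] and Pl = T_l2[OF P_T[OF \<phi>(1)]]
  show "(\<lambda>p. X \<alpha> p * u p, \<lambda>p. X \<alpha> p * w p + q \<alpha> p) \<in> pairs"
  proof (rule pairsI[where \<phi>="\<lambda>j p. X \<alpha> p * \<phi> j p"])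
    show "l2_tendsto M (\<lambda>j p. X \<alpha> p * \<phi> j p) (\<lambda>p. X \<alpha> p * u p)" by (rule Xt[OF l(1) Tl \<phi>(2)])
    show "l2_tendsto M (\<lambda>j. D (\<lambda>p. X \<alpha> p * \<phi> j p)) (\<lambda>p. X \<alpha> p * w p + q \<alpha> p)"
      unfolding P_eq
      by (rule l2_tendsto_add[OF X_mult_l2[OF l(2)] X_mult_l2[OF Dl] Xt[OF l(2) Dl \<phi>(3)] l(3) Pl \<phi>(4)])
  qed (intro X_mult_l2 l2_add l X_T \<phi>)+
  have tM: "l2_tendsto M (\<lambda>j p. m \<alpha> p * \<phi> j p) (\<lambda>p. m \<alpha> p * u p)"
    by (rule l2_tendsto_bounded_mult[OF l(1) Tl \<phi>(2) m_meas m_bdd])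
  have tX: "l2_tendsto M (\<lambda>j p. 2 * (X \<alpha> p * P \<alpha> (\<phi> j) p)) (\<lambda>p. 2 * (X \<alpha> p * q \<alpha> p))"
    by (rule l2_tendsto_scale[OF X_mult_l2[OF l(3)] X_mult_l2[OF Pl] Xt[OF l(3) Pl \<phi>(4)]])
  have t2: "l2_tendsto M (\<lambda>j p. 2 * (X \<alpha> p * P \<alpha> (\<phi> j) p) + m \<alpha> p * \<phi> j p) (\<lambda>p. 2 * (X \<alpha> p * q \<alpha> p) + m \<alpha> p * u p)"
    by (rule l2_tendsto_add[OF l2_scale[OF X_mult_l2[OF l(3)]] l2_scale[OF X_mult_l2[OF Pl]] tX m_mult_l2[OF l(1)] m_mult_l2[OF Tl] tM])
  have tXX: "l2_tendsto M (\<lambda>j p. X \<alpha> p * (X \<alpha> p * D (\<phi> j) p)) (\<lambda>p. X \<alpha> p * (X \<alpha> p * w p))"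
    by (rule Xt[OF X_mult_l2[OF l(2)] X_mult_l2[OF Dl] Xt[OF l(2) Dl \<phi>(3)]])
  have D2: "D (\<lambda>p. X \<alpha> p * (X \<alpha> p * \<phi> j p)) p = X \<alpha> p * (X \<alpha> p * D (\<phi> j) p) + (2 * (X \<alpha> p * P \<alpha> (\<phi> j) p) + m \<alpha> p * \<phi> j p)"
    if "p \<in> space M" for p j
    using D_X2[OF \<phi>(1)[of j] that, of \<alpha>] by (simp add: P_def algebra_simps)
  show "(\<lambda>p. X \<alpha> p * (X \<alpha> p * u p), \<lambda>p. X \<alpha> p * (X \<alpha> p * w p) + (2 * (X \<alpha> p * q \<alpha> p) + m \<alpha> p * u p)) \<in> pairs"
  proof (rule pairsI[where \<phi>="\<lambda>j p. X \<alpha> p * (X \<alpha> p * \<phi> j p)"])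
    show "l2_tendsto M (\<lambda>j p. X \<alpha> p * (X \<alpha> p * \<phi> j p)) (\<lambda>p. X \<alpha> p * (X \<alpha> p * u p))"
      by (rule Xt[OF X_mult_l2[OF l(1)] X_mult_l2[OF Tl] Xt[OF l(1) Tl \<phi>(2)]])
    let ?R = "\<lambda>p. X \<alpha> p * (X \<alpha> p * w p) + (2 * (X \<alpha> p * q \<alpha> p) + m \<alpha> p * u p)"
    let ?L = "\<lambda>j p. X \<alpha> p * (X \<alpha> p * D (\<phi> j) p) + (2 * (X \<alpha> p * P \<alpha> (\<phi> j) p) + m \<alpha> p * \<phi> j p)"
    have "l2_tendsto M ?L ?R"
      by (rule l2_tendsto_add[OF X_mult_l2[OF X_mult_l2[OF l(2)]] X_mult_l2[OF X_mult_l2[OF Dl]] tXX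
            l2_add[OF l2_scale[OF X_mult_l2[OF l(3)]] m_mult_l2[OF l(1)]]
            l2_add[OF l2_scale[OF X_mult_l2[OF Pl]] m_mult_l2[OF Tl]] t2])
    moreover have "ip M (\<lambda>p. ?L j p - ?R p) (\<lambda>p. ?L j p - ?R p) =
       ip M (\<lambda>p. D (\<lambda>p. X \<alpha> p * (X \<alpha> p * \<phi> j p)) p - ?R p) (\<lambda>p. D (\<lambda>p. X \<alpha> p * (X \<alpha> p * \<phi> j p)) p - ?R p)" for j
      unfolding ip_def by (rule Bochner_Integration.integral_cong[OF refl]) (simp only: D2)
    ultimately show "l2_tendsto M (\<lambda>j. D (\<lambda>p. X \<alpha> p * (X \<alpha> p * \<phi> j p))) ?R" by simp
  qed (intro X_mult_l2 l2_add l2_scale m_mult_l2 l X_T \<phi>)+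
qed

lemma triples_skew:
  assumes "(u, w, q) \<in> triples" "(u', w', q') \<in> triples"
  shows "ip M (q \<alpha>) u' = - ip M u (q' \<alpha>)"
proof -
  note l = triples_l2[OF assms(1)] and l' = triples_l2[OF assms(2)]
  obtain \<phi> where \<phi>: "\<And>j. \<phi> j \<in> T" "l2_tendsto M \<phi> u" "l2_tendsto M (\<lambda>j. D (\<phi> j)) w"
    "\<And>\<alpha>. l2_tendsto M (\<lambda>j. P \<alpha> (\<phi> j)) (q \<alpha>)" by (rule triplesE[OF assms(1)], rule that)
  obtain \<psi> where \<psi>: "\<And>j. \<psi> j \<in> T" "l2_tendsto M \<psi> u'" "l2_tendsto M (\<lambda>j. D (\<psi> j)) w'"
    "\<And>\<alpha>. l2_tendsto M (\<lambda>j. P \<alpha> (\<psi> j)) (q' \<alpha>)" by (rule triplesE[OF assms(2)], rule that)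
  have "(\<lambda>j. ip M (P \<alpha> (\<phi> j)) (\<psi> j)) \<longlonglongrightarrow> ip M (q \<alpha>) u'"
    by (rule l2_tendsto_ip[OF l(3) T_l2[OF P_T[OF \<phi>(1)]] \<phi>(4) l'(1) T_l2[OF \<psi>(1)] \<psi>(2)])
  moreover have "(\<lambda>j. - ip M (\<phi> j) (P \<alpha> (\<psi> j))) \<longlonglongrightarrow> - ip M u (q' \<alpha>)"
    by (intro tendsto_minus l2_tendsto_ip[OF l(1) T_l2[OF \<phi>(1)] \<phi>(2) l'(3) T_l2[OF P_T[OF \<psi>(1)]] \<psi>(4)])
  ultimately show ?thesis unfolding P_skew[OF \<phi>(1) \<psi>(1)] by (rule LIMSEQ_unique)
qed

text \<open>\<open>m \<alpha>\<close> is the commutator of \<open>P \<alpha>\<close> with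
  multiplication by \<open>X \<alpha>\<close>. As \<open>P \<alpha>\<close> is skew and the
  multiplication symmetric, both terms of this commutator, paired with the function itself, give the
  same value.\<close>

lemma triples_X_ip:
  assumes "(u, w, q) \<in> triples"
  shows "ip M (\<lambda>p. X \<alpha> p * u p) (q \<alpha>) = - ip M (\<lambda>p. m \<alpha> p * u p) u / 2"
proof -
  note l = triples_l2[OF assms(1)]
  obtain C where C: "\<And>p. p \<in> space M \<Longrightarrow> \<bar>X \<alpha> p\<bar> \<le> C" using X_bdd by blast
  obtain \<phi> where \<phi>: "\<And>j. \<phi> j \<in> T" "l2_tendsto M \<phi> u" "l2_tendsto M (\<lambda>j. D (\<phi> j)) w"
    "\<And>\<alpha>. l2_tendsto M (\<lambda>j. P \<alpha> (\<phi> j)) (q \<alpha>)" by (rule triplesE[OF assms(1)], rule that)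
  note Tl = T_l2[OF \<phi>(1)] and Pl = T_l2[OF P_T[OF \<phi>(1)]]
  have a: "(\<lambda>j. ip M (\<lambda>p. X \<alpha> p * \<phi> j p) (P \<alpha> (\<phi> j))) \<longlonglongrightarrow> ip M (\<lambda>p. X \<alpha> p * u p) (q \<alpha>)"
    by (rule l2_tendsto_ip[OF X_mult_l2[OF l(1)] X_mult_l2[OF Tl]
          l2_tendsto_bounded_mult[OF l(1) Tl \<phi>(2) X_meas C] l(3) Pl \<phi>(4)])
  have b: "(\<lambda>j. - ip M (\<lambda>p. m \<alpha> p * \<phi> j p) (\<phi> j) / 2) \<longlonglongrightarrow> - ip M (\<lambda>p. m \<alpha> p * u p) u / 2"
    by (intro tendsto_divide tendsto_minus tendsto_const l2_tendsto_ip[OF m_mult_l2[OF l(1)] m_mult_l2[OF Tl]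
          l2_tendsto_bounded_mult[OF l(1) Tl \<phi>(2) m_meas m_bdd] l(1) Tl \<phi>(2)]) (simp_all only: zero_neq_numeral[symmetric] not_False_eq_True)
  have "ip M (\<lambda>p. X \<alpha> p * \<phi> j p) (P \<alpha> (\<phi> j)) = - ip M (\<lambda>p. m \<alpha> p * \<phi> j p) (\<phi> j) / 2" for j
  proof -
    have pt: "m \<alpha> p * \<phi> j p = P \<alpha> (\<lambda>p. X \<alpha> p * \<phi> j p) p - X \<alpha> p * P \<alpha> (\<phi> j) p" if "p \<in> space M" for p
      using D_X2[OF \<phi>(1)[of j] that, of \<alpha>] by (simp add: P_def algebra_simps)
    have "ip M (\<lambda>p. m \<alpha> p * \<phi> j p) (\<phi> j) = ip M (\<lambda>p. P \<alpha> (\<lambda>p. X \<alpha> p * \<phi> j p) p - X \<alpha> p * P \<alpha> (\<phi> j) p) (\<phi> j)"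
      unfolding ip_def by (rule Bochner_Integration.integral_cong[OF refl]) (simp only: pt)
    also have "\<dots> = ip M (P \<alpha> (\<lambda>p. X \<alpha> p * \<phi> j p)) (\<phi> j) - ip M (\<lambda>p. X \<alpha> p * P \<alpha> (\<phi> j) p) (\<phi> j)"
      by (intro ip_diff_left T_l2 P_T X_T \<phi>(1))
    also have "\<dots> = - 2 * ip M (\<lambda>p. X \<alpha> p * \<phi> j p) (P \<alpha> (\<phi> j))"
      unfolding P_skew[OF X_T[OF \<phi>(1)] \<phi>(1)] ip_X_left[of \<alpha> "P \<alpha> (\<phi> j)"] by (simp add: ip_sym)
    finally show ?thesis by simp
  qed
  with a b show ?thesis by (simp add: LIMSEQ_unique)
qed

lemma triples_P_bound:
  assumes "(u, w, q) \<in> triples"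
  shows "(\<Sum>\<alpha>\<in>UNIV. ip M (q \<alpha>) (q \<alpha>)) \<le> - 4 * ip M u w + n\<^sup>2 * \<delta> * ip M u u"
proof -
  note l = triples_l2[OF assms(1)]
  obtain \<phi> where \<phi>: "\<And>j. \<phi> j \<in> T" "l2_tendsto M \<phi> u" "l2_tendsto M (\<lambda>j. D (\<phi> j)) w"
    "\<And>\<alpha>. l2_tendsto M (\<lambda>j. P \<alpha> (\<phi> j)) (q \<alpha>)" by (rule triplesE[OF assms(1)], rule that)
  note Tl = T_l2[OF \<phi>(1)] and Pl = T_l2[OF P_T[OF \<phi>(1)]] and Dl = T_l2[OF T_D[OF \<phi>(1)]]
  show ?thesis
  proof (rule LIMSEQ_le)
    show "(\<lambda>j. \<Sum>\<alpha>\<in>UNIV. ip M (P \<alpha> (\<phi> j)) (P \<alpha> (\<phi> j))) \<longlonglongrightarrow> (\<Sum>\<alpha>\<in>UNIV. ip M (q \<alpha>) (q \<alpha>))"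
      by (intro tendsto_sum l2_tendsto_ip[OF l(3) Pl \<phi>(4) l(3) Pl \<phi>(4)])
    show "(\<lambda>j. - 4 * ip M (\<phi> j) (D (\<phi> j)) + n\<^sup>2 * \<delta> * ip M (\<phi> j) (\<phi> j)) \<longlonglongrightarrow> - 4 * ip M u w + n\<^sup>2 * \<delta> * ip M u u"
      by (intro tendsto_add tendsto_mult tendsto_const l2_tendsto_ip[OF l(1) Tl \<phi>(2) l(2) Dl \<phi>(3)]
          l2_tendsto_ip[OF l(1) Tl \<phi>(2) l(1) Tl \<phi>(2)])
  qed (use P_bound[OF \<phi>(1)] in auto)
qed

end

text \<open>At \<open>s = sqrt B / sqrt A\<close> both terms equal
  \<open>sqrt A * sqrt B\<close>.\<close>

lemma optimize_parameter:
  fixes A B n S :: real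
  assumes A: "A > 0" and B: "B > 0" and n: "n > 0" and le: "\<And>s. s > 0 \<Longrightarrow> n * S \<le> s * A + B / s"
  shows "S \<le> 2 / n * sqrt A * sqrt B"
proof -
  let ?a = "sqrt A" and ?b = "sqrt B"
  have ab: "?a > 0" "?b > 0" using A B by simp_all
  have "n * S \<le> ?b / ?a * (?a * ?a) + (?b * ?b) / (?b / ?a)"
    using le[of "?b / ?a"] ab A B by simp
  also have "\<dots> = 2 * (?a * ?b)" using ab by (simp add: field_simps del: real_sqrt_mult_self)
  finally show ?thesis using n by (simp add: field_simps)
qed

section \<open>The inequality for the eigenfunctions\<close>

context plate_immersion
begin

text \<open>Each coordinate contributes one instance of \<open>couple_inequality\<close>. The
  geometry enters only in the summation over the coordinates, through \<open>m_sum\<close> and the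
  commutator bound.\<close>

lemma eigen_inequality:
  fixes ev :: "nat \<Rightarrow> real" and f g :: "real \<Rightarrow> real"
  assumes mono: "\<And>i. 1 \<le> i \<Longrightarrow> ev i \<le> ev (Suc i)" and lim: "filterlim ev at_top sequentially"
    and mult: "\<And>\<mu>. multiplicity \<mu> (card {i. 1 \<le> i \<and> ev i = \<mu>})"
    and ev1: "0 < ev 1" and k: "ev k < ev (Suc k)"
    and fg: "\<And>x. 0 < x \<Longrightarrow> x < ev (Suc k) \<Longrightarrow> 0 < f x \<and> 0 < g x"
    and fgc: "\<And>x y. 0 < x \<Longrightarrow> x < ev (Suc k) \<Longrightarrow> 0 < y \<Longrightarrow> y < ev (Suc k) \<Longrightarrow> (f x - f y)\<^sup>2 \<le>
       ((f x)\<^sup>2 / (g x * (ev (Suc k) - x)) + (f y)\<^sup>2 / (g y * (ev (Suc k) - y))) * ((g y - g x) * (x - y))"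
    and s: "s > 0"
  shows "n * (\<Sum>i=1..k. f (ev i)) \<le> s * (\<Sum>i=1..k. g (ev i) * (2 * (n + 2) * sqrt (ev i) + n\<^sup>2 * \<delta>)) +
     (\<Sum>i=1..k. (f (ev i))\<^sup>2 / (g (ev i) * (ev (Suc k) - ev i)) * (sqrt (ev i) + n\<^sup>2 / 4 * \<delta>)) / s"
proof -
  let ?L = "ev (Suc k)" and ?K = "{1..k}"
  from orthonormal_eigenfunctions[OF lim mult, of k]
  obtain u where u': "(\<forall>i\<in>?K. u i \<in> eigenspace (ev i)) \<and>
     (\<forall>i\<in>?K. \<forall>j\<in>?K. ip M (u i) (u j) = (if i = j then 1 else 0))" by (elim exE)
  have u: "\<And>i. i \<in> ?K \<Longrightarrow> u i \<in> eigenspace (ev i)"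
    and on: "\<And>i j. i \<in> ?K \<Longrightarrow> j \<in> ?K \<Longrightarrow> ip M (u i) (u j) = (if i = j then 1 else 0)"
    using u' by simp_all
  have "\<forall>i\<in>?K. \<exists>w. (u i, w) \<in> pairs" using u by (simp add: eigenspace_def)
  from bchoice[OF this] obtain w where w': "\<forall>i\<in>?K. (u i, w i) \<in> pairs" by (elim exE)
  then have w: "\<And>i. i \<in> ?K \<Longrightarrow> (u i, w i) \<in> pairs" by simp
  have "\<forall>i\<in>?K. \<exists>q. (u i, w i, q) \<in> triples" using w triples_exist by simp
  from bchoice[OF this] obtain q where "\<forall>i\<in>?K. (u i, w i, q i) \<in> triples" by (elim exE)
  then have q: "\<And>i. i \<in> ?K \<Longrightarrow> (u i, w i, q i) \<in> triples" by simp
  note ul = triples_l2(1)[OF q] and wl = triples_l2(2)[OF q] and ql = triples_l2(3)[OF q]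
  have mono': "ev i \<le> ev j" if "1 \<le> i" "i \<le> j" for i j
    using that(2,1) by (induction rule: dec_induct) (auto intro!: order_trans[OF _ mono])
  have evp: "0 < ev i" if "i \<in> ?K" for i using mono'[of 1 i] ev1 that by auto
  have evL: "ev i < ?L" if "i \<in> ?K" for i using mono'[of i k] k that by auto
  have ww: "ip M (w i) (w j) = (if i = j then ev i else 0)" if "i \<in> ?K" "j \<in> ?K" for i j
    using eigen_ip[OF u[OF that(1)] w[OF that(1)] w[OF that(2)]] on[OF that] by simp
  define F where "F i = (f (ev i))\<^sup>2 / (g (ev i) * (?L - ev i))" for i
  have F: "0 \<le> F i" if "i \<in> ?K" for i using fg[of "ev i"] evp[OF that] evL[OF that] by (simp add: F_def)
  \<comment> \<open>\<open>t\<close> is the integral of \<open>|grad x|^2 u^2\<close>,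
    \<open>\<tau>\<close> the squared norm of half the commutator, and \<open>W\<close> the amount
    by which the squared norm of the Laplacian of \<open>x u\<close> exceeds \<open>ev i\<close>
    times the squared norm of \<open>x u\<close>, as \<open>YY\<close> will show.\<close>
  define t where "t \<alpha> i = ip M (\<lambda>p. m \<alpha> p * u i p) (u i) / 2" for \<alpha> i
  define \<tau> where "\<tau> \<alpha> i = ip M (q i \<alpha>) (q i \<alpha>) / 4" for \<alpha> i
  define W where "W \<alpha> i = ip M (q i \<alpha>) (q i \<alpha>) - ip M (\<lambda>p. m \<alpha> p * u i p) (w i)" for \<alpha> i
  have main: "(\<Sum>i\<in>?K. f (ev i) * t \<alpha> i) \<le> s * (\<Sum>i\<in>?K. g (ev i) * W \<alpha> i) +
     (\<Sum>i\<in>?K. (f (ev i))\<^sup>2 / (g (ev i) * (?L - ev i)) * \<tau> \<alpha> i) / s" for \<alpha>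
  proof -
    define a where "a i j = ip M (\<lambda>p. X \<alpha> p * u i p) (u j)" for i j
    define b where "b i j = ip M (q i \<alpha>) (u j) / 2" for i j
    \<comment> \<open>The trial function; \<open>z i\<close> is its weak Laplacian, and
      \<open>r i\<close> is half the commutator without its components along the
      \<open>u j\<close>.\<close>
    define v where "v i p = X \<alpha> p * u i p - (\<Sum>j\<in>?K. a i j * u j p)" for i p
    define z where "z i p = X \<alpha> p * w i p + q i \<alpha> p - (\<Sum>j\<in>?K. a i j * w j p)" for i p
    define r where "r i p = q i \<alpha> p / 2 - (\<Sum>j\<in>?K. b i j * u j p)" for i p
    have suml: "l2 M (\<lambda>p. \<Sum>j\<in>?K. c j * u j p)" "l2 M (\<lambda>p. \<Sum>j\<in>?K. c j * w j p)" for c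
      by (intro l2_sum l2_scale ul wl; simp)+
    have vu: "ip M (v i) (u l) = 0" if "i \<in> ?K" "l \<in> ?K" for i l
    proof -
      have "ip M (v i) (u l) = ip M (\<lambda>p. X \<alpha> p * u i p) (u l) - ip M (\<lambda>p. \<Sum>j\<in>?K. a i j * u j p) (u l)"
        unfolding v_def by (intro ip_diff_left X_mult_l2 ul suml that)
      also have "ip M (\<lambda>p. \<Sum>j\<in>?K. a i j * u j p) (u l) = a i l"
        by (intro orthonormal_lincomb_ip ul on that) auto
      finally show ?thesis by (simp add: a_def)
    qed
    have vl: "l2 M (v i)" if "i \<in> ?K" for i unfolding v_def by (intro l2_diff X_mult_l2 ul suml that)
    have rl: "l2 M (r i)" if "i \<in> ?K" for i
      unfolding r_def using l2_scale[OF ql[OF that], of "1/2"] by (intro l2_diff suml) simp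
    have vz: "(v i, z i) \<in> pairs" if "i \<in> ?K" for i
      unfolding v_def z_def by (intro pairs_diff triples_X_pairs(1)[OF q] pairs_sum pairs_scale w that)
    have var: "?L * ip M (v i) (v i) \<le> ip M (z i) (z i)" if i: "i \<in> ?K" for i
    proof (rule variational_principle[of ?K u w ev, OF _ w u on _ vz[OF i] vu[OF i]])
      fix \<mu> v' assume v': "\<mu> < ?L" "v' \<in> eigenspace \<mu>" "\<And>i. i \<in> ?K \<Longrightarrow> ip M v' (u i) = 0"
      show "ip M v' v' = 0" by (rule spectral_gap[of ev k u \<mu> v', OF mono mult u on v'])
    qed simp_all
    have vv: "ip M (v i) (v i) = ip M (\<lambda>p. X \<alpha> p * u i p) (\<lambda>p. X \<alpha> p * u i p) - (\<Sum>j\<in>?K. (a i j)\<^sup>2)" if i: "i \<in> ?K" for i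
    proof -
      have "ip M (v i) (v i) = ip M (v i) (\<lambda>p. X \<alpha> p * u i p) - ip M (v i) (\<lambda>p. \<Sum>j\<in>?K. a i j * u j p)"
        by (subst (2) v_def[abs_def]) (intro ip_diff_right X_mult_l2 ul suml vl that)
      also have "ip M (v i) (\<lambda>p. \<Sum>j\<in>?K. a i j * u j p) = 0"
        using vl ul vu i by (subst ip_sum_right) (auto simp: ip_scale_right l2_scale)
      also have "ip M (v i) (\<lambda>p. X \<alpha> p * u i p) = ip M (\<lambda>p. X \<alpha> p * u i p) (\<lambda>p. X \<alpha> p * u i p) -
          ip M (\<lambda>p. \<Sum>j\<in>?K. a i j * u j p) (\<lambda>p. X \<alpha> p * u i p)"
        unfolding v_def by (intro ip_diff_left X_mult_l2 ul suml that)
      also have "ip M (\<lambda>p. \<Sum>j\<in>?K. a i j * u j p) (\<lambda>p. X \<alpha> p * u i p) = (\<Sum>j\<in>?K. a i j * ip M (u j) (\<lambda>p. X \<alpha> p * u i p))"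
        using ul X_mult_l2[OF ul[OF i]] by (subst ip_sum_left) (auto simp: ip_scale_left l2_scale)
      also have "\<dots> = (\<Sum>j\<in>?K. (a i j)\<^sup>2)"
        by (intro sum.cong refl) (simp add: a_def power2_eq_square ip_sym[of M "u _"])
      finally show ?thesis by simp
    qed
    let ?Y = "\<lambda>i p. X \<alpha> p * w i p + q i \<alpha> p"
    have Yl: "l2 M (?Y i)" if "i \<in> ?K" for i by (intro l2_add X_mult_l2 wl ql that)
    have Yw: "ip M (w j) (?Y i) = ev j * a i j" if "i \<in> ?K" "j \<in> ?K" for i j
      using eigen_ip[OF u[OF that(2)] w[OF that(2)] triples_X_pairs(1)[OF q[OF that(1)]]]
      by (simp add: a_def ip_sym[of M "u j"])
    have zz: "ip M (z i) (z i) = ip M (?Y i) (?Y i) - (\<Sum>j\<in>?K. ev j * (a i j)\<^sup>2)" if i: "i \<in> ?K" for i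
    proof -
      have zl: "l2 M (z i)" by (rule pairs_l2(2)[OF vz[OF i]])
      have zw: "ip M (z i) (w l) = 0" if l: "l \<in> ?K" for l
        using eigen_ip[OF u[OF l] w[OF l] vz[OF i]] vu[OF i l] by (simp add: ip_sym)
      have "ip M (z i) (z i) = ip M (z i) (?Y i) - ip M (z i) (\<lambda>p. \<Sum>j\<in>?K. a i j * w j p)"
        by (subst (2) z_def[abs_def]) (intro ip_diff_right Yl suml zl that)
      also have "ip M (z i) (\<lambda>p. \<Sum>j\<in>?K. a i j * w j p) = 0"
        using zl wl zw by (subst ip_sum_right) (auto simp: ip_scale_right l2_scale)
      also have "ip M (z i) (?Y i) = ip M (?Y i) (?Y i) - ip M (\<lambda>p. \<Sum>j\<in>?K. a i j * w j p) (?Y i)"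
        unfolding z_def by (intro ip_diff_left Yl suml that)
      also have "ip M (\<lambda>p. \<Sum>j\<in>?K. a i j * w j p) (?Y i) = (\<Sum>j\<in>?K. a i j * ip M (w j) (?Y i))"
        using wl Yl[OF i] by (subst ip_sum_left) (auto simp: ip_scale_left l2_scale)
      also have "\<dots> = (\<Sum>j\<in>?K. ev j * (a i j)\<^sup>2)"
      proof (intro sum.cong refl)
        fix j assume "j \<in> ?K"
        then show "a i j * ip M (w j) (?Y i) = ev j * (a i j)\<^sup>2"
          unfolding Yw[OF i \<open>j \<in> ?K\<close>] by (simp add: power2_eq_square)
      qed
      finally show ?thesis by simp
    qed
    \<comment> \<open>The terms that contain \<open>X \<alpha> p * w i p\<close> cannot be estimated
      separately. Testing the equation of \<open>u i\<close> with the square of the coordinate times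
      \<open>u i\<close> evaluates them together.\<close>
    have YY: "ip M (?Y i) (?Y i) = W \<alpha> i + ev i * ip M (\<lambda>p. X \<alpha> p * u i p) (\<lambda>p. X \<alpha> p * u i p)" if i: "i \<in> ?K" for i
    proof -
      note Xw = X_mult_l2[OF wl[OF i]] and Xq = X_mult_l2[OF ql[OF i]] and mu = m_mult_l2[OF ul[OF i]]
      have "ip M (w i) (\<lambda>p. X \<alpha> p * (X \<alpha> p * w i p) + (2 * (X \<alpha> p * q i \<alpha> p) + m \<alpha> p * u i p)) =
          ev i * ip M (u i) (\<lambda>p. X \<alpha> p * (X \<alpha> p * u i p))"
        by (rule eigen_ip[OF u[OF i] w[OF i] triples_X_pairs(2)[OF q[OF i]]])
      moreover have "ip M (w i) (\<lambda>p. X \<alpha> p * (X \<alpha> p * w i p) + (2 * (X \<alpha> p * q i \<alpha> p) + m \<alpha> p * u i p)) =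
          ip M (\<lambda>p. X \<alpha> p * w i p) (\<lambda>p. X \<alpha> p * w i p) + (2 * ip M (\<lambda>p. X \<alpha> p * w i p) (q i \<alpha>) + ip M (\<lambda>p. m \<alpha> p * u i p) (w i))"
        using i Xw Xq mu
        by (simp add: ip_add_right X_mult_l2 l2_add l2_scale wl ip_scale_right ip_X_left ip_sym[of M "w i" "\<lambda>p. m \<alpha> p * u i p"])
      moreover have "ip M (?Y i) (?Y i) = ip M (\<lambda>p. X \<alpha> p * w i p) (\<lambda>p. X \<alpha> p * w i p) +
          2 * ip M (\<lambda>p. X \<alpha> p * w i p) (q i \<alpha>) + ip M (q i \<alpha>) (q i \<alpha>)"
        using ip_expand[OF X_mult_l2[OF wl[OF i], of \<alpha>] ql[OF i, of \<alpha>], of 1] by simp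
      ultimately show ?thesis by (simp add: W_def ip_X_left)
    qed
    have rr: "ip M (r i) (r i) = \<tau> \<alpha> i - (\<Sum>j\<in>?K. (b i j)\<^sup>2)" if i: "i \<in> ?K" for i
    proof -
      let ?h = "\<lambda>p. q i \<alpha> p / 2"
      have hl: "l2 M ?h" using l2_scale[OF ql[OF i], of "1/2"] by simp
      have hu: "ip M ?h (u j) = b i j" for j
        using ip_scale_left[of M "1/2" "q i \<alpha>" "u j"] by (simp add: b_def)
      have ru: "ip M (r i) (u l) = 0" if l: "l \<in> ?K" for l
      proof -
        have "ip M (r i) (u l) = ip M ?h (u l) - ip M (\<lambda>p. \<Sum>j\<in>?K. b i j * u j p) (u l)"
          unfolding r_def by (intro ip_diff_left hl ul suml l)
        also have "ip M (\<lambda>p. \<Sum>j\<in>?K. b i j * u j p) (u l) = b i l"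
          by (intro orthonormal_lincomb_ip ul on l) auto
        finally show ?thesis by (simp add: hu)
      qed
      have "ip M (r i) (r i) = ip M (r i) ?h - ip M (r i) (\<lambda>p. \<Sum>j\<in>?K. b i j * u j p)"
        by (subst (2) r_def[abs_def]) (intro ip_diff_right hl suml rl that)
      also have "ip M (r i) (\<lambda>p. \<Sum>j\<in>?K. b i j * u j p) = 0"
        using rl[OF i] ul ru by (subst ip_sum_right) (auto simp: ip_scale_right l2_scale)
      also have "ip M (r i) ?h = ip M ?h ?h - ip M (\<lambda>p. \<Sum>j\<in>?K. b i j * u j p) ?h"
        unfolding r_def by (intro ip_diff_left hl suml)
      also have "ip M ?h ?h = \<tau> \<alpha> i"
        using ip_scale_left[of M "1/2" "q i \<alpha>" ?h] ip_scale_right[of M "q i \<alpha>" "1/2" "q i \<alpha>"] by (simp add: \<tau>_def)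
      also have "ip M (\<lambda>p. \<Sum>j\<in>?K. b i j * u j p) ?h = (\<Sum>j\<in>?K. b i j * ip M (u j) ?h)"
        using ul hl by (subst ip_sum_left) (auto simp: ip_scale_left l2_scale)
      also have "\<dots> = (\<Sum>j\<in>?K. (b i j)\<^sup>2)"
        by (intro sum.cong refl) (simp add: hu[symmetric] power2_eq_square ip_sym[of M "u _"])
      finally show ?thesis by simp
    qed
    \<comment> \<open>Only one of the two projections matters, since \<open>v i\<close> is already
      orthogonal to the \<open>u j\<close>. The minus sign comes from \<open>triples_X_ip\<close>
      and disappears when Cauchy-Schwarz squares the expression.\<close>
    have vr: "ip M (v i) (r i) = - (t \<alpha> i + 2 * (\<Sum>j\<in>?K. a i j * b i j)) / 2" if i: "i \<in> ?K" for i
    proof -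
      let ?h = "\<lambda>p. q i \<alpha> p / 2"
      have hl: "l2 M ?h" using l2_scale[OF ql[OF i], of "1/2"] by simp
      have hu: "ip M ?h (u j) = b i j" for j
        using ip_scale_left[of M "1/2" "q i \<alpha>" "u j"] by (simp add: b_def)
      have "ip M (v i) (r i) = ip M (v i) ?h - ip M (v i) (\<lambda>p. \<Sum>j\<in>?K. b i j * u j p)"
        unfolding r_def by (intro ip_diff_right hl suml vl i)
      also have "ip M (v i) (\<lambda>p. \<Sum>j\<in>?K. b i j * u j p) = 0"
        using vl[OF i] ul vu[OF i] by (subst ip_sum_right) (auto simp: ip_scale_right l2_scale)
      also have "ip M (v i) ?h = ip M (\<lambda>p. X \<alpha> p * u i p) ?h - ip M (\<lambda>p. \<Sum>j\<in>?K. a i j * u j p) ?h"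
        unfolding v_def by (intro ip_diff_left X_mult_l2 hl suml ul i)
      also have "ip M (\<lambda>p. \<Sum>j\<in>?K. a i j * u j p) ?h = (\<Sum>j\<in>?K. a i j * ip M (u j) ?h)"
        using ul hl by (subst ip_sum_left) (auto simp: ip_scale_left l2_scale)
      also have "\<dots> = (\<Sum>j\<in>?K. a i j * b i j)"
        by (intro sum.cong refl) (simp add: hu[symmetric] ip_sym[of M "u _"])
      also have "ip M (\<lambda>p. X \<alpha> p * u i p) ?h = - t \<alpha> i / 2"
        using ip_scale_right[of M "\<lambda>p. X \<alpha> p * u i p" "1/2" "q i \<alpha>"] triples_X_ip[OF q[OF i], of \<alpha>]
        by (simp add: t_def)
      finally show ?thesis by (simp add: field_simps)
    qed
    have sq4: "(- y / 2)\<^sup>2 = y\<^sup>2 / 4" for y :: real by (simp add: power_divide)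
    show ?thesis
    proof (rule couple_inequality[where a=a and b=b and N="\<lambda>i. ip M (v i) (v i)"])
      fix i assume i: "i \<in> ?K"
      show "ev i < ?L" by (rule evL[OF i])
      show "0 < f (ev i)" "0 < g (ev i)" using fg[OF evp[OF i] evL[OF i]] by simp_all
      show "0 \<le> ip M (v i) (v i)" by simp
      have "?L * ip M (v i) (v i) \<le> W \<alpha> i + ev i * (ip M (v i) (v i) + (\<Sum>j\<in>?K. (a i j)\<^sup>2)) - (\<Sum>j\<in>?K. ev j * (a i j)\<^sup>2)"
        using var[OF i] unfolding zz[OF i] YY[OF i] vv[OF i] by simp
      then show "(?L - ev i) * ip M (v i) (v i) \<le> W \<alpha> i + (\<Sum>j\<in>?K. (ev i - ev j) * (a i j)\<^sup>2)"
        by (simp add: algebra_simps sum_subtractf sum_distrib_left)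
      have "(ip M (v i) (r i))\<^sup>2 \<le> ip M (v i) (v i) * ip M (r i) (r i)" by (rule ip_Cauchy_Schwarz[OF vl[OF i] rl[OF i]])
      then show "(t \<alpha> i + 2 * (\<Sum>j\<in>?K. a i j * b i j))\<^sup>2 \<le> 4 * (ip M (v i) (v i) * (\<tau> \<alpha> i - (\<Sum>j\<in>?K. (b i j)\<^sup>2)))"
        unfolding vr[OF i] rr[OF i] sq4 by linarith
      show "(\<Sum>j\<in>?K. (b i j)\<^sup>2) \<le> \<tau> \<alpha> i" using ip_nonneg[of M "r i"] unfolding rr[OF i] by simp
      fix j assume j: "j \<in> ?K"
      show "(f (ev i) - f (ev j))\<^sup>2 \<le> ((f (ev i))\<^sup>2 / (g (ev i) * (?L - ev i)) + (f (ev j))\<^sup>2 / (g (ev j) * (?L - ev j))) *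
          ((g (ev j) - g (ev i)) * (ev i - ev j))" by (intro fgc evp evL i j)
      show "a i j = a j i" by (simp add: a_def ip_X_left ip_sym[of M "u i"])
      show "b i j = - b j i" using triples_skew[OF q[OF i] q[OF j], of \<alpha>] by (simp add: b_def ip_sym)
    qed (use s in auto)
  qed
  have tsum: "(\<Sum>\<alpha>\<in>UNIV. t \<alpha> i) = n" if i: "i \<in> ?K" for i
  proof -
    have "(\<Sum>\<alpha>\<in>UNIV. ip M (\<lambda>p. m \<alpha> p * u i p) (u i)) = ip M (\<lambda>p. \<Sum>\<alpha>\<in>UNIV. m \<alpha> p * u i p) (u i)"
      by (rule ip_sum_left[symmetric]) (intro m_mult_l2 ul i)+
    also have "\<dots> = ip M (\<lambda>p. 2 * n * u i p) (u i)"
      unfolding ip_def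
      by (rule Bochner_Integration.integral_cong[OF refl]) (simp only: sum_distrib_right[symmetric] m_sum)
    also have "\<dots> = 2 * n" using on[OF i i] by (simp only: ip_scale_left) simp
    finally show ?thesis by (simp add: t_def sum_divide_distrib[symmetric])
  qed
  \<comment> \<open>The squared norm of \<open>w i\<close> is \<open>ev i\<close>: the equation of
    \<open>u i\<close> tested with \<open>u i\<close> itself.\<close>
  have uw: "- ip M (u i) (w i) \<le> sqrt (ev i)" if i: "i \<in> ?K" for i
    using ip_abs_le[OF ul[OF i] wl[OF i]] on[OF i i] ww[OF i i] by simp
  have qsum: "(\<Sum>\<alpha>\<in>UNIV. ip M (q i \<alpha>) (q i \<alpha>)) \<le> 4 * sqrt (ev i) + n\<^sup>2 * \<delta>" if i: "i \<in> ?K" for i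
    using triples_P_bound[OF q[OF i]] uw[OF i] on[OF i i] by simp
  have \<tau>sum: "(\<Sum>\<alpha>\<in>UNIV. \<tau> \<alpha> i) \<le> sqrt (ev i) + n\<^sup>2 / 4 * \<delta>" if i: "i \<in> ?K" for i
    using qsum[OF i] by (simp add: \<tau>_def sum_divide_distrib[symmetric])
  have Wsum: "(\<Sum>\<alpha>\<in>UNIV. W \<alpha> i) \<le> 2 * (n + 2) * sqrt (ev i) + n\<^sup>2 * \<delta>" if i: "i \<in> ?K" for i
  proof -
    have "(\<Sum>\<alpha>\<in>UNIV. ip M (\<lambda>p. m \<alpha> p * u i p) (w i)) = ip M (\<lambda>p. \<Sum>\<alpha>\<in>UNIV. m \<alpha> p * u i p) (w i)"
      by (rule ip_sum_left[symmetric]) (intro m_mult_l2 ul wl i)+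
    also have "\<dots> = ip M (\<lambda>p. 2 * n * u i p) (w i)"
      unfolding ip_def
      by (rule Bochner_Integration.integral_cong[OF refl]) (simp only: sum_distrib_right[symmetric] m_sum)
    also have "\<dots> = 2 * n * ip M (u i) (w i)" by (simp only: ip_scale_left)
    finally have "(\<Sum>\<alpha>\<in>UNIV. W \<alpha> i) = (\<Sum>\<alpha>\<in>UNIV. ip M (q i \<alpha>) (q i \<alpha>)) + 2 * n * (- ip M (u i) (w i))"
      by (simp add: W_def sum_subtractf)
    moreover have "2 * n * (- ip M (u i) (w i)) \<le> 2 * n * sqrt (ev i)"
      using n_pos by (intro mult_left_mono[OF uw[OF i]]) simp
    moreover have "2 * (n + 2) * sqrt (ev i) = 2 * n * sqrt (ev i) + 4 * sqrt (ev i)"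
      by (simp add: distrib_right)
    ultimately show ?thesis using qsum[OF i] by linarith
  qed
  have "n * (\<Sum>i\<in>?K. f (ev i)) = (\<Sum>i\<in>?K. f (ev i) * (\<Sum>\<alpha>\<in>UNIV. t \<alpha> i))"
    unfolding sum_distrib_left by (intro sum.cong refl) (simp add: sum_distrib_left[symmetric] tsum)
  also have "\<dots> = (\<Sum>\<alpha>\<in>UNIV. \<Sum>i\<in>?K. f (ev i) * t \<alpha> i)"
    by (subst sum.swap) (simp add: sum_distrib_left)
  also have "\<dots> \<le> (\<Sum>\<alpha>\<in>UNIV. s * (\<Sum>i\<in>?K. g (ev i) * W \<alpha> i) + (\<Sum>i\<in>?K. F i * \<tau> \<alpha> i) / s)"
    unfolding F_def by (intro sum_mono main)
  also have "\<dots> = s * (\<Sum>\<alpha>\<in>UNIV. \<Sum>i\<in>?K. g (ev i) * W \<alpha> i) + (\<Sum>\<alpha>\<in>UNIV. \<Sum>i\<in>?K. F i * \<tau> \<alpha> i) / s"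
    by (simp add: sum.distrib sum_distrib_left sum_divide_distrib)
  also have "\<dots> = s * (\<Sum>i\<in>?K. g (ev i) * (\<Sum>\<alpha>\<in>UNIV. W \<alpha> i)) + (\<Sum>i\<in>?K. F i * (\<Sum>\<alpha>\<in>UNIV. \<tau> \<alpha> i)) / s"
    unfolding sum_distrib_left
      sum.swap[of "\<lambda>\<alpha> i. g (ev i) * W \<alpha> i"] sum.swap[of "\<lambda>\<alpha> i. F i * \<tau> \<alpha> i"] by (rule refl)
  also have "\<dots> \<le> s * (\<Sum>i\<in>?K. g (ev i) * (2 * (n + 2) * sqrt (ev i) + n\<^sup>2 * \<delta>)) +
      (\<Sum>i\<in>?K. F i * (sqrt (ev i) + n\<^sup>2 / 4 * \<delta>)) / s"
  proof (intro add_mono mult_left_mono divide_right_mono sum_mono)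
    fix i assume i: "i \<in> ?K"
    show "0 \<le> g (ev i)" using fg[OF evp[OF i] evL[OF i]] by simp
    show "0 \<le> F i" by (rule F[OF i])
    show "(\<Sum>\<alpha>\<in>UNIV. W \<alpha> i) \<le> 2 * (n + 2) * sqrt (ev i) + n\<^sup>2 * \<delta>" by (rule Wsum[OF i])
    show "(\<Sum>\<alpha>\<in>UNIV. \<tau> \<alpha> i) \<le> sqrt (ev i) + n\<^sup>2 / 4 * \<delta>" by (rule \<tau>sum[OF i])
  qed (use s in simp_all)
  finally show ?thesis by (simp add: F_def)
qed

theorem eigenvalue_inequality:
  fixes ev :: "nat \<Rightarrow> real" and f g :: "real \<Rightarrow> real"
  assumes mono: "\<And>i. 1 \<le> i \<Longrightarrow> ev i \<le> ev (Suc i)" and lim: "filterlim ev at_top sequentially"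
    and mult: "\<And>\<mu>. multiplicity \<mu> (card {i. 1 \<le> i \<and> ev i = \<mu>})"
    and ev1: "0 < ev 1" and k1: "1 \<le> k" and k: "ev k < ev (Suc k)"
    and fg: "\<And>x. 0 < x \<Longrightarrow> x < ev (Suc k) \<Longrightarrow> 0 < f x \<and> 0 < g x"
    and fgc: "\<And>x y. 0 < x \<Longrightarrow> x < ev (Suc k) \<Longrightarrow> 0 < y \<Longrightarrow> y < ev (Suc k) \<Longrightarrow> (f x - f y)\<^sup>2 \<le>
       ((f x)\<^sup>2 / (g x * (ev (Suc k) - x)) + (f y)\<^sup>2 / (g y * (ev (Suc k) - y))) * ((g y - g x) * (x - y))"
  shows "(\<Sum>i=1..k. f (ev i)) \<le> 2 / n *
     sqrt (\<Sum>i=1..k. g (ev i) * (2 * (n + 2) * sqrt (ev i) + n\<^sup>2 * \<delta>)) *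
     sqrt (\<Sum>i=1..k. (f (ev i))\<^sup>2 / (g (ev i) * (ev (Suc k) - ev i)) * (sqrt (ev i) + n\<^sup>2 / 4 * \<delta>))"
    (is "?S \<le> 2 / n * sqrt ?A * sqrt ?B")
proof -
  have mono': "ev i \<le> ev j" if "1 \<le> i" "i \<le> j" for i j
    using that(2,1) by (induction rule: dec_induct) (auto intro!: order_trans[OF _ mono])
  have evp: "0 < ev i" if "i \<in> {1..k}" for i using mono'[of 1 i] ev1 that by auto
  have evL: "ev i < ev (Suc k)" if "i \<in> {1..k}" for i using mono'[of i k] k that by auto
  \<comment> \<open>The optimal parameter is the quotient of the two roots and requires both sums to
    be positive; \<open>k1\<close> rules out empty sums.\<close>
  have A: "?A > 0"
  proof (intro sum_pos mult_pos_pos)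
    fix i assume i: "i \<in> {1..k}"
    show "0 < g (ev i)" using fg[OF evp[OF i] evL[OF i]] by simp
    show "0 < 2 * (n + 2) * sqrt (ev i) + n\<^sup>2 * \<delta>"
      using evp[OF i] n_pos \<delta>_nonneg by (intro add_pos_nonneg) auto
  qed (use k1 in auto)
  have B: "?B > 0"
  proof (intro sum_pos mult_pos_pos divide_pos_pos zero_less_power)
    fix i assume i: "i \<in> {1..k}"
    show "0 < g (ev i)" "0 < f (ev i)" using fg[OF evp[OF i] evL[OF i]] by auto
    show "0 < ev (Suc k) - ev i" using evL[OF i] by simp
    show "0 < sqrt (ev i) + n\<^sup>2 / 4 * \<delta>"
      using evp[OF i] n_pos \<delta>_nonneg by (intro add_pos_nonneg) auto
  qed (use k1 in auto)
  show ?thesis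
    by (rule optimize_parameter[OF A B n_pos]) (rule eigen_inequality[OF mono lim mult ev1 k fg fgc])
qed

end

section \<open>The clamped plate problem on a bounded domain\<close>

text \<open>Collects the estimates of finitely many charts into one: every step spends half of
  \<open>e\<close>, and the two finite lists of functionals are concatenated.\<close>

lemma sum_functional_bounds:
  fixes P :: "'v \<Rightarrow> bool" and E :: "'p \<Rightarrow> real" and l :: "'v \<Rightarrow> 'p \<Rightarrow> real" and a :: "'s \<Rightarrow> 'p \<Rightarrow> real"
  assumes "finite S" "\<And>s e. s \<in> S \<Longrightarrow> 0 < e \<Longrightarrow> \<exists>N (h :: nat \<Rightarrow> 'v). (\<forall>r<N. P (h r)) \<and> (\<forall>\<phi>\<in>T. a s \<phi> \<le> e * E \<phi> + (\<Sum>r<N. (l (h r) \<phi>)\<^sup>2))"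
    and "0 < e" and E: "\<And>\<phi>. \<phi> \<in> T \<Longrightarrow> 0 \<le> E \<phi>"
  shows "\<exists>N (h :: nat \<Rightarrow> 'v). (\<forall>r<N. P (h r)) \<and> (\<forall>\<phi>\<in>T. (\<Sum>s\<in>S. a s \<phi>) \<le> e * E \<phi> + (\<Sum>r<N. (l (h r) \<phi>)\<^sup>2))"
  using assms(1-3)
proof (induction S arbitrary: e)
  case empty
  then have "(\<forall>r<0. P (h r)) \<and> (\<forall>\<phi>\<in>T. (\<Sum>s\<in>{}. a s \<phi>) \<le> e * E \<phi> + (\<Sum>r<0. (l (h r) \<phi>)\<^sup>2))" for h :: "nat \<Rightarrow> 'v"
    using E by simp
  then show ?case by blast
next
  case (insert s S)
  have e2: "0 < e / 2" using insert.prems by simp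
  have "\<exists>N (h :: nat \<Rightarrow> 'v). (\<forall>r<N. P (h r)) \<and> (\<forall>\<phi>\<in>T. (\<Sum>s\<in>S. a s \<phi>) \<le> e / 2 * E \<phi> + (\<Sum>r<N. (l (h r) \<phi>)\<^sup>2))"
    by (rule insert.IH[OF insert.prems(1) e2]) simp_all
  then obtain N1 and h1 :: "nat \<Rightarrow> 'v" where h1: "\<forall>r<N1. P (h1 r)"
    and b1: "\<forall>\<phi>\<in>T. (\<Sum>s\<in>S. a s \<phi>) \<le> e / 2 * E \<phi> + (\<Sum>r<N1. (l (h1 r) \<phi>)\<^sup>2)"
    by (elim exE conjE)
  obtain N2 and h2 :: "nat \<Rightarrow> 'v" where h2: "\<forall>r<N2. P (h2 r)"
    and b2: "\<forall>\<phi>\<in>T. a s \<phi> \<le> e / 2 * E \<phi> + (\<Sum>r<N2. (l (h2 r) \<phi>)\<^sup>2)"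
    using insert.prems(1)[OF insertI1 e2] by (elim exE conjE)
  define h where "h r = (if r < N1 then h1 r else h2 (r - N1))" for r
  have "P (h r)" if "r < N1 + N2" for r using h1 h2 that by (auto simp: h_def)
  moreover have "(\<Sum>s\<in>insert s S. a s \<phi>) \<le> e * E \<phi> + (\<Sum>r<N1 + N2. (l (h r) \<phi>)\<^sup>2)" if \<phi>: "\<phi> \<in> T" for \<phi>
  proof -
    have s1: "(\<Sum>r<N1. (l (h r) \<phi>)\<^sup>2) = (\<Sum>r<N1. (l (h1 r) \<phi>)\<^sup>2)" by (rule sum.cong) (simp_all add: h_def)
    have s2: "(\<Sum>r = N1..<N1 + N2. (l (h r) \<phi>)\<^sup>2) = (\<Sum>r<N2. (l (h2 r) \<phi>)\<^sup>2)"
      using sum.shift_bounds_nat_ivl[of "\<lambda>r. (l (h r) \<phi>)\<^sup>2" 0 N1 N2] by (simp add: h_def atLeast0LessThan add.commute)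
    have "(\<Sum>r<N1 + N2. (l (h r) \<phi>)\<^sup>2) = (\<Sum>r<N1. (l (h r) \<phi>)\<^sup>2) + (\<Sum>r = N1..<N1 + N2. (l (h r) \<phi>)\<^sup>2)"
      unfolding lessThan_atLeast0 by (rule sum.atLeastLessThan_concat[symmetric]) simp_all
    then show ?thesis using bspec[OF b1 \<phi>] bspec[OF b2 \<phi>] insert.hyps by (simp only: s1 s2) simp
  qed
  ultimately show ?case by blast
qed

locale riemannian_domain = riemannian A G
  for A :: "('a::{t2_space, second_countable_topology}, 'n::finite) chart set" and G +
  fixes \<Omega> :: "'a set"
  assumes domain: "bounded_domain \<Omega>"
begin

abbreviation "MD \<equiv> restrict_space vol \<Omega>"
abbreviation "TD \<equiv> test_functions A \<Omega>"

lemma open_domain: "open \<Omega>" and domain_nonempty: "\<Omega> \<noteq> {}" and compact_closure_domain: "compact (closure \<Omega>)"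
  using domain by (auto simp: bounded_domain_def)

lemma domain_sets: "\<Omega> \<inter> space vol \<in> sets vol" using open_domain by simp

lemma integral_MD:
  fixes f :: "'a \<Rightarrow> real"
  assumes "\<And>p. p \<notin> \<Omega> \<Longrightarrow> f p = 0" shows "(\<integral>p. f p \<partial>MD) = (\<integral>p. f p \<partial>vol)"
proof -
  have "(\<integral>p. f p \<partial>MD) = (\<integral>p. indicator \<Omega> p *\<^sub>R f p \<partial>vol)" by (rule integral_restrict_space[OF domain_sets])
  also have "\<dots> = (\<integral>p. f p \<partial>vol)" using assms by (intro Bochner_Integration.integral_cong) (auto simp: indicator_def)
  finally show ?thesis .
qed

lemma l2_bounded:
  assumes f: "f \<in> borel_measurable borel" and C: "\<And>p. p \<in> \<Omega> \<Longrightarrow> \<bar>f p\<bar> \<le> C" shows "l2 MD f"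
proof -
  have "emeasure vol \<Omega> \<le> emeasure vol (closure \<Omega>)" by (rule emeasure_mono) (auto simp: closure_subset)
  also have "\<dots> < \<infinity>" by (rule emeasure_vol_compact_finite[OF compact_closure_domain])
  finally have fin: "emeasure vol \<Omega> < \<infinity>" .
  interpret finite_measure MD
    by (rule finite_measureI) (use fin domain_sets in \<open>simp add: space_restrict_space emeasure_restrict_space\<close>)
  have m: "f \<in> borel_measurable MD" using f by (intro measurable_restrict_space1) simp
  moreover have "integrable MD (\<lambda>p. (f p)\<^sup>2)"
  proof (rule integrable_const_bound)
    show "(\<lambda>p. (f p)\<^sup>2) \<in> borel_measurable MD" using m by simp
    show "AE p in MD. norm ((f p)\<^sup>2) \<le> C\<^sup>2"
    proof (rule AE_I2)
      fix p assume "p \<in> space MD"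
      then have "\<bar>f p\<bar> \<le> C" by (intro C) (simp add: space_restrict_space)
      then have "\<bar>f p\<bar>\<^sup>2 \<le> C\<^sup>2" by (intro power_mono) simp_all
      then show "norm ((f p)\<^sup>2) \<le> C\<^sup>2" by simp
    qed
  qed
  ultimately show ?thesis by (simp add: l2_def)
qed

lemma l2_continuous: assumes f: "continuous_on UNIV f" shows "l2 MD f"
proof -
  obtain C where "0 < C" "\<And>p. p \<in> closure \<Omega> \<Longrightarrow> \<bar>f p\<bar> \<le> C"
    by (rule compact_continuous_bounded[OF compact_closure_domain continuous_on_subset[OF f subset_UNIV]]) (rule that)
  then show ?thesis
    using closure_subset[of \<Omega>] by (intro l2_bounded[of _ C] borel_measurable_continuous_onI[OF f]) blast
qed

section \<open>Test functions of the domain\<close>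

lemma testI:
  assumes s: "smooth_map A \<phi>" and K: "compact K" "K \<subseteq> \<Omega>" "\<And>p. p \<notin> K \<Longrightarrow> \<phi> p = 0"
  shows "\<phi> \<in> TD"
proof -
  have sub: "closure {p. \<phi> p \<noteq> 0} \<subseteq> K"
    by (rule closure_minimal[OF _ compact_imp_closed[OF K(1)]]) (use K(3) in blast)
  have "compact (K \<inter> closure {p. \<phi> p \<noteq> 0})" by (rule compact_Int_closed[OF K(1)]) simp
  moreover have "K \<inter> closure {p. \<phi> p \<noteq> 0} = closure {p. \<phi> p \<noteq> 0}" using sub by blast
  ultimately show ?thesis using s sub K(2) by (simp add: test_functions_def)
qed

lemma testE:
  assumes "\<phi> \<in> TD"
  obtains K where "compact K" "K \<subseteq> \<Omega>" "\<And>p. p \<notin> K \<Longrightarrow> \<phi> p = 0"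
proof (rule that)
  show "compact (closure {p. \<phi> p \<noteq> 0})" "closure {p. \<phi> p \<noteq> 0} \<subseteq> \<Omega>"
    using assms by (auto simp: test_functions_def)
  show "\<phi> p = 0" if "p \<notin> closure {p. \<phi> p \<noteq> 0}" for p
    using that closure_subset[of "{p. \<phi> p \<noteq> 0}"] by blast
qed

lemma test_smooth: "\<phi> \<in> TD \<Longrightarrow> smooth_map A \<phi>" by (simp add: test_functions_def)

lemma test_CkM: "\<phi> \<in> TD \<Longrightarrow> CkM k \<phi>" by (rule smooth_CkM[OF test_smooth])

lemma test_zero_outside: assumes "\<phi> \<in> TD" "p \<notin> \<Omega>" shows "\<phi> p = 0"
  by (rule testE[OF assms(1)]) (use assms(2) in blast)

lemma test_l2: "\<phi> \<in> TD \<Longrightarrow> l2 MD \<phi>"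
  by (rule l2_continuous[OF CkM_continuous[OF test_CkM]])

lemma test_mult: assumes u: "smooth_map A u" and \<phi>: "\<phi> \<in> TD" shows "(\<lambda>p. u p * \<phi> p) \<in> TD"
proof (rule testE[OF \<phi>])
  fix K assume K: "compact K" "K \<subseteq> \<Omega>" "\<And>p. p \<notin> K \<Longrightarrow> \<phi> p = 0"
  show ?thesis by (rule testI[OF smooth_mult[OF u test_smooth[OF \<phi>]] K(1,2)]) (simp add: K(3))
qed

lemma test_add: assumes \<phi>: "\<phi> \<in> TD" and \<psi>: "\<psi> \<in> TD" shows "(\<lambda>p. \<phi> p + \<psi> p) \<in> TD"
proof (rule testE[OF \<phi>], rule testE[OF \<psi>])
  fix K L assume K: "compact K" "K \<subseteq> \<Omega>" "\<And>p. p \<notin> K \<Longrightarrow> \<phi> p = 0" and L: "compact L" "L \<subseteq> \<Omega>" "\<And>p. p \<notin> L \<Longrightarrow> \<psi> p = 0"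
  show ?thesis
    by (rule testI[OF smooth_add[OF test_smooth[OF \<phi>] test_smooth[OF \<psi>]] compact_Un[OF K(1) L(1)]]) (use K L in auto)
qed

lemma test_Lap: assumes \<phi>: "\<phi> \<in> TD" shows "Lap \<phi> \<in> TD"
proof (rule testE[OF \<phi>])
  fix K assume K: "compact K" "K \<subseteq> \<Omega>" "\<And>p. p \<notin> K \<Longrightarrow> \<phi> p = 0"
  show ?thesis
    by (rule testI[OF smooth_Lap[OF test_smooth[OF \<phi>]] K(1,2)]) (rule Lap_zero_outside[OF compact_imp_closed[OF K(1)] _ K(3)])
qed

lemma ip_test: "\<phi> \<in> TD \<Longrightarrow> ip MD \<phi> u = (\<integral>p. \<phi> p * u p \<partial>vol)"
  unfolding ip_def by (rule integral_MD) (simp add: test_zero_outside)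

lemma green_test:
  assumes \<phi>: "\<phi> \<in> TD" and \<psi>: "\<psi> \<in> TD"
  shows "integrable vol (grp \<phi> \<psi>)" "ip MD \<phi> (Lap \<psi>) = - (\<integral>p. grp \<phi> \<psi> p \<partial>vol)"
proof -
  obtain K where K: "compact K" "\<And>p. p \<notin> K \<Longrightarrow> \<phi> p = 0" by (rule testE[OF \<phi>]) (rule that)
  show "integrable vol (grp \<phi> \<psi>)" by (rule green_formula(2)[OF K test_CkM[OF \<phi>] test_CkM[OF \<psi>]])
  show "ip MD \<phi> (Lap \<psi>) = - (\<integral>p. grp \<phi> \<psi> p \<partial>vol)"
    unfolding ip_test[OF \<phi>] by (rule green_formula(3)[OF K test_CkM[OF \<phi>] test_CkM[OF \<psi>]])
qed

lemma Lap_symmetric: "\<phi> \<in> TD \<Longrightarrow> \<psi> \<in> TD \<Longrightarrow> ip MD (Lap \<phi>) \<psi> = ip MD \<phi> (Lap \<psi>)"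
  using green_test(2)[of \<phi> \<psi>] green_test(2)[of \<psi> \<phi>] by (simp add: ip_sym[of _ "Lap \<phi>"] grp_sym[of \<phi> \<psi>])

text \<open>By Green's formula the energy is \<open>- ip MD \<phi> (Lap \<phi>)\<close>, and twice
  this is at most the right side because the norm of \<open>\<phi> + Lap \<phi>\<close> is
  nonnegative.\<close>

lemma dirichlet_energy_le:
  assumes \<phi>: "\<phi> \<in> TD"
  shows "(\<integral>p. grp \<phi> \<phi> p \<partial>vol) \<le> ip MD \<phi> \<phi> + ip MD (Lap \<phi>) (Lap \<phi>)"
proof -
  note l = test_l2[OF \<phi>] test_l2[OF test_Lap[OF \<phi>]]
  have "0 \<le> ip MD (\<lambda>p. \<phi> p + 1 * Lap \<phi> p) (\<lambda>p. \<phi> p + 1 * Lap \<phi> p)" by (rule ip_nonneg)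
  also have "\<dots> = ip MD \<phi> \<phi> + 2 * 1 * ip MD \<phi> (Lap \<phi>) + 1\<^sup>2 * ip MD (Lap \<phi>) (Lap \<phi>)" by (rule ip_expand[OF l])
  finally have "- 2 * ip MD \<phi> (Lap \<phi>) \<le> ip MD \<phi> \<phi> + ip MD (Lap \<phi>) (Lap \<phi>)" by simp
  moreover have "0 \<le> (\<integral>p. grp \<phi> \<phi> p \<partial>vol)" by (rule Bochner_Integration.integral_nonneg) (rule grp_nonneg)
  ultimately show ?thesis using green_test(2)[OF \<phi> \<phi>] by simp
qed

lemma integrable_test_mult: 
  assumes u: "continuous_on UNIV u" and \<phi>: "\<phi> \<in> TD" shows "integrable vol (\<lambda>p. u p * \<phi> p)"
proof (rule testE[OF \<phi>])
  fix K assume K: "compact K" "K \<subseteq> \<Omega>" "\<And>p. p \<notin> K \<Longrightarrow> \<phi> p = 0"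
  show ?thesis
    by (rule integrable_vol_compact[OF continuous_on_mult[OF u CkM_continuous[OF test_CkM[OF \<phi>]]] K(1)]) (simp add: K(3))
qed

text \<open>The cut-offs reduce the claim to single charts: \<open>\<phi>^2\<close> is at most
  \<open>a\<close> times the sum of the squares of \<open>b s * \<phi>\<close>, where
  \<open>a\<close> bounds the inverse of the sum of the squared cut-offs. The energy of each
  \<open>b s * \<phi>\<close> is controlled by the energy and the norm of \<open>\<phi>\<close>,
  hence by the norms of \<open>\<phi>\<close> and \<open>Lap \<phi>\<close>.\<close>

lemma compactness_MD:
  assumes e: "0 < e"
  shows "\<exists>m (h :: nat \<Rightarrow> 'a \<Rightarrow> real). (\<forall>r<m. l2 MD (h r)) \<and>
      (\<forall>\<phi>\<in>TD. ip MD \<phi> \<phi> \<le> e * (ip MD \<phi> \<phi> + ip MD (Lap \<phi>) (Lap \<phi>)) + (\<Sum>r<m. (ip MD (h r) \<phi>)\<^sup>2))"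
proof -
  let ?E = "\<lambda>\<phi>. ip MD \<phi> \<phi> + ip MD (Lap \<phi>) (Lap \<phi>)"
  obtain S :: "'a set" and c B b where S: "finite S" and c: "\<And>s. c s \<in> A" and B: "\<And>s. compact (B s)" "\<And>s. B s \<subseteq> dom_of (c s)"
    and b: "\<And>s. CkM (Suc 0) (b s)" "\<And>s p. 0 \<le> b s p" "\<And>s p. p \<notin> B s \<Longrightarrow> b s p = 0"
    and pos: "\<And>p. p \<in> closure \<Omega> \<Longrightarrow> \<exists>s\<in>S. 0 < b s p"
    by (rule chart_bumps[OF compact_closure_domain], rule that) (assumption+)
  define h where "h p = (\<Sum>s\<in>S. (b s p)\<^sup>2)" for p
  have bc: "continuous_on UNIV (b s)" for s by (rule CkM_continuous[OF b(1)])
  have hpos: "0 < h p" if p: "p \<in> closure \<Omega>" for p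
  proof -
    obtain s where s: "s \<in> S" "0 < b s p" using pos[OF p] by blast
    then have s': "0 < (b s p)\<^sup>2" by simp
    show "0 < h p" unfolding h_def by (rule sum_pos2[where f="\<lambda>s. (b s p)\<^sup>2", OF S s(1) s']) simp
  qed
  have "continuous_on (closure \<Omega>) (\<lambda>p. 1 / h p)"
    unfolding h_def
    by (intro continuous_on_divide continuous_on_const continuous_on_sum continuous_on_power continuous_on_subset[OF bc subset_UNIV])
      (use hpos in \<open>force simp: h_def\<close>)
  then obtain a where a: "0 < a" "\<And>p. p \<in> closure \<Omega> \<Longrightarrow> \<bar>1 / h p\<bar> \<le> a"
    by (rule compact_continuous_bounded[OF compact_closure_domain]) (rule that)
  have le: "(\<phi> p)\<^sup>2 \<le> (\<Sum>s\<in>S. a * (b s p * \<phi> p)\<^sup>2)" if \<phi>: "\<phi> \<in> TD" for \<phi> p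
  proof (cases "p \<in> \<Omega>")
    case True
    then have p: "p \<in> closure \<Omega>" using closure_subset by blast
    have "1 \<le> a * h p" using a(2)[OF p] hpos[OF p] by (simp add: field_simps)
    then have "1 * (\<phi> p)\<^sup>2 \<le> (a * h p) * (\<phi> p)\<^sup>2" by (rule mult_right_mono) simp
    then show ?thesis by (simp add: h_def sum_distrib_left sum_distrib_right power_mult_distrib mult_ac)
  qed (simp add: test_zero_outside[OF \<phi>])
  have int: "integrable vol (\<lambda>p. (b s p * \<phi> p)\<^sup>2)" if "\<phi> \<in> TD" for s \<phi>
  proof -
    have "integrable vol (\<lambda>p. ((b s p)\<^sup>2 * \<phi> p) * \<phi> p)"
      by (intro integrable_test_mult that continuous_on_mult continuous_on_power bc CkM_continuous[OF test_CkM[OF that]])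
    then show ?thesis by (simp add: power2_eq_square mult_ac)
  qed
  have ip_le: "ip MD \<phi> \<phi> \<le> (\<Sum>s\<in>S. a * (\<integral>p. (b s p * \<phi> p)\<^sup>2 \<partial>vol))" if \<phi>: "\<phi> \<in> TD" for \<phi>
  proof -
    have "ip MD \<phi> \<phi> = (\<integral>p. (\<phi> p)\<^sup>2 \<partial>vol)" unfolding ip_test[OF \<phi>] by (simp add: power2_eq_square)
    also have "\<dots> \<le> (\<integral>p. (\<Sum>s\<in>S. a * (b s p * \<phi> p)\<^sup>2) \<partial>vol)"
    proof (rule integral_mono[OF _ _ le[OF \<phi>]])
      show "integrable vol (\<lambda>p. (\<phi> p)\<^sup>2)"
        using integrable_test_mult[OF CkM_continuous[OF test_CkM[OF \<phi>]] \<phi>] by (simp add: power2_eq_square)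
      show "integrable vol (\<lambda>p. \<Sum>s\<in>S. a * (b s p * \<phi> p)\<^sup>2)"
        by (intro Bochner_Integration.integrable_sum integrable_mult_right int \<phi>)
    qed
    also have "\<dots> = (\<Sum>s\<in>S. \<integral>p. a * (b s p * \<phi> p)\<^sup>2 \<partial>vol)"
      by (rule Bochner_Integration.integral_sum) (intro integrable_mult_right int \<phi>)
    finally show ?thesis by simp
  qed
  have "\<exists>N (h :: nat \<Rightarrow> 'a \<Rightarrow> real). (\<forall>r<N. l2 MD (h r)) \<and>
      (\<forall>\<phi>\<in>TD. (\<Sum>s\<in>S. a * (\<integral>p. (b s p * \<phi> p)\<^sup>2 \<partial>vol)) \<le> e * ?E \<phi> + (\<Sum>r<N. (ip MD (h r) \<phi>)\<^sup>2))"
  proof (rule sum_functional_bounds[OF S _ e])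
    fix s and e' :: real assume s: "s \<in> S" and e': "0 < e'"
    obtain C1 where C1: "0 < C1" "\<And>p. p \<in> B s \<Longrightarrow> \<bar>(b s p)\<^sup>2\<bar> \<le> C1"
      by (rule compact_continuous_bounded[OF B(1) continuous_on_power[OF continuous_on_subset[OF bc subset_UNIV]]]) (rule that)
    obtain C2 where C2: "0 < C2" "\<And>p. p \<in> B s \<Longrightarrow> \<bar>grp (b s) (b s) p\<bar> \<le> C2"
      by (rule compact_continuous_bounded[OF B(1) continuous_on_subset[OF CkM_continuous[OF CkM_grp[OF b(1) b(1)]] subset_UNIV]]) (rule that)
    have C1': "(b s p)\<^sup>2 \<le> C1" for p using C1 b(3)[of p s] by (cases "p \<in> B s") auto
    have C2': "grp (b s) (b s) p \<le> C2" for p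
    proof (cases "p \<in> B s")
      case True
      then show ?thesis using C2(2)[OF True] by linarith
    next
      case False
      have "grp (b s) (b s) p = 0"
        by (rule grp_zero_outside[where b="b s", OF compact_imp_closed[OF B(1)] False b(3)])
      then show ?thesis using C2(1) by simp
    qed
    \<comment> \<open>The denominator is the constant by which the energy of
      \<open>b s * \<phi>\<close> is bounded in terms of \<open>?E \<phi>\<close>.\<close>
    define e'' where "e'' = e' / (2 * C1 + 2 * C2)"
    have e'': "0 < e''" using e' C1(1) C2(1) by (simp add: e''_def)
    have bs: "b s p = 0" if "p \<notin> B s" for p by (rule b(3)[OF that])
    obtain N and h :: "nat \<Rightarrow> 'a \<Rightarrow> real" where h: "\<forall>r<N. h r \<in> borel_measurable borel \<and> (\<exists>C. \<forall>p. \<bar>h r p\<bar> \<le> C)"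
      and bd: "\<forall>\<phi>. CkM (Suc 0) \<phi> \<longrightarrow> a * (\<integral>p. (b s p * \<phi> p)\<^sup>2 \<partial>vol) \<le>
       e'' * (\<integral>p. grp (\<lambda>p. b s p * \<phi> p) (\<lambda>p. b s p * \<phi> p) p \<partial>vol) + (\<Sum>r<N. (\<integral>p. h r p * \<phi> p \<partial>vol)\<^sup>2)"
      by (rule exE[OF chart_compactness[where b="b s", OF c[of s] B(1)[of s] B(2)[of s] b(1)[of s] bs e'' a(1)]], assumption) (elim exE conjE)
    have "l2 MD (h r)" if r: "r < N" for r
    proof -
      obtain C where "\<forall>p. \<bar>h r p\<bar> \<le> C" using h r by blast
      then show ?thesis using h r by (intro l2_bounded[of _ C]) auto
    qed
    moreover have "a * (\<integral>p. (b s p * \<phi> p)\<^sup>2 \<partial>vol) \<le> e' * ?E \<phi> + (\<Sum>r<N. (ip MD (h r) \<phi>)\<^sup>2)" if \<phi>: "\<phi> \<in> TD" for \<phi>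
    proof -
      let ?g = "grp (\<lambda>p. b s p * \<phi> p) (\<lambda>p. b s p * \<phi> p)"
      have i1: "integrable vol (\<lambda>p. 2 * C1 * grp \<phi> \<phi> p + 2 * C2 * (\<phi> p * \<phi> p))"
        by (intro Bochner_Integration.integrable_add integrable_mult_right green_test(1)[OF \<phi> \<phi>]
            integrable_test_mult[OF CkM_continuous[OF test_CkM[OF \<phi>]] \<phi>])
      have "(\<integral>p. ?g p \<partial>vol) \<le> (\<integral>p. 2 * C1 * grp \<phi> \<phi> p + 2 * C2 * (\<phi> p * \<phi> p) \<partial>vol)"
      proof (rule integral_mono'[OF i1])
        fix p
        have "?g p \<le> 2 * (b s p)\<^sup>2 * grp \<phi> \<phi> p + 2 * (\<phi> p)\<^sup>2 * grp (b s) (b s) p"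
          by (rule grp_mult_self_le[OF b(1) test_CkM[OF \<phi>]])
        also have "\<dots> \<le> 2 * C1 * grp \<phi> \<phi> p + 2 * (\<phi> p)\<^sup>2 * C2"
          by (intro add_mono mult_right_mono mult_left_mono C1' C2' grp_nonneg) auto
        finally show "?g p \<le> 2 * C1 * grp \<phi> \<phi> p + 2 * C2 * (\<phi> p * \<phi> p)" by (simp add: power2_eq_square mult_ac)
        show "0 \<le> 2 * C1 * grp \<phi> \<phi> p + 2 * C2 * (\<phi> p * \<phi> p)"
          using C1(1) C2(1) grp_nonneg[of \<phi> p] by simp
      qed
      also have "\<dots> = 2 * C1 * (\<integral>p. grp \<phi> \<phi> p \<partial>vol) + 2 * C2 * ip MD \<phi> \<phi>"
        unfolding ip_test[OF \<phi>]
        by (simp add: green_test(1)[OF \<phi> \<phi>] integrable_test_mult[OF CkM_continuous[OF test_CkM[OF \<phi>]] \<phi>])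
      also have "\<dots> \<le> 2 * C1 * ?E \<phi> + 2 * C2 * ?E \<phi>"
        using C1(1) C2(1) by (intro add_mono mult_left_mono dirichlet_energy_le \<phi>) simp_all
      finally have g: "(\<integral>p. ?g p \<partial>vol) \<le> (2 * C1 + 2 * C2) * ?E \<phi>" by (simp add: distrib_right)
      have hi: "(\<integral>p. h r p * \<phi> p \<partial>vol) = ip MD (h r) \<phi>" for r
        unfolding ip_sym[of MD "h r"] ip_test[OF \<phi>] by (simp add: mult.commute)
      have "a * (\<integral>p. (b s p * \<phi> p)\<^sup>2 \<partial>vol) \<le> e'' * (\<integral>p. ?g p \<partial>vol) + (\<Sum>r<N. (ip MD (h r) \<phi>)\<^sup>2)"
        using mp[OF spec[OF bd] test_CkM[OF \<phi>]] unfolding hi .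
      also have "\<dots> \<le> e'' * ((2 * C1 + 2 * C2) * ?E \<phi>) + (\<Sum>r<N. (ip MD (h r) \<phi>)\<^sup>2)"
        by (intro add_right_mono mult_left_mono g less_imp_le[OF e''])
      also have "e'' * ((2 * C1 + 2 * C2) * ?E \<phi>) = e' * ?E \<phi>"
        using C1(1) C2(1) by (simp add: e''_def)
      finally show ?thesis .
    qed
    ultimately show "\<exists>N (h :: nat \<Rightarrow> 'a \<Rightarrow> real). (\<forall>r<N. l2 MD (h r)) \<and>
      (\<forall>\<phi>\<in>TD. a * (\<integral>p. (b s p * \<phi> p)\<^sup>2 \<partial>vol) \<le> e' * ?E \<phi> + (\<Sum>r<N. (ip MD (h r) \<phi>)\<^sup>2))"
      by (intro exI[of _ N] exI[of _ h] conjI ballI allI impI)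
  qed (simp add: add_nonneg_nonneg)
  then obtain N and h :: "nat \<Rightarrow> 'a \<Rightarrow> real" where h: "\<forall>r<N. l2 MD (h r)" and
      bd: "\<forall>\<phi>\<in>TD. (\<Sum>s\<in>S. a * (\<integral>p. (b s p * \<phi> p)\<^sup>2 \<partial>vol)) \<le> e * ?E \<phi> + (\<Sum>r<N. (ip MD (h r) \<phi>)\<^sup>2)"
    by (elim exE conjE)
  show ?thesis
    by (intro exI[of _ N] exI[of _ h] conjI h ballI) (rule order_trans[OF ip_le bspec[OF bd]])
qed

sublocale plate MD TD Lap
proof
  show "(\<lambda>p. 0) \<in> TD" by (rule testI[OF smooth_const, of "{}"]) simp_all
  show "(\<lambda>p. a * \<phi> p) \<in> TD" if "\<phi> \<in> TD" for a \<phi> by (rule test_mult[OF smooth_const that])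
  show "Lap (\<lambda>p. \<phi> p + \<psi> p) = (\<lambda>p. Lap \<phi> p + Lap \<psi> p)" if "\<phi> \<in> TD" "\<psi> \<in> TD" for \<phi> \<psi>
    by (rule Lap_add[OF test_CkM[OF that(1)] test_CkM[OF that(2)]])
  show "Lap (\<lambda>p. a * \<phi> p) = (\<lambda>p. a * Lap \<phi> p)" if "\<phi> \<in> TD" for a \<phi> by (rule Lap_scale[OF test_CkM[OF that]])
qed (rule test_l2 test_add test_Lap Lap_symmetric compactness_MD | assumption)+

end

section \<open>Isometric immersions\<close>

locale immersed_domain = riemannian_domain A G \<Omega>
  for A :: "('a::{t2_space, second_countable_topology}, 'n::finite) chart set" and G \<Omega> +
  fixes X :: "'a \<Rightarrow> real^'m::finite"
  assumes immersion: "isometric_immersion A G X"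
begin

abbreviation Xc :: "'m \<Rightarrow> 'a \<Rightarrow> real" where "Xc \<alpha> p \<equiv> X p $ \<alpha>"

definition mean_curvature_sq :: "'a \<Rightarrow> real" where "mean_curvature_sq p = (norm (mean_curvature A G X p))\<^sup>2"

lemma chart_immersion: assumes c: "c \<in> A" shows "coord_immersion (img c) (gm c) (X \<circ> param c)"
proof -
  interpret C: coord_metric "img c" "gm c" by (rule chart_metric[OF c])
  show ?thesis
  proof
    show "Ck k (img c) (X \<circ> param c)" for k
      using immersion c by (simp add: isometric_immersion_def smooth_map_def smooth_on_iff)
    show "gm c x $ i $ j = partial i (X \<circ> param c) x \<bullet> partial j (X \<circ> param c) x" if "x \<in> img c" for x i j
      using immersion c param_in_dom[OF c that]
      by (simp add: isometric_immersion_def gm_def cpartial_def coord_param[OF c that])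
  qed
qed

lemma Xc_smooth: "smooth_map A (Xc \<alpha>)"
  unfolding smooth_map_iff_CkM CkM_def
proof (intro allI ballI)
  fix k c assume c: "c \<in> A"
  interpret C: coord_immersion "img c" "gm c" "X \<circ> param c" by (rule chart_immersion[OF c])
  show "Ck k (img c) (Xc \<alpha> \<circ> param c)" using C.Yc_Ck[of k \<alpha>] by (simp add: o_def)
qed

lemma sum_grp_Xc_Xc: "(\<Sum>\<alpha>\<in>UNIV. grp (Xc \<alpha>) (Xc \<alpha>) p) = real CARD('n)"
proof -
  let ?c = "chart_at A p"
  interpret C: coord_immersion "img ?c" "gm ?c" "X \<circ> param ?c" by (rule chart_immersion[OF chart_at_in(1)])
  have x: "coord ?c p \<in> img ?c" using chart_at_in(2) by simp
  show ?thesis using C.sum_gp_Yc_Yc[OF x] unfolding grp_def gpc_def o_def .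
qed

lemma sum_grp_Xc_grp_Xc: "(\<Sum>\<alpha>\<in>UNIV. grp (Xc \<alpha>) u p * grp (Xc \<alpha>) v p) = grp u v p"
proof -
  let ?c = "chart_at A p"
  interpret C: coord_immersion "img ?c" "gm ?c" "X \<circ> param ?c" by (rule chart_immersion[OF chart_at_in(1)])
  have x: "coord ?c p \<in> img ?c" using chart_at_in(2) by simp
  show ?thesis using C.sum_gp_Yc_gp_Yc[OF x] unfolding grp_def gpc_def o_def .
qed

lemma sum_Lap_Xc_grp_Xc: "(\<Sum>\<alpha>\<in>UNIV. Lap (Xc \<alpha>) p * grp (Xc \<alpha>) u p) = 0"
proof -
  let ?c = "chart_at A p"
  interpret C: coord_immersion "img ?c" "gm ?c" "X \<circ> param ?c" by (rule chart_immersion[OF chart_at_in(1)])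
  have x: "coord ?c p \<in> img ?c" using chart_at_in(2) by simp
  show ?thesis using C.sum_lap_Yc_gp[OF x] unfolding laplacian_chart_at lapc_def grp_def gpc_def o_def .
qed

text \<open>Beltrami's formula \<open>\<Delta>X = n H\<close>.\<close>

lemma sum_Lap_Xc_sq: "(\<Sum>\<alpha>\<in>UNIV. (Lap (Xc \<alpha>) p)\<^sup>2) = (real CARD('n))\<^sup>2 * mean_curvature_sq p"
proof -
  let ?c = "chart_at A p"
  let ?Y = "X \<circ> param ?c" and ?x = "coord ?c p"
  interpret C: coord_immersion "img ?c" "gm ?c" ?Y by (rule chart_immersion[OF chart_at_in(1)])
  have x: "?x \<in> img ?c" using chart_at_in(2) by simp
  have "(cpartial ?c j X \<circ> param ?c) y = partial j ?Y y" if "y \<in> img ?c" for j y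
    by (simp add: cpartial_def coord_param[OF chart_at_in(1) that])
  from C.partial_cong_U[OF this x]
  have w: "cpartial ?c i (cpartial ?c j X) p = partial i (partial j ?Y) ?x" for i j
    unfolding cpartial_def[of ?c i] .
  have S: "tangent_space_in ?c X p = span (range (\<lambda>k. partial k ?Y ?x))"
    by (simp add: tangent_space_in_def cpartial_def)
  have "(\<chi> \<alpha>. Lap (Xc \<alpha>) p) = (\<chi> \<alpha>. C.lap (C.Yc \<alpha>) ?x)"
    unfolding laplacian_chart_at lapc_def o_def ..
  also have "\<dots> = (\<Sum>i\<in>UNIV. \<Sum>j\<in>UNIV. matrix_inv (G ?c p) $ i $ j *\<^sub>R second_fundamental_form_in ?c X i j p)"
    unfolding C.lap_Yc_normal[OF x] second_fundamental_form_in_def Let_def w S C.gi_def gm_def param_coord[OF chart_at_in] ..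
  also have "\<dots> = real CARD('n) *\<^sub>R mean_curvature A G X p" by (simp add: mean_curvature_def Let_def)
  finally have "(norm (\<chi> \<alpha>. Lap (Xc \<alpha>) p))\<^sup>2 = (norm (real CARD('n) *\<^sub>R mean_curvature A G X p))\<^sup>2" by simp
  then show ?thesis by (simp add: mean_curvature_sq_def power2_norm_eq_inner inner_vec_def power2_eq_square[of "Lap _ _"] power_mult_distrib)
qed

text \<open>A supremum of reals is informative only for a bounded set. The mean curvature is
  computed from selected charts and closest points, so its continuity is not visible; its norm is
  bounded because Beltrami's formula expresses it by Laplacians that are continuous on the compact
  closure.\<close>

lemma bdd_above_mean_curvature_sq: "bdd_above (mean_curvature_sq ` \<Omega>)"
proof -
  have "continuous_on UNIV (\<lambda>p. \<Sum>\<alpha>\<in>UNIV. (Lap (Xc \<alpha>) p)\<^sup>2)"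
    by (intro continuous_on_sum continuous_on_power CkM_continuous[OF smooth_CkM[OF smooth_Lap[OF Xc_smooth]]])
  then have cont: "continuous_on (closure \<Omega>) (\<lambda>p. \<Sum>\<alpha>\<in>UNIV. (Lap (Xc \<alpha>) p)\<^sup>2)" by (rule continuous_on_subset) simp
  obtain C where C: "0 < C" "\<And>p. p \<in> closure \<Omega> \<Longrightarrow> \<bar>\<Sum>\<alpha>\<in>UNIV. (Lap (Xc \<alpha>) p)\<^sup>2\<bar> \<le> C"
    by (rule compact_continuous_bounded[OF compact_closure_domain cont]) (rule that)
  have n: "0 < (real CARD('n))\<^sup>2" by simp
  show ?thesis
  proof (rule bdd_aboveI2)
    fix p assume "p \<in> \<Omega>"
    then have "p \<in> closure \<Omega>" using closure_subset by blast
    from C(2)[OF this] have "(real CARD('n))\<^sup>2 * mean_curvature_sq p \<le> C" unfolding sum_Lap_Xc_sq by linarith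
    then show "mean_curvature_sq p \<le> C / (real CARD('n))\<^sup>2" using n by (simp add: field_simps)
  qed
qed

abbreviation curvature_bound :: real where "curvature_bound \<equiv> SUP p\<in>\<Omega>. mean_curvature_sq p"

lemma mean_curvature_sq_le: "p \<in> \<Omega> \<Longrightarrow> mean_curvature_sq p \<le> curvature_bound"
  by (rule cSUP_upper[OF _ bdd_above_mean_curvature_sq])

lemma curvature_bound_nonneg: "0 \<le> curvature_bound"
proof -
  obtain p where "p \<in> \<Omega>" using domain_nonempty by blast
  then have "mean_curvature_sq p \<le> curvature_bound" by (rule mean_curvature_sq_le)
  then show ?thesis using zero_le_power2 unfolding mean_curvature_sq_def by (rule order_trans[rotated])
qed

lemma commutator_Xc:
  assumes \<phi>: "\<phi> \<in> TD"
  shows "Lap (\<lambda>p. Xc \<alpha> p * \<phi> p) p - Xc \<alpha> p * Lap \<phi> p = \<phi> p * Lap (Xc \<alpha>) p + 2 * grp (Xc \<alpha>) \<phi> p"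
  unfolding Lap_mult[OF smooth_CkM[OF Xc_smooth] test_CkM[OF \<phi>]] by simp

text \<open>The Laplacian of the immersion is normal and the gradient part tangential, so the mixed
  terms cancel in the sum over the coordinates.\<close>

lemma sum_commutator_sq:
  assumes \<phi>: "\<phi> \<in> TD"
  shows "(\<Sum>\<alpha>\<in>UNIV. (\<phi> p * Lap (Xc \<alpha>) p + 2 * grp (Xc \<alpha>) \<phi> p)\<^sup>2) =
    (real CARD('n))\<^sup>2 * mean_curvature_sq p * (\<phi> p)\<^sup>2 + 4 * grp \<phi> \<phi> p"
proof -
  have "(\<Sum>\<alpha>\<in>UNIV. (\<phi> p * Lap (Xc \<alpha>) p + 2 * grp (Xc \<alpha>) \<phi> p)\<^sup>2) =
      (\<phi> p)\<^sup>2 * (\<Sum>\<alpha>\<in>UNIV. (Lap (Xc \<alpha>) p)\<^sup>2) + 4 * \<phi> p * (\<Sum>\<alpha>\<in>UNIV. Lap (Xc \<alpha>) p * grp (Xc \<alpha>) \<phi> p)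
      + 4 * (\<Sum>\<alpha>\<in>UNIV. grp (Xc \<alpha>) \<phi> p * grp (Xc \<alpha>) \<phi> p)"
    unfolding sum_distrib_left sum.distrib[symmetric]
    by (intro sum.cong refl) (simp add: power2_eq_square algebra_simps)
  then show ?thesis unfolding sum_Lap_Xc_sq sum_Lap_Xc_grp_Xc sum_grp_Xc_grp_Xc by (simp add: mult_ac)
qed

lemma commutator_energy:
  assumes \<phi>: "\<phi> \<in> TD"
  shows "(\<Sum>\<alpha>\<in>UNIV. ip MD (\<lambda>p. Lap (\<lambda>p. Xc \<alpha> p * \<phi> p) p - Xc \<alpha> p * Lap \<phi> p) (\<lambda>p. Lap (\<lambda>p. Xc \<alpha> p * \<phi> p) p - Xc \<alpha> p * Lap \<phi> p))
        \<le> - 4 * ip MD \<phi> (Lap \<phi>) + (real CARD('n))\<^sup>2 * curvature_bound * ip MD \<phi> \<phi>"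
proof -
  let ?P = "\<lambda>\<alpha> p. Lap (\<lambda>p. Xc \<alpha> p * \<phi> p) p - Xc \<alpha> p * Lap \<phi> p"
  let ?n = "real CARD('n)"
  have P: "?P \<alpha> \<in> TD" for \<alpha>
  proof -
    have "(\<lambda>p. Lap (\<lambda>p. Xc \<alpha> p * \<phi> p) p + (- 1) * (Xc \<alpha> p * Lap \<phi> p)) \<in> TD"
      by (rule test_add[OF test_Lap[OF test_mult[OF Xc_smooth \<phi>]] test_mult[OF smooth_const test_mult[OF Xc_smooth test_Lap[OF \<phi>]]]])
    then show ?thesis by simp
  qed
  have Pi: "integrable vol (\<lambda>p. ?P \<alpha> p * ?P \<alpha> p)" for \<alpha>
    by (rule integrable_test_mult[OF CkM_continuous[OF test_CkM[OF P]] P])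
  have i: "integrable vol (\<lambda>p. ?n\<^sup>2 * curvature_bound * (\<phi> p * \<phi> p) + 4 * grp \<phi> \<phi> p)"
    by (intro Bochner_Integration.integrable_add integrable_mult_right green_test(1)[OF \<phi> \<phi>]
      integrable_test_mult[OF CkM_continuous[OF test_CkM[OF \<phi>]] \<phi>])
  have "(\<Sum>\<alpha>\<in>UNIV. ip MD (?P \<alpha>) (?P \<alpha>)) = (\<Sum>\<alpha>\<in>UNIV. \<integral>p. ?P \<alpha> p * ?P \<alpha> p \<partial>vol)"
    by (intro sum.cong refl ip_test P)
  also have "\<dots> = (\<integral>p. (\<Sum>\<alpha>\<in>UNIV. ?P \<alpha> p * ?P \<alpha> p) \<partial>vol)"
    by (rule Bochner_Integration.integral_sum[symmetric]) (rule Pi)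
  also have "\<dots> \<le> (\<integral>p. ?n\<^sup>2 * curvature_bound * (\<phi> p * \<phi> p) + 4 * grp \<phi> \<phi> p \<partial>vol)"
  proof (rule integral_mono[OF Bochner_Integration.integrable_sum[OF Pi] i])
    fix p
    have "(\<Sum>\<alpha>\<in>UNIV. ?P \<alpha> p * ?P \<alpha> p) = (\<Sum>\<alpha>\<in>UNIV. (\<phi> p * Lap (Xc \<alpha>) p + 2 * grp (Xc \<alpha>) \<phi> p)\<^sup>2)"
      unfolding commutator_Xc[OF \<phi>] power2_eq_square ..
    also have "\<dots> = ?n\<^sup>2 * mean_curvature_sq p * (\<phi> p)\<^sup>2 + 4 * grp \<phi> \<phi> p" by (rule sum_commutator_sq[OF \<phi>])
    also have "\<dots> \<le> ?n\<^sup>2 * curvature_bound * (\<phi> p * \<phi> p) + 4 * grp \<phi> \<phi> p"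
    \<comment> \<open>The supremum bounds the curvature only inside \<open>\<Omega>\<close>;
      elsewhere \<open>\<phi>\<close> vanishes and with it the curvature term.\<close>
    proof (cases "p \<in> \<Omega>")
      case True
      then show ?thesis unfolding power2_eq_square[of "\<phi> p"]
        by (intro add_right_mono mult_right_mono mult_left_mono mean_curvature_sq_le) simp_all
    qed (simp add: test_zero_outside[OF \<phi>])
    finally show "(\<Sum>\<alpha>\<in>UNIV. ?P \<alpha> p * ?P \<alpha> p) \<le> ?n\<^sup>2 * curvature_bound * (\<phi> p * \<phi> p) + 4 * grp \<phi> \<phi> p" .
  qed
  also have "\<dots> = ?n\<^sup>2 * curvature_bound * ip MD \<phi> \<phi> + 4 * (\<integral>p. grp \<phi> \<phi> p \<partial>vol)"
    unfolding ip_test[OF \<phi>]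
    by (simp add: green_test(1)[OF \<phi> \<phi>] integrable_test_mult[OF CkM_continuous[OF test_CkM[OF \<phi>]] \<phi>])
  also have "\<dots> = - 4 * ip MD \<phi> (Lap \<phi>) + ?n\<^sup>2 * curvature_bound * ip MD \<phi> \<phi>"
    unfolding green_test(2)[OF \<phi> \<phi>] by simp
  finally show ?thesis .
qed

text \<open>Commuting a second order operator twice with a function removes all derivatives of
  \<open>\<phi>\<close> and leaves a multiplication.\<close>

lemma double_commutator_Xc:
  assumes \<phi>: "\<phi> \<in> TD"
  shows "Lap (\<lambda>p. Xc \<alpha> p * (Xc \<alpha> p * \<phi> p)) p - 2 * Xc \<alpha> p * Lap (\<lambda>p. Xc \<alpha> p * \<phi> p) p + Xc \<alpha> p * Xc \<alpha> p * Lap \<phi> p =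
    2 * grp (Xc \<alpha>) (Xc \<alpha>) p * \<phi> p"
proof -
  have g: "grp (Xc \<alpha>) (\<lambda>p. Xc \<alpha> p * \<phi> p) p = Xc \<alpha> p * grp (Xc \<alpha>) \<phi> p + \<phi> p * grp (Xc \<alpha>) (Xc \<alpha>) p"
    by (rule grp_mult[OF smooth_CkM[OF Xc_smooth] test_CkM[OF \<phi>]])
  note 1 = Lap_mult[OF smooth_CkM[OF Xc_smooth] test_CkM[OF \<phi>], of \<alpha> p]
    and 2 = Lap_mult[OF smooth_CkM[OF Xc_smooth] test_CkM[OF test_mult[OF Xc_smooth \<phi>]], of \<alpha> \<alpha> p]
  show ?thesis unfolding 2 1 g by (simp add: algebra_simps)
qed

sublocale plate_immersion MD TD Lap Xc "\<lambda>\<alpha> p. 2 * grp (Xc \<alpha>) (Xc \<alpha>) p" "real CARD('n)" curvature_bound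
proof
  fix \<alpha> :: 'm
  have c: "continuous_on UNIV (Xc \<alpha>)" by (rule CkM_continuous[where k=0, OF smooth_CkM[OF Xc_smooth]])
  show "Xc \<alpha> \<in> borel_measurable MD"
    using borel_measurable_continuous_onI[OF c] by (intro measurable_restrict_space1) simp
  have "continuous_on UNIV (\<lambda>p. 2 * grp (Xc \<alpha>) (Xc \<alpha>) p)"
    by (intro continuous_on_mult continuous_on_const CkM_continuous[where k=0, OF CkM_grp[OF smooth_CkM[OF Xc_smooth] smooth_CkM[OF Xc_smooth]]])
  from borel_measurable_continuous_onI[OF this]
  show "(\<lambda>p. 2 * grp (Xc \<alpha>) (Xc \<alpha>) p) \<in> borel_measurable MD" by (intro measurable_restrict_space1) simp
next
  have "continuous_on UNIV (\<lambda>p. \<Sum>\<alpha>\<in>UNIV. \<bar>Xc \<alpha> p\<bar>)"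
    by (intro continuous_on_sum continuous_on_rabs CkM_continuous[where k=0, OF smooth_CkM[OF Xc_smooth]])
  then have cont: "continuous_on (closure \<Omega>) (\<lambda>p. \<Sum>\<alpha>\<in>UNIV. \<bar>Xc \<alpha> p\<bar>)" by (rule continuous_on_subset) simp
  obtain C where C: "0 < C" "\<And>p. p \<in> closure \<Omega> \<Longrightarrow> \<bar>\<Sum>\<alpha>\<in>UNIV. \<bar>Xc \<alpha> p\<bar>\<bar> \<le> C"
    by (rule compact_continuous_bounded[OF compact_closure_domain cont]) (rule that)
  have "\<bar>Xc \<alpha> p\<bar> \<le> C" if "p \<in> space MD" for \<alpha> p
  proof -
    have "p \<in> closure \<Omega>" using that closure_subset by (auto simp: space_restrict_space)
    from C(2)[OF this] have "(\<Sum>\<alpha>\<in>UNIV. \<bar>Xc \<alpha> p\<bar>) \<le> C" by linarith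
    moreover have "\<bar>Xc \<alpha> p\<bar> \<le> (\<Sum>\<alpha>\<in>UNIV. \<bar>Xc \<alpha> p\<bar>)" by (rule member_le_sum) simp_all
    ultimately show ?thesis by linarith
  qed
  then show "\<exists>C. \<forall>\<alpha>. \<forall>p\<in>space MD. \<bar>Xc \<alpha> p\<bar> \<le> C" by blast
qed (rule commutator_energy, assumption |
    simp add: grp_nonneg sum_grp_Xc_Xc sum_distrib_left[symmetric] test_mult[OF Xc_smooth] double_commutator_Xc curvature_bound_nonneg)+

end

section \<open>Agreement of the abstract problem with the notions of the statement\<close>

context riemannian_domain
begin

lemma LINT_domain: "(LINT p:\<Omega>|vol. f p) = (\<integral>p. f p \<partial>MD)" for f :: "'a \<Rightarrow> real"
  unfolding set_lebesgue_integral_def by (rule integral_restrict_space[OF domain_sets, symmetric])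

lemma L2_on_iff: "L2_on vol \<Omega> u \<longleftrightarrow> l2 MD u"
  unfolding L2_on_def l2_def set_borel_measurable_def set_integrable_def
  by (simp only: borel_measurable_restrict_space_iff[OF domain_sets] integrable_restrict_space[OF domain_sets])

lemma AE_domain: "(AE p in vol. p \<in> \<Omega> \<longrightarrow> P p) \<longleftrightarrow> (AE p in MD. P p)"
  by (rule AE_restrict_space_iff[OF domain_sets, symmetric])

lemma H20_iff: "u \<in> H20 A G \<Omega> \<longleftrightarrow> (\<exists>w. (u, w) \<in> pairs)"
  unfolding H20_def pairs_def Let_def LINT_domain L2_on_iff ip_def power2_eq_square by auto

lemma clamped_eigenspace_eq: "clamped_eigenspace A G \<Omega> \<mu> = eigenspace \<mu>"
  unfolding clamped_eigenspace_def eigenspace_def Let_def H20_iff LINT_domain ip_def by blast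

lemma has_multiplicity_iff: "has_multiplicity A G \<Omega> \<mu> d \<longleftrightarrow> multiplicity \<mu> d"
  unfolding has_multiplicity_def multiplicity_def clamped_eigenspace_eq AE_domain ..

end

theorem theorem2p2:
  fixes A :: "('a::{t2_space, second_countable_topology}, 'n::finite) chart set"
    and G :: "('a, 'n) chart \<Rightarrow> 'a \<Rightarrow> real^'n^'n"
    and X :: "'a \<Rightarrow> real^'m::finite"
    and \<Omega> :: "'a set"
    and ev :: "nat \<Rightarrow> real"
    and k :: nat
    and f g :: "real \<Rightarrow> real"
    and n \<delta> :: real
  assumes "riemannian_manifold A G"
    and "isometric_immersion A G X"
    and "bounded_domain \<Omega>"
    and "clamped_spectrum A G \<Omega> ev"
    and n: "n = real CARD('n)"
    and \<delta>: "\<delta> = (SUP p\<in>\<Omega>. (norm (mean_curvature A G X p))\<^sup>2)"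
    and "1 \<le> k"
    and "ev k < ev (k + 1)"
    and "(f, g) \<in> couples (ev (k + 1))"
  shows "(\<Sum>i=1..k. f (ev i)) \<le>
    2 / n *
    sqrt (\<Sum>i=1..k. g (ev i) * (2 * (n + 2) * sqrt (ev i) + n\<^sup>2 * \<delta>)) *
    sqrt (\<Sum>i=1..k. (f (ev i))\<^sup>2 / (g (ev i) * (ev (k + 1) - ev i)) *
                     (sqrt (ev i) + n\<^sup>2 / 4 * \<delta>))"
proof -
  interpret immersed_domain A G \<Omega> X
    using assms(1-3) by unfold_locales
  let ?L = "ev (Suc k)"
  have \<delta>': "\<delta> = curvature_bound" unfolding \<delta> mean_curvature_sq_def ..
  have spec: "0 < ev 1" "\<And>i. 1 \<le> i \<Longrightarrow> ev i \<le> ev (Suc i)" "filterlim ev at_top sequentially"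
    "\<And>\<mu>. multiplicity \<mu> (card {i. 1 \<le> i \<and> ev i = \<mu>})"
    using assms(4) unfolding clamped_spectrum_def has_multiplicity_iff by blast+
  have pos: "0 < f x \<and> 0 < g x" if "0 < x" "x < ?L" for x
    using assms(9) that by (simp add: couples_def)
  \<comment> \<open>The condition on the couple is multiplied by the square of \<open>x - y\<close>.
    In this form it also holds for \<open>x = y\<close>, so the double sums need no exception for
    their diagonal terms or for repeated eigenvalues.\<close>
  have couple: "(f x - f y)\<^sup>2 \<le> ((f x)\<^sup>2 / (g x * (?L - x)) + (f y)\<^sup>2 / (g y * (?L - y))) * ((g y - g x) * (x - y))"
    if "0 < x" "x < ?L" "0 < y" "y < ?L" for x y
  proof (cases "x = y")
    case False
    let ?Q = "(f x)\<^sup>2 / (g x * (?L - x)) + (f y)\<^sup>2 / (g y * (?L - y))"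
    have le: "((f x - f y) / (x - y))\<^sup>2 + ?Q * ((g x - g y) / (x - y)) \<le> 0"
      using assms(9) that False by (simp add: couples_def)
    have clear: "a\<^sup>2 \<le> Q * (- b * d)" if "(a / d)\<^sup>2 + Q * (b / d) \<le> 0" "d \<noteq> 0" for a b d Q :: real
    proof -
      have "((a / d)\<^sup>2 + Q * (b / d)) * d\<^sup>2 \<le> 0" using that(1) by (rule mult_nonpos_nonneg) simp
      then show ?thesis using that(2) by (simp add: distrib_right power2_eq_square)
    qed
    have "(f x - f y)\<^sup>2 \<le> ?Q * (- (g x - g y) * (x - y))" by (rule clear[OF le]) (use False in simp)
    then show ?thesis by simp
  qed simp
  show ?thesis
    using eigenvalue_inequality[OF spec(2,3,4,1) assms(7) assms(8)[unfolded Suc_eq_plus1[symmetric]] pos couple]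
    unfolding n \<delta>' Suc_eq_plus1 .
qed

end
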